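(* Let $C=A\vee_vB$ be an algebra obtained by gluing a node $v$ from algebras $A$ and $B$. Then there exist bijections between the following sets. - The set of quasi-hereditary structures of $C$. - The set of pairs of quasi-hereditary structures $([\unlhd_A],[\unlhd_B])$ of $A$ and $B$ that satisfy condition $(\Delta)$: if there exists an arrow $x\to v$ in $Q_A$ with $x\lhd_A^{\rm m}v$, then $v\lhd_B^{\rm m}y$ holds for any arrow $v\to y$ in $Q_B$. - The set of pairs of quasi-hereditary structures $([\unlhd_A],[\unlhd_B])$ of $A$ and $B$ that satisfy condition $(\nabla)$: if there exists an arrow $v\to y$ in $Q_B$ with $y\lhd_B^{\rm m}v$, then $v\lhd_A^{\rm m}x$ holds for any arrow $x\to v$ in $Q_A$.
   Context: $\Bbbk$ is a field; modules are finitely generated right modules; paths are composed left to right; algebras are finite-dimensional basic bound quiver algebras. For such an algebra with vertex set $\Lambda$ and primitive idempotents $e_i$ ($i\in\Lambda$), write $P(i)$ for the indecomposable projective module $e_i(\text{algebra})$, $S(i)$ for its simple top, and $I(i)$ for the indecomposable injective module with socle $S(i)$. Gluing a node: $A=\Bbbk Q_A/I_A$ and $B=\Bbbk Q_B/I_B$ are basic algebras such that $Q_A$ has a sink and $Q_B$ has a source; fix a choice of such a sink and such a source, and call both $v$. $Q_A\vee_vQ_B$ is the quiver obtained by identifying these two vertices. The algebra obtained by gluing the node $v$ is $A\vee_vB:=\Bbbk(Q_A\vee_vQ_B)/J$, where $J$ is generated by $I_A$, $I_B$ and all paths $pq$ of length two ($p,q$ arrows) such that $v$ is the target of $p$ and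 the source of $q$. Quasi-hereditary structures: for a partial order $\unlhd$ on the vertex set $\Lambda$ (with strict part $\lhd$), the standard module $\Delta(i)$ is the maximal quotient of $P(i)$, and the costandard module $\nabla(i)$ the maximal submodule of $I(i)$, all of whose composition factors $S(j)$ satisfy $j\unlhd i$. The algebra together with $\unlhd$ is quasi-hereditary if for all $i\in\Lambda$ one has $[\Delta(i):S(i)]=1$ (composition multiplicity) and the kernel of the canonical surjection $P(i)\to\Delta(i)$ has a finite filtration with subquotients in $\{\Delta(j)\mid j\rhd i\}$; then $\unlhd$ is called a quasi-hereditary partial order. Two partial orders on $\Lambda$ are equivalent if they give the same standard module $\Delta(i)$ for each $i$. A quasi-hereditary structure is an equivalence class $[\unlhd]$ of quasi-hereditary partial orders. Each such class contains a unique coarsest order, the minimal adapted order $\unlhd^{\rm m}$, which is the transitive closure of the relations given by $i\unlhd^{\rm m}j$ whenever $[\Delta(j):S(i)]\ne0$ or $[\nabla(j):S(i)]\ne0$; $\lhd^{\rm m}$ denotes its strict part. In the conditions $(\Delta)$ and $(\nabla)$, $\unlhd_A^{\rm m}$ and $\unlhd_B^{\rm m}$ are the minimal adapted orders of the classes $[\unlhd_A]$ and $[\unlhd_B]$. *)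

theory Defs
  imports
    "HOL-Algebra.QuotRing"
    "HOL-Algebra.Module"
    "Graph_Theory.Arc_Walk"
begin

section \<open>Right modules over a ring\<close>

text \<open>
  Right modules are encoded by the record type \<^typ>\<open>('r, 'm) module\<close> of the library, where
  \<open>smult M a x\<close> is read as the right action \<open>x \<cdot> a\<close>, that is,
  \<open>smult M (a \<otimes> b) x = smult M b (smult M a x)\<close>.  The record fields \<open>mult\<close> and \<open>one\<close> carry no
  meaning for modules.  The locale \<^locale>\<open>submodule\<close> (a subgroup closed under the
  action) does not depend on the side of the action.
\<close>

definition restrict_mod :: "('r, 'm) module \<Rightarrow> 'm set \<Rightarrow> ('r, 'm) module" where
  "restrict_mod M U = M\<lparr>carrier := U\<rparr>"

definition quot_mod :: "('r, 'm) module \<Rightarrow> 'm set \<Rightarrow> ('r, 'm set) module" where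
  "quot_mod M U =
    \<lparr>carrier = a_rcosets\<^bsub>M\<^esub> U, mult = undefined, one = undefined,
     zero = U, add = set_add M,
     smult = (\<lambda>a X. \<Union>x\<in>X. U +>\<^bsub>M\<^esub> (a \<odot>\<^bsub>M\<^esub> x))\<rparr>"

definition mod_iso ::
  "('r, 'c) ring_scheme \<Rightarrow> ('r, 'm) module \<Rightarrow> ('r, 'n) module \<Rightarrow> bool" where
  "mod_iso R M N \<longleftrightarrow> (\<exists>h. bij_betw h (carrier M) (carrier N) \<and>
     (\<forall>x\<in>carrier M. \<forall>y\<in>carrier M. h (x \<oplus>\<^bsub>M\<^esub> y) = h x \<oplus>\<^bsub>N\<^esub> h y) \<and>
     (\<forall>a\<in>carrier R. \<forall>x\<in>carrier M. h (a \<odot>\<^bsub>M\<^esub> x) = a \<odot>\<^bsub>N\<^esub> h x))"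

definition simple_mod :: "('r, 'c) ring_scheme \<Rightarrow> ('r, 'm) module \<Rightarrow> bool" where
  "simple_mod R M \<longleftrightarrow> carrier M \<noteq> {\<zero>\<^bsub>M\<^esub>} \<and>
     (\<forall>U. submodule U R M \<longrightarrow> U = {\<zero>\<^bsub>M\<^esub>} \<or> U = carrier M)"

definition maximal_submodule ::
  "('r, 'c) ring_scheme \<Rightarrow> ('r, 'm) module \<Rightarrow> 'm set \<Rightarrow> bool" where
  "maximal_submodule R M U \<longleftrightarrow> submodule U R M \<and> U \<noteq> carrier M \<and>
     (\<forall>V. submodule V R M \<longrightarrow> U \<subseteq> V \<longrightarrow> V = U \<or> V = carrier M)"

definition rad_mod :: "('r, 'c) ring_scheme \<Rightarrow> ('r, 'm) module \<Rightarrow> 'm set" where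
  "rad_mod R M = carrier M \<inter> \<Inter>{U. maximal_submodule R M U}"

definition top_mod :: "('r, 'c) ring_scheme \<Rightarrow> ('r, 'm) module \<Rightarrow> ('r, 'm set) module" where
  "top_mod R M = quot_mod M (rad_mod R M)"

definition filtration ::
  "('r, 'c) ring_scheme \<Rightarrow> ('r, 'm) module \<Rightarrow> 'm set list \<Rightarrow> bool" where
  "filtration R M F \<longleftrightarrow> F \<noteq> [] \<and> hd F = {\<zero>\<^bsub>M\<^esub>} \<and> last F = carrier M \<and>
     (\<forall>U\<in>set F. submodule U R M) \<and> (\<forall>l. Suc l < length F \<longrightarrow> F ! l \<subseteq> F ! Suc l)"

definition subquot :: "('r, 'm) module \<Rightarrow> 'm set list \<Rightarrow> nat \<Rightarrow> ('r, 'm set) module" where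
  "subquot M F l = quot_mod (restrict_mod M (F ! Suc l)) (F ! l)"

definition composition_series_of ::
  "('r, 'c) ring_scheme \<Rightarrow> ('r, 'm) module \<Rightarrow> 'm set list \<Rightarrow> bool" where
  "composition_series_of R M F \<longleftrightarrow> filtration R M F \<and>
     (\<forall>l. Suc l < length F \<longrightarrow> simple_mod R (subquot M F l))"

text \<open>
  The multiplicity \<open>[M : S]\<close> for modules \<open>M\<close> of finite length; the number does not depend on the
  composition series by the Jordan-Hoelder theorem.
\<close>

definition comp_mult ::
  "('r, 'c) ring_scheme \<Rightarrow> ('r, 'm) module \<Rightarrow> ('r, 'n) module \<Rightarrow> nat" where
  "comp_mult R M S = (THE n. \<exists>F. composition_series_of R M F \<and>
     n = card {l. Suc l < length F \<and> mod_iso R (subquot M F l) S})"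


section \<open>Bound quiver algebras\<close>

text \<open>
  A quiver is a finite directed multigraph, possibly with loops (\<^locale>\<open>fin_digraph\<close>).  A path is
  given by its starting vertex and its list of arrows in the order of traversal, so that the
  empty list yields the trivial paths.  Elements of the path algebra are the
  finitely supported families of coefficients on the set of paths; the product is induced by
  the composition of paths from left to right.
\<close>

definition qpaths :: "('v, 'e) pre_digraph \<Rightarrow> ('v \<times> 'e list) set" where
  "qpaths Q = {(u, p). \<exists>w. pre_digraph.awalk Q u p w}"

definition path_mult ::
  "('v, 'e) pre_digraph \<Rightarrow> ('v \<times> 'e list \<Rightarrow> 'k::field) \<Rightarrow> ('v \<times> 'e list \<Rightarrow> 'k) \<Rightarrow>
     'v \<times> 'e list \<Rightarrow> 'k" where
  "path_mult Q f g = (\<lambda>(u, p). \<Sum>n\<le>length p.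
     f (u, take n p) * g (pre_digraph.awlast Q u (take n p), drop n p))"

definition path_algebra :: "('v, 'e) pre_digraph \<Rightarrow> ('v \<times> 'e list \<Rightarrow> 'k::field) ring" where
  "path_algebra Q =
    \<lparr>carrier = {f. finite {x. f x \<noteq> 0} \<and> {x. f x \<noteq> 0} \<subseteq> qpaths Q},
     mult = path_mult Q,
     one = (\<lambda>(u, p). if u \<in> verts Q \<and> p = [] then 1 else 0),
     zero = (\<lambda>_. 0),
     add = (\<lambda>f g x. f x + g x)\<rparr>"

definition path_elem :: "'v \<times> 'e list \<Rightarrow> 'v \<times> 'e list \<Rightarrow> 'k::field" where
  "path_elem x = (\<lambda>y. if y = x then 1 else 0)"

text \<open>The \<open>m\<close>-th power of the arrow ideal, i.e. the span of all paths of length at least \<open>m\<close>.\<close>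

definition arrow_ideal_power ::
  "('v, 'e) pre_digraph \<Rightarrow> nat \<Rightarrow> ('v \<times> 'e list \<Rightarrow> 'k::field) set" where
  "arrow_ideal_power Q m =
    {f \<in> carrier (path_algebra Q). \<forall>u p. f (u, p) \<noteq> 0 \<longrightarrow> m \<le> length p}"

definition admissible_ideal ::
  "('v, 'e) pre_digraph \<Rightarrow> ('v \<times> 'e list \<Rightarrow> 'k::field) set \<Rightarrow> bool" where
  "admissible_ideal Q I \<longleftrightarrow> ideal I (path_algebra Q) \<and>
     I \<subseteq> arrow_ideal_power Q 2 \<and> (\<exists>m\<ge>2. arrow_ideal_power Q m \<subseteq> I)"

definition bound_quiver ::
  "('v, 'e) pre_digraph \<Rightarrow> ('v \<times> 'e list \<Rightarrow> 'k::field) set \<Rightarrow> bool" where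
  "bound_quiver Q I \<longleftrightarrow> fin_digraph Q \<and> admissible_ideal Q I"

definition bq_algebra ::
  "('v, 'e) pre_digraph \<Rightarrow> ('v \<times> 'e list \<Rightarrow> 'k::field) set \<Rightarrow>
     ('v \<times> 'e list \<Rightarrow> 'k) set ring" where
  "bq_algebra Q I = path_algebra Q Quot I"

definition vertex_idem ::
  "('v, 'e) pre_digraph \<Rightarrow> ('v \<times> 'e list \<Rightarrow> 'k::field) set \<Rightarrow> 'v \<Rightarrow>
     ('v \<times> 'e list \<Rightarrow> 'k) set" where
  "vertex_idem Q I i = I +>\<^bsub>path_algebra Q\<^esub> path_elem (i, [])"

text \<open>The structure map of the \<open>k\<close>-algebra, \<open>c \<mapsto> c \<cdot> 1\<close>.\<close>

definition scalar_elem ::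
  "('v, 'e) pre_digraph \<Rightarrow> ('v \<times> 'e list \<Rightarrow> 'k::field) set \<Rightarrow> 'k \<Rightarrow>
     ('v \<times> 'e list \<Rightarrow> 'k) set" where
  "scalar_elem Q I c = I +>\<^bsub>path_algebra Q\<^esub> (\<lambda>x. c * \<one>\<^bsub>path_algebra Q\<^esub> x)"


section \<open>Projective, simple and injective modules\<close>

definition proj_mod ::
  "('v, 'e) pre_digraph \<Rightarrow> ('v \<times> 'e list \<Rightarrow> 'k::field) set \<Rightarrow> 'v \<Rightarrow>
     (('v \<times> 'e list \<Rightarrow> 'k) set, ('v \<times> 'e list \<Rightarrow> 'k) set) module" where
  "proj_mod Q I i = (let A = bq_algebra Q I in
    \<lparr>carrier = {vertex_idem Q I i \<otimes>\<^bsub>A\<^esub> a | a. a \<in> carrier A},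
     mult = undefined, one = undefined,
     zero = \<zero>\<^bsub>A\<^esub>, add = add A, smult = (\<lambda>a x. x \<otimes>\<^bsub>A\<^esub> a)\<rparr>)"

definition simple_at ::
  "('v, 'e) pre_digraph \<Rightarrow> ('v \<times> 'e list \<Rightarrow> 'k::field) set \<Rightarrow> 'v \<Rightarrow>
     (('v \<times> 'e list \<Rightarrow> 'k) set, ('v \<times> 'e list \<Rightarrow> 'k) set set) module" where
  "simple_at Q I i = top_mod (bq_algebra Q I) (proj_mod Q I i)"

text \<open>
  The injective module with socle \<open>S(i)\<close> is the \<open>k\<close>-linear dual \<open>Hom\<^sub>k(A e\<^sub>i, k)\<close> of the
  left module \<open>A e\<^sub>i\<close>, with right action \<open>(\<phi> \<cdot> a)(x) = \<phi>(a x)\<close>.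
\<close>

definition left_proj ::
  "('v, 'e) pre_digraph \<Rightarrow> ('v \<times> 'e list \<Rightarrow> 'k::field) set \<Rightarrow> 'v \<Rightarrow>
     ('v \<times> 'e list \<Rightarrow> 'k) set set" where
  "left_proj Q I i = (let A = bq_algebra Q I in
     {a \<otimes>\<^bsub>A\<^esub> vertex_idem Q I i | a. a \<in> carrier A})"

definition inj_mod ::
  "('v, 'e) pre_digraph \<Rightarrow> ('v \<times> 'e list \<Rightarrow> 'k::field) set \<Rightarrow> 'v \<Rightarrow>
     (('v \<times> 'e list \<Rightarrow> 'k) set, ('v \<times> 'e list \<Rightarrow> 'k) set \<Rightarrow> 'k) module" where
  "inj_mod Q I i = (let A = bq_algebra Q I; L = left_proj Q I i in
    \<lparr>carrier = {\<phi> \<in> extensional L.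
       (\<forall>x\<in>L. \<forall>y\<in>L. \<phi> (x \<oplus>\<^bsub>A\<^esub> y) = \<phi> x + \<phi> y) \<and>
       (\<forall>c. \<forall>x\<in>L. \<phi> (scalar_elem Q I c \<otimes>\<^bsub>A\<^esub> x) = c * \<phi> x)},
     mult = undefined, one = undefined,
     zero = (\<lambda>x\<in>L. 0), add = (\<lambda>\<phi> \<psi>. \<lambda>x\<in>L. \<phi> x + \<psi> x),
     smult = (\<lambda>a \<phi>. \<lambda>x\<in>L. \<phi> (a \<otimes>\<^bsub>A\<^esub> x))\<rparr>)"


section \<open>Quasi-hereditary structures\<close>

text \<open>
  A partial order on the vertex set is a relation \<open>r\<close> with \<open>partial_order_on (verts Q) r\<close>, where
  \<open>(i, j) \<in> r\<close> means \<open>i \<unlhd> j\<close>; its strict part is \<open>r - Id\<close>.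
\<close>

definition factors_below ::
  "('v, 'e) pre_digraph \<Rightarrow> ('v \<times> 'e list \<Rightarrow> 'k::field) set \<Rightarrow> ('v \<times> 'v) set \<Rightarrow> 'v \<Rightarrow>
     (('v \<times> 'e list \<Rightarrow> 'k) set, 'm) module \<Rightarrow> bool" where
  "factors_below Q I r i M \<longleftrightarrow>
    (\<forall>j\<in>verts Q. comp_mult (bq_algebra Q I) M (simple_at Q I j) \<noteq> 0 \<longrightarrow> (j, i) \<in> r)"

text \<open>
  The maximal quotient of \<open>P(i)\<close> of the required form is the quotient by the least submodule (with
  respect to inclusion) yielding such a quotient.
\<close>

definition std_kernel ::
  "('v, 'e) pre_digraph \<Rightarrow> ('v \<times> 'e list \<Rightarrow> 'k::field) set \<Rightarrow> ('v \<times> 'v) set \<Rightarrow> 'v \<Rightarrow>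
     ('v \<times> 'e list \<Rightarrow> 'k) set set" where
  "std_kernel Q I r i = (LEAST U. submodule U (bq_algebra Q I) (proj_mod Q I i) \<and>
     factors_below Q I r i (quot_mod (proj_mod Q I i) U))"

definition std_mod ::
  "('v, 'e) pre_digraph \<Rightarrow> ('v \<times> 'e list \<Rightarrow> 'k::field) set \<Rightarrow> ('v \<times> 'v) set \<Rightarrow> 'v \<Rightarrow>
     (('v \<times> 'e list \<Rightarrow> 'k) set, ('v \<times> 'e list \<Rightarrow> 'k) set set) module" where
  "std_mod Q I r i = quot_mod (proj_mod Q I i) (std_kernel Q I r i)"

definition costd_mod ::
  "('v, 'e) pre_digraph \<Rightarrow> ('v \<times> 'e list \<Rightarrow> 'k::field) set \<Rightarrow> ('v \<times> 'v) set \<Rightarrow> 'v \<Rightarrow>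
     (('v \<times> 'e list \<Rightarrow> 'k) set, ('v \<times> 'e list \<Rightarrow> 'k) set \<Rightarrow> 'k) module" where
  "costd_mod Q I r i = restrict_mod (inj_mod Q I i)
     (GREATEST U. submodule U (bq_algebra Q I) (inj_mod Q I i) \<and>
        factors_below Q I r i (restrict_mod (inj_mod Q I i) U))"

definition quasi_hereditary_order ::
  "('v, 'e) pre_digraph \<Rightarrow> ('v \<times> 'e list \<Rightarrow> 'k::field) set \<Rightarrow> ('v \<times> 'v) set \<Rightarrow> bool" where
  "quasi_hereditary_order Q I r \<longleftrightarrow> partial_order_on (verts Q) r \<and>
    (\<forall>i\<in>verts Q.
       comp_mult (bq_algebra Q I) (std_mod Q I r i) (simple_at Q I i) = 1 \<and>
       (let K = restrict_mod (proj_mod Q I i) (std_kernel Q I r i) in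
         \<exists>F. filtration (bq_algebra Q I) K F \<and>
           (\<forall>l. Suc l < length F \<longrightarrow>
             (\<exists>j\<in>verts Q. (i, j) \<in> r - Id \<and>
                mod_iso (bq_algebra Q I) (subquot K F l) (std_mod Q I r j)))))"

definition equivalent_orders ::
  "('v, 'e) pre_digraph \<Rightarrow> ('v \<times> 'e list \<Rightarrow> 'k::field) set \<Rightarrow>
     (('v \<times> 'v) set \<times> ('v \<times> 'v) set) set" where
  "equivalent_orders Q I = {(r, s). quasi_hereditary_order Q I r \<and>
     quasi_hereditary_order Q I s \<and> (\<forall>i\<in>verts Q. std_mod Q I r i = std_mod Q I s i)}"

definition qh_structures ::
  "('v, 'e) pre_digraph \<Rightarrow> ('v \<times> 'e list \<Rightarrow> 'k::field) set \<Rightarrow> ('v \<times> 'v) set set set" where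
  "qh_structures Q I = {r. quasi_hereditary_order Q I r} // equivalent_orders Q I"

text \<open>
  The minimal adapted order of a quasi-hereditary structure \<open>X\<close>.  The standard and the costandard
  modules are the same for all representatives \<open>r \<in> X\<close>.  Reflexivity of the transitive
  closure comes from \<open>[\<Delta>(j) : S(j)] = 1\<close>.
\<close>

definition min_adapted ::
  "('v, 'e) pre_digraph \<Rightarrow> ('v \<times> 'e list \<Rightarrow> 'k::field) set \<Rightarrow> ('v \<times> 'v) set set \<Rightarrow>
     ('v \<times> 'v) set" where
  "min_adapted Q I X = {(i, j). i \<in> verts Q \<and> j \<in> verts Q \<and> (\<exists>r\<in>X.
      comp_mult (bq_algebra Q I) (std_mod Q I r j) (simple_at Q I i) \<noteq> 0 \<or>
      comp_mult (bq_algebra Q I) (costd_mod Q I r j) (simple_at Q I i) \<noteq> 0)}\<^sup>+"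


section \<open>Gluing a node\<close>

text \<open>
  The vertices \<open>v\<close> of \<open>QA\<close> and \<open>w\<close> of \<open>QB\<close> are identified; the resulting vertex is \<open>Inl v\<close>.
\<close>

definition glue_vertex :: "'a \<Rightarrow> 'b \<Rightarrow> 'b \<Rightarrow> 'a + 'b" where
  "glue_vertex v w x = (if x = w then Inl v else Inr x)"

definition glue_quiver ::
  "('a, 'e) pre_digraph \<Rightarrow> 'a \<Rightarrow> ('b, 'f) pre_digraph \<Rightarrow> 'b \<Rightarrow> ('a + 'b, 'e + 'f) pre_digraph"
  where
  "glue_quiver QA v QB w =
    \<lparr>verts = Inl ` verts QA \<union> glue_vertex v w ` verts QB,
     arcs = Inl ` arcs QA \<union> Inr ` arcs QB,
     tail = case_sum (\<lambda>a. Inl (tail QA a)) (\<lambda>b. glue_vertex v w (tail QB b)),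
     head = case_sum (\<lambda>a. Inl (head QA a)) (\<lambda>b. glue_vertex v w (head QB b))\<rparr>"

text \<open>The linear extension of a map \<open>h\<close> between sets of paths.\<close>

definition push_forward :: "('x \<Rightarrow> 'y) \<Rightarrow> ('x \<Rightarrow> 'k::field) \<Rightarrow> 'y \<Rightarrow> 'k" where
  "push_forward h f = (\<lambda>y. \<Sum>x | f x \<noteq> 0 \<and> h x = y. f x)"

definition glue_ideal ::
  "('a, 'e) pre_digraph \<Rightarrow> ('a \<times> 'e list \<Rightarrow> 'k::field) set \<Rightarrow> 'a \<Rightarrow>
   ('b, 'f) pre_digraph \<Rightarrow> ('b \<times> 'f list \<Rightarrow> 'k) set \<Rightarrow> 'b \<Rightarrow>
     (('a + 'b) \<times> ('e + 'f) list \<Rightarrow> 'k) set" where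
  "glue_ideal QA IA v QB IB w = (let Q = glue_quiver QA v QB w in
     Idl\<^bsub>path_algebra Q\<^esub>
      (push_forward (map_prod Inl (map Inl)) ` IA \<union>
       push_forward (map_prod (glue_vertex v w) (map Inr)) ` IB \<union>
       {path_elem (tail Q p, [p, q]) | p q.
          p \<in> arcs Q \<and> q \<in> arcs Q \<and> head Q p = Inl v \<and> tail Q q = Inl v}))"


section \<open>The compatibility conditions\<close>

text \<open>Here \<open>mA\<close> and \<open>mB\<close> stand for the minimal adapted orders.\<close>

definition cond_Delta ::
  "('a, 'e) pre_digraph \<Rightarrow> 'a \<Rightarrow> ('a \<times> 'a) set \<Rightarrow>
   ('b, 'f) pre_digraph \<Rightarrow> 'b \<Rightarrow> ('b \<times> 'b) set \<Rightarrow> bool" where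
  "cond_Delta QA v mA QB w mB \<longleftrightarrow>
    (\<exists>a\<in>arcs QA. head QA a = v \<and> (tail QA a, v) \<in> mA - Id) \<longrightarrow>
    (\<forall>b\<in>arcs QB. tail QB b = w \<longrightarrow> (w, head QB b) \<in> mB - Id)"

definition cond_nabla ::
  "('a, 'e) pre_digraph \<Rightarrow> 'a \<Rightarrow> ('a \<times> 'a) set \<Rightarrow>
   ('b, 'f) pre_digraph \<Rightarrow> 'b \<Rightarrow> ('b \<times> 'b) set \<Rightarrow> bool" where
  "cond_nabla QA v mA QB w mB \<longleftrightarrow>
    (\<exists>b\<in>arcs QB. tail QB b = w \<and> (head QB b, w) \<in> mB - Id) \<longrightarrow>
    (\<forall>a\<in>arcs QA. head QA a = v \<longrightarrow> (v, tail QA a) \<in> mA - Id)"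

end

theory Submission
  imports Defs
begin

text \<open>
  The standard module of a vertex \<open>i\<close> is \<open>P(i) / K(i)\<close>, where \<open>K(i)\<close> is the least right ideal containing
  \<open>e\<^sub>i A e\<^sub>q\<close> for all \<open>q\<close> that are not below \<open>i\<close>; all conditions on an order are expressed in terms of
  these right ideals.  The algebra \<open>C = A \<or>\<^sub>v B\<close> maps onto \<open>A\<close> and onto \<open>B\<close>.  The first map is injective on
  \<open>P(i)\<close> for the vertices \<open>i \<noteq> v\<close> of \<open>A\<close>, the second one for all vertices \<open>i\<close> of \<open>B\<close>, so filtrations by
  standard modules can be transferred along these maps, except for the subquotients \<open>\<Delta>(v)\<close> of \<open>P(i)\<close> for
  vertices \<open>i\<close> of \<open>A\<close>.  Those are the same over \<open>A\<close> and \<open>C\<close> if and only if no arrow \<open>v \<rightarrow> y\<close> satisfies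
  \<open>y \<lhd> v\<close>, and they occur if and only if some arrow \<open>x \<rightarrow> v\<close> satisfies \<open>x \<lhd> v\<close>.  Hence an
  order is quasi-hereditary for \<open>C\<close> if and only if its restrictions to \<open>A\<close> and \<open>B\<close> are and there are no
  two arrows \<open>x \<rightarrow> v \<rightarrow> y\<close> with \<open>x \<lhd> v\<close> and \<open>y \<lhd> v\<close>.  The ends of an arrow are comparable in every
  quasi-hereditary order and related in the same way in the minimal adapted order, so both \<open>(\<Delta>)\<close> and
  \<open>(\<nabla>)\<close> express this condition.
\<close>

section \<open>The path algebra\<close>

text \<open>The exceptional role of v has one cause: over \<open>A\<close> the projective at v is
  simple, because v is a sink, while over \<open>C\<close> it is the projective of \<open>B\<close>.
  Suppose \<Delta>(v) occurs in P(i) over \<open>C\<close> for another vertex i of \<open>A\<close>.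
  Its generator can be lifted to P(i), where everything killed by the map to \<open>A\<close> acts
  as zero; this forces \<Delta>(v) to be the same over both algebras. Conversely one must know that
  \<Delta>(v) does not occur when no arrow x \<rightarrow> v has x below v. The usual source is the
  reciprocity (P(i) : \<Delta>(v)) = [\<nabla>(v) : S(i)]; here it is replaced by following traces
  of projectives down a filtration. Costandard modules then only enter through the minimal adapted
  order, of which two facts suffice: it is contained in every representative of its class, and it
  orders the ends of each arrow as the representatives do. No bases are chosen: dimensions are
  counted along a chain of subspaces, which restricts to submodules and maps to quotients.\<close>

lemma (in pre_digraph) awlast_eq: "awlast u p = (if p = [] then u else head G (last p))"
  by (simp add: awalk_verts_conv)

text \<open>The unit vectors have to lie in \<open>S\<close> only for points of the support of
  \<open>f\<close>. This matters in \<open>J_iff\<close>, where the other paths need not lie in the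
  ideal.\<close>

lemma finsupp_induct:
  fixes f :: "'x \<Rightarrow> 'k::field"
  assumes fin: "finite {x. f x \<noteq> 0}" and b: "\<And>x. f x \<noteq> 0 \<Longrightarrow> b x \<in> S"
    and bdef: "\<And>x. b x = (\<lambda>y. if y = x then 1 else 0)"
    and zero: "(\<lambda>_. 0) \<in> S"
    and add: "\<And>g h. g \<in> S \<Longrightarrow> h \<in> S \<Longrightarrow> (\<lambda>x. g x + h x) \<in> S"
    and smul: "\<And>c g. g \<in> S \<Longrightarrow> (\<lambda>x. c * g x) \<in> S"
  shows "f \<in> S"
proof -
  have "\<forall>f. {x. f x \<noteq> 0} \<subseteq> T \<longrightarrow> (\<forall>x. f x \<noteq> 0 \<longrightarrow> b x \<in> S) \<longrightarrow> f \<in> S" if "finite T" for T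
    using that
  proof (induction T rule: finite_induct)
    case empty
    have "f = (\<lambda>_. 0)" if "{x. f x \<noteq> 0} \<subseteq> {}" for f :: "'x \<Rightarrow> 'k"
      using that by blast
    with zero show ?case by metis
  next
    case (insert y T)
    show ?case
    proof (intro allI impI)
      fix f :: "'x \<Rightarrow> 'k"
      assume sub: "{x. f x \<noteq> 0} \<subseteq> insert y T" and mem: "\<forall>x. f x \<noteq> 0 \<longrightarrow> b x \<in> S"
      define g where "g = (\<lambda>x. if x = y then 0 else f x)"
      have "{x. g x \<noteq> 0} \<subseteq> T" using sub by (auto simp: g_def)
      moreover have "\<forall>x. g x \<noteq> 0 \<longrightarrow> b x \<in> S" using mem by (simp add: g_def)
      ultimately have "g \<in> S" using insert.IH by blast
      moreover have "(\<lambda>x. f y * b y x) \<in> S"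
      proof (cases "f y = 0")
        case True
        then show ?thesis using zero by simp
      next
        case False
        then show ?thesis using mem smul by blast
      qed
      ultimately have "(\<lambda>x. g x + f y * b y x) \<in> S" by (rule add)
      moreover have "(\<lambda>x. g x + f y * b y x) = f" by (rule ext) (simp add: g_def bdef)
      ultimately show "f \<in> S" by simp
    qed
  qed
  with fin b show ?thesis by blast
qed

context fin_digraph
begin

lemma qpaths_iff: "(u, p) \<in> qpaths G \<longleftrightarrow> awalk u p (awlast u p)"
  by (auto simp: qpaths_def)

lemma qpaths_append: "(u, p @ q) \<in> qpaths G \<longleftrightarrow> (u, p) \<in> qpaths G \<and> (awlast u p, q) \<in> qpaths G"
  by (simp add: qpaths_iff awlast_append)

lemma qpaths_Nil [simp]: "(u, []) \<in> qpaths G \<longleftrightarrow> u \<in> verts G"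
  by (simp add: qpaths_iff awalk_Nil_iff)

lemma qpaths_Cons: "(u, a # p) \<in> qpaths G \<longleftrightarrow> a \<in> arcs G \<and> tail G a = u \<and> (head G a, p) \<in> qpaths G"
  by (auto simp: qpaths_iff awalk_Cons_iff)

lemma qpaths_take_drop:
  "(u, take n p) \<in> qpaths G \<Longrightarrow> (awlast u (take n p), drop n p) \<in> qpaths G \<Longrightarrow> (u, p) \<in> qpaths G"
  using qpaths_append[of u "take n p" "drop n p"] by simp

lemma path_carrierD:
  "f \<in> carrier (path_algebra G) \<Longrightarrow> finite {x. f x \<noteq> 0}"
  "f \<in> carrier (path_algebra G) \<Longrightarrow> f x \<noteq> 0 \<Longrightarrow> x \<in> qpaths G"
  by (auto simp: path_algebra_def)

lemma path_carrierI:
  "finite {x. f x \<noteq> 0} \<Longrightarrow> (\<And>x. f x \<noteq> 0 \<Longrightarrow> x \<in> qpaths G) \<Longrightarrow> f \<in> carrier (path_algebra G)"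
  by (auto simp: path_algebra_def)

lemma path_algebra_simps:
  "f \<otimes>\<^bsub>path_algebra G\<^esub> g = path_mult G f g"
  "f \<oplus>\<^bsub>path_algebra G\<^esub> g = (\<lambda>x. f x + g x)"
  "\<zero>\<^bsub>path_algebra G\<^esub> = (\<lambda>_. 0)"
  "\<one>\<^bsub>path_algebra G\<^esub> = (\<lambda>(u, p). if u \<in> verts G \<and> p = [] then 1 else 0)"
  by (simp_all add: path_algebra_def)

lemma path_mult_apply:
  "path_mult G f g (u, p) = (\<Sum>n\<le>length p. f (u, take n p) * g (awlast u (take n p), drop n p))"
  by (simp add: path_mult_def)

lemma path_mult_nz:
  assumes "path_mult G f g (u, p) \<noteq> 0"
  shows "\<exists>n\<le>length p. f (u, take n p) \<noteq> 0 \<and> g (awlast u (take n p), drop n p) \<noteq> 0"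
proof (rule ccontr)
  assume "\<not> ?thesis"
  then have "path_mult G f g (u, p) = 0"
    unfolding path_mult_apply by (intro sum.neutral) auto
  with assms show False by simp
qed

lemma path_mult_closed:
  assumes f: "f \<in> carrier (path_algebra G)" and g: "g \<in> carrier (path_algebra G)"
  shows "path_mult G f g \<in> carrier (path_algebra G)"
proof (rule path_carrierI)
  have "{x. path_mult G f g x \<noteq> 0} \<subseteq>
    (\<lambda>((u, p), (u', q)). (u, p @ q)) ` ({x. f x \<noteq> 0} \<times> {x. g x \<noteq> 0})"
  proof
    fix x assume "x \<in> {x. path_mult G f g x \<noteq> 0}"
    moreover obtain u p where x: "x = (u, p)" by fastforce
    ultimately obtain n where "f (u, take n p) \<noteq> 0" "g (awlast u (take n p), drop n p) \<noteq> 0"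
      using path_mult_nz by blast
    then show "x \<in> (\<lambda>((u, p), (u', q)). (u, p @ q)) ` ({x. f x \<noteq> 0} \<times> {x. g x \<noteq> 0})"
      by (intro image_eqI[where x = "((u, take n p), (awlast u (take n p), drop n p))"]) (auto simp: x)
  qed
  then show "finite {x. path_mult G f g x \<noteq> 0}"
    by (rule finite_subset) (use f g path_carrierD(1) in auto)
next
  fix x assume *: "path_mult G f g x \<noteq> 0"
  obtain u p where x: "x = (u, p)" by fastforce
  from * x obtain n where "f (u, take n p) \<noteq> 0" "g (awlast u (take n p), drop n p) \<noteq> 0"
    using path_mult_nz by blast
  then show "x \<in> qpaths G"
    unfolding x using f g path_carrierD(2) qpaths_take_drop by blast
qed

text \<open>Both products sum over the ways of cutting a path into three pieces. The left one runs
  over the second cut \<open>n\<close> and the first cut \<open>m\<close> below it, the right one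
  over the first cut \<open>m\<close> and the length \<open>l\<close> of the middle piece;
  \<open>sum.triangle_reindex_eq\<close> exchanges the two.\<close>

lemma path_mult_assoc:
  "path_mult G (path_mult G f g) h = path_mult G f (path_mult G g h)"
proof
  fix x :: "'a \<times> 'b list"
  obtain u p where x: "x = (u, p)" by fastforce
  let ?L = "length p"
  let ?t = "\<lambda>m l. f (u, take m p) * g (awlast u (take m p), take l (drop m p)) *
     h (awlast u (take (m + l) p), drop (m + l) p)"
  have "path_mult G (path_mult G f g) h (u, p) = (\<Sum>n\<le>?L. \<Sum>m\<le>n. ?t m (n - m))"
    unfolding path_mult_apply sum_distrib_right
    by (intro sum.cong refl) (auto simp: min_def drop_take)
  also have "\<dots> = (\<Sum>(m, l) \<in> {(m, l). m + l \<le> ?L}. ?t m l)"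
    by (rule sum.triangle_reindex_eq[symmetric])
  also have "{(m, l). m + l \<le> ?L} = (SIGMA m:{..?L}. {..?L - m})" by auto
  also have "(\<Sum>(m, l) \<in> (SIGMA m:{..?L}. {..?L - m}). ?t m l) = (\<Sum>m\<le>?L. \<Sum>l\<le>?L - m. ?t m l)"
    by (simp add: sum.Sigma)
  also have "\<dots> = path_mult G f (path_mult G g h) (u, p)"
    unfolding path_mult_apply sum_distrib_left
  proof (intro sum.cong refl)
    show "{..length p - m} = {..length (drop m p)}" for m by simp
    fix m l
    have "awlast (awlast u (take m p)) (take l (drop m p)) = awlast u (take (m + l) p)"
      by (simp only: awlast_append[symmetric] take_add)
    moreover have "drop l (drop m p) = drop (m + l) p" by (simp add: add.commute)
    ultimately show "?t m l = f (u, take m p) * (g (awlast u (take m p), take l (drop m p)) *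
      h (awlast (awlast u (take m p)) (take l (drop m p)), drop l (drop m p)))"
      by (simp only: mult.assoc)
  qed
  finally show "path_mult G (path_mult G f g) h x = path_mult G f (path_mult G g h) x"
    by (simp add: x)
qed

text \<open>The left factor is the sum of the trivial paths at the vertices with \<open>P\<close>. A
  single vertex and the identity of the path algebra are both of this form.\<close>

lemma idem_mult:
  assumes "f \<in> carrier (path_algebra G)"
  shows "path_mult G (\<lambda>(u, p). if P u \<and> p = [] then 1 else 0) f = (\<lambda>(u, p). if P u then f (u, p) else 0)"
proof
  fix x :: "'a \<times> 'b list"
  obtain u p where x: "x = (u, p)" by fastforce
  have "path_mult G (\<lambda>(u, p). if P u \<and> p = [] then 1 else 0) f (u, p) =
    (\<Sum>n\<le>length p. if n = 0 then (if P u then f (u, p) else 0) else 0)"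
    unfolding path_mult_apply by (intro sum.cong refl) auto
  then show "path_mult G (\<lambda>(u, p). if P u \<and> p = [] then 1 else 0) f x =
    (case x of (u, p) \<Rightarrow> if P u then f (u, p) else 0)"
    by (simp add: x)
qed

lemma mult_idem:
  assumes "f \<in> carrier (path_algebra G)"
  shows "path_mult G f (\<lambda>(u, p). if P u \<and> p = [] then 1 else 0) =
    (\<lambda>(u, p). if P (awlast u p) then f (u, p) else 0)"
proof
  fix x :: "'a \<times> 'b list"
  obtain u p where x: "x = (u, p)" by fastforce
  have "path_mult G f (\<lambda>(u, p). if P u \<and> p = [] then 1 else 0) (u, p) =
    (\<Sum>n\<le>length p. if n = length p then (if P (awlast u p) then f (u, p) else 0) else 0)"
    unfolding path_mult_apply by (intro sum.cong refl) auto
  then show "path_mult G f (\<lambda>(u, p). if P u \<and> p = [] then 1 else 0) x =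
    (case x of (u, p) \<Rightarrow> if P (awlast u p) then f (u, p) else 0)"
    by (simp add: x)
qed

lemma path_end_in_verts: "(u, p) \<in> qpaths G \<Longrightarrow> u \<in> verts G \<and> awlast u p \<in> verts G"
  by (auto simp: qpaths_iff intro: awalk_last_in_verts)

lemma path_one_closed:
  "(\<lambda>(u, p). if u \<in> verts G \<and> p = [] then 1 else (0::'k::field)) \<in> carrier (path_algebra G)"
proof (rule path_carrierI)
  have "{x. (case x of (u, p) \<Rightarrow> if u \<in> verts G \<and> p = [] then 1 else (0::'k)) \<noteq> 0} \<subseteq> verts G \<times> {[]}"
    by (auto split: if_splits)
  then show "finite {x. (case x of (u, p) \<Rightarrow> if u \<in> verts G \<and> p = [] then 1 else (0::'k)) \<noteq> 0}"
    by (rule finite_subset) auto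
qed (auto split: if_splits)

lemma path_one_mult: "f \<in> carrier (path_algebra G) \<Longrightarrow> \<one>\<^bsub>path_algebra G\<^esub> \<otimes>\<^bsub>path_algebra G\<^esub> f = f"
  unfolding path_algebra_simps
  by (subst idem_mult) (auto simp: fun_eq_iff dest!: path_carrierD(2) dest: path_end_in_verts)

lemma path_mult_one: "f \<in> carrier (path_algebra G) \<Longrightarrow> f \<otimes>\<^bsub>path_algebra G\<^esub> \<one>\<^bsub>path_algebra G\<^esub> = f"
  unfolding path_algebra_simps
  by (subst mult_idem) (auto simp: fun_eq_iff dest!: path_carrierD(2) dest: path_end_in_verts)

lemma path_add_closed:
  assumes "f \<in> carrier (path_algebra G)" "g \<in> carrier (path_algebra G)"
  shows "(\<lambda>x. f x + g x) \<in> carrier (path_algebra G)"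
proof (rule path_carrierI)
  have "{x. f x + g x \<noteq> 0} \<subseteq> {x. f x \<noteq> 0} \<union> {x. g x \<noteq> 0}" by auto
  then show "finite {x. f x + g x \<noteq> 0}"
    by (rule finite_subset) (use assms path_carrierD(1) in auto)
next
  fix x assume "f x + g x \<noteq> 0"
  then have "f x \<noteq> 0 \<or> g x \<noteq> 0" by auto
  then show "x \<in> qpaths G" using assms path_carrierD(2) by blast
qed

lemma path_smul_closed:
  assumes "f \<in> carrier (path_algebra G)"
  shows "(\<lambda>x. c * f x) \<in> carrier (path_algebra G)"
proof (rule path_carrierI)
  have "{x. c * f x \<noteq> 0} \<subseteq> {x. f x \<noteq> 0}" by auto
  then show "finite {x. c * f x \<noteq> 0}"
    by (rule finite_subset) (use assms path_carrierD(1) in auto)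
qed (use assms path_carrierD(2) in fastforce)

lemma path_zero_closed: "(\<lambda>_. 0) \<in> carrier (path_algebra G)"
  by (rule path_carrierI) auto

lemma abelian_group_path_algebra: "abelian_group (path_algebra G :: ('a \<times> 'b list \<Rightarrow> 'k::field) ring)"
proof (rule abelian_groupI)
  fix f :: "'a \<times> 'b list \<Rightarrow> 'k" assume "f \<in> carrier (path_algebra G)"
  then show "\<exists>y\<in>carrier (path_algebra G). y \<oplus>\<^bsub>path_algebra G\<^esub> f = \<zero>\<^bsub>path_algebra G\<^esub>"
    by (intro bexI[where x = "\<lambda>x. (-1) * f x"] path_smul_closed) (auto simp: path_algebra_simps)
qed (auto simp: path_algebra_simps path_add_closed path_zero_closed add_ac)

lemma ring_path_algebra: "ring (path_algebra G :: ('a \<times> 'b list \<Rightarrow> 'k::field) ring)"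
proof (rule ringI)
  show "Group.monoid (path_algebra G :: ('a \<times> 'b list \<Rightarrow> 'k::field) ring)"
    by (rule monoidI)
      (auto simp: path_one_mult path_mult_one, auto simp: path_algebra_simps path_mult_closed path_mult_assoc path_one_closed)
qed (auto simp: path_algebra_simps path_mult_def algebra_simps sum.distrib abelian_group_path_algebra)

lemma path_minus:
  assumes "f \<in> carrier (path_algebra G)"
  shows "\<ominus>\<^bsub>path_algebra G\<^esub> f = (\<lambda>x. - f x)"
proof -
  interpret R: ring "path_algebra G :: ('a \<times> 'b list \<Rightarrow> 'k::field) ring" by (rule ring_path_algebra)
  have "(\<lambda>x. (-1) * f x) \<in> carrier (path_algebra G)" using assms by (rule path_smul_closed)
  then show ?thesis using assms
    by (intro R.minus_equality) (auto simp: path_algebra_simps)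
qed

lemma path_diff:
  assumes "f \<in> carrier (path_algebra G)" "g \<in> carrier (path_algebra G)"
  shows "f \<ominus>\<^bsub>path_algebra G\<^esub> g = (\<lambda>x. f x - g x)"
  using assms by (simp add: a_minus_def path_minus path_algebra_simps)

lemma path_smul_mult:
  "path_mult G (\<lambda>x. c * f x) g = (\<lambda>x. c * path_mult G f g x)"
  "path_mult G f (\<lambda>x. c * g x) = (\<lambda>x. c * path_mult G f g x)"
  by (simp_all add: fun_eq_iff path_mult_def sum_distrib_left mult.assoc mult.left_commute[of c])

lemma path_elem_closed: "x \<in> qpaths G \<Longrightarrow> path_elem x \<in> carrier (path_algebra G)"
  by (rule path_carrierI) (auto simp: path_elem_def split: if_splits)

lemma path_elem_vertex: "path_elem (i, []) = (\<lambda>(u, p). if u = i \<and> p = [] then 1 else 0)"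
  by (auto simp: path_elem_def fun_eq_iff)

text \<open>Among the cuts of a path, only the one at \<open>length p\<close> can separate
  \<open>p\<close> from \<open>q\<close>.\<close>

lemma path_elem_append:
  "path_mult G (path_elem (u, p)) (path_elem (awlast u p, q)) =
    (path_elem (u, p @ q) :: 'a \<times> 'b list \<Rightarrow> 'k::field)"
proof
  fix x :: "'a \<times> 'b list"
  obtain u' r where x: "x = (u', r)" by fastforce
  have "path_mult G (path_elem (u, p)) (path_elem (awlast u p, q)) (u', r) =
    (\<Sum>n\<le>length r. if n = length p then path_elem (u, p @ q) (u', r) else (0::'k))"
    unfolding path_mult_apply
  proof (intro sum.cong refl)
    fix n assume n: "n \<in> {..length r}"
    have eq: "n = length p \<and> r = p @ q \<longleftrightarrow> take n r = p \<and> drop n r = q"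
    proof
      assume "n = length p \<and> r = p @ q"
      then show "take n r = p \<and> drop n r = q" by simp
    next
      assume *: "take n r = p \<and> drop n r = q"
      then have "r = p @ q" using append_take_drop_id[of n r] by simp
      moreover have "length (take n r) = n" using n by simp
      then have "n = length p" using * by simp
      ultimately show "n = length p \<and> r = p @ q" by simp
    qed
    show "path_elem (u, p) (u', take n r) * path_elem (awlast u p, q) (awlast u' (take n r), drop n r) =
      (if n = length p then path_elem (u, p @ q) (u', r) else (0::'k))"
    proof (cases "u' = u \<and> take n r = p \<and> drop n r = q")
      case True
      then have "n = length p" "r = p @ q" using eq by blast+
      then show ?thesis using True by (simp add: path_elem_def)
    next
      case False
      then have "\<not> (u' = u \<and> n = length p \<and> r = p @ q)" using eq by blast
      then have "(if n = length p then path_elem (u, p @ q) (u', r) else 0) = (0::'k)"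
        unfolding path_elem_def by (metis Pair_inject)
      moreover have "(path_elem (u, p) (u', take n r) :: 'k) = 0 \<or>
          (path_elem (awlast u p, q) (awlast u' (take n r), drop n r) :: 'k) = 0"
        using False by (simp add: path_elem_def del: drop_eq_Nil)
      ultimately show ?thesis by (metis mult_eq_0_iff)
    qed
  qed
  also have "\<dots> = path_elem (u, p @ q) (u', r)"
    by (simp add: sum.delta) (simp add: path_elem_def)
  finally show "path_mult G (path_elem (u, p)) (path_elem (awlast u p, q)) x = (path_elem (u, p @ q) x :: 'k)"
    by (simp add: x)
qed

lemma path_algebra_induct:
  assumes f: "f \<in> carrier (path_algebra G)"
    and "\<And>x. f x \<noteq> 0 \<Longrightarrow> path_elem x \<in> S"
    and "(\<lambda>_. 0) \<in> S"
    and "\<And>g h. g \<in> S \<Longrightarrow> h \<in> S \<Longrightarrow> (\<lambda>x. g x + h x) \<in> S"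
    and "\<And>c g. g \<in> S \<Longrightarrow> (\<lambda>x. c * g x) \<in> S"
  shows "f \<in> S"
proof (rule finsupp_induct[where b = path_elem and S = S and f = f])
  show "finite {x. f x \<noteq> 0}" using f by (rule path_carrierD(1))
  show "path_elem x = (\<lambda>y. if y = x then 1 else 0)" for x :: "'a \<times> 'b list"
    by (simp add: path_elem_def)
qed (fact assms)+

end

section \<open>Right modules over a basic algebra\<close>

text \<open>\<open>N p\<close> is the \<open>p\<close>-th power of the arrow ideal and \<open>X\<close> the set of arrows.  In \<open>arrow_coef\<close>, \<open>\<kappa>\<close> is the
  coefficient of the arrow \<open>\<alpha>\<close> and \<open>\<epsilon>'\<close>, \<open>\<epsilon>\<close> are those of the trivial paths at its ends: the matrix with rows
  \<open>(\<epsilon>', \<kappa>)\<close> and \<open>(0, \<epsilon>)\<close> is the representation of dimension two supported on \<open>\<alpha>\<close>.\<close>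

locale basic_algebra = ring R for R :: "('r, 'z) ring_scheme" (structure) +
  fixes V :: "'v set" and e :: "'v \<Rightarrow> 'r" and s :: "'k::field \<Rightarrow> 'r"
    and N :: "nat \<Rightarrow> 'r set" and X :: "('v \<times> 'r \<times> 'v) set"
  assumes fin_V: "finite V"
    and e_closed [simp, intro]: "i \<in> V \<Longrightarrow> e i \<in> carrier R"
    and e_idem: "i \<in> V \<Longrightarrow> e i \<otimes> e i = e i"
    and e_orth: "i \<in> V \<Longrightarrow> j \<in> V \<Longrightarrow> i \<noteq> j \<Longrightarrow> e i \<otimes> e j = \<zero>"
    and e_sum: "finsum R e V = \<one>"
    and s_closed [simp, intro]: "s c \<in> carrier R"
    and s_add: "s (c + d) = s c \<oplus> s d"
    and s_mult: "s (c * d) = s c \<otimes> s d"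
    and s_one: "s 1 = \<one>"
    and s_comm: "x \<in> carrier R \<Longrightarrow> s c \<otimes> x = x \<otimes> s c"
    and N_ideal: "ideal (N p) R"
    and N_mult: "a \<in> N p \<Longrightarrow> b \<in> N q \<Longrightarrow> a \<otimes> b \<in> N (p + q)"
    and N_0: "N 0 = carrier R"
    and N_nil: "\<exists>m. N m = {\<zero>}"
    and e_local: "i \<in> V \<Longrightarrow> a \<in> carrier R \<Longrightarrow> \<exists>c. \<exists>n\<in>N 1. e i \<otimes> a = s c \<otimes> e i \<oplus> n"
    and e_notin: "i \<in> V \<Longrightarrow> e i \<notin> N 1"
    and fin_gen: "\<exists>bs. set bs \<subseteq> carrier R \<and> (\<forall>G. subgroup G (add_monoid R) \<longrightarrow>
      (\<forall>c. \<forall>x\<in>G. s c \<otimes> x \<in> G) \<longrightarrow> set bs \<subseteq> G \<longrightarrow> carrier R \<subseteq> G)"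
    and arrow: "(i, \<alpha>, j) \<in> X \<Longrightarrow> i \<in> V \<and> j \<in> V \<and> \<alpha> \<in> N 1 \<and> \<alpha> \<notin> N 2 \<and> e i \<otimes> \<alpha> = \<alpha> \<and> \<alpha> \<otimes> e j = \<alpha>"
    and N_right: "n \<in> N 1 \<Longrightarrow> v \<in> V \<Longrightarrow> subgroup G (add_monoid R) \<Longrightarrow>
      (\<And>x \<alpha> a. (x, \<alpha>, v) \<in> X \<Longrightarrow> a \<in> carrier R \<Longrightarrow> a \<otimes> \<alpha> \<in> G) \<Longrightarrow> n \<otimes> e v \<in> G"
    and N_left: "n \<in> N 1 \<Longrightarrow> v \<in> V \<Longrightarrow> subgroup G (add_monoid R) \<Longrightarrow>
      (\<And>y \<alpha> a. (v, \<alpha>, y) \<in> X \<Longrightarrow> a \<in> carrier R \<Longrightarrow> \<alpha> \<otimes> a \<in> G) \<Longrightarrow> e v \<otimes> n \<in> G"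
    and arrow_coef: "(i, \<alpha>, j) \<in> X \<Longrightarrow> \<exists>\<kappa> \<epsilon> \<epsilon>'.
      (\<forall>a\<in>carrier R. \<forall>b\<in>carrier R. \<kappa> (a \<oplus> b) = \<kappa> a + (\<kappa> b :: 'k) \<and> \<epsilon> (a \<oplus> b) = \<epsilon> a + (\<epsilon> b :: 'k) \<and>
        \<kappa> (a \<otimes> b) = \<epsilon>' a * \<kappa> b + \<kappa> a * \<epsilon> b \<and> \<epsilon> (a \<otimes> b) = \<epsilon> a * \<epsilon> b) \<and>
      \<kappa> \<alpha> = 1 \<and> (\<forall>c. \<kappa> (s c) = 0 \<and> \<epsilon> (s c) = c \<and> \<epsilon>' (s c) = c) \<and>
      (\<forall>q\<in>V. \<kappa> (e q) = 0 \<and> \<epsilon> (e q) = (if q = j then 1 else 0) \<and> \<epsilon>' (e q) = (if q = i then 1 else 0))"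

text \<open>The element type of \<open>M\<close> is independent of that of the ring, so the same
  lemmas serve right ideals, quotients (whose elements are cosets) and dual modules (whose elements
  are linear forms).\<close>

locale rmodule = basic_algebra R V e s N X + M: abelian_group M
  for R :: "('r, 'z) ring_scheme" (structure) and V :: "'v set" and e :: "'v \<Rightarrow> 'r" and s :: "'k::field \<Rightarrow> 'r"
    and N and X :: "('v \<times> 'r \<times> 'v) set" and M :: "('r, 'm) module" (structure) +
  assumes smult_closed [simp, intro]: "a \<in> carrier R \<Longrightarrow> x \<in> carrier M \<Longrightarrow> a \<odot>\<^bsub>M\<^esub> x \<in> carrier M"
    and smult_l_distr: "a \<in> carrier R \<Longrightarrow> b \<in> carrier R \<Longrightarrow> x \<in> carrier M \<Longrightarrow>
      (a \<oplus> b) \<odot>\<^bsub>M\<^esub> x = a \<odot>\<^bsub>M\<^esub> x \<oplus>\<^bsub>M\<^esub> b \<odot>\<^bsub>M\<^esub> x"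
    and smult_r_distr: "a \<in> carrier R \<Longrightarrow> x \<in> carrier M \<Longrightarrow> y \<in> carrier M \<Longrightarrow>
      a \<odot>\<^bsub>M\<^esub> (x \<oplus>\<^bsub>M\<^esub> y) = a \<odot>\<^bsub>M\<^esub> x \<oplus>\<^bsub>M\<^esub> a \<odot>\<^bsub>M\<^esub> y"
    and smult_assoc: "a \<in> carrier R \<Longrightarrow> b \<in> carrier R \<Longrightarrow> x \<in> carrier M \<Longrightarrow>
      (a \<otimes> b) \<odot>\<^bsub>M\<^esub> x = b \<odot>\<^bsub>M\<^esub> (a \<odot>\<^bsub>M\<^esub> x)"
    and smult_one: "x \<in> carrier M \<Longrightarrow> \<one> \<odot>\<^bsub>M\<^esub> x = x"
begin

lemma smult_l_zero [simp]:
  assumes "x \<in> carrier M" shows "\<zero> \<odot>\<^bsub>M\<^esub> x = \<zero>\<^bsub>M\<^esub>"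
proof -
  have "\<zero> \<odot>\<^bsub>M\<^esub> x \<oplus>\<^bsub>M\<^esub> \<zero> \<odot>\<^bsub>M\<^esub> x = \<zero> \<odot>\<^bsub>M\<^esub> x"
    using smult_l_distr[of \<zero> \<zero> x] assms by simp
  then show ?thesis using assms M.add.l_cancel_one[of "\<zero> \<odot>\<^bsub>M\<^esub> x"] by simp
qed

lemma smult_r_zero [simp]:
  assumes "a \<in> carrier R" shows "a \<odot>\<^bsub>M\<^esub> \<zero>\<^bsub>M\<^esub> = \<zero>\<^bsub>M\<^esub>"
proof -
  have "a \<odot>\<^bsub>M\<^esub> \<zero>\<^bsub>M\<^esub> \<oplus>\<^bsub>M\<^esub> a \<odot>\<^bsub>M\<^esub> \<zero>\<^bsub>M\<^esub> = a \<odot>\<^bsub>M\<^esub> \<zero>\<^bsub>M\<^esub>"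
    using smult_r_distr[of a "\<zero>\<^bsub>M\<^esub>" "\<zero>\<^bsub>M\<^esub>"] assms by simp
  then show ?thesis using assms M.add.l_cancel_one[of "a \<odot>\<^bsub>M\<^esub> \<zero>\<^bsub>M\<^esub>"] by simp
qed

lemma smult_l_minus:
  assumes "a \<in> carrier R" "x \<in> carrier M"
  shows "(\<ominus> a) \<odot>\<^bsub>M\<^esub> x = \<ominus>\<^bsub>M\<^esub> (a \<odot>\<^bsub>M\<^esub> x)"
proof -
  have "(\<ominus> a) \<odot>\<^bsub>M\<^esub> x \<oplus>\<^bsub>M\<^esub> a \<odot>\<^bsub>M\<^esub> x = \<zero>\<^bsub>M\<^esub>"
    using smult_l_distr[of "\<ominus> a" a x] assms by (simp add: l_neg)
  then show ?thesis using assms M.minus_equality by simp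
qed

abbreviation subm :: "'m set \<Rightarrow> bool" where
  "subm U \<equiv> submodule U R M"

text \<open>Closure under negatives comes from the action of the negative of one.\<close>

lemma subm_iff:
  "subm U \<longleftrightarrow> U \<subseteq> carrier M \<and> \<zero>\<^bsub>M\<^esub> \<in> U \<and> (\<forall>x\<in>U. \<forall>y\<in>U. x \<oplus>\<^bsub>M\<^esub> y \<in> U) \<and>
    (\<forall>a\<in>carrier R. \<forall>x\<in>U. a \<odot>\<^bsub>M\<^esub> x \<in> U)" (is "?L \<longleftrightarrow> ?R")
proof
  assume ?L
  then interpret submodule U R M .
  show ?R using subset smult_closed m_closed one_closed by auto
next
  assume r: ?R
  have "\<ominus>\<^bsub>M\<^esub> x \<in> U" if "x \<in> U" for x
  proof -
    have "(\<ominus> \<one>) \<odot>\<^bsub>M\<^esub> x \<in> U" using r that by blast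
    moreover have "x \<in> carrier M" using r that by blast
    ultimately show ?thesis using smult_l_minus[of \<one> x] smult_one[of x] by simp
  qed
  then show ?L
    using r by (intro submodule.intro subgroup.intro) (auto simp: submodule_axioms_def a_inv_def)
qed

lemma submD:
  assumes "subm U"
  shows "U \<subseteq> carrier M" "\<zero>\<^bsub>M\<^esub> \<in> U" "x \<in> U \<Longrightarrow> x \<in> carrier M"
    "x \<in> U \<Longrightarrow> y \<in> U \<Longrightarrow> x \<oplus>\<^bsub>M\<^esub> y \<in> U" "a \<in> carrier R \<Longrightarrow> x \<in> U \<Longrightarrow> a \<odot>\<^bsub>M\<^esub> x \<in> U"
    "x \<in> U \<Longrightarrow> \<ominus>\<^bsub>M\<^esub> x \<in> U" "x \<in> U \<Longrightarrow> y \<in> U \<Longrightarrow> x \<ominus>\<^bsub>M\<^esub> y \<in> U"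
proof -
  show c: "U \<subseteq> carrier M" "\<zero>\<^bsub>M\<^esub> \<in> U" and "x \<in> U \<Longrightarrow> x \<in> carrier M"
    and p: "\<And>x y. x \<in> U \<Longrightarrow> y \<in> U \<Longrightarrow> x \<oplus>\<^bsub>M\<^esub> y \<in> U"
    and "a \<in> carrier R \<Longrightarrow> x \<in> U \<Longrightarrow> a \<odot>\<^bsub>M\<^esub> x \<in> U"
    using assms unfolding subm_iff by auto
  show m: "\<And>x. x \<in> U \<Longrightarrow> \<ominus>\<^bsub>M\<^esub> x \<in> U"
    using subgroup.m_inv_closed[OF submodule.axioms(1)[OF assms]] by (simp add: a_inv_def)
  show "x \<in> U \<Longrightarrow> y \<in> U \<Longrightarrow> x \<ominus>\<^bsub>M\<^esub> y \<in> U"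
    using p m by (simp add: a_minus_def)
qed

section \<open>Subspaces, flags and dimensions\<close>

definition subsp :: "'m set \<Rightarrow> bool" where
  "subsp U \<longleftrightarrow> U \<subseteq> carrier M \<and> \<zero>\<^bsub>M\<^esub> \<in> U \<and> (\<forall>x\<in>U. \<forall>y\<in>U. x \<oplus>\<^bsub>M\<^esub> y \<in> U) \<and>
    (\<forall>c. \<forall>x\<in>U. s c \<odot>\<^bsub>M\<^esub> x \<in> U)"

lemma s_zero [simp]: "s 0 = \<zero>"
proof -
  have "s 0 \<oplus> s 0 = s 0" using s_add[of 0 0] by simp
  then show ?thesis using add.l_cancel_one[of "s 0" "s 0"] by simp
qed

lemma s_uminus: "s (- c) = \<ominus> s c"
proof -
  have "s (- c) \<oplus> s c = \<zero>" using s_add[of "- c" c] by simp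
  then show ?thesis using minus_equality by simp
qed

lemma s_minus_smult: "x \<in> carrier M \<Longrightarrow> s (- c) \<odot>\<^bsub>M\<^esub> x = \<ominus>\<^bsub>M\<^esub> (s c \<odot>\<^bsub>M\<^esub> x)"
  by (simp add: s_uminus smult_l_minus)

lemma s_smult_smult: "x \<in> carrier M \<Longrightarrow> s c \<odot>\<^bsub>M\<^esub> (s d \<odot>\<^bsub>M\<^esub> x) = s (c * d) \<odot>\<^bsub>M\<^esub> x"
  using smult_assoc[of "s d" "s c" x] by (simp add: s_mult[symmetric] mult.commute)

lemma s_one_smult: "x \<in> carrier M \<Longrightarrow> s 1 \<odot>\<^bsub>M\<^esub> x = x"
  by (simp add: s_one smult_one)

lemma subspD:
  assumes "subsp U"
  shows "U \<subseteq> carrier M" "\<zero>\<^bsub>M\<^esub> \<in> U" "x \<in> U \<Longrightarrow> x \<in> carrier M"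
    "x \<in> U \<Longrightarrow> y \<in> U \<Longrightarrow> x \<oplus>\<^bsub>M\<^esub> y \<in> U" "x \<in> U \<Longrightarrow> s c \<odot>\<^bsub>M\<^esub> x \<in> U"
    "x \<in> U \<Longrightarrow> \<ominus>\<^bsub>M\<^esub> x \<in> U" "x \<in> U \<Longrightarrow> y \<in> U \<Longrightarrow> x \<ominus>\<^bsub>M\<^esub> y \<in> U"
proof -
  show "U \<subseteq> carrier M" "\<zero>\<^bsub>M\<^esub> \<in> U" and c: "\<And>x. x \<in> U \<Longrightarrow> x \<in> carrier M"
    and p: "\<And>x y. x \<in> U \<Longrightarrow> y \<in> U \<Longrightarrow> x \<oplus>\<^bsub>M\<^esub> y \<in> U"
    and h: "\<And>x c. x \<in> U \<Longrightarrow> s c \<odot>\<^bsub>M\<^esub> x \<in> U"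
    using assms unfolding subsp_def by auto
  show m: "\<And>x. x \<in> U \<Longrightarrow> \<ominus>\<^bsub>M\<^esub> x \<in> U"
  proof -
    fix x assume "x \<in> U"
    then show "\<ominus>\<^bsub>M\<^esub> x \<in> U" using h[of x "- 1"] c s_minus_smult[of x 1] s_one_smult by simp
  qed
  show "x \<in> U \<Longrightarrow> y \<in> U \<Longrightarrow> x \<ominus>\<^bsub>M\<^esub> y \<in> U"
    using p m by (simp add: a_minus_def)
qed

lemma subm_subsp: "subm U \<Longrightarrow> subsp U"
  by (simp add: subm_iff subsp_def)

lemma minus_add_cancel:
  assumes "x \<in> carrier M" "y \<in> carrier M"
  shows "(x \<ominus>\<^bsub>M\<^esub> y) \<oplus>\<^bsub>M\<^esub> y = x" "(x \<oplus>\<^bsub>M\<^esub> y) \<ominus>\<^bsub>M\<^esub> y = x" "y \<oplus>\<^bsub>M\<^esub> (x \<ominus>\<^bsub>M\<^esub> y) = x"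
proof -
  show *: "(x \<ominus>\<^bsub>M\<^esub> y) \<oplus>\<^bsub>M\<^esub> y = x" "(x \<oplus>\<^bsub>M\<^esub> y) \<ominus>\<^bsub>M\<^esub> y = x"
    using assms by (simp_all add: a_minus_def M.a_assoc M.l_neg M.r_neg)
  show "y \<oplus>\<^bsub>M\<^esub> (x \<ominus>\<^bsub>M\<^esub> y) = x"
    using * assms by (simp add: M.a_comm)
qed

lemma minus_add_add:
  assumes "x \<in> carrier M" "y \<in> carrier M" "z \<in> carrier M"
  shows "(x \<oplus>\<^bsub>M\<^esub> z) \<ominus>\<^bsub>M\<^esub> (y \<oplus>\<^bsub>M\<^esub> z) = x \<ominus>\<^bsub>M\<^esub> y"
proof -
  have "(x \<oplus>\<^bsub>M\<^esub> z) \<ominus>\<^bsub>M\<^esub> (y \<oplus>\<^bsub>M\<^esub> z) = x \<oplus>\<^bsub>M\<^esub> (z \<oplus>\<^bsub>M\<^esub> (\<ominus>\<^bsub>M\<^esub> z \<oplus>\<^bsub>M\<^esub> \<ominus>\<^bsub>M\<^esub> y))"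
    using assms by (simp add: a_minus_def M.add.inv_mult_group M.a_assoc)
  also have "z \<oplus>\<^bsub>M\<^esub> (\<ominus>\<^bsub>M\<^esub> z \<oplus>\<^bsub>M\<^esub> \<ominus>\<^bsub>M\<^esub> y) = \<ominus>\<^bsub>M\<^esub> y" using assms by (rule_tac M.r_neg2) auto
  finally show ?thesis by (simp add: a_minus_def)
qed

definition "span1 U y = {u \<oplus>\<^bsub>M\<^esub> s c \<odot>\<^bsub>M\<^esub> y | u c. u \<in> U}"

text \<open>A finite chain of subspaces from 0 to \<open>M\<close> with steps of dimension at most one; it serves as
  a substitute for a basis that passes to submodules and quotients.\<close>

definition flag :: "(nat \<Rightarrow> 'm set) \<Rightarrow> nat \<Rightarrow> bool" where
  "flag L K \<longleftrightarrow> L 0 = {\<zero>\<^bsub>M\<^esub>} \<and> L K = carrier M \<and> (\<forall>n. subsp (L n)) \<and> (\<forall>n. L n \<subseteq> L (Suc n)) \<and>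
    (\<forall>n. \<forall>x\<in>L (Suc n). \<forall>y\<in>L (Suc n) - L n. \<exists>c. x \<ominus>\<^bsub>M\<^esub> s c \<odot>\<^bsub>M\<^esub> y \<in> L n)"

text \<open>The pivot positions of \<open>U\<close> along the flag, as in an echelon form; their
  number plays the part of the dimension of \<open>U\<close>.\<close>

definition jumps :: "(nat \<Rightarrow> 'm set) \<Rightarrow> nat \<Rightarrow> 'm set \<Rightarrow> nat set" where
  "jumps L K U = {n. n < K \<and> (\<exists>x\<in>U. x \<in> L (Suc n) \<and> x \<notin> L n)}"

lemma finite_jumps [simp]: "finite (jumps L K U)"
  by (simp add: jumps_def)

lemma jumps_mono: "U \<subseteq> W \<Longrightarrow> jumps L K U \<subseteq> jumps L K W"
  by (auto simp: jumps_def)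

context
  fixes L K
  assumes fl: "flag L K"
begin

lemma flagD:
  shows "L 0 = {\<zero>\<^bsub>M\<^esub>}" "L K = carrier M" "subsp (L n)" "L n \<subseteq> L (Suc n)"
    and "x \<in> L (Suc n) \<Longrightarrow> y \<in> L (Suc n) \<Longrightarrow> y \<notin> L n \<Longrightarrow> \<exists>c. x \<ominus>\<^bsub>M\<^esub> s c \<odot>\<^bsub>M\<^esub> y \<in> L n"
  using fl unfolding flag_def by blast+

lemma flag_mono: "m \<le> n \<Longrightarrow> L m \<subseteq> L n"
  by (rule lift_Suc_mono_le[of L]) (rule flagD(4))

lemma level:
  assumes "x \<in> carrier M" "x \<noteq> \<zero>\<^bsub>M\<^esub>"
  shows "\<exists>n<K. x \<in> L (Suc n) \<and> x \<notin> L n"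
proof -
  define n where "n = (LEAST n. x \<in> L n)"
  have xK: "x \<in> L K" using flagD(2) assms by simp
  have xn: "x \<in> L n" unfolding n_def using xK by (rule LeastI[of "\<lambda>n. x \<in> L n" K])
  have nK: "n \<le> K" unfolding n_def using xK by (rule Least_le[of "\<lambda>n. x \<in> L n" K])
  have "n \<noteq> 0"
  proof
    assume "n = 0"
    then show False using xn flagD(1) assms(2) by simp
  qed
  then obtain m where m: "n = Suc m" by (cases n) auto
  have "x \<notin> L m" using not_less_Least[of m "\<lambda>n. x \<in> L n"] m n_def by auto
  with xn nK m show ?thesis by (intro exI[of _ m]) simp
qed

text \<open>The element \<open>z\<close> is taken in the lowest level of the flag that meets
  \<open>W - U\<close>. Were \<open>n\<close> already a jump of \<open>U\<close>, a multiple of an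
  element of \<open>U\<close> could be subtracted from \<open>z\<close> to obtain an element of
  \<open>W - U\<close> inside \<open>L n\<close>.\<close>

lemma new_jump:
  assumes U: "subsp U" and W: "subsp W" and UW: "U \<subset> W"
  obtains z n where "z \<in> W" "z \<notin> U" "n < K" "z \<in> L (Suc n)" "z \<notin> L n" "n \<notin> jumps L K U"
    "(W - U) \<inter> L n = {}"
proof -
  obtain w where w: "w \<in> W" "w \<notin> U" using UW by blast
  define k where "k = (LEAST n. (W - U) \<inter> L n \<noteq> {})"
  have "w \<in> L K" using flagD(2) w subspD(3)[OF W] by simp
  then have ex: "(W - U) \<inter> L K \<noteq> {}" using w by blast
  have k: "(W - U) \<inter> L k \<noteq> {}"
    unfolding k_def using ex by (rule LeastI[of "\<lambda>n. (W - U) \<inter> L n \<noteq> {}" K])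
  have kK: "k \<le> K" unfolding k_def using ex by (rule Least_le[of "\<lambda>n. (W - U) \<inter> L n \<noteq> {}" K])
  have "k \<noteq> 0"
  proof
    assume "k = 0"
    then show False using k flagD(1) subspD(2)[OF U] by simp
  qed
  then obtain n where n: "k = Suc n" by (cases k) auto
  have emp: "(W - U) \<inter> L n = {}" using not_less_Least[of n "\<lambda>n. (W - U) \<inter> L n \<noteq> {}"] n k_def by auto
  obtain z where z: "z \<in> W" "z \<notin> U" "z \<in> L (Suc n)" using k n by blast
  have "n \<notin> jumps L K U"
  proof
    assume "n \<in> jumps L K U"
    then obtain u where u: "u \<in> U" "u \<in> L (Suc n)" "u \<notin> L n" by (auto simp: jumps_def)
    then obtain c where c: "z \<ominus>\<^bsub>M\<^esub> s c \<odot>\<^bsub>M\<^esub> u \<in> L n" using flagD(5)[OF z(3)] by blast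
    have cu: "s c \<odot>\<^bsub>M\<^esub> u \<in> U" using subspD(5)[OF U u(1)] .
    then have "z \<ominus>\<^bsub>M\<^esub> s c \<odot>\<^bsub>M\<^esub> u \<in> W" using subspD(7)[OF W] z UW by blast
    moreover have "z \<ominus>\<^bsub>M\<^esub> s c \<odot>\<^bsub>M\<^esub> u \<notin> U"
    proof
      assume "z \<ominus>\<^bsub>M\<^esub> s c \<odot>\<^bsub>M\<^esub> u \<in> U"
      then have "(z \<ominus>\<^bsub>M\<^esub> s c \<odot>\<^bsub>M\<^esub> u) \<oplus>\<^bsub>M\<^esub> s c \<odot>\<^bsub>M\<^esub> u \<in> U" using cu subspD(4)[OF U] by blast
      then show False using z minus_add_cancel(1)[of z "s c \<odot>\<^bsub>M\<^esub> u"] subspD(3)[OF W] subspD(3)[OF U] cu by simp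
    qed
    ultimately show False using c emp by blast
  qed
  moreover have "z \<notin> L n" using emp z by blast
  ultimately show ?thesis using that[of z n] z kK n emp by simp
qed

lemma jumps_strict:
  assumes "subsp U" "subsp W" "U \<subset> W"
  shows "card (jumps L K U) < card (jumps L K W)"
proof -
  obtain z n where "z \<in> W" "n < K" "z \<in> L (Suc n)" "z \<notin> L n" "n \<notin> jumps L K U"
    using new_jump[OF assms] by metis
  then have "n \<in> jumps L K W" by (auto simp: jumps_def)
  then have "jumps L K U \<subset> jumps L K W" using jumps_mono assms(3) \<open>n \<notin> jumps L K U\<close> by blast
  then show ?thesis by (simp add: psubset_card_mono)
qed

text \<open>The new pivot is the level \<open>n\<close> of the element \<open>z\<close> from
  \<open>new_jump\<close>. Every other pivot of \<open>W\<close> is one of \<open>U\<close>: an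
  element of level above \<open>n\<close> can be corrected by a multiple of \<open>z\<close> into
  \<open>U\<close> without changing its level.\<close>

lemma jumps_span1:
  assumes U: "subsp U" and W: "subsp W" and y: "y \<in> W" "y \<notin> U" and eq: "W = span1 U y"
  shows "card (jumps L K W) = Suc (card (jumps L K U))"
proof -
  have yM: "y \<in> carrier M" using y W subspD(3) by blast
  have sub: "U \<subseteq> W"
  proof
    fix u assume u: "u \<in> U"
    then have "u = u \<oplus>\<^bsub>M\<^esub> s 0 \<odot>\<^bsub>M\<^esub> y" using subspD(3)[OF U] yM by simp
    then show "u \<in> W" unfolding eq span1_def using u by blast
  qed
  then have "U \<subset> W" using y by blast
  then obtain z n where z: "z \<in> W" "z \<notin> U" "n < K" "z \<in> L (Suc n)" "z \<notin> L n" "n \<notin> jumps L K U"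
    and emp: "(W - U) \<inter> L n = {}"
    using new_jump[OF U W] by metis
  obtain u c where zu: "z = u \<oplus>\<^bsub>M\<^esub> s c \<odot>\<^bsub>M\<^esub> y" "u \<in> U" using z eq span1_def by blast
  have uM: "u \<in> carrier M" using subspD(3)[OF U] zu by blast
  have c: "c \<noteq> 0"
  proof
    assume "c = 0"
    then have "z = u" using zu(1) uM yM by simp
    then show False using z(2) zu(2) by simp
  qed
  have "jumps L K W = insert n (jumps L K U)"
  proof
    show "insert n (jumps L K U) \<subseteq> jumps L K W"
      using jumps_mono[OF sub] z by (auto simp: jumps_def)
    show "jumps L K W \<subseteq> insert n (jumps L K U)"
    proof
      fix k assume "k \<in> jumps L K W"
      then obtain x where k: "k < K" and x: "x \<in> W" "x \<in> L (Suc k)" "x \<notin> L k" by (auto simp: jumps_def)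
      show "k \<in> insert n (jumps L K U)"
      proof (cases "x \<in> U \<or> k = n")
        case True
        then show ?thesis using k x by (auto simp: jumps_def)
      next
        case False
        have "\<not> Suc k \<le> n"
        proof
          assume "Suc k \<le> n"
          then have "x \<in> L n" using flag_mono x by blast
          with emp False x show False by blast
        qed
        with False have nk: "Suc n \<le> k" by auto
        then have zk: "z \<in> L k" using flag_mono z by blast
        obtain u' c' where xu: "x = u' \<oplus>\<^bsub>M\<^esub> s c' \<odot>\<^bsub>M\<^esub> y" "u' \<in> U" using x eq span1_def by blast
        have u'M: "u' \<in> carrier M" using subspD(3)[OF U] xu by blast
        \<comment> \<open>Modulo \<open>U\<close>, \<open>z\<close> is \<open>c\<close> times
          \<open>y\<close> and \<open>x\<close> is \<open>c'\<close> times \<open>y\<close>, so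
          subtracting \<open>c' / c\<close> times \<open>z\<close> from \<open>x\<close> leaves an
          element of \<open>U\<close>.\<close>
        define d where "d = c' / c"
        have "s d \<odot>\<^bsub>M\<^esub> z = s d \<odot>\<^bsub>M\<^esub> u \<oplus>\<^bsub>M\<^esub> s c' \<odot>\<^bsub>M\<^esub> y"
          using zu uM yM c by (simp add: smult_r_distr s_smult_smult d_def)
        then have "x \<ominus>\<^bsub>M\<^esub> s d \<odot>\<^bsub>M\<^esub> z = u' \<ominus>\<^bsub>M\<^esub> s d \<odot>\<^bsub>M\<^esub> u"
          using xu uM u'M yM
          by (simp add: minus_add_add)
        then have mem: "x \<ominus>\<^bsub>M\<^esub> s d \<odot>\<^bsub>M\<^esub> z \<in> U"
          using subspD(7)[OF U xu(2) subspD(5)[OF U zu(2)]] by simp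
        have sLk: "subsp (L k)" "subsp (L (Suc k))" by (rule flagD(3))+
        have dz: "s d \<odot>\<^bsub>M\<^esub> z \<in> L k" using subspD(5)[OF sLk(1) zk] .
        then have "s d \<odot>\<^bsub>M\<^esub> z \<in> L (Suc k)" using flag_mono[of k "Suc k"] by auto
        then have 1: "x \<ominus>\<^bsub>M\<^esub> s d \<odot>\<^bsub>M\<^esub> z \<in> L (Suc k)" using subspD(7)[OF sLk(2)] x by blast
        have "x \<ominus>\<^bsub>M\<^esub> s d \<odot>\<^bsub>M\<^esub> z \<notin> L k"
        proof
          assume "x \<ominus>\<^bsub>M\<^esub> s d \<odot>\<^bsub>M\<^esub> z \<in> L k"
          then have "(x \<ominus>\<^bsub>M\<^esub> s d \<odot>\<^bsub>M\<^esub> z) \<oplus>\<^bsub>M\<^esub> s d \<odot>\<^bsub>M\<^esub> z \<in> L k" using subspD(4)[OF sLk(1)] dz by blast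
          then show False using minus_add_cancel(1)[of x "s d \<odot>\<^bsub>M\<^esub> z"] x subspD(3)[OF W] subspD(3)[OF sLk(1)] dz
            by simp
        qed
        with 1 mem k show ?thesis by (auto simp: jumps_def)
      qed
    qed
  qed
  then show ?thesis using z by simp
qed

end

end

lemma restrict_simps [simp]:
  "carrier (restrict_mod M W) = W" "\<zero>\<^bsub>restrict_mod M W\<^esub> = \<zero>\<^bsub>M\<^esub>"
  "x \<oplus>\<^bsub>restrict_mod M W\<^esub> y = x \<oplus>\<^bsub>M\<^esub> y" "a \<odot>\<^bsub>restrict_mod M W\<^esub> x = a \<odot>\<^bsub>M\<^esub> x"
  "restrict_mod (restrict_mod M W) W' = restrict_mod M W'"
  by (simp_all add: restrict_mod_def)

section \<open>Generated submodules, simple subquotients, restriction and quotient modules\<close>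

context rmodule
begin

text \<open>The \<open>e j\<close> sum to one, so \<open>x\<close> is the sum of its
  components.\<close>

lemma e_detect:
  assumes U: "subm U" and x: "x \<in> carrier M" and ex: "\<And>j. j \<in> V \<Longrightarrow> e j \<odot>\<^bsub>M\<^esub> x \<in> U"
  shows "x \<in> U"
proof -
  have "finsum R e T \<in> carrier R \<and> finsum R e T \<odot>\<^bsub>M\<^esub> x \<in> U" if "finite T" "T \<subseteq> V" for T
    using that
  proof (induction T rule: finite_induct)
    case empty
    then show ?case using x submD(2)[OF U] by simp
  next
    case (insert j T)
    then have j: "j \<in> V" and T: "T \<subseteq> V" by auto
    have "finsum R e (insert j T) = e j \<oplus> finsum R e T"
      using insert.hyps T by (intro finsum_insert) (auto simp: j)
    moreover have "finsum R e T \<in> carrier R" "finsum R e T \<odot>\<^bsub>M\<^esub> x \<in> U" using insert.IH T by auto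
    ultimately show ?case
      using x j ex[OF j] by (simp add: smult_l_distr submD(4)[OF U])
  qed
  then have "finsum R e V \<odot>\<^bsub>M\<^esub> x \<in> U" using fin_V by blast
  then show ?thesis using x by (simp add: e_sum smult_one)
qed

lemma carrier_subm: "subm (carrier M)"
  by (simp add: subm_iff)

lemma zero_subm: "subm {\<zero>\<^bsub>M\<^esub>}"
  by (simp add: subm_iff)

definition gen :: "'m set \<Rightarrow> 'm \<Rightarrow> 'm set" where
  "gen U y = {u \<oplus>\<^bsub>M\<^esub> a \<odot>\<^bsub>M\<^esub> y | u a. u \<in> U \<and> a \<in> carrier R}"

lemma add_swap:
  assumes "x \<in> carrier M" "y \<in> carrier M" "z \<in> carrier M" "w \<in> carrier M"
  shows "(x \<oplus>\<^bsub>M\<^esub> y) \<oplus>\<^bsub>M\<^esub> (z \<oplus>\<^bsub>M\<^esub> w) = (x \<oplus>\<^bsub>M\<^esub> z) \<oplus>\<^bsub>M\<^esub> (y \<oplus>\<^bsub>M\<^esub> w)"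
  using assms by (simp add: M.a_assoc M.a_lcomm)

lemma gen_subm:
  assumes U: "subm U" and y: "y \<in> carrier M"
  shows "subm (gen U y)" "U \<subseteq> gen U y" "y \<in> gen U y"
proof -
  show "subm (gen U y)"
    unfolding subm_iff
  proof (intro conjI ballI)
    show "gen U y \<subseteq> carrier M" using submD(3)[OF U] y by (auto simp: gen_def)
    have "\<zero>\<^bsub>M\<^esub> = \<zero>\<^bsub>M\<^esub> \<oplus>\<^bsub>M\<^esub> \<zero> \<odot>\<^bsub>M\<^esub> y" using y by simp
    then show "\<zero>\<^bsub>M\<^esub> \<in> gen U y" unfolding gen_def using submD(2)[OF U] zero_closed by blast
  next
    fix x x' assume "x \<in> gen U y" "x' \<in> gen U y"
    then obtain u a u' a' where x: "x = u \<oplus>\<^bsub>M\<^esub> a \<odot>\<^bsub>M\<^esub> y" "u \<in> U" "a \<in> carrier R"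
      "x' = u' \<oplus>\<^bsub>M\<^esub> a' \<odot>\<^bsub>M\<^esub> y" "u' \<in> U" "a' \<in> carrier R"
      unfolding gen_def by blast
    then have "x \<oplus>\<^bsub>M\<^esub> x' = (u \<oplus>\<^bsub>M\<^esub> u') \<oplus>\<^bsub>M\<^esub> (a \<oplus> a') \<odot>\<^bsub>M\<^esub> y"
      using y submD(3)[OF U] by (simp add: add_swap smult_l_distr)
    then show "x \<oplus>\<^bsub>M\<^esub> x' \<in> gen U y" unfolding gen_def using x submD(4)[OF U] by blast
  next
    fix b x assume b: "b \<in> carrier R" and "x \<in> gen U y"
    then obtain u a where x: "x = u \<oplus>\<^bsub>M\<^esub> a \<odot>\<^bsub>M\<^esub> y" "u \<in> U" "a \<in> carrier R"
      unfolding gen_def by blast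
    then have "b \<odot>\<^bsub>M\<^esub> x = b \<odot>\<^bsub>M\<^esub> u \<oplus>\<^bsub>M\<^esub> (a \<otimes> b) \<odot>\<^bsub>M\<^esub> y"
      using y b submD(3)[OF U] by (simp add: smult_r_distr smult_assoc)
    then show "b \<odot>\<^bsub>M\<^esub> x \<in> gen U y" unfolding gen_def using x b submD(5)[OF U] by blast
  qed
  show "U \<subseteq> gen U y"
  proof
    fix u assume u: "u \<in> U"
    then have "u = u \<oplus>\<^bsub>M\<^esub> \<zero> \<odot>\<^bsub>M\<^esub> y" using y submD(3)[OF U] by simp
    then show "u \<in> gen U y" unfolding gen_def using u zero_closed by blast
  qed
  have "y = \<zero>\<^bsub>M\<^esub> \<oplus>\<^bsub>M\<^esub> \<one> \<odot>\<^bsub>M\<^esub> y" using y by (simp add: smult_one)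
  then show "y \<in> gen U y" unfolding gen_def using submD(2)[OF U] one_closed by blast
qed

lemma gen_subset: "subm W \<Longrightarrow> U \<subseteq> W \<Longrightarrow> y \<in> W \<Longrightarrow> gen U y \<subseteq> W"
  unfolding gen_def using submD(4,5) by blast

definition covers :: "'m set \<Rightarrow> 'm set \<Rightarrow> bool" where
  "covers U W \<longleftrightarrow> subm U \<and> subm W \<and> U \<subset> W \<and> (\<forall>Y. subm Y \<longrightarrow> U \<subseteq> Y \<longrightarrow> Y \<subseteq> W \<longrightarrow> Y = U \<or> Y = W)"

lemma N_closed: "n \<in> N p \<Longrightarrow> n \<in> carrier R"
  using additive_subgroup.a_subset[OF ideal.axioms(1)[OF N_ideal]] by blast

lemma N_l: "n \<in> N p \<Longrightarrow> a \<in> carrier R \<Longrightarrow> a \<otimes> n \<in> N p"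
  using ideal.I_l_closed[OF N_ideal] .

lemma N_r: "n \<in> N p \<Longrightarrow> a \<in> carrier R \<Longrightarrow> n \<otimes> a \<in> N p"
  using ideal.I_r_closed[OF N_ideal] .

text \<open>By \<open>e_local\<close> every ring element acts on \<open>y\<close> as a scalar up to
  the radical, and the radical sends \<open>y\<close> into \<open>U\<close>.\<close>

lemma gen_span1:
  assumes U: "subm U" and y: "y \<in> carrier M" and j: "j \<in> V" "e j \<odot>\<^bsub>M\<^esub> y = y"
    and n: "\<And>n. n \<in> N 1 \<Longrightarrow> n \<odot>\<^bsub>M\<^esub> y \<in> U"
  shows "gen U y = span1 U y"
proof
  show "span1 U y \<subseteq> gen U y" unfolding span1_def gen_def using s_closed by blast
  show "gen U y \<subseteq> span1 U y"
  proof
    fix x assume "x \<in> gen U y"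
    then obtain u a where x: "x = u \<oplus>\<^bsub>M\<^esub> a \<odot>\<^bsub>M\<^esub> y" "u \<in> U" "a \<in> carrier R"
      unfolding gen_def by blast
    obtain c n where n': "n \<in> N 1" "e j \<otimes> a = s c \<otimes> e j \<oplus> n" using e_local[OF j(1) x(3)] by blast
    have nR: "n \<in> carrier R" using N_closed n' by blast
    have "a \<odot>\<^bsub>M\<^esub> y = (e j \<otimes> a) \<odot>\<^bsub>M\<^esub> y" using x(3) j y by (simp add: smult_assoc)
    also have "\<dots> = s c \<odot>\<^bsub>M\<^esub> y \<oplus>\<^bsub>M\<^esub> n \<odot>\<^bsub>M\<^esub> y"
      using j y nR by (simp add: n'(2) smult_l_distr s_comm[of "e j"] smult_assoc)
    finally have "x = (u \<oplus>\<^bsub>M\<^esub> n \<odot>\<^bsub>M\<^esub> y) \<oplus>\<^bsub>M\<^esub> s c \<odot>\<^bsub>M\<^esub> y"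
      using x y nR submD(3)[OF U] by (simp add: M.a_assoc M.a_comm[of "s c \<odot>\<^bsub>M\<^esub> y"])
    then show "x \<in> span1 U y" unfolding span1_def using submD(4)[OF U x(2) n[OF n'(1)]] by blast
  qed
qed

text \<open>A simple subquotient is one-dimensional and supported at one vertex: some element of
  \<open>W\<close> outside \<open>U\<close> is moved into \<open>U\<close> by the radical, and one
  of its components is still outside \<open>U\<close>.\<close>

lemma cover_structure:
  assumes c: "covers U W"
  obtains j y where "j \<in> V" "y \<in> W" "y \<notin> U" "e j \<odot>\<^bsub>M\<^esub> y = y" "\<And>n. n \<in> N 1 \<Longrightarrow> n \<odot>\<^bsub>M\<^esub> y \<in> U"
    "W = gen U y" "W = span1 U y"
proof -
  have U: "subm U" and W: "subm W" and UW: "U \<subset> W"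
    and mx: "\<And>Y. subm Y \<Longrightarrow> U \<subseteq> Y \<Longrightarrow> Y \<subseteq> W \<Longrightarrow> Y = U \<or> Y = W"
    using c unfolding covers_def by auto
  obtain w where w: "w \<in> W" "w \<notin> U" using UW by blast
  have wM: "w \<in> carrier M" using submD(3)[OF W] w by blast
  let ?P = "\<lambda>p. \<forall>n\<in>N p. n \<odot>\<^bsub>M\<^esub> w \<in> U"
  obtain m where m: "N m = {\<zero>}" using N_nil by blast
  have exm: "?P m" using m wM submD(2)[OF U] by simp
  \<comment> \<open>The least power of the radical sending \<open>w\<close> into \<open>U\<close>.
    An element of the preceding power that does not do so yields \<open>y0\<close>, on which the
    radical acts as zero modulo \<open>U\<close>.\<close>
  define p where "p = (LEAST p. ?P p)"
  have Pp: "?P p" unfolding p_def using exm by (rule LeastI[of ?P m])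
  have "p \<noteq> 0"
  proof
    assume "p = 0"
    then have "\<one> \<odot>\<^bsub>M\<^esub> w \<in> U" using Pp N_0 by simp
    then show False using w wM by (simp add: smult_one)
  qed
  then obtain q where q: "p = Suc q" by (cases p) auto
  have "\<not> ?P q" using not_less_Least[of q ?P] q p_def by simp
  then obtain n0 where n0: "n0 \<in> N q" "n0 \<odot>\<^bsub>M\<^esub> w \<notin> U" by blast
  have n0R: "n0 \<in> carrier R" using N_closed n0 by blast
  define y0 where "y0 = n0 \<odot>\<^bsub>M\<^esub> w"
  have y0: "y0 \<in> W" "y0 \<notin> U" "y0 \<in> carrier M" using n0 n0R w wM submD(5)[OF W] by (auto simp: y0_def)
  have Ny0: "n \<odot>\<^bsub>M\<^esub> y0 \<in> U" if "n \<in> N 1" for n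
  proof -
    have "n0 \<otimes> n \<in> N p" using N_mult[OF n0(1) that] q by simp
    then have "(n0 \<otimes> n) \<odot>\<^bsub>M\<^esub> w \<in> U" using Pp by blast
    then show ?thesis using n0R N_closed[OF that] wM by (simp add: smult_assoc y0_def)
  qed
  obtain j where j: "j \<in> V" "e j \<odot>\<^bsub>M\<^esub> y0 \<notin> U" using e_detect[OF U y0(3)] y0(2) by blast
  define y where "y = e j \<odot>\<^bsub>M\<^esub> y0"
  have y: "y \<in> W" "y \<notin> U" "y \<in> carrier M" using j y0 submD(5)[OF W] by (auto simp: y_def)
  have ejy: "e j \<odot>\<^bsub>M\<^esub> y = y" using j y0 by (simp add: y_def smult_assoc[symmetric] e_idem)
  have Ny: "n \<odot>\<^bsub>M\<^esub> y \<in> U" if "n \<in> N 1" for n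
  proof -
    have "e j \<otimes> n \<in> N 1" using N_l that j by blast
    then show ?thesis using Ny0 N_closed[OF that] y0 j by (simp add: y_def smult_assoc[symmetric])
  qed
  have "gen U y \<noteq> U" using gen_subm(3)[OF U y(3)] y(2) by metis
  then have W': "gen U y = W"
    using mx[OF gen_subm(1,2)[OF U y(3)] gen_subset[OF W _ y(1)]] UW by blast
  have sp: "gen U y = span1 U y" by (rule gen_span1[OF U y(3) j(1) ejy Ny])
  show ?thesis
    by (rule that[OF j(1) y(1,2) ejy Ny]) (simp_all add: W' sp[symmetric])
qed

lemma rmodule_restrict:
  assumes W: "subm W"
  shows "rmodule R V e s N X (restrict_mod M W)"
proof -
  have "abelian_group (restrict_mod M W)"
  proof (rule abelian_groupI)
    fix x assume "x \<in> carrier (restrict_mod M W)"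
    then show "\<exists>y\<in>carrier (restrict_mod M W). y \<oplus>\<^bsub>restrict_mod M W\<^esub> x = \<zero>\<^bsub>restrict_mod M W\<^esub>"
      using submD(3,6)[OF W] by (intro bexI[of _ "\<ominus>\<^bsub>M\<^esub> x"]) (simp_all add: M.l_neg)
  qed (use submD(2,3,4)[OF W] in \<open>simp_all add: M.a_ac\<close>)
  then show ?thesis
    using submD(3,5)[OF W]
    by (intro rmodule.intro basic_algebra_axioms rmodule_axioms.intro)
      (simp_all add: smult_l_distr smult_r_distr smult_assoc smult_one)
qed

lemma restrict_subm:
  assumes W: "subm W"
  shows "submodule U R (restrict_mod M W) \<longleftrightarrow> subm U \<and> U \<subseteq> W"
  unfolding rmodule.subm_iff[OF rmodule_restrict[OF W]] subm_iff
  using submD(1)[OF W] by auto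

lemma subm_abelian_subgroup: "subm U \<Longrightarrow> abelian_subgroup U M"
  by (rule abelian_subgroupI3[OF additive_subgroup.intro[OF submodule.axioms(1)] M.abelian_group_axioms])

lemma coset_self: "subm U \<Longrightarrow> x \<in> carrier M \<Longrightarrow> x \<in> U +>\<^bsub>M\<^esub> x"
  by (rule abelian_subgroup.a_rcos_self[OF subm_abelian_subgroup])

lemma coset_mem_iff: "y \<in> U +>\<^bsub>M\<^esub> x \<longleftrightarrow> (\<exists>u\<in>U. y = u \<oplus>\<^bsub>M\<^esub> x)"
  by (auto simp: a_r_coset_def')

lemma coset_eq_iff:
  assumes U: "subm U" and x: "x \<in> carrier M" and y: "y \<in> carrier M"
  shows "U +>\<^bsub>M\<^esub> x = U +>\<^bsub>M\<^esub> y \<longleftrightarrow> x \<ominus>\<^bsub>M\<^esub> y \<in> U"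
proof
  assume "U +>\<^bsub>M\<^esub> x = U +>\<^bsub>M\<^esub> y"
  then have "x \<in> U +>\<^bsub>M\<^esub> y" using coset_self[OF U x] by simp
  then obtain u where u: "u \<in> U" "x = u \<oplus>\<^bsub>M\<^esub> y" unfolding coset_mem_iff by blast
  then show "x \<ominus>\<^bsub>M\<^esub> y \<in> U" using minus_add_cancel(2)[of u y] submD(3)[OF U] y by simp
next
  assume *: "x \<ominus>\<^bsub>M\<^esub> y \<in> U"
  have "x = (x \<ominus>\<^bsub>M\<^esub> y) \<oplus>\<^bsub>M\<^esub> y" using minus_add_cancel(1) x y by simp
  then have "x \<in> U +>\<^bsub>M\<^esub> y" using * unfolding coset_mem_iff by blast
  then show "U +>\<^bsub>M\<^esub> x = U +>\<^bsub>M\<^esub> y"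
    using M.a_repr_independence[of x U y] y submodule.axioms(1)[OF U] by simp
qed

lemma coset_zero: "subm U \<Longrightarrow> U +>\<^bsub>M\<^esub> \<zero>\<^bsub>M\<^esub> = U"
  using submD(1) by (rule M.a_coset_add_zero)

lemma coset_eq_self_iff:
  assumes U: "subm U" and x: "x \<in> carrier M"
  shows "U +>\<^bsub>M\<^esub> x = U \<longleftrightarrow> x \<in> U"
proof -
  have "\<ominus>\<^bsub>M\<^esub> \<zero>\<^bsub>M\<^esub> = \<zero>\<^bsub>M\<^esub>" by (rule M.minus_equality) simp_all
  then have "x \<ominus>\<^bsub>M\<^esub> \<zero>\<^bsub>M\<^esub> = x" using x by (simp add: a_minus_def)
  then show ?thesis using coset_eq_iff[OF U x M.zero_closed] coset_zero[OF U] by simp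
qed

text \<open>The union over a coset in the definition of the action collapses, since all members of
  the coset lead to the same coset.\<close>

lemma quot_simps:
  assumes U: "subm U"
  shows "carrier (quot_mod M U) = {U +>\<^bsub>M\<^esub> x | x. x \<in> carrier M}"
    and "\<zero>\<^bsub>quot_mod M U\<^esub> = U"
    and "x \<in> carrier M \<Longrightarrow> y \<in> carrier M \<Longrightarrow>
      (U +>\<^bsub>M\<^esub> x) \<oplus>\<^bsub>quot_mod M U\<^esub> (U +>\<^bsub>M\<^esub> y) = U +>\<^bsub>M\<^esub> (x \<oplus>\<^bsub>M\<^esub> y)"
    and "a \<in> carrier R \<Longrightarrow> x \<in> carrier M \<Longrightarrow>
      a \<odot>\<^bsub>quot_mod M U\<^esub> (U +>\<^bsub>M\<^esub> x) = U +>\<^bsub>M\<^esub> (a \<odot>\<^bsub>M\<^esub> x)"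
proof -
  show "carrier (quot_mod M U) = {U +>\<^bsub>M\<^esub> x | x. x \<in> carrier M}"
  proof -
    have "carrier (quot_mod M U) = a_rcosets\<^bsub>M\<^esub> U" by (simp add: quot_mod_def)
    also have "\<dots> = {U +>\<^bsub>M\<^esub> x | x. x \<in> carrier M}"
      unfolding A_RCOSETS_def RCOSETS_def by (auto simp: a_r_coset_def)
    finally show ?thesis .
  qed
  show "\<zero>\<^bsub>quot_mod M U\<^esub> = U" by (simp add: quot_mod_def)
  show "x \<in> carrier M \<Longrightarrow> y \<in> carrier M \<Longrightarrow>
      (U +>\<^bsub>M\<^esub> x) \<oplus>\<^bsub>quot_mod M U\<^esub> (U +>\<^bsub>M\<^esub> y) = U +>\<^bsub>M\<^esub> (x \<oplus>\<^bsub>M\<^esub> y)"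
    by (simp add: quot_mod_def abelian_subgroup.a_rcos_sum[OF subm_abelian_subgroup[OF U]])
  assume a: "a \<in> carrier R" and x: "x \<in> carrier M"
  have "U +>\<^bsub>M\<^esub> (a \<odot>\<^bsub>M\<^esub> z) = U +>\<^bsub>M\<^esub> (a \<odot>\<^bsub>M\<^esub> x)" if z: "z \<in> U +>\<^bsub>M\<^esub> x" for z
  proof -
    obtain u where u: "u \<in> U" "z = u \<oplus>\<^bsub>M\<^esub> x" using z unfolding coset_mem_iff by blast
    have uM: "u \<in> carrier M" using u submD(3)[OF U] by blast
    have "a \<odot>\<^bsub>M\<^esub> z \<ominus>\<^bsub>M\<^esub> a \<odot>\<^bsub>M\<^esub> x = a \<odot>\<^bsub>M\<^esub> u"
      using minus_add_cancel(2)[of "a \<odot>\<^bsub>M\<^esub> u" "a \<odot>\<^bsub>M\<^esub> x"] u(2) uM a x by (simp add: smult_r_distr)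
    then have "a \<odot>\<^bsub>M\<^esub> z \<ominus>\<^bsub>M\<^esub> a \<odot>\<^bsub>M\<^esub> x \<in> U" using submD(5)[OF U a u(1)] by simp
    moreover have "z \<in> carrier M" using u uM x by simp
    ultimately show ?thesis using a x by (simp add: coset_eq_iff[OF U])
  qed
  then have "(\<Union>z\<in>U +>\<^bsub>M\<^esub> x. U +>\<^bsub>M\<^esub> (a \<odot>\<^bsub>M\<^esub> z)) = U +>\<^bsub>M\<^esub> (a \<odot>\<^bsub>M\<^esub> x)"
    using coset_self[OF U x] by blast
  then show "a \<odot>\<^bsub>quot_mod M U\<^esub> (U +>\<^bsub>M\<^esub> x) = U +>\<^bsub>M\<^esub> (a \<odot>\<^bsub>M\<^esub> x)"
    by (simp add: quot_mod_def)
qed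

lemma rmodule_quot:
  assumes U: "subm U"
  shows "rmodule R V e s N X (quot_mod M U)"
proof -
  note q = quot_simps[OF U]
  have "abelian_group (quot_mod M U)"
  proof (rule abelian_groupI)
    fix A assume "A \<in> carrier (quot_mod M U)"
    then obtain x where x: "x \<in> carrier M" "A = U +>\<^bsub>M\<^esub> x" using q(1) by auto
    then have "(U +>\<^bsub>M\<^esub> (\<ominus>\<^bsub>M\<^esub> x)) \<oplus>\<^bsub>quot_mod M U\<^esub> A = \<zero>\<^bsub>quot_mod M U\<^esub>"
      by (simp add: q(2,3) M.l_neg coset_zero[OF U])
    then show "\<exists>B\<in>carrier (quot_mod M U). B \<oplus>\<^bsub>quot_mod M U\<^esub> A = \<zero>\<^bsub>quot_mod M U\<^esub>"
      using x q(1) by blast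
  next
    show "\<zero>\<^bsub>quot_mod M U\<^esub> \<in> carrier (quot_mod M U)"
      unfolding q using coset_zero[OF U] M.zero_closed by blast
  next
    fix A assume "A \<in> carrier (quot_mod M U)"
    then obtain x where x: "x \<in> carrier M" "A = U +>\<^bsub>M\<^esub> x" using q(1) by auto
    have "\<zero>\<^bsub>quot_mod M U\<^esub> \<oplus>\<^bsub>quot_mod M U\<^esub> A = (U +>\<^bsub>M\<^esub> \<zero>\<^bsub>M\<^esub>) \<oplus>\<^bsub>quot_mod M U\<^esub> A"
      by (simp add: q(2) coset_zero[OF U])
    also have "\<dots> = A" using x by (simp add: q(3))
    finally show "\<zero>\<^bsub>quot_mod M U\<^esub> \<oplus>\<^bsub>quot_mod M U\<^esub> A = A" .
  next
    fix A B assume "A \<in> carrier (quot_mod M U)" "B \<in> carrier (quot_mod M U)"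
    then obtain x y where x: "x \<in> carrier M" "A = U +>\<^bsub>M\<^esub> x" "y \<in> carrier M" "B = U +>\<^bsub>M\<^esub> y"
      using q(1) by auto
    then show "A \<oplus>\<^bsub>quot_mod M U\<^esub> B = B \<oplus>\<^bsub>quot_mod M U\<^esub> A" by (simp add: q(3) M.a_comm)
    have "A \<oplus>\<^bsub>quot_mod M U\<^esub> B = U +>\<^bsub>M\<^esub> (x \<oplus>\<^bsub>M\<^esub> y)" using x by (simp add: q(3))
    then show "A \<oplus>\<^bsub>quot_mod M U\<^esub> B \<in> carrier (quot_mod M U)" unfolding q(1) using x by blast
    fix C assume "C \<in> carrier (quot_mod M U)"
    then obtain z where "z \<in> carrier M" "C = U +>\<^bsub>M\<^esub> z" using q(1) by auto
    with x show "(A \<oplus>\<^bsub>quot_mod M U\<^esub> B) \<oplus>\<^bsub>quot_mod M U\<^esub> C = A \<oplus>\<^bsub>quot_mod M U\<^esub> (B \<oplus>\<^bsub>quot_mod M U\<^esub> C)"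
      by (simp add: q(3) M.a_assoc)
  qed
  then show ?thesis
  proof (intro rmodule.intro basic_algebra_axioms rmodule_axioms.intro)
    fix a A assume a: "a \<in> carrier R" and "A \<in> carrier (quot_mod M U)"
    then obtain x where x: "x \<in> carrier M" "A = U +>\<^bsub>M\<^esub> x" using q(1) by auto
    have "a \<odot>\<^bsub>quot_mod M U\<^esub> A = U +>\<^bsub>M\<^esub> (a \<odot>\<^bsub>M\<^esub> x)" using x a by (simp add: q(4))
    then show "a \<odot>\<^bsub>quot_mod M U\<^esub> A \<in> carrier (quot_mod M U)" unfolding q(1) using x a by blast
    fix b assume b: "b \<in> carrier R"
    show "(a \<oplus> b) \<odot>\<^bsub>quot_mod M U\<^esub> A = a \<odot>\<^bsub>quot_mod M U\<^esub> A \<oplus>\<^bsub>quot_mod M U\<^esub> b \<odot>\<^bsub>quot_mod M U\<^esub> A"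
      using a b x by (simp add: q(3,4) smult_l_distr)
    show "(a \<otimes> b) \<odot>\<^bsub>quot_mod M U\<^esub> A = b \<odot>\<^bsub>quot_mod M U\<^esub> (a \<odot>\<^bsub>quot_mod M U\<^esub> A)"
      using a b x by (simp add: q(4) smult_assoc)
  next
    fix a A B assume a: "a \<in> carrier R" and "A \<in> carrier (quot_mod M U)" "B \<in> carrier (quot_mod M U)"
    then obtain x y where "x \<in> carrier M" "A = U +>\<^bsub>M\<^esub> x" "y \<in> carrier M" "B = U +>\<^bsub>M\<^esub> y"
      using q(1) by auto
    then show "a \<odot>\<^bsub>quot_mod M U\<^esub> (A \<oplus>\<^bsub>quot_mod M U\<^esub> B) =
        a \<odot>\<^bsub>quot_mod M U\<^esub> A \<oplus>\<^bsub>quot_mod M U\<^esub> a \<odot>\<^bsub>quot_mod M U\<^esub> B"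
      using a by (simp add: q(3,4) smult_r_distr)
  next
    fix A assume "A \<in> carrier (quot_mod M U)"
    then obtain x where "x \<in> carrier M" "A = U +>\<^bsub>M\<^esub> x" using q(1) by auto
    then show "\<one> \<odot>\<^bsub>quot_mod M U\<^esub> A = A" by (simp add: q(4) smult_one)
  qed
qed

lemma quot_subm_preimage:
  assumes U: "subm U" and W: "submodule W R (quot_mod M U)"
  shows "subm {x \<in> carrier M. U +>\<^bsub>M\<^esub> x \<in> W}" "U \<subseteq> {x \<in> carrier M. U +>\<^bsub>M\<^esub> x \<in> W}"
    "W = (\<lambda>x. U +>\<^bsub>M\<^esub> x) ` {x \<in> carrier M. U +>\<^bsub>M\<^esub> x \<in> W}"
proof -
  note q = quot_simps[OF U]
  note w = rmodule.submD[OF rmodule_quot[OF U] W]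
  show "subm {x \<in> carrier M. U +>\<^bsub>M\<^esub> x \<in> W}"
    unfolding subm_iff
  proof (intro conjI ballI)
    show "\<zero>\<^bsub>M\<^esub> \<in> {x \<in> carrier M. U +>\<^bsub>M\<^esub> x \<in> W}"
      using w(2) by (simp add: coset_zero[OF U] q(2))
    show "x \<oplus>\<^bsub>M\<^esub> y \<in> {x \<in> carrier M. U +>\<^bsub>M\<^esub> x \<in> W}"
      if "x \<in> {x \<in> carrier M. U +>\<^bsub>M\<^esub> x \<in> W}" "y \<in> {x \<in> carrier M. U +>\<^bsub>M\<^esub> x \<in> W}" for x y
      using that w(4)[of "U +>\<^bsub>M\<^esub> x" "U +>\<^bsub>M\<^esub> y"] by (simp add: q(3))
    show "a \<odot>\<^bsub>M\<^esub> x \<in> {x \<in> carrier M. U +>\<^bsub>M\<^esub> x \<in> W}"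
      if "x \<in> {x \<in> carrier M. U +>\<^bsub>M\<^esub> x \<in> W}" "a \<in> carrier R" for x a
      using that w(5)[of a "U +>\<^bsub>M\<^esub> x"] by (simp add: q(4))
  qed auto
  show "U \<subseteq> {x \<in> carrier M. U +>\<^bsub>M\<^esub> x \<in> W}"
  proof
    fix x assume x: "x \<in> U"
    then have xM: "x \<in> carrier M" using submD(3)[OF U] by blast
    have "U +>\<^bsub>M\<^esub> x = U" using coset_eq_self_iff[OF U xM] x by blast
    then show "x \<in> {x \<in> carrier M. U +>\<^bsub>M\<^esub> x \<in> W}" using w(2) xM unfolding q(2) by simp
  qed
  show "W = (\<lambda>x. U +>\<^bsub>M\<^esub> x) ` {x \<in> carrier M. U +>\<^bsub>M\<^esub> x \<in> W}"
    using w(1) unfolding q(1) by auto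
qed

lemma quot_subm_image:
  assumes U: "subm U" and Y: "subm Y" "U \<subseteq> Y"
  shows "submodule ((\<lambda>x. U +>\<^bsub>M\<^esub> x) ` Y) R (quot_mod M U)"
    "{x \<in> carrier M. U +>\<^bsub>M\<^esub> x \<in> (\<lambda>x. U +>\<^bsub>M\<^esub> x) ` Y} = Y"
proof -
  note q = quot_simps[OF U]
  show "submodule ((\<lambda>x. U +>\<^bsub>M\<^esub> x) ` Y) R (quot_mod M U)"
    unfolding rmodule.subm_iff[OF rmodule_quot[OF U]]
  proof (intro conjI ballI)
    show "(\<lambda>x. U +>\<^bsub>M\<^esub> x) ` Y \<subseteq> carrier (quot_mod M U)" using submD(3)[OF Y(1)] by (auto simp: q(1))
    show "\<zero>\<^bsub>quot_mod M U\<^esub> \<in> (\<lambda>x. U +>\<^bsub>M\<^esub> x) ` Y"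
      using submD(2)[OF Y(1)] coset_zero[OF U] by (auto simp: q(2))
    show "A \<oplus>\<^bsub>quot_mod M U\<^esub> B \<in> (\<lambda>x. U +>\<^bsub>M\<^esub> x) ` Y"
      if "A \<in> (\<lambda>x. U +>\<^bsub>M\<^esub> x) ` Y" "B \<in> (\<lambda>x. U +>\<^bsub>M\<^esub> x) ` Y" for A B
      using that submD(3,4)[OF Y(1)] by (auto simp: q(3))
    show "a \<odot>\<^bsub>quot_mod M U\<^esub> A \<in> (\<lambda>x. U +>\<^bsub>M\<^esub> x) ` Y"
      if "A \<in> (\<lambda>x. U +>\<^bsub>M\<^esub> x) ` Y" "a \<in> carrier R" for A a
      using that submD(3,5)[OF Y(1)] by (auto simp: q(4))
  qed
  show "{x \<in> carrier M. U +>\<^bsub>M\<^esub> x \<in> (\<lambda>x. U +>\<^bsub>M\<^esub> x) ` Y} = Y"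
  proof
    show "Y \<subseteq> {x \<in> carrier M. U +>\<^bsub>M\<^esub> x \<in> (\<lambda>x. U +>\<^bsub>M\<^esub> x) ` Y}" using submD(3)[OF Y(1)] by blast
    show "{x \<in> carrier M. U +>\<^bsub>M\<^esub> x \<in> (\<lambda>x. U +>\<^bsub>M\<^esub> x) ` Y} \<subseteq> Y"
    proof
      fix x assume "x \<in> {x \<in> carrier M. U +>\<^bsub>M\<^esub> x \<in> (\<lambda>x. U +>\<^bsub>M\<^esub> x) ` Y}"
      then obtain y where x: "x \<in> carrier M" and y: "y \<in> Y" "U +>\<^bsub>M\<^esub> x = U +>\<^bsub>M\<^esub> y" by blast
      have yM: "y \<in> carrier M" using submD(3)[OF Y(1)] y by blast
      have "x \<ominus>\<^bsub>M\<^esub> y \<in> Y" using coset_eq_iff[OF U x yM] y(2) Y(2) by blast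
      then show "x \<in> Y" using submD(4)[OF Y(1) _ y(1)] minus_add_cancel(1)[OF x yM] by metis
    qed
  qed
qed

text \<open>Submodules of the quotient correspond to submodules of \<open>M\<close> containing
  \<open>U\<close>, by image and preimage under the coset map.\<close>

lemma simple_quot_iff:
  assumes U: "subm U"
  shows "simple_mod R (quot_mod M U) \<longleftrightarrow> covers U (carrier M)"
proof
  note q = quot_simps[OF U]
  assume s: "simple_mod R (quot_mod M U)"
  have "U \<noteq> carrier M"
  proof
    assume eq: "U = carrier M"
    have "carrier (quot_mod M U) = {U}"
      unfolding q(1) using coset_eq_self_iff[OF U] coset_zero[OF U] M.zero_closed eq by blast
    then show False using s by (simp add: simple_mod_def q(2))
  qed
  moreover have "Y = U \<or> Y = carrier M" if Y: "subm Y" "U \<subseteq> Y" for Y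
  proof -
    let ?I = "(\<lambda>x. U +>\<^bsub>M\<^esub> x) ` Y"
    have "?I = {U} \<or> ?I = carrier (quot_mod M U)"
      using s quot_subm_image(1)[OF U Y] unfolding simple_mod_def q(2) by blast
    moreover have "Y = U" if "?I = {U}"
      using quot_subm_image(2)[OF U Y] coset_eq_self_iff[OF U] submD(3)[OF U] unfolding that by auto
    moreover have "Y = carrier M" if "?I = carrier (quot_mod M U)"
      using quot_subm_image(2)[OF U Y] unfolding that q(1) by auto
    ultimately show ?thesis by blast
  qed
  ultimately show "covers U (carrier M)"
    unfolding covers_def using U carrier_subm submD(1)[OF U] by auto
next
  note q = quot_simps[OF U]
  assume c: "covers U (carrier M)"
  have "carrier (quot_mod M U) \<noteq> {U}"
  proof
    assume *: "carrier (quot_mod M U) = {U}"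
    obtain x where x: "x \<in> carrier M" "x \<notin> U" using c unfolding covers_def by blast
    have "U +>\<^bsub>M\<^esub> x = U" using * x unfolding q(1) by blast
    then show False using coset_eq_self_iff[OF U] x by blast
  qed
  moreover have "W = {U} \<or> W = carrier (quot_mod M U)" if W: "submodule W R (quot_mod M U)" for W
  proof -
    note p = quot_subm_preimage[OF U W]
    let ?Y = "{x \<in> carrier M. U +>\<^bsub>M\<^esub> x \<in> W}"
    have "?Y = U \<or> ?Y = carrier M" using c p(1,2) unfolding covers_def by blast
    moreover have "W = {U}" if "?Y = U"
    proof -
      have "W = (\<lambda>x. U +>\<^bsub>M\<^esub> x) ` U" using p(3) that by simp
      moreover have "U +>\<^bsub>M\<^esub> x = U" if "x \<in> U" for x
        using coset_eq_self_iff[OF U submD(3)[OF U that]] that by blast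
      ultimately show ?thesis using submD(2)[OF U] by auto
    qed
    moreover have "W = carrier (quot_mod M U)" if "?Y = carrier M"
    proof -
      have "W = (\<lambda>x. U +>\<^bsub>M\<^esub> x) ` carrier M" using p(3) that by simp
      then show ?thesis unfolding q(1) by auto
    qed
    ultimately show ?thesis by blast
  qed
  ultimately show "simple_mod R (quot_mod M U)"
    unfolding simple_mod_def q(2) by blast
qed

lemma restrict_covers:
  assumes W: "subm W"
  shows "rmodule.covers R (restrict_mod M W) U W \<longleftrightarrow> covers U W"
  unfolding rmodule.covers_def[OF rmodule_restrict[OF W]] covers_def restrict_subm[OF W] by auto

lemma simple_sq_iff:
  assumes W: "subm W" and U: "subm U" "U \<subseteq> W"
  shows "simple_mod R (quot_mod (restrict_mod M W) U) \<longleftrightarrow> covers U W"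
  using rmodule.simple_quot_iff[OF rmodule_restrict[OF W], of U] restrict_covers[OF W] restrict_subm[OF W] U
  by simp

end

section \<open>The regular module, the projectives P(j) and their simple tops\<close>

context basic_algebra
begin

text \<open>The fields \<open>mult\<close> and \<open>one\<close> have the same value
  \<open>undefined\<close> as in \<open>proj_mod\<close>, so that for a bound quiver algebra
  \<open>pmod\<close> is the very same record and not just an isomorphic module.\<close>

definition reg :: "('r, 'r) module" where
  "reg = \<lparr>carrier = carrier R, mult = undefined, one = undefined, zero = \<zero>, add = add R,
     smult = (\<lambda>a x. x \<otimes> a)\<rparr>"

definition eR :: "'v \<Rightarrow> 'r set" where
  "eR j = {e j \<otimes> a | a. a \<in> carrier R}"

definition pmod :: "'v \<Rightarrow> ('r, 'r) module" where
  "pmod j = restrict_mod reg (eR j)"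

definition simp_of :: "'v \<Rightarrow> ('r, 'r set) module" where
  "simp_of j = top_mod R (pmod j)"

lemma reg_simps [simp]:
  "carrier reg = carrier R" "\<zero>\<^bsub>reg\<^esub> = \<zero>" "x \<oplus>\<^bsub>reg\<^esub> y = x \<oplus> y" "a \<odot>\<^bsub>reg\<^esub> x = x \<otimes> a"
  "\<ominus>\<^bsub>reg\<^esub> x = \<ominus> x" "x \<ominus>\<^bsub>reg\<^esub> y = x \<ominus> y"
  by (simp_all add: reg_def a_inv_def m_inv_def a_minus_def)

lemma rmodule_reg: "rmodule R V e s N X reg"
proof -
  have "abelian_group reg"
  proof (rule abelian_groupI)
    fix x assume "x \<in> carrier reg"
    then show "\<exists>y\<in>carrier reg. y \<oplus>\<^bsub>reg\<^esub> x = \<zero>\<^bsub>reg\<^esub>"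
      by (intro bexI[of _ "\<ominus> x"]) (simp_all add: l_neg)
  qed (simp_all add: a_ac)
  then show ?thesis
    by (intro rmodule.intro basic_algebra_axioms rmodule_axioms.intro)
      (simp_all add: l_distr r_distr m_assoc)
qed

sublocale reg: rmodule R V e s N X reg
  by (rule rmodule_reg)

lemma eR_iff: "j \<in> V \<Longrightarrow> x \<in> eR j \<longleftrightarrow> x \<in> carrier R \<and> e j \<otimes> x = x"
  by (auto simp: eR_def m_assoc[symmetric] e_idem) metis

lemma eR_subm: "j \<in> V \<Longrightarrow> reg.subm (eR j)"
  unfolding reg.subm_iff by (auto simp: eR_iff r_distr m_assoc[symmetric])

lemma e_in_eR: "j \<in> V \<Longrightarrow> e j \<in> eR j"
  by (simp add: eR_iff e_idem)

lemma N_subm: "reg.subm (N p)"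
  using ideal.axioms(1)[OF N_ideal[of p]] reg.N_r[of _ p] reg.N_closed[of _ p]
  unfolding reg.subm_iff by (auto simp: additive_subgroup.zero_closed additive_subgroup.a_closed)

lemma rmodule_pmod: "j \<in> V \<Longrightarrow> rmodule R V e s N X (pmod j)"
  unfolding pmod_def by (rule reg.rmodule_restrict[OF eR_subm])

lemma pmod_simps [simp]:
  "carrier (pmod j) = eR j" "\<zero>\<^bsub>pmod j\<^esub> = \<zero>" "x \<oplus>\<^bsub>pmod j\<^esub> y = x \<oplus> y" "a \<odot>\<^bsub>pmod j\<^esub> x = x \<otimes> a"
  by (simp_all add: pmod_def)

lemma pmod_subm: "j \<in> V \<Longrightarrow> submodule U R (pmod j) \<longleftrightarrow> reg.subm U \<and> U \<subseteq> eR j"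
  unfolding pmod_def by (rule reg.restrict_subm[OF eR_subm])

lemma inter_subm: "reg.subm U \<Longrightarrow> reg.subm W \<Longrightarrow> reg.subm (U \<inter> W)"
  unfolding reg.subm_iff by blast

lemma local_decomp:
  assumes j: "j \<in> V" and y: "y \<in> eR j"
  obtains c n where "n \<in> eR j" "n \<in> N 1" "y = s c \<otimes> e j \<oplus> n"
proof -
  have yR: "y \<in> carrier R" "e j \<otimes> y = y" using y eR_iff[OF j] by auto
  obtain c n where n: "n \<in> N 1" "y = s c \<otimes> e j \<oplus> n" using e_local[OF j yR(1)] yR(2) by auto
  have nR: "n \<in> carrier R" using n reg.N_closed by blast
  have "s c \<otimes> e j \<in> eR j" using j by (simp add: eR_iff s_comm[of "e j"] m_assoc[symmetric] e_idem)
  then have "y \<ominus> s c \<otimes> e j \<in> eR j" using reg.submD(7)[OF eR_subm[OF j] y] by simp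
  moreover have "y \<ominus> s c \<otimes> e j = n"
    using reg.minus_add_cancel(2)[of n "s c \<otimes> e j"] nR j n(2) by (simp add: a_comm)
  ultimately show ?thesis using that n by simp
qed

text \<open>P(j) is local: a submodule with an element outside the radical contains, after
  subtraction of the radical part of that element, a nonzero multiple of \<open>e j\<close>, and
  hence everything.\<close>

lemma radical_covers:
  assumes j: "j \<in> V"
  shows "reg.covers (eR j \<inter> N 1) (eR j)"
  unfolding reg.covers_def
proof (intro conjI allI impI)
  show "reg.subm (eR j \<inter> N 1)" "reg.subm (eR j)" using inter_subm eR_subm N_subm j by auto
  show "eR j \<inter> N 1 \<subset> eR j" using e_in_eR e_notin j by blast
  fix Y assume Y: "reg.subm Y" "eR j \<inter> N 1 \<subseteq> Y" "Y \<subseteq> eR j"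
  show "Y = eR j \<inter> N 1 \<or> Y = eR j"
  proof (cases "Y \<subseteq> N 1")
    case True
    then show ?thesis using Y by blast
  next
    case False
    then obtain y where y: "y \<in> Y" "y \<notin> N 1" by blast
    obtain c n where n: "n \<in> eR j" "n \<in> N 1" "y = s c \<otimes> e j \<oplus> n"
      using local_decomp[OF j, of y] Y y by blast
    have nR: "n \<in> carrier R" using n reg.N_closed by blast
    have "c \<noteq> 0"
    proof
      assume "c = 0"
      then have "y = n" using n nR j by simp
      then show False using y n by simp
    qed
    have "y \<ominus> n \<in> Y" using reg.submD(7)[OF Y(1) y(1), of n] n Y(2) by auto
    moreover have "y \<ominus> n = s c \<otimes> e j" using reg.minus_add_cancel(2)[of "s c \<otimes> e j" n] n(3) nR j by simp
    ultimately have "s c \<otimes> e j \<in> Y" by simp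
    then have "s c \<otimes> e j \<otimes> s (1 / c) \<in> Y" using reg.submD(5)[OF Y(1), of "s (1 / c)"] by simp
    moreover have "s c \<otimes> e j \<otimes> s (1 / c) = e j"
    proof -
      have "s c \<otimes> e j \<otimes> s (1 / c) = e j \<otimes> (s c \<otimes> s (1 / c))"
        using j by (simp add: s_comm[of "e j"] m_assoc)
      also have "s c \<otimes> s (1 / c) = \<one>" using \<open>c \<noteq> 0\<close> by (simp add: s_mult[symmetric] s_one)
      finally show ?thesis using j by simp
    qed
    ultimately have "e j \<in> Y" by simp
    then have "eR j \<subseteq> Y" using reg.submD(5)[OF Y(1)] by (auto simp: eR_def)
    then show ?thesis using Y by blast
  qed
qed

lemma rad_pmod:
  assumes j: "j \<in> V"
  shows "rad_mod R (pmod j) = eR j \<inter> N 1"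
proof
  interpret P: rmodule R V e s N X "pmod j" by (rule rmodule_pmod[OF j])
  have mx: "maximal_submodule R (pmod j) U \<longleftrightarrow> P.covers U (eR j)" for U
    using P.carrier_subm P.submD(1)[of U] unfolding maximal_submodule_def P.covers_def
    by (simp add: psubset_eq) (metis P.submD(1) pmod_simps(1))
  have "P.covers (eR j \<inter> N 1) (eR j)"
    using radical_covers[OF j] unfolding P.covers_def reg.covers_def pmod_subm[OF j] by blast
  then show "rad_mod R (pmod j) \<subseteq> eR j \<inter> N 1"
    unfolding rad_mod_def mx by auto
  have "eR j \<inter> N 1 \<subseteq> U" if U: "P.covers U (eR j)" for U
  proof
    fix x assume x: "x \<in> eR j \<inter> N 1"
    \<comment> \<open>For a maximal submodule \<open>U\<close> the radical sends the generator
      \<open>y\<close> of the top into \<open>U\<close>, and \<open>e j\<close> is a multiple of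
      \<open>y\<close> modulo \<open>U\<close>. Hence the radical sends \<open>e j\<close> into
      \<open>U\<close> as well, and \<open>x\<close> is its own product with
      \<open>e j\<close>.\<close>
    obtain y where y: "y \<in> eR j" "\<And>n. n \<in> N 1 \<Longrightarrow> n \<odot>\<^bsub>pmod j\<^esub> y \<in> U" "eR j = P.span1 U y"
      using P.cover_structure[OF U] by metis
    have sU: "P.subm U" using U unfolding P.covers_def by blast
    obtain u c where u: "e j = u \<oplus> y \<otimes> s c" "u \<in> U"
      using e_in_eR[OF j] unfolding y(3) P.span1_def by auto
    have R: "x \<in> carrier R" "u \<in> carrier R" "y \<in> carrier R" and ex: "e j \<otimes> x = x"
      using x y(1) u(2) P.submD(3)[OF sU, of u] eR_iff[OF j] by auto
    have "x = u \<otimes> x \<oplus> y \<otimes> (s c \<otimes> x)"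
      using ex R unfolding u(1) by (simp add: l_distr m_assoc)
    moreover have "u \<otimes> x \<in> U" using P.submD(5)[OF sU R(1) u(2)] by simp
    moreover have "y \<otimes> (s c \<otimes> x) \<in> U" using y(2)[of "s c \<otimes> x"] reg.N_l[of x 1 "s c"] x by simp
    ultimately show "x \<in> U" using P.submD(4)[OF sU, of "u \<otimes> x" "y \<otimes> (s c \<otimes> x)"] by simp
  qed
  then show "eR j \<inter> N 1 \<subseteq> rad_mod R (pmod j)"
    unfolding rad_mod_def mx by auto
qed

lemma simp_of_eq: "j \<in> V \<Longrightarrow> simp_of j = quot_mod (pmod j) (eR j \<inter> N 1)"
  by (simp add: simp_of_def top_mod_def rad_pmod)

end

section \<open>Subquotients isomorphic to a quotient of P(j)\<close>

context rmodule
begin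

text \<open>The elementwise form of an isomorphism between P(j) modulo \<open>L\<close> and
  \<open>W\<close> modulo \<open>U\<close>: \<open>t\<close> is the image of \<open>e j\<close>, and
  its annihilator modulo \<open>U\<close> is described by \<open>L\<close>. In this form filtrations
  can be transferred between algebras by moving generators.\<close>

definition gens :: "'m set \<Rightarrow> 'm set \<Rightarrow> 'v \<Rightarrow> 'r set \<Rightarrow> bool" where
  "gens U W j L \<longleftrightarrow> (\<exists>t\<in>W. e j \<odot>\<^bsub>M\<^esub> t = t \<and> W = gen U t \<and>
     (\<forall>a\<in>carrier R. a \<odot>\<^bsub>M\<^esub> t \<in> U \<longleftrightarrow> e j \<otimes> a \<in> L))"

lemma mod_iso_quot_iff:
  assumes U: "subm U" and j: "j \<in> V" and L: "submodule L R (pmod j)"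
  shows "mod_iso R (quot_mod M U) (quot_mod (pmod j) L) \<longleftrightarrow> gens U (carrier M) j L"
proof
  interpret P: rmodule R V e s N X "pmod j" by (rule rmodule_pmod[OF j])
  note q = quot_simps[OF U] and p = P.quot_simps[OF L]
  let ?c = "\<lambda>x. U +>\<^bsub>M\<^esub> x" and ?d = "\<lambda>x. L +>\<^bsub>pmod j\<^esub> x"
  let ?Q = "quot_mod M U" and ?P = "quot_mod (pmod j) L"
  have ea: "e j \<otimes> a \<in> eR j" if "a \<in> carrier R" for a using that by (auto simp: eR_def)
  {
    assume "mod_iso R ?Q ?P"
    then obtain h where bij: "bij_betw h (carrier ?Q) (carrier ?P)"
      and sm: "\<And>a x. a \<in> carrier R \<Longrightarrow> x \<in> carrier ?Q \<Longrightarrow> h (a \<odot>\<^bsub>?Q\<^esub> x) = a \<odot>\<^bsub>?P\<^esub> h x"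
      unfolding mod_iso_def by blast
    have cq: "?c x \<in> carrier ?Q" if "x \<in> carrier M" for x using that q(1) by blast
    have "?d (e j) \<in> carrier ?P" using p(1) e_in_eR[OF j] by auto
    then have "?d (e j) \<in> h ` carrier ?Q" unfolding bij_betw_imp_surj_on[OF bij] .
    then obtain X0 where X0: "X0 \<in> carrier ?Q" "h X0 = ?d (e j)" by (elim imageE) simp
    then obtain t0 where t0: "t0 \<in> carrier M" "X0 = ?c t0" using q(1) by auto
    \<comment> \<open>A representative of the preimage of the class of \<open>e j\<close>,
      multiplied by \<open>e j\<close> so that this idempotent fixes it on the nose and not just
      modulo \<open>U\<close>.\<close>
    define t where "t = e j \<odot>\<^bsub>M\<^esub> t0"
    have t: "t \<in> carrier M" "e j \<odot>\<^bsub>M\<^esub> t = t"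
      using t0 j by (simp_all add: t_def smult_assoc[symmetric] e_idem)
    have hc: "h (?c t) = ?d (e j)"
    proof -
      have "?c t = e j \<odot>\<^bsub>?Q\<^esub> X0" using q(4)[of "e j" t0] t0 j by (simp add: t_def)
      then have "h (?c t) = e j \<odot>\<^bsub>?P\<^esub> ?d (e j)" using sm[of "e j" X0] X0 j by simp
      also have "\<dots> = ?d (e j)" using p(4)[of "e j" "e j"] j e_in_eR[OF j] by (simp add: e_idem)
      finally show ?thesis .
    qed
    have ha: "h (?c (a \<odot>\<^bsub>M\<^esub> t)) = ?d (e j \<otimes> a)" if a: "a \<in> carrier R" for a
      using sm[OF a cq[OF t(1)]] q(4)[OF a t(1)] hc p(4)[of a "e j"] a e_in_eR[OF j] by simp
    have inj: "?c x = ?c y" if "h (?c x) = h (?c y)" "x \<in> carrier M" "y \<in> carrier M" for x y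
      using inj_onD[OF bij_betw_imp_inj_on[OF bij] that(1) cq[OF that(2)] cq[OF that(3)]] .
    have "carrier M = gen U t"
    proof
      show "carrier M \<subseteq> gen U t"
      proof
        fix x assume x: "x \<in> carrier M"
        have "h (?c x) \<in> carrier ?P" using bij_betwE[OF bij] cq[OF x] by blast
        then obtain z where z: "z \<in> eR j" "h (?c x) = ?d z" using p(1) by auto
        then obtain a where a: "a \<in> carrier R" "z = e j \<otimes> a" by (auto simp: eR_def)
        then have "?c x = ?c (a \<odot>\<^bsub>M\<^esub> t)" using inj ha z x t a by simp
        then have u: "x \<ominus>\<^bsub>M\<^esub> a \<odot>\<^bsub>M\<^esub> t \<in> U" using coset_eq_iff[OF U x] a t by simp
        have "x = (x \<ominus>\<^bsub>M\<^esub> a \<odot>\<^bsub>M\<^esub> t) \<oplus>\<^bsub>M\<^esub> a \<odot>\<^bsub>M\<^esub> t" using minus_add_cancel(1)[of x "a \<odot>\<^bsub>M\<^esub> t"] x a t by simp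
        then show "x \<in> gen U t" unfolding gen_def using u a by blast
      qed
      show "gen U t \<subseteq> carrier M" using submD(1)[OF gen_subm(1)[OF U t(1)]] .
    qed
    moreover have "a \<odot>\<^bsub>M\<^esub> t \<in> U \<longleftrightarrow> e j \<otimes> a \<in> L" if a: "a \<in> carrier R" for a
    proof -
      have "h (?c \<zero>\<^bsub>M\<^esub>) = ?d \<zero>" using ha[of \<zero>] t j by simp
      then have "?c (a \<odot>\<^bsub>M\<^esub> t) = ?c \<zero>\<^bsub>M\<^esub> \<longleftrightarrow> ?d (e j \<otimes> a) = ?d \<zero>"
        using ha[OF a] inj[of "a \<odot>\<^bsub>M\<^esub> t" "\<zero>\<^bsub>M\<^esub>"] a t by auto
      then show ?thesis
        using coset_zero[OF U] P.coset_zero[OF L] coset_eq_self_iff[OF U, of "a \<odot>\<^bsub>M\<^esub> t"] a t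
          P.coset_eq_self_iff[OF L, of "e j \<otimes> a"] ea[OF a] by simp
    qed
    ultimately show "gens U (carrier M) j L" unfolding gens_def using t by blast
  }
  {
    assume "gens U (carrier M) j L"
    then obtain t where t: "t \<in> carrier M" "e j \<odot>\<^bsub>M\<^esub> t = t" "carrier M = gen U t"
      and tU: "\<And>a. a \<in> carrier R \<Longrightarrow> a \<odot>\<^bsub>M\<^esub> t \<in> U \<longleftrightarrow> e j \<otimes> a \<in> L" unfolding gens_def by blast
    \<comment> \<open>Every class contains a multiple of \<open>t\<close> by some \<open>a\<close>;
      its image, the class of \<open>e j \<otimes> a\<close>, does not depend on the chosen
      \<open>a\<close> by \<open>eq\<close> below.\<close>
    define h where "h A = ?d (e j \<otimes> (SOME a. a \<in> carrier R \<and> A = ?c (a \<odot>\<^bsub>M\<^esub> t)))" for A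
    have eq: "?c (a \<odot>\<^bsub>M\<^esub> t) = ?c (b \<odot>\<^bsub>M\<^esub> t) \<longleftrightarrow> ?d (e j \<otimes> a) = ?d (e j \<otimes> b)"
      if a: "a \<in> carrier R" and b: "b \<in> carrier R" for a b
    proof -
      have 1: "a \<odot>\<^bsub>M\<^esub> t \<ominus>\<^bsub>M\<^esub> b \<odot>\<^bsub>M\<^esub> t = (a \<ominus> b) \<odot>\<^bsub>M\<^esub> t"
        using a b t(1) by (simp add: a_minus_def smult_l_distr smult_l_minus)
      have "e j \<otimes> a \<ominus>\<^bsub>pmod j\<^esub> e j \<otimes> b = e j \<otimes> a \<oplus> \<ominus> \<one> \<odot>\<^bsub>pmod j\<^esub> (e j \<otimes> b)"
        using P.smult_l_minus[of \<one> "e j \<otimes> b"] P.smult_one[of "e j \<otimes> b"] ea[OF b] by (simp add: a_minus_def)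
      also have "\<dots> = e j \<otimes> (a \<ominus> b)" using a b j by (simp add: a_minus_def r_distr r_minus)
      finally have 2: "e j \<otimes> a \<ominus>\<^bsub>pmod j\<^esub> e j \<otimes> b = e j \<otimes> (a \<ominus> b)" .
      show ?thesis
        using coset_eq_iff[OF U, of "a \<odot>\<^bsub>M\<^esub> t" "b \<odot>\<^bsub>M\<^esub> t"] P.coset_eq_iff[OF L, of "e j \<otimes> a" "e j \<otimes> b"]
          a b t(1) ea tU[of "a \<ominus> b"] 1 2 by simp
    qed
    have h: "h (?c (a \<odot>\<^bsub>M\<^esub> t)) = ?d (e j \<otimes> a)" if a: "a \<in> carrier R" for a
    proof -
      let ?P = "\<lambda>b. b \<in> carrier R \<and> ?c (a \<odot>\<^bsub>M\<^esub> t) = ?c (b \<odot>\<^bsub>M\<^esub> t)"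
      have "?P (SOME b. ?P b)" by (rule someI[of ?P a]) (simp add: a)
      then show ?thesis using eq[OF a] unfolding h_def by blast
    qed
    have rep: "\<exists>a\<in>carrier R. A = ?c (a \<odot>\<^bsub>M\<^esub> t)" if A: "A \<in> carrier ?Q" for A
    proof -
      obtain x where x: "x \<in> carrier M" "A = ?c x" using A q(1) by auto
      then obtain u a where u: "x = u \<oplus>\<^bsub>M\<^esub> a \<odot>\<^bsub>M\<^esub> t" "u \<in> U" "a \<in> carrier R"
        unfolding t(3) gen_def by blast
      then have "x \<ominus>\<^bsub>M\<^esub> a \<odot>\<^bsub>M\<^esub> t = u" using minus_add_cancel(2)[of u "a \<odot>\<^bsub>M\<^esub> t"] submD(3)[OF U] t(1) by simp
      then have "?c x = ?c (a \<odot>\<^bsub>M\<^esub> t)" using coset_eq_iff[OF U x(1), of "a \<odot>\<^bsub>M\<^esub> t"] u t(1) by simp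
      then show ?thesis using x u by blast
    qed
    show "mod_iso R ?Q ?P"
      unfolding mod_iso_def
    proof (intro exI conjI ballI)
      show "bij_betw h (carrier ?Q) (carrier ?P)"
        unfolding bij_betw_def
      proof
        show "inj_on h (carrier ?Q)"
        proof (rule inj_onI)
          fix A B assume A: "A \<in> carrier ?Q" and B: "B \<in> carrier ?Q" and hh: "h A = h B"
          obtain a b where "a \<in> carrier R" "A = ?c (a \<odot>\<^bsub>M\<^esub> t)" "b \<in> carrier R" "B = ?c (b \<odot>\<^bsub>M\<^esub> t)"
            using rep[OF A] rep[OF B] by blast
          then show "A = B" using h eq hh by simp
        qed
        show "h ` carrier ?Q = carrier ?P"
        proof
          show "h ` carrier ?Q \<subseteq> carrier ?P"
          proof
            fix z assume "z \<in> h ` carrier ?Q"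
            then obtain A where A: "A \<in> carrier ?Q" "z = h A" by (elim imageE) simp
            obtain a where a: "a \<in> carrier R" "A = ?c (a \<odot>\<^bsub>M\<^esub> t)" using rep[OF A(1)] by blast
            have "z = ?d (e j \<otimes> a)" using A(2) a h by simp
            then show "z \<in> carrier ?P" unfolding p(1) using ea[OF a(1)] by auto
          qed
          show "carrier ?P \<subseteq> h ` carrier ?Q"
          proof
            fix z assume "z \<in> carrier ?P"
            then obtain y where y: "y \<in> eR j" "z = ?d y" unfolding p(1) by auto
            then obtain a where a: "a \<in> carrier R" "z = ?d (e j \<otimes> a)" unfolding eR_def by blast
            then have "z = h (?c (a \<odot>\<^bsub>M\<^esub> t))" using h by simp
            moreover have "?c (a \<odot>\<^bsub>M\<^esub> t) \<in> carrier ?Q" unfolding q(1) using a t(1) by blast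
            ultimately show "z \<in> h ` carrier ?Q" by blast
          qed
        qed
      qed
      fix A assume A: "A \<in> carrier ?Q"
      obtain a where a: "a \<in> carrier R" "A = ?c (a \<odot>\<^bsub>M\<^esub> t)" using rep[OF A] by blast
      {
        fix B assume B: "B \<in> carrier ?Q"
        obtain b where b: "b \<in> carrier R" "B = ?c (b \<odot>\<^bsub>M\<^esub> t)" using rep[OF B] by blast
        have "A \<oplus>\<^bsub>?Q\<^esub> B = ?c ((a \<oplus> b) \<odot>\<^bsub>M\<^esub> t)" using a b t(1) by (simp add: q(3) smult_l_distr)
        then have "h (A \<oplus>\<^bsub>?Q\<^esub> B) = ?d (e j \<otimes> (a \<oplus> b))" using h[of "a \<oplus> b"] a b by simp
        also have "\<dots> = h A \<oplus>\<^bsub>?P\<^esub> h B"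
          using p(3)[of "e j \<otimes> a" "e j \<otimes> b"] ea a b h j by (simp add: r_distr)
        finally show "h (A \<oplus>\<^bsub>?Q\<^esub> B) = h A \<oplus>\<^bsub>?P\<^esub> h B" .
      }
      fix b assume b: "b \<in> carrier R"
      have "b \<odot>\<^bsub>?Q\<^esub> A = ?c ((a \<otimes> b) \<odot>\<^bsub>M\<^esub> t)" using a b t(1) by (simp add: q(4) smult_assoc)
      then have "h (b \<odot>\<^bsub>?Q\<^esub> A) = ?d (e j \<otimes> (a \<otimes> b))" using h[of "a \<otimes> b"] a b by simp
      also have "\<dots> = b \<odot>\<^bsub>?P\<^esub> h A"
        using p(4)[of b "e j \<otimes> a"] ea a b h j by (simp add: m_assoc)
      finally show "h (b \<odot>\<^bsub>?Q\<^esub> A) = b \<odot>\<^bsub>?P\<^esub> h A" .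
    qed
  }
qed

lemma mod_iso_sq_iff:
  assumes W: "subm W" and U: "subm U" "U \<subseteq> W" and j: "j \<in> V" and L: "submodule L R (pmod j)"
  shows "mod_iso R (quot_mod (restrict_mod M W) U) (quot_mod (pmod j) L) \<longleftrightarrow> gens U W j L"
proof -
  interpret W: rmodule R V e s N X "restrict_mod M W" by (rule rmodule_restrict[OF W])
  have "W.gens U W j L \<longleftrightarrow> gens U W j L"
    unfolding W.gens_def gens_def W.gen_def gen_def by simp
  then show ?thesis
    using W.mod_iso_quot_iff[OF _ j L, of U] restrict_subm[OF W, of U] U by simp
qed

end

section \<open>Composition multiplicities as dimensions of M e_j\<close>

context rmodule
begin

definition fd :: bool where
  "fd \<longleftrightarrow> (\<exists>L K. flag L K)"

lemma span1_subsp: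
  assumes U: "subsp U" and y: "y \<in> carrier M"
  shows "subsp (span1 U y)" "U \<subseteq> span1 U y" "y \<in> span1 U y"
proof -
  show "U \<subseteq> span1 U y"
  proof
    fix u assume u: "u \<in> U"
    then have "u = u \<oplus>\<^bsub>M\<^esub> s 0 \<odot>\<^bsub>M\<^esub> y" using y subspD(3)[OF U] by simp
    then show "u \<in> span1 U y" unfolding span1_def using u by blast
  qed
  have "y = \<zero>\<^bsub>M\<^esub> \<oplus>\<^bsub>M\<^esub> s 1 \<odot>\<^bsub>M\<^esub> y" using y by (simp add: s_one_smult)
  then show "y \<in> span1 U y" unfolding span1_def using subspD(2)[OF U] by blast
  show "subsp (span1 U y)"
    unfolding subsp_def
  proof (intro conjI ballI allI)
    show "span1 U y \<subseteq> carrier M" using subspD(3)[OF U] y by (auto simp: span1_def)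
    show "\<zero>\<^bsub>M\<^esub> \<in> span1 U y" using \<open>U \<subseteq> span1 U y\<close> subspD(2)[OF U] by blast
  next
    fix x x' assume "x \<in> span1 U y" "x' \<in> span1 U y"
    then obtain u a u' a' where x: "x = u \<oplus>\<^bsub>M\<^esub> s a \<odot>\<^bsub>M\<^esub> y" "u \<in> U"
      "x' = u' \<oplus>\<^bsub>M\<^esub> s a' \<odot>\<^bsub>M\<^esub> y" "u' \<in> U"
      unfolding span1_def by blast
    then have "x \<oplus>\<^bsub>M\<^esub> x' = (u \<oplus>\<^bsub>M\<^esub> u') \<oplus>\<^bsub>M\<^esub> s (a + a') \<odot>\<^bsub>M\<^esub> y"
      using y subspD(3)[OF U] by (simp add: add_swap s_add smult_l_distr)
    then show "x \<oplus>\<^bsub>M\<^esub> x' \<in> span1 U y" unfolding span1_def using x subspD(4)[OF U] by blast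
  next
    fix c x assume "x \<in> span1 U y"
    then obtain u a where x: "x = u \<oplus>\<^bsub>M\<^esub> s a \<odot>\<^bsub>M\<^esub> y" "u \<in> U"
      unfolding span1_def by blast
    then have "s c \<odot>\<^bsub>M\<^esub> x = s c \<odot>\<^bsub>M\<^esub> u \<oplus>\<^bsub>M\<^esub> s (c * a) \<odot>\<^bsub>M\<^esub> y"
      using y subspD(3)[OF U] by (simp add: smult_r_distr s_smult_smult)
    then show "s c \<odot>\<^bsub>M\<^esub> x \<in> span1 U y" unfolding span1_def using x subspD(5)[OF U] by blast
  qed
qed

lemma span1_step:
  assumes U: "subsp U" and y: "y \<in> carrier M"
    and x: "x \<in> span1 U y" and z: "z \<in> span1 U y" "z \<notin> U"
  shows "\<exists>c. x \<ominus>\<^bsub>M\<^esub> s c \<odot>\<^bsub>M\<^esub> z \<in> U"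
proof -
  obtain u a u' b where x: "x = u \<oplus>\<^bsub>M\<^esub> s a \<odot>\<^bsub>M\<^esub> y" "u \<in> U" and z': "z = u' \<oplus>\<^bsub>M\<^esub> s b \<odot>\<^bsub>M\<^esub> y" "u' \<in> U"
    using x z(1) unfolding span1_def by blast
  have uM: "u \<in> carrier M" "u' \<in> carrier M" using x z' subspD(3)[OF U] by auto
  have "b \<noteq> 0"
  proof
    assume "b = 0"
    then have "z = u'" using z' uM y by simp
    then show False using z(2) z' by simp
  qed
  then have "s (a / b) \<odot>\<^bsub>M\<^esub> z = s (a / b) \<odot>\<^bsub>M\<^esub> u' \<oplus>\<^bsub>M\<^esub> s a \<odot>\<^bsub>M\<^esub> y"
    using z' uM y by (simp add: smult_r_distr s_smult_smult)
  then have "x \<ominus>\<^bsub>M\<^esub> s (a / b) \<odot>\<^bsub>M\<^esub> z = u \<ominus>\<^bsub>M\<^esub> s (a / b) \<odot>\<^bsub>M\<^esub> u'"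
    using x uM y by (simp add: minus_add_add)
  then show ?thesis using subspD(7)[OF U x(2) subspD(5)[OF U z'(2)]] by metis
qed

text \<open>For \<open>U = carrier M\<close> this is the space M e_j, isomorphic to Hom(P(j), M),
  whose dimension is the multiplicity of S(j) in M.\<close>

definition epart :: "'v \<Rightarrow> 'm set \<Rightarrow> 'm set" where
  "epart j U = {x \<in> U. e j \<odot>\<^bsub>M\<^esub> x = x}"

lemma s_e_comm: "j \<in> V \<Longrightarrow> x \<in> carrier M \<Longrightarrow> e j \<odot>\<^bsub>M\<^esub> (s c \<odot>\<^bsub>M\<^esub> x) = s c \<odot>\<^bsub>M\<^esub> (e j \<odot>\<^bsub>M\<^esub> x)"
  by (simp add: smult_assoc[symmetric] s_comm)

lemma epart_subsp:
  assumes U: "subm U" and j: "j \<in> V"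
  shows "subsp (epart j U)"
  unfolding subsp_def epart_def
  using submD(2,3,4,5)[OF U] j by (auto simp: smult_r_distr s_e_comm)

lemma epart_mem: "subm U \<Longrightarrow> j \<in> V \<Longrightarrow> x \<in> U \<Longrightarrow> e j \<odot>\<^bsub>M\<^esub> x \<in> epart j U"
  using submD(3,5)[of U] by (auto simp: epart_def smult_assoc[symmetric] e_idem)

text \<open>\<open>W\<close> arises from \<open>U\<close> by adding multiples of \<open>y\<close>,
  and \<open>y\<close> is concentrated at \<open>i\<close>; so multiplication by \<open>e j\<close>
  either keeps the new vector or kills it.\<close>

lemma epart_cover:
  assumes c: "covers U W" and i: "i \<in> V" and y: "y \<in> W" "y \<notin> U" "e i \<odot>\<^bsub>M\<^esub> y = y" "W = span1 U y"
    and j: "j \<in> V"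
  shows "i = j \<Longrightarrow> epart j W = span1 (epart j U) y" "i \<noteq> j \<Longrightarrow> epart j W = epart j U"
proof -
  have U: "subm U" and W: "subm W" and UW: "U \<subseteq> W" using c unfolding covers_def by auto
  have yM: "y \<in> carrier M" using y W submD(3) by blast
  have ejy: "e j \<odot>\<^bsub>M\<^esub> y = (if i = j then y else \<zero>\<^bsub>M\<^esub>)"
  proof (cases "i = j")
    case False
    have "e j \<odot>\<^bsub>M\<^esub> y = (e i \<otimes> e j) \<odot>\<^bsub>M\<^esub> y" using y(3) yM i j by (simp add: smult_assoc)
    then show ?thesis using False e_orth[OF i j] yM by simp
  qed (use y in simp)
  have rep: "\<exists>u\<in>epart j U. \<exists>c. x = u \<oplus>\<^bsub>M\<^esub> s c \<odot>\<^bsub>M\<^esub> (e j \<odot>\<^bsub>M\<^esub> y)" if x: "x \<in> epart j W" for x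
  proof -
    obtain u c where u: "x = u \<oplus>\<^bsub>M\<^esub> s c \<odot>\<^bsub>M\<^esub> y" "u \<in> U" using x unfolding epart_def y(4) span1_def by blast
    have "x = e j \<odot>\<^bsub>M\<^esub> x" using x unfolding epart_def by simp
    also have "\<dots> = e j \<odot>\<^bsub>M\<^esub> u \<oplus>\<^bsub>M\<^esub> s c \<odot>\<^bsub>M\<^esub> (e j \<odot>\<^bsub>M\<^esub> y)"
      using u yM j submD(3)[OF U u(2)] by (simp add: smult_r_distr s_e_comm)
    finally show ?thesis using epart_mem[OF U j u(2)] by blast
  qed
  show "epart j W = span1 (epart j U) y" if ij: "i = j"
  proof
    show "epart j W \<subseteq> span1 (epart j U) y"
    proof
      fix x assume "x \<in> epart j W"
      then show "x \<in> span1 (epart j U) y" using rep[of x] ejy ij unfolding span1_def by auto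
    qed
    show "span1 (epart j U) y \<subseteq> epart j W"
    proof
      fix x assume "x \<in> span1 (epart j U) y"
      then obtain u c where u: "x = u \<oplus>\<^bsub>M\<^esub> s c \<odot>\<^bsub>M\<^esub> y" "u \<in> U" "e j \<odot>\<^bsub>M\<^esub> u = u"
        unfolding span1_def epart_def by blast
      have "x \<in> W" using u UW y(1) submD(4,5)[OF W] by auto
      moreover have "e j \<odot>\<^bsub>M\<^esub> x = x"
        using u yM j submD(3)[OF U u(2)] ejy ij by (simp add: smult_r_distr s_e_comm)
      ultimately show "x \<in> epart j W" by (simp add: epart_def)
    qed
  qed
  show "epart j W = epart j U" if ij: "i \<noteq> j"
  proof
    show "epart j U \<subseteq> epart j W" using UW by (auto simp: epart_def)
    show "epart j W \<subseteq> epart j U"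
    proof
      fix x assume "x \<in> epart j W"
      then obtain u c where u: "u \<in> epart j U" "x = u \<oplus>\<^bsub>M\<^esub> s c \<odot>\<^bsub>M\<^esub> \<zero>\<^bsub>M\<^esub>" using rep[of x] ejy ij by auto
      have "u \<in> carrier M" using u submD(3)[OF U] by (simp add: epart_def)
      then show "x \<in> epart j U" using u by simp
    qed
  qed
qed

text \<open>S(j) is P(j) modulo its radical, so an isomorphism amounts to a generator of
  \<open>W\<close> over \<open>U\<close> that is fixed by \<open>e j\<close>. By
  \<open>epart_cover\<close> all elements of \<open>W\<close> fixed by \<open>e j\<close> lie in
  \<open>U\<close> unless \<open>j\<close> is the vertex of \<open>y\<close>.\<close>

lemma simple_iso_cover:
  assumes c: "covers U W" and i: "i \<in> V" and y: "y \<in> W" "y \<notin> U" "e i \<odot>\<^bsub>M\<^esub> y = y" "W = span1 U y"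
    "W = gen U y" "\<And>n. n \<in> N 1 \<Longrightarrow> n \<odot>\<^bsub>M\<^esub> y \<in> U"
    and j: "j \<in> V"
  shows "mod_iso R (quot_mod (restrict_mod M W) U) (simp_of j) \<longleftrightarrow> i = j"
proof -
  have U: "subm U" and W: "subm W" and UW: "U \<subseteq> W" using c unfolding covers_def by auto
  have yM: "y \<in> carrier M" using y W submD(3) by blast
  have "submodule (eR j \<inter> N 1) R (pmod j)"
    unfolding pmod_subm[OF j] using inter_subm[OF eR_subm[OF j] N_subm] by blast
  then have "mod_iso R (quot_mod (restrict_mod M W) U) (simp_of j) \<longleftrightarrow> gens U W j (eR j \<inter> N 1)"
    using mod_iso_sq_iff[OF W U UW j] simp_of_eq[OF j] by simp
  also have "\<dots> \<longleftrightarrow> i = j"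
  proof
    assume "gens U W j (eR j \<inter> N 1)"
    then obtain t where t: "t \<in> W" "e j \<odot>\<^bsub>M\<^esub> t = t"
      and ta: "\<And>a. a \<in> carrier R \<Longrightarrow> a \<odot>\<^bsub>M\<^esub> t \<in> U \<longleftrightarrow> e j \<otimes> a \<in> eR j \<inter> N 1"
      unfolding gens_def by blast
    show "i = j"
    proof (rule ccontr)
      assume "i \<noteq> j"
      then have "t \<in> epart j U" using epart_cover(2)[OF c i y(1-4) j] t by (auto simp: epart_def)
      then have "\<one> \<odot>\<^bsub>M\<^esub> t \<in> U" using submD(3)[OF U] by (simp add: epart_def smult_one)
      then show False using ta[of \<one>] e_notin[OF j] j by simp
    qed
  next
    assume ij: "i = j"
    have "a \<odot>\<^bsub>M\<^esub> y \<in> U \<longleftrightarrow> e j \<otimes> a \<in> eR j \<inter> N 1" if a: "a \<in> carrier R" for a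
    proof
      assume aU: "a \<odot>\<^bsub>M\<^esub> y \<in> U"
      have eaj: "e j \<otimes> a \<in> eR j" using a by (auto simp: eR_def)
      obtain c n where n: "n \<in> N 1" "e j \<otimes> a = s c \<otimes> e j \<oplus> n" using e_local[OF j a] by blast
      have nR: "n \<in> carrier R" using n N_closed by blast
      have "a \<odot>\<^bsub>M\<^esub> y = (e j \<otimes> a) \<odot>\<^bsub>M\<^esub> y" using a y(3) yM j ij by (simp add: smult_assoc)
      also have "\<dots> = s c \<odot>\<^bsub>M\<^esub> y \<oplus>\<^bsub>M\<^esub> n \<odot>\<^bsub>M\<^esub> y"
        using j yM nR y(3) ij by (simp add: n(2) smult_l_distr s_comm[of "e j"] smult_assoc)
      finally have "s c \<odot>\<^bsub>M\<^esub> y = a \<odot>\<^bsub>M\<^esub> y \<ominus>\<^bsub>M\<^esub> n \<odot>\<^bsub>M\<^esub> y"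
        using minus_add_cancel(2)[of "s c \<odot>\<^bsub>M\<^esub> y" "n \<odot>\<^bsub>M\<^esub> y"] yM nR by simp
      then have cy: "s c \<odot>\<^bsub>M\<^esub> y \<in> U" using submD(7)[OF U aU y(6)[OF n(1)]] by simp
      have "c = 0"
      proof (rule ccontr)
        assume "c \<noteq> 0"
        have "s (1 / c) \<odot>\<^bsub>M\<^esub> (s c \<odot>\<^bsub>M\<^esub> y) \<in> U" using submD(5)[OF U _ cy] by simp
        then show False using \<open>c \<noteq> 0\<close> yM y(2) by (simp add: s_smult_smult s_one_smult)
      qed
      then have "e j \<otimes> a = n" using n(2) nR j by simp
      then show "e j \<otimes> a \<in> eR j \<inter> N 1" using n(1) eaj by simp
    next
      assume "e j \<otimes> a \<in> eR j \<inter> N 1"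
      then have "(e j \<otimes> a) \<odot>\<^bsub>M\<^esub> y \<in> U" using y(6) by blast
      then show "a \<odot>\<^bsub>M\<^esub> y \<in> U" using a y(3) yM j ij by (simp add: smult_assoc)
    qed
    then show "gens U W j (eR j \<inter> N 1)" unfolding gens_def using y(1,3,5) ij by blast
  qed
  finally show ?thesis .
qed

context
  fixes L K
  assumes fl: "flag L K"
begin

text \<open>Each simple step raises the dimension of the part at \<open>j\<close> by one if it is of
  type S(j), and leaves it alone otherwise. So the number of steps of type S(j) depends on the
  module only, which is the part of the Jordan-Hoelder theorem behind
  \<open>comp_mult\<close>.\<close>

lemma comp_count:
  assumes F: "composition_series_of R M F" and j: "j \<in> V" and n: "n < length F"
  shows "card {l. l < n \<and> mod_iso R (subquot M F l) (simp_of j)} = card (jumps L K (epart j (F ! n)))"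
  using n
proof (induction n)
  case 0
  have "F \<noteq> []" "hd F = {\<zero>\<^bsub>M\<^esub>}" using F by (simp_all add: composition_series_of_def filtration_def)
  then have "F ! 0 = {\<zero>\<^bsub>M\<^esub>}" by (simp add: hd_conv_nth)
  then have "jumps L K (epart j (F ! 0)) = {}"
    using subspD(2)[OF flagD(3)[OF fl]] by (auto simp: jumps_def epart_def)
  then show ?case by simp
next
  case (Suc n)
  have f: "subm (F ! n)" "subm (F ! Suc n)" "F ! n \<subseteq> F ! Suc n" "simple_mod R (subquot M F n)"
    using F Suc.prems by (auto simp: composition_series_of_def filtration_def)
  have c: "covers (F ! n) (F ! Suc n)"
    using f simple_sq_iff[OF f(2,1,3)] by (simp add: subquot_def)
  obtain i y where i: "i \<in> V" and y: "y \<in> F ! Suc n" "y \<notin> F ! n" "e i \<odot>\<^bsub>M\<^esub> y = y"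
     "F ! Suc n = span1 (F ! n) y" "F ! Suc n = gen (F ! n) y" "\<And>k. k \<in> N 1 \<Longrightarrow> k \<odot>\<^bsub>M\<^esub> y \<in> F ! n"
    using cover_structure[OF c] by metis
  have iso: "mod_iso R (subquot M F n) (simp_of j) \<longleftrightarrow> i = j"
    unfolding subquot_def by (rule simple_iso_cover[OF c i y j])
  have split: "{l. l < Suc n \<and> mod_iso R (subquot M F l) (simp_of j)} =
    {l. l < n \<and> mod_iso R (subquot M F l) (simp_of j)} \<union> (if i = j then {n} else {})"
    using iso less_Suc_eq by auto
  have IH: "card {l. l < n \<and> mod_iso R (subquot M F l) (simp_of j)} = card (jumps L K (epart j (F ! n)))"
    using Suc by simp
  show ?case
  proof (cases "i = j")
    case True
    have "y \<in> epart j (F ! Suc n)" "y \<notin> epart j (F ! n)" using y True by (auto simp: epart_def)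
    then have "card (jumps L K (epart j (F ! Suc n))) = Suc (card (jumps L K (epart j (F ! n))))"
      using jumps_span1[OF fl epart_subsp[OF f(1) j] epart_subsp[OF f(2) j]] epart_cover(1)[OF c i y(1-4) j True]
      by simp
    then show ?thesis unfolding split using True IH by (simp add: card_insert_if)
  next
    case False
    then show ?thesis unfolding split using epart_cover(2)[OF c i y(1-4) j False] IH by simp
  qed
qed

lemma comp_series_exists:
  assumes "subm W"
  shows "\<exists>F. F \<noteq> [] \<and> hd F = {\<zero>\<^bsub>M\<^esub>} \<and> last F = W \<and> (\<forall>U\<in>set F. subm U) \<and>
    (\<forall>l. Suc l < length F \<longrightarrow> covers (F ! l) (F ! Suc l))"
  using assms
proof (induction "card (jumps L K W)" arbitrary: W rule: less_induct)
  case less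
  show ?case
  proof (cases "W = {\<zero>\<^bsub>M\<^esub>}")
    case True
    then show ?thesis by (intro exI[of _ "[{\<zero>\<^bsub>M\<^esub>}]"]) (simp add: zero_subm)
  next
    case False
    let ?S = "\<lambda>U. subm U \<and> U \<subset> W" and ?c = "\<lambda>U. card (jumps L K U)"
    have S0: "?S {\<zero>\<^bsub>M\<^esub>}" using False submD(2)[OF less.prems] zero_subm by auto
    have lt: "?c U < ?c W" if "?S U" for U
      using jumps_strict[OF fl] that less.prems subm_subsp by simp
    \<comment> \<open>A proper submodule of largest dimension is maximal in \<open>W\<close>, and
      induction on the dimension applies to it.\<close>
    define U where "U = arg_max ?c ?S"
    have "?S U \<and> (\<forall>Y. ?S Y \<longrightarrow> ?c Y \<le> ?c U)"
      unfolding U_def by (rule arg_max_nat_lemma[of ?S, OF S0]) (use lt in auto)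
    then have U: "?S U" and mx: "\<And>Y. ?S Y \<Longrightarrow> ?c Y \<le> ?c U" by blast+
    have cov: "covers U W"
      unfolding covers_def
    proof (intro conjI allI impI)
      fix Y assume Y: "subm Y" "U \<subseteq> Y" "Y \<subseteq> W"
      show "Y = U \<or> Y = W"
      proof (rule ccontr)
        assume "\<not> (Y = U \<or> Y = W)"
        then have "?S Y" "U \<subset> Y" using Y by auto
        then show False using mx[of Y] jumps_strict[OF fl, of U Y] U subm_subsp by fastforce
      qed
    qed (use U less.prems in auto)
    obtain F where F: "F \<noteq> []" "hd F = {\<zero>\<^bsub>M\<^esub>}" "last F = U" "\<forall>U\<in>set F. subm U"
      "\<forall>l. Suc l < length F \<longrightarrow> covers (F ! l) (F ! Suc l)"
      using less.hyps[OF lt[OF U]] U by blast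
    have "covers ((F @ [W]) ! l) ((F @ [W]) ! Suc l)" if "Suc l < length (F @ [W])" for l
    proof (cases "Suc l < length F")
      case True
      then show ?thesis using F(5) by (simp add: nth_append)
    next
      case False
      then have l: "Suc l = length F" using that by simp
      then have "F ! l = U" using F(1,3) by (metis diff_Suc_1 last_conv_nth)
      then show ?thesis using l cov by (simp add: nth_append)
    qed
    then show ?thesis using F less.prems by (intro exI[of _ "F @ [W]"]) auto
  qed
qed

lemma comp_mult_eq:
  assumes j: "j \<in> V"
  shows "comp_mult R M (simp_of j) = card (jumps L K (epart j (carrier M)))"
  unfolding comp_mult_def
proof (rule the_equality)
  have count: "card {l. Suc l < length F \<and> mod_iso R (subquot M F l) (simp_of j)} =
      card (jumps L K (epart j (carrier M)))" if F: "composition_series_of R M F" for F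
  proof -
    have "F \<noteq> []" "last F = carrier M" using F by (auto simp: composition_series_of_def filtration_def)
    then have "F ! (length F - 1) = carrier M" "length F - 1 < length F" by (simp_all add: last_conv_nth)
    moreover have "{l. Suc l < length F \<and> P l} = {l. l < length F - 1 \<and> P l}" for P by auto
    ultimately show ?thesis using comp_count[OF F j, of "length F - 1"] by simp
  qed
  obtain F where F: "F \<noteq> []" "hd F = {\<zero>\<^bsub>M\<^esub>}" "last F = carrier M" "\<forall>U\<in>set F. subm U"
      "\<forall>l. Suc l < length F \<longrightarrow> covers (F ! l) (F ! Suc l)"
    using comp_series_exists[OF carrier_subm] by blast
  have "composition_series_of R M F"
    unfolding composition_series_of_def filtration_def
  proof (intro conjI allI impI)
    fix l assume l: "Suc l < length F"
    then have c: "subm (F ! l)" "subm (F ! Suc l)" "F ! l \<subset> F ! Suc l" "covers (F ! l) (F ! Suc l)"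
      using F(5) unfolding covers_def by auto
    then show "F ! l \<subseteq> F ! Suc l" by blast
    show "simple_mod R (subquot M F l)"
      using c simple_sq_iff[of "F ! Suc l" "F ! l"] by (simp add: subquot_def)
  qed (fact F(1-4))+
  then show "\<exists>F. composition_series_of R M F \<and> card (jumps L K (epart j (carrier M))) =
      card {l. Suc l < length F \<and> mod_iso R (subquot M F l) (simp_of j)}"
    using count by auto
  fix n assume "\<exists>F. composition_series_of R M F \<and>
      n = card {l. Suc l < length F \<and> mod_iso R (subquot M F l) (simp_of j)}"
  then show "n = card (jumps L K (epart j (carrier M)))" using count by blast
qed

end

lemma comp_mult_nonzero_iff:
  assumes fd and j: "j \<in> V"
  shows "comp_mult R M (simp_of j) \<noteq> 0 \<longleftrightarrow> (\<exists>x\<in>carrier M. e j \<odot>\<^bsub>M\<^esub> x \<noteq> \<zero>\<^bsub>M\<^esub>)"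
proof -
  obtain L K where fl: "flag L K" using assms(1) fd_def by blast
  have "comp_mult R M (simp_of j) \<noteq> 0 \<longleftrightarrow> jumps L K (epart j (carrier M)) \<noteq> {}"
    using comp_mult_eq[OF fl j] by simp
  also have "\<dots> \<longleftrightarrow> (\<exists>x\<in>epart j (carrier M). x \<noteq> \<zero>\<^bsub>M\<^esub>)"
  proof
    assume "jumps L K (epart j (carrier M)) \<noteq> {}"
    then obtain n x where "x \<in> epart j (carrier M)" "x \<notin> L n" by (auto simp: jumps_def)
    then show "\<exists>x\<in>epart j (carrier M). x \<noteq> \<zero>\<^bsub>M\<^esub>" using subspD(2)[OF flagD(3)[OF fl]] by metis
  next
    assume "\<exists>x\<in>epart j (carrier M). x \<noteq> \<zero>\<^bsub>M\<^esub>"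
    then obtain x where x: "x \<in> epart j (carrier M)" "x \<noteq> \<zero>\<^bsub>M\<^esub>" by blast
    then show "jumps L K (epart j (carrier M)) \<noteq> {}"
      using level[OF fl, of x] unfolding jumps_def epart_def by blast
  qed
  also have "\<dots> \<longleftrightarrow> (\<exists>x\<in>carrier M. e j \<odot>\<^bsub>M\<^esub> x \<noteq> \<zero>\<^bsub>M\<^esub>)"
  proof
    assume "\<exists>x\<in>epart j (carrier M). x \<noteq> \<zero>\<^bsub>M\<^esub>"
    then obtain x where "x \<in> carrier M" "e j \<odot>\<^bsub>M\<^esub> x = x" "x \<noteq> \<zero>\<^bsub>M\<^esub>" unfolding epart_def by blast
    then show "\<exists>x\<in>carrier M. e j \<odot>\<^bsub>M\<^esub> x \<noteq> \<zero>\<^bsub>M\<^esub>" by (intro bexI[of _ x]) simp_all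
  next
    assume "\<exists>x\<in>carrier M. e j \<odot>\<^bsub>M\<^esub> x \<noteq> \<zero>\<^bsub>M\<^esub>"
    then show "\<exists>x\<in>epart j (carrier M). x \<noteq> \<zero>\<^bsub>M\<^esub>" using epart_mem[OF carrier_subm j] by blast
  qed
  finally show ?thesis .
qed

text \<open>By \<open>comp_mult_eq\<close> the multiplicity is one if and only if M e_j is a line;
  \<open>y\<close> is a spanning vector of it.\<close>

lemma comp_mult_one_iff:
  assumes fd and j: "j \<in> V"
  shows "comp_mult R M (simp_of j) = 1 \<longleftrightarrow>
    (\<exists>y\<in>carrier M. y \<noteq> \<zero>\<^bsub>M\<^esub> \<and> e j \<odot>\<^bsub>M\<^esub> y = y \<and> (\<forall>x\<in>carrier M. \<exists>c. e j \<odot>\<^bsub>M\<^esub> x = s c \<odot>\<^bsub>M\<^esub> y))"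
proof -
  obtain L K where fl: "flag L K" using assms(1) fd_def by blast
  let ?E = "epart j (carrier M)" and ?Z = "{\<zero>\<^bsub>M\<^esub>}"
  have E: "subsp ?E" by (rule epart_subsp[OF carrier_subm j])
  have Z: "subsp ?Z" by (rule subm_subsp[OF zero_subm])
  have Zc: "jumps L K ?Z = {}" using subspD(2)[OF flagD(3)[OF fl]] by (auto simp: jumps_def)
  have sp: "span1 ?Z y = {s c \<odot>\<^bsub>M\<^esub> y | c. True}" if "y \<in> carrier M" for y
    using that by (auto simp: span1_def)
  have one: "card (jumps L K (span1 ?Z y)) = 1" "subsp (span1 ?Z y)"
    if y: "y \<in> ?E" "y \<noteq> \<zero>\<^bsub>M\<^esub>" for y
  proof -
    have yM: "y \<in> carrier M" using y by (simp add: epart_def)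
    note S = span1_subsp[OF Z yM]
    show "subsp (span1 ?Z y)" by (rule S(1))
    show "card (jumps L K (span1 ?Z y)) = 1"
      using jumps_span1[OF fl Z S(1) S(3) _ refl] y(2) Zc by simp
  qed
  have "comp_mult R M (simp_of j) = 1 \<longleftrightarrow> card (jumps L K ?E) = 1"
    using comp_mult_eq[OF fl j] by simp
  also have "\<dots> \<longleftrightarrow> (\<exists>y\<in>?E. y \<noteq> \<zero>\<^bsub>M\<^esub> \<and> ?E = span1 ?Z y)"
  proof
    assume c1: "card (jumps L K ?E) = 1"
    then have "jumps L K ?E \<noteq> {}" by auto
    then obtain n y where y: "y \<in> ?E" "y \<notin> L n" unfolding jumps_def by blast
    then have y0: "y \<noteq> \<zero>\<^bsub>M\<^esub>" using subspD(2)[OF flagD(3)[OF fl]] by blast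
    have yM: "y \<in> carrier M" using y by (simp add: epart_def)
    have sub: "span1 ?Z y \<subseteq> ?E" unfolding sp[OF yM] using subspD(5)[OF E y(1)] by blast
    have "?E = span1 ?Z y"
    proof (rule ccontr)
      assume "?E \<noteq> span1 ?Z y"
      then have "span1 ?Z y \<subset> ?E" using sub by blast
      then show False using jumps_strict[OF fl one(2)[OF y(1) y0] E] one(1)[OF y(1) y0] c1 by simp
    qed
    then show "\<exists>y\<in>?E. y \<noteq> \<zero>\<^bsub>M\<^esub> \<and> ?E = span1 ?Z y" using y y0 by blast
  next
    assume "\<exists>y\<in>?E. y \<noteq> \<zero>\<^bsub>M\<^esub> \<and> ?E = span1 ?Z y"
    then show "card (jumps L K ?E) = 1" using one(1) by metis
  qed
  also have "\<dots> \<longleftrightarrow> (\<exists>y\<in>carrier M. y \<noteq> \<zero>\<^bsub>M\<^esub> \<and> e j \<odot>\<^bsub>M\<^esub> y = y \<and>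
      (\<forall>x\<in>carrier M. \<exists>c. e j \<odot>\<^bsub>M\<^esub> x = s c \<odot>\<^bsub>M\<^esub> y))" (is "?L \<longleftrightarrow> ?R")
  proof
    assume ?L
    then obtain y where y: "y \<in> ?E" "y \<noteq> \<zero>\<^bsub>M\<^esub>" "?E = span1 ?Z y" by blast
    have yM: "y \<in> carrier M" "e j \<odot>\<^bsub>M\<^esub> y = y" using y by (simp_all add: epart_def)
    have "\<exists>c. e j \<odot>\<^bsub>M\<^esub> x = s c \<odot>\<^bsub>M\<^esub> y" if "x \<in> carrier M" for x
      using epart_mem[OF carrier_subm j that] unfolding y(3) sp[OF yM(1)] by blast
    then show ?R using y yM by blast
  next
    assume ?R
    then obtain y where y: "y \<in> carrier M" "y \<noteq> \<zero>\<^bsub>M\<^esub>" "e j \<odot>\<^bsub>M\<^esub> y = y"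
      and a: "\<And>x. x \<in> carrier M \<Longrightarrow> \<exists>c. e j \<odot>\<^bsub>M\<^esub> x = s c \<odot>\<^bsub>M\<^esub> y" by blast
    have yE: "y \<in> ?E" using y by (simp add: epart_def)
    have "?E \<subseteq> span1 ?Z y" unfolding sp[OF y(1)] using a by (auto simp: epart_def) metis
    moreover have "span1 ?Z y \<subseteq> ?E" unfolding sp[OF y(1)] using subspD(5)[OF E yE] by blast
    ultimately show ?L using y yE by blast
  qed
  finally show ?thesis .
qed

lemma fd_restrict:
  assumes fd and W: "subm W"
  shows "rmodule.fd s (restrict_mod M W)"
proof -
  obtain L K where fl: "flag L K" using assms(1) fd_def by blast
  interpret W: rmodule R V e s N X "restrict_mod M W" by (rule rmodule_restrict[OF W])
  have minus: "x \<ominus>\<^bsub>restrict_mod M W\<^esub> y = x \<ominus>\<^bsub>M\<^esub> y" if "x \<in> W" "y \<in> W" for x y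
    using W.smult_l_minus[of \<one> y] smult_l_minus[of \<one> y] submD(3)[OF W] that W.smult_one[of y] smult_one[of y]
    by (simp add: a_minus_def)
  have "W.flag (\<lambda>n. L n \<inter> W) K"
    unfolding W.flag_def
  proof (intro conjI allI ballI)
    show "L 0 \<inter> W = {\<zero>\<^bsub>restrict_mod M W\<^esub>}" using flagD(1)[OF fl] submD(2)[OF W] by auto
    show "L K \<inter> W = carrier (restrict_mod M W)" using flagD(2)[OF fl] submD(1)[OF W] by auto
    show "W.subsp (L n \<inter> W)" for n
      using subspD(2,4,5)[OF flagD(3)[OF fl, of n]] submD(2,4,5)[OF W] by (auto simp: W.subsp_def)
    show "L n \<inter> W \<subseteq> L (Suc n) \<inter> W" for n using flagD(4)[OF fl] by blast
    fix n x y assume x: "x \<in> L (Suc n) \<inter> W" and y: "y \<in> L (Suc n) \<inter> W - L n \<inter> W"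
    then obtain c where c: "x \<ominus>\<^bsub>M\<^esub> s c \<odot>\<^bsub>M\<^esub> y \<in> L n" using flagD(5)[OF fl, of x n y] by blast
    have "s c \<odot>\<^bsub>M\<^esub> y \<in> W" using y submD(5)[OF W] by simp
    then have "x \<ominus>\<^bsub>restrict_mod M W\<^esub> s c \<odot>\<^bsub>restrict_mod M W\<^esub> y \<in> L n \<inter> W"
      using c x minus submD(7)[OF W] by simp
    then show "\<exists>c. x \<ominus>\<^bsub>restrict_mod M W\<^esub> s c \<odot>\<^bsub>restrict_mod M W\<^esub> y \<in> L n \<inter> W" by blast
  qed
  then show ?thesis unfolding W.fd_def by blast
qed

lemma fd_quot:
  assumes fd and U: "subm U"
  shows "rmodule.fd s (quot_mod M U)"
proof -
  obtain L K where fl: "flag L K" using assms(1) fd_def by blast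
  interpret Q: rmodule R V e s N X "quot_mod M U" by (rule rmodule_quot[OF U])
  note q = quot_simps[OF U]
  let ?c = "\<lambda>x. U +>\<^bsub>M\<^esub> x"
  have LM: "x \<in> carrier M" if "x \<in> L n" for x n using subspD(3)[OF flagD(3)[OF fl] that] .
  have minus: "?c x \<ominus>\<^bsub>quot_mod M U\<^esub> ?c y = ?c (x \<ominus>\<^bsub>M\<^esub> y)" if "x \<in> carrier M" "y \<in> carrier M" for x y
  proof -
    have "?c (x \<ominus>\<^bsub>M\<^esub> y) \<oplus>\<^bsub>quot_mod M U\<^esub> ?c y = ?c x"
      using that minus_add_cancel(1)[OF that] by (simp add: q(3))
    moreover have "?c (x \<ominus>\<^bsub>M\<^esub> y) \<in> carrier (quot_mod M U)" "?c y \<in> carrier (quot_mod M U)"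
      using that unfolding q(1) by blast+
    ultimately show ?thesis using Q.minus_add_cancel(2)[of "?c (x \<ominus>\<^bsub>M\<^esub> y)" "?c y"] by simp
  qed
  have "Q.flag (\<lambda>n. ?c ` L n) K"
    unfolding Q.flag_def
  proof (intro conjI allI ballI)
    show "?c ` L 0 = {\<zero>\<^bsub>quot_mod M U\<^esub>}" using flagD(1)[OF fl] coset_zero[OF U] by (simp add: q(2))
    show "?c ` L K = carrier (quot_mod M U)" using flagD(2)[OF fl] by (auto simp: q(1))
    show "Q.subsp (?c ` L n)" for n
      unfolding Q.subsp_def
    proof (intro conjI ballI allI)
      note l = flagD(3)[OF fl, of n]
      show "?c ` L n \<subseteq> carrier (quot_mod M U)" using LM by (auto simp: q(1))
      show "\<zero>\<^bsub>quot_mod M U\<^esub> \<in> ?c ` L n" using subspD(2)[OF l] coset_zero[OF U] by (auto simp: q(2))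
      show "A \<oplus>\<^bsub>quot_mod M U\<^esub> B \<in> ?c ` L n" if AB: "A \<in> ?c ` L n" "B \<in> ?c ` L n" for A B
      proof -
        obtain x y where "x \<in> L n" "y \<in> L n" "A = ?c x" "B = ?c y" using AB by blast
        then show ?thesis using q(3)[OF LM LM] subspD(4)[OF l] by auto
      qed
      show "s c \<odot>\<^bsub>quot_mod M U\<^esub> A \<in> ?c ` L n" if A: "A \<in> ?c ` L n" for A c
      proof -
        obtain x where "x \<in> L n" "A = ?c x" using A by blast
        then show ?thesis using q(4)[OF s_closed LM] subspD(5)[OF l] by auto
      qed
    qed
    show "?c ` L n \<subseteq> ?c ` L (Suc n)" for n using flagD(4)[OF fl] by blast
    fix n A B assume A: "A \<in> ?c ` L (Suc n)" and B: "B \<in> ?c ` L (Suc n) - ?c ` L n"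
    obtain x y where x: "x \<in> L (Suc n)" "A = ?c x" and y: "y \<in> L (Suc n)" "B = ?c y" using A B by blast
    have "y \<notin> L n" using B y by blast
    then obtain c where c: "x \<ominus>\<^bsub>M\<^esub> s c \<odot>\<^bsub>M\<^esub> y \<in> L n" using flagD(5)[OF fl x(1) y(1)] by blast
    have "A \<ominus>\<^bsub>quot_mod M U\<^esub> s c \<odot>\<^bsub>quot_mod M U\<^esub> B = ?c (x \<ominus>\<^bsub>M\<^esub> s c \<odot>\<^bsub>M\<^esub> y)"
      using x y LM minus[of x "s c \<odot>\<^bsub>M\<^esub> y"] q(4)[of "s c" y] by simp
    then show "\<exists>c. A \<ominus>\<^bsub>quot_mod M U\<^esub> s c \<odot>\<^bsub>quot_mod M U\<^esub> B \<in> ?c ` L n" using c by auto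
  qed
  then show ?thesis unfolding Q.fd_def by blast
qed

end

section \<open>Finite dimension of the algebra\<close>

context basic_algebra
begin

text \<open>Generators are adjoined one at a time. One that already lies in the span leaves the
  subspace unchanged, which a flag permits, so linear independence does not have to be arranged. The
  sequence is constant after the last generator because flags are indexed by all natural
  numbers.\<close>

primrec spans :: "'r list \<Rightarrow> nat \<Rightarrow> 'r set" where
  "spans bs 0 = {\<zero>}"
| "spans bs (Suc n) = (if n < length bs then reg.span1 (spans bs n) (bs ! n) else spans bs n)"

lemma spans_subsp: "set bs \<subseteq> carrier R \<Longrightarrow> reg.subsp (spans bs n)"
proof (induction n)
  case 0
  then show ?case using reg.subm_subsp[OF reg.zero_subm] by simp
next
  case (Suc n)
  have "bs ! n \<in> carrier R" if "n < length bs" using Suc.prems nth_mem[OF that] by blast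
  then show ?case using reg.span1_subsp(1)[of "spans bs n" "bs ! n"] Suc by simp
qed

lemma fd_reg: "reg.fd"
proof -
  obtain bs where bs: "set bs \<subseteq> carrier R" and
    gen: "\<And>G. subgroup G (add_monoid R) \<Longrightarrow> (\<forall>c. \<forall>x\<in>G. s c \<otimes> x \<in> G) \<Longrightarrow> set bs \<subseteq> G \<Longrightarrow> carrier R \<subseteq> G"
    using fin_gen by metis
  have sub: "reg.subsp (spans bs n)" for n by (rule spans_subsp[OF bs])
  have bn: "bs ! n \<in> carrier R" if "n < length bs" for n using bs nth_mem[OF that] by blast
  have step: "spans bs n \<subseteq> spans bs (Suc n)" for n
    using reg.span1_subsp(2)[OF sub, of "bs ! n" n] bn by auto
  have mono: "spans bs m \<subseteq> spans bs n" if "m \<le> n" for m n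
    by (rule lift_Suc_mono_le[of "spans bs"]) (rule step, rule that)
  let ?K = "length bs"
  have sK: "reg.subsp (spans bs ?K)" by (rule sub)
  note sKD = reg.subspD[OF sK]
  have "reg.flag (spans bs) ?K"
    unfolding reg.flag_def
  proof (intro conjI allI ballI)
    have "carrier R \<subseteq> spans bs ?K"
    proof (rule gen)
      show "subgroup (spans bs ?K) (add_monoid R)"
      proof (intro subgroup.intro)
        show "inv\<^bsub>add_monoid R\<^esub> x \<in> spans bs ?K" if "x \<in> spans bs ?K" for x
          using sKD(6)[OF that] by (simp add: a_inv_def[of R, symmetric])
      qed (use sKD(1,2,4) in auto)
      show "\<forall>c. \<forall>x\<in>spans bs ?K. s c \<otimes> x \<in> spans bs ?K"
        using sKD(3,5) by (auto simp: s_comm)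
      show "set bs \<subseteq> spans bs ?K"
      proof
        fix b assume "b \<in> set bs"
        then obtain n where n: "n < ?K" "b = bs ! n" by (auto simp: in_set_conv_nth)
        then have "b \<in> spans bs (Suc n)" using reg.span1_subsp(3)[OF sub, of "bs ! n" n] bn[of n] by simp
        then show "b \<in> spans bs ?K" using mono[of "Suc n" ?K] n by auto
      qed
    qed
    then show "spans bs ?K = carrier reg" using reg.subspD(1)[OF sub] by auto
    fix n x y assume x: "x \<in> spans bs (Suc n)" and y: "y \<in> spans bs (Suc n) - spans bs n"
    show "\<exists>c. x \<ominus>\<^bsub>reg\<^esub> s c \<odot>\<^bsub>reg\<^esub> y \<in> spans bs n"
      using reg.span1_step[OF sub, of "bs ! n" x n y] x y bn[of n] by (cases "n < ?K") auto
  qed (use sub step in \<open>simp_all del: spans.simps(2)\<close>)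
  then show ?thesis unfolding reg.fd_def by blast
qed

lemma fd_pmod: "j \<in> V \<Longrightarrow> rmodule.fd s (pmod j)"
  unfolding pmod_def by (rule reg.fd_restrict[OF fd_reg eR_subm])

end

section \<open>Standard modules and their filtrations\<close>

context basic_algebra
begin

text \<open>The right ideal generated by the elements of \<open>F\<close> multiplied by the
  \<open>e q\<close> with \<open>P q\<close>. If \<open>F\<close> is a submodule, it is the trace in
  \<open>F\<close> of the projectives P(q) with \<open>P q\<close>. The predicate is a parameter
  because it is used with the vertices not below \<open>i\<close>, which gives the kernel of P(i)
  \<rightarrow> \<Delta>(i), and with the vertices strictly above the node in
  \<open>no_label\<close>.\<close>

definition trace :: "('v \<Rightarrow> bool) \<Rightarrow> 'r set \<Rightarrow> 'r set" where
  "trace P F = \<Inter>{U. reg.subm U \<and> (\<forall>x\<in>F. \<forall>q\<in>V. P q \<longrightarrow> x \<otimes> e q \<in> U)}"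

lemma Inter_subm:
  assumes ne: "A \<noteq> {}" and A: "\<And>U. U \<in> A \<Longrightarrow> reg.subm U"
  shows "reg.subm (\<Inter>A)"
  unfolding reg.subm_iff
proof (intro conjI ballI)
  show "\<Inter>A \<subseteq> carrier reg" using ne reg.submD(1)[OF A] by blast
  show "\<zero>\<^bsub>reg\<^esub> \<in> \<Inter>A" using reg.submD(2)[OF A] by blast
  show "x \<oplus>\<^bsub>reg\<^esub> y \<in> \<Inter>A" if "x \<in> \<Inter>A" "y \<in> \<Inter>A" for x y
    using that reg.submD(4)[OF A] by blast
  show "a \<odot>\<^bsub>reg\<^esub> x \<in> \<Inter>A" if "a \<in> carrier R" "x \<in> \<Inter>A" for a x
    using that reg.submD(5)[OF A] by blast
qed

lemma trace_subm:
  assumes F: "F \<subseteq> carrier R"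
  shows "reg.subm (trace P F)"
  unfolding trace_def
proof (rule Inter_subm)
  have "carrier R \<in> {U. reg.subm U \<and> (\<forall>x\<in>F. \<forall>q\<in>V. P q \<longrightarrow> x \<otimes> e q \<in> U)}"
    using F reg.carrier_subm by auto
  then show "{U. reg.subm U \<and> (\<forall>x\<in>F. \<forall>q\<in>V. P q \<longrightarrow> x \<otimes> e q \<in> U)} \<noteq> {}" by blast
qed blast

lemma trace_in: "x \<in> F \<Longrightarrow> q \<in> V \<Longrightarrow> P q \<Longrightarrow> x \<otimes> e q \<in> trace P F"
  by (auto simp: trace_def)

lemma trace_least:
  "reg.subm U \<Longrightarrow> (\<And>x q. x \<in> F \<Longrightarrow> q \<in> V \<Longrightarrow> P q \<Longrightarrow> x \<otimes> e q \<in> U) \<Longrightarrow> trace P F \<subseteq> U"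
  by (auto simp: trace_def)

lemma trace_mono: "F \<subseteq> G \<Longrightarrow> trace P F \<subseteq> trace P G"
  by (auto simp: trace_def)

lemma trace_sub: "reg.subm F \<Longrightarrow> trace P F \<subseteq> F"
  using reg.submD(5)[of F] by (intro trace_least) auto

definition ker :: "('v \<times> 'v) set \<Rightarrow> 'v \<Rightarrow> 'r set" where
  "ker r i = trace (\<lambda>q. (q, i) \<notin> r) (eR i)"

definition stdm :: "('v \<times> 'v) set \<Rightarrow> 'v \<Rightarrow> ('r, 'r set) module" where
  "stdm r i = quot_mod (pmod i) (ker r i)"

definition fbelow :: "('v \<times> 'v) set \<Rightarrow> 'v \<Rightarrow> ('r, 'm) module \<Rightarrow> bool" where
  "fbelow r i M \<longleftrightarrow> (\<forall>j\<in>V. comp_mult R M (simp_of j) \<noteq> 0 \<longrightarrow> (j, i) \<in> r)"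

lemma eR_sub: "j \<in> V \<Longrightarrow> eR j \<subseteq> carrier R"
  by (auto simp: eR_iff)

lemma ker_subm: "i \<in> V \<Longrightarrow> reg.subm (ker r i)"
  unfolding ker_def using eR_sub by (rule trace_subm)

lemma ker_sub: "i \<in> V \<Longrightarrow> ker r i \<subseteq> eR i"
  unfolding ker_def using eR_subm by (rule trace_sub)

lemma ker_in: "i \<in> V \<Longrightarrow> q \<in> V \<Longrightarrow> (q, i) \<notin> r \<Longrightarrow> a \<in> carrier R \<Longrightarrow> e i \<otimes> a \<otimes> e q \<in> ker r i"
  unfolding ker_def by (rule trace_in) (auto simp: eR_def)

lemma ker_pmod: "i \<in> V \<Longrightarrow> submodule (ker r i) R (pmod i)"
  by (simp add: pmod_subm ker_subm ker_sub)

lemma quot_comp_mult: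
  assumes i: "i \<in> V" and U: "reg.subm U" "U \<subseteq> eR i" and j: "j \<in> V"
  shows "comp_mult R (quot_mod (pmod i) U) (simp_of j) \<noteq> 0 \<longleftrightarrow> (\<exists>x\<in>eR i. x \<otimes> e j \<notin> U)"
proof -
  interpret P: rmodule R V e s N X "pmod i" by (rule rmodule_pmod[OF i])
  have sU: "P.subm U" using U pmod_subm[OF i] by simp
  interpret Q: rmodule R V e s N X "quot_mod (pmod i) U" by (rule P.rmodule_quot[OF sU])
  note q = P.quot_simps[OF sU]
  have "comp_mult R (quot_mod (pmod i) U) (simp_of j) \<noteq> 0 \<longleftrightarrow>
      (\<exists>A\<in>carrier (quot_mod (pmod i) U). e j \<odot>\<^bsub>quot_mod (pmod i) U\<^esub> A \<noteq> U)"
    using Q.comp_mult_nonzero_iff[OF P.fd_quot[OF fd_pmod[OF i] sU] j] by (simp only: q(2))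
  also have "\<dots> \<longleftrightarrow> (\<exists>x\<in>eR i. U +>\<^bsub>pmod i\<^esub> (x \<otimes> e j) \<noteq> U)"
    unfolding q(1) using q(4)[of "e j"] j by auto
  also have "\<dots> \<longleftrightarrow> (\<exists>x\<in>eR i. x \<otimes> e j \<notin> U)"
  proof -
    have "U +>\<^bsub>pmod i\<^esub> (x \<otimes> e j) = U \<longleftrightarrow> x \<otimes> e j \<in> U" if "x \<in> eR i" for x
      using reg.submD(5)[OF eR_subm[OF i], of "e j" x] that j by (intro P.coset_eq_self_iff[OF sU]) simp
    then show ?thesis by blast
  qed
  finally show ?thesis .
qed

text \<open>A factor S(j) occurs in the quotient by \<open>U\<close> if and only if some x e_j with
  x in P(i) is outside \<open>U\<close>. So the eligible submodules are exactly those that contain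
  the generators of the trace.\<close>

lemma ker_least:
  assumes i: "i \<in> V"
  shows "(LEAST U. submodule U R (pmod i) \<and> fbelow r i (quot_mod (pmod i) U)) = ker r i"
proof (rule Least_equality)
  show "submodule (ker r i) R (pmod i) \<and> fbelow r i (quot_mod (pmod i) (ker r i))"
    using quot_comp_mult[OF i ker_subm[OF i] ker_sub[OF i]] ker_pmod[OF i]
    unfolding fbelow_def ker_def by (metis trace_in)
next
  fix U assume U: "submodule U R (pmod i) \<and> fbelow r i (quot_mod (pmod i) U)"
  then have sU: "reg.subm U" "U \<subseteq> eR i" using pmod_subm[OF i] by auto
  show "ker r i \<subseteq> U"
    unfolding ker_def
  proof (rule trace_least[OF sU(1)])
    fix x q assume "x \<in> eR i" "q \<in> V" "(q, i) \<notin> r"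
    then show "x \<otimes> e q \<in> U" using U quot_comp_mult[OF i sU, of q] unfolding fbelow_def by blast
  qed
qed

lemma stdm_comp_mult: "i \<in> V \<Longrightarrow> j \<in> V \<Longrightarrow>
    comp_mult R (stdm r i) (simp_of j) \<noteq> 0 \<longleftrightarrow> (\<exists>x\<in>eR i. x \<otimes> e j \<notin> ker r i)"
  unfolding stdm_def by (rule quot_comp_mult) (auto simp: ker_subm ker_sub)

text \<open>The condition \<open>[\<Delta>(i) : S(i)] = 1\<close>.\<close>

definition schur :: "('v \<times> 'v) set \<Rightarrow> 'v \<Rightarrow> bool" where
  "schur r i \<longleftrightarrow> e i \<notin> ker r i \<and> (\<forall>a\<in>carrier R. \<exists>c. e i \<otimes> a \<otimes> e i \<ominus> s c \<otimes> e i \<in> ker r i)"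

lemma stdm_comp_mult_one:
  assumes i: "i \<in> V"
  shows "comp_mult R (stdm r i) (simp_of i) = 1 \<longleftrightarrow> schur r i"
proof -
  let ?U = "ker r i" and ?Q = "quot_mod (pmod i) (ker r i)"
  interpret P: rmodule R V e s N X "pmod i" by (rule rmodule_pmod[OF i])
  have sU: "P.subm ?U" by (rule ker_pmod[OF i])
  interpret Q: rmodule R V e s N X ?Q by (rule P.rmodule_quot[OF sU])
  note q = P.quot_simps[OF sU]
  let ?c = "\<lambda>x. ?U +>\<^bsub>pmod i\<^esub> x"
  have ei: "e i \<in> eR i" by (rule e_in_eR[OF i])
  have eqP: "?c x = ?c y \<longleftrightarrow> x \<ominus> y \<in> ?U" if "x \<in> eR i" "y \<in> eR i" for x y
  proof -
    have "y \<in> carrier R" using that eR_sub[OF i] by blast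
    then have "\<ominus>\<^bsub>pmod i\<^esub> y = \<ominus> y"
      using P.smult_l_minus[of \<one> y] P.smult_one[of y] that by (simp add: r_minus)
    then have "x \<ominus>\<^bsub>pmod i\<^esub> y = x \<ominus> y" by (simp add: a_minus_def)
    then show ?thesis using P.coset_eq_iff[OF sU, of x y] that by simp
  qed
  have zero: "?c x = ?U \<longleftrightarrow> x \<in> ?U" if "x \<in> eR i" for x
    using P.coset_eq_self_iff[OF sU, of x] that by simp
  have cm: "x \<otimes> a \<in> eR i" if "x \<in> eR i" "a \<in> carrier R" for x a
    using reg.submD(5)[OF eR_subm[OF i] that(2,1)] by simp
  have sei: "s c \<otimes> e i = e i \<otimes> s c" for c using i by (simp add: s_comm)
  have "comp_mult R (stdm r i) (simp_of i) = 1 \<longleftrightarrow>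
    (\<exists>A\<in>carrier ?Q. A \<noteq> ?U \<and> e i \<odot>\<^bsub>?Q\<^esub> A = A \<and> (\<forall>B\<in>carrier ?Q. \<exists>c. e i \<odot>\<^bsub>?Q\<^esub> B = s c \<odot>\<^bsub>?Q\<^esub> A))"
    unfolding stdm_def using Q.comp_mult_one_iff[OF P.fd_quot[OF fd_pmod[OF i] sU] i] by (simp only: q(2))
  also have "\<dots> \<longleftrightarrow> (\<exists>y\<in>eR i. y \<notin> ?U \<and> ?c (y \<otimes> e i) = ?c y \<and> (\<forall>x\<in>eR i. \<exists>c. ?c (x \<otimes> e i) = ?c (y \<otimes> s c)))"
  proof -
    have 4: "a \<odot>\<^bsub>?Q\<^esub> ?c x = ?c (x \<otimes> a)" if "a \<in> carrier R" "x \<in> eR i" for a x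
      using q(4)[of a x] that by simp
    have C: "carrier ?Q = ?c ` eR i" using q(1) by auto
    show ?thesis unfolding C using 4 zero i by (simp add: bex_simps(7) ball_simps(9) cong: bex_cong ball_cong)
  qed
  also have "\<dots> \<longleftrightarrow> schur r i" (is "?L \<longleftrightarrow> _")
  proof
    assume ?L
    then obtain y where y: "y \<in> eR i" "y \<notin> ?U" and a: "\<And>x. x \<in> eR i \<Longrightarrow> \<exists>c. ?c (x \<otimes> e i) = ?c (y \<otimes> s c)"
      by blast
    have einot: "e i \<notin> ?U"
    proof
      assume "e i \<in> ?U"
      then have "e i \<otimes> y \<in> ?U" using reg.submD(5)[OF ker_subm[OF i]] y eR_sub[OF i] by auto
      then show False using y eR_iff[OF i] by simp
    qed
    \<comment> \<open>The spanning vector \<open>y\<close> need not be the class of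
      \<open>e i\<close>, but the latter is a nonzero multiple of it, because \<open>e i\<close> is
      outside the kernel. So the class of \<open>e i\<close> spans as well.\<close>
    obtain c where c: "?c (e i \<otimes> e i) = ?c (y \<otimes> s c)" using a[OF ei] by blast
    have yR: "y \<in> carrier R" using y eR_sub[OF i] by blast
    have c0: "c \<noteq> 0"
    proof
      assume "c = 0"
      then have "?c (e i) = ?c \<zero>" using c yR i by (simp add: P.smult_r_zero e_idem)
      then show False using einot zero[OF ei] P.coset_zero[OF sU] by simp
    qed
    have "\<exists>d. e i \<otimes> b \<otimes> e i \<ominus> s d \<otimes> e i \<in> ?U" if b: "b \<in> carrier R" for b
    proof -
      have eb: "e i \<otimes> b \<in> eR i" using b by (auto simp: eR_def)
      obtain d where d: "?c (e i \<otimes> b \<otimes> e i) = ?c (y \<otimes> s d)" using a[OF eb] by blast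
      have "?c (y \<otimes> s d) = s (d / c) \<odot>\<^bsub>?Q\<^esub> ?c (y \<otimes> s c)"
      proof -
        have "y \<otimes> s c \<otimes> s (d / c) = y \<otimes> s d" using yR c0 by (simp add: m_assoc s_mult[symmetric])
        then show ?thesis using q(4)[of "s (d / c)" "y \<otimes> s c"] cm[OF y(1)] by simp
      qed
      also have "\<dots> = s (d / c) \<odot>\<^bsub>?Q\<^esub> ?c (e i)" using c i by (simp add: e_idem)
      also have "\<dots> = ?c (s (d / c) \<otimes> e i)" using q(4)[of "s (d / c)" "e i"] ei by (simp add: sei)
      finally have "?c (e i \<otimes> b \<otimes> e i) = ?c (s (d / c) \<otimes> e i)" using d by simp
      then show ?thesis using eqP cm[OF eb] cm[OF ei] i by (auto simp: sei)
    qed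
    then show "schur r i" unfolding schur_def using einot by blast
  next
    assume sch: "schur r i"
    show ?L
    proof (intro bexI conjI ballI)
      show "e i \<in> eR i" "e i \<notin> ?U" using ei sch by (auto simp: schur_def)
      show "?c (e i \<otimes> e i) = ?c (e i)" using i by (simp add: e_idem)
      fix x assume x: "x \<in> eR i"
      then have xR: "x \<in> carrier R" "e i \<otimes> x = x" using eR_iff[OF i] by auto
      obtain c where "e i \<otimes> x \<otimes> e i \<ominus> s c \<otimes> e i \<in> ?U" using sch xR unfolding schur_def by blast
      then have "?c (x \<otimes> e i) = ?c (e i \<otimes> s c)" using eqP cm x ei i xR by (simp add: sei)
      then show "\<exists>c. ?c (x \<otimes> e i) = ?c (e i \<otimes> s c)" by blast
    qed
  qed
  finally show ?thesis .
qed

text \<open>Only the set \<open>J\<close> of labels of the factors is recorded, without order and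
  multiplicity. That suffices for quasi-heredity, which restricts the labels alone, and label sets
  are easily transported along maps of vertices.\<close>

inductive dfil :: "('v \<times> 'v) set \<Rightarrow> 'v set \<Rightarrow> 'r set \<Rightarrow> bool" for r where
  dfil_zero: "dfil r {} {\<zero>}"
| dfil_step: "dfil r J U \<Longrightarrow> reg.subm W \<Longrightarrow> U \<subseteq> W \<Longrightarrow> j \<in> V \<Longrightarrow> reg.gens U W j (ker r j) \<Longrightarrow>
    dfil r (insert j J) W"

lemma dfil_subm: "dfil r J W \<Longrightarrow> reg.subm W"
  by (cases rule: dfil.cases) (use reg.zero_subm in auto)

lemma dfil_iff_filtration:
  assumes i: "i \<in> V" and W: "reg.subm W"
  shows "(\<exists>F. filtration R (restrict_mod reg W) F \<and> (\<forall>l. Suc l < length F \<longrightarrow>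
      (\<exists>j\<in>V. P j \<and> mod_iso R (subquot (restrict_mod reg W) F l) (stdm r j)))) \<longleftrightarrow>
    (\<exists>J. dfil r J W \<and> (\<forall>j\<in>J. j \<in> V \<and> P j))"
proof
  let ?K = "restrict_mod reg W"
  have sq: "mod_iso R (subquot ?K F l) (stdm r j) \<longleftrightarrow> reg.gens (F ! l) (F ! Suc l) j (ker r j)"
    if "reg.subm (F ! l)" "reg.subm (F ! Suc l)" "F ! l \<subseteq> F ! Suc l" "j \<in> V" for F l j
    unfolding subquot_def stdm_def restrict_simps
    by (rule reg.mod_iso_sq_iff[OF that(2,1,3,4) ker_pmod[OF that(4)]])
  {
    assume "\<exists>F. filtration R ?K F \<and> (\<forall>l. Suc l < length F \<longrightarrow>
      (\<exists>j\<in>V. P j \<and> mod_iso R (subquot ?K F l) (stdm r j)))"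
    then obtain F where F: "filtration R ?K F"
      and st: "\<And>l. Suc l < length F \<Longrightarrow> \<exists>j\<in>V. P j \<and> mod_iso R (subquot ?K F l) (stdm r j)" by blast
    have F': "F \<noteq> []" "hd F = {\<zero>}" "last F = W" and Fs: "\<And>U. U \<in> set F \<Longrightarrow> reg.subm U"
      and Fi: "\<And>l. Suc l < length F \<Longrightarrow> F ! l \<subseteq> F ! Suc l"
      using F reg.restrict_subm[OF W] unfolding filtration_def by auto
    have "\<exists>J. dfil r J (F ! n) \<and> (\<forall>j\<in>J. j \<in> V \<and> P j)" if "n < length F" for n
      using that
    proof (induction n)
      case 0
      then show ?case using F' dfil_zero by (auto simp: hd_conv_nth)
    next
      case (Suc n)
      then obtain J where J: "dfil r J (F ! n)" "\<forall>j\<in>J. j \<in> V \<and> P j" by auto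
      obtain j where j: "j \<in> V" "P j" "mod_iso R (subquot ?K F n) (stdm r j)" using st[OF Suc.prems] by blast
      have "reg.subm (F ! Suc n)" using Fs[OF nth_mem[OF Suc.prems]] .
      then have "dfil r (insert j J) (F ! Suc n)"
        using dfil_step[OF J(1) _ Fi[OF Suc.prems] j(1)] sq[OF dfil_subm[OF J(1)] _ Fi[OF Suc.prems] j(1)] j(3)
        by blast
      then show ?case using J j by blast
    qed
    from this[of "length F - 1"] show "\<exists>J. dfil r J W \<and> (\<forall>j\<in>J. j \<in> V \<and> P j)"
      using F' by (simp add: last_conv_nth)
  }
  {
    assume "\<exists>J. dfil r J W \<and> (\<forall>j\<in>J. j \<in> V \<and> P j)"
    then obtain J where J: "dfil r J W" "\<forall>j\<in>J. j \<in> V \<and> P j" by blast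
    then have "\<exists>F. F \<noteq> [] \<and> hd F = {\<zero>} \<and> last F = W \<and> (\<forall>U\<in>set F. reg.subm U \<and> U \<subseteq> W) \<and>
      (\<forall>l. Suc l < length F \<longrightarrow> F ! l \<subseteq> F ! Suc l \<and>
        (\<exists>j\<in>V. P j \<and> reg.gens (F ! l) (F ! Suc l) j (ker r j)))"
    proof (induction rule: dfil.induct)
      case dfil_zero
      show ?case by (intro exI[of _ "[{\<zero>}]"]) (use reg.zero_subm in simp)
    next
      case (dfil_step J U W j)
      then obtain F where F: "F \<noteq> []" "hd F = {\<zero>}" "last F = U" "\<forall>Y\<in>set F. reg.subm Y \<and> Y \<subseteq> U"
        "\<forall>l. Suc l < length F \<longrightarrow> F ! l \<subseteq> F ! Suc l \<and>
          (\<exists>j\<in>V. P j \<and> reg.gens (F ! l) (F ! Suc l) j (ker r j))" by auto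
      have "(F @ [W]) ! l \<subseteq> (F @ [W]) ! Suc l \<and>
          (\<exists>j\<in>V. P j \<and> reg.gens ((F @ [W]) ! l) ((F @ [W]) ! Suc l) j (ker r j))"
        if l: "Suc l < length (F @ [W])" for l
      proof (cases "Suc l < length F")
        case True
        then show ?thesis using F(5) by (simp add: nth_append)
      next
        case False
        then have l: "Suc l = length F" using l by simp
        then have "l = length F - 1" by simp
        then have "F ! l = U" using F(1,3) by (simp add: last_conv_nth)
        then have "(F @ [W]) ! l = U" "(F @ [W]) ! Suc l = W" using l by (simp_all add: nth_append)
        then show ?thesis using dfil_step.hyps dfil_step.prems by auto
      qed
      moreover have "\<forall>Y\<in>set (F @ [W]). reg.subm Y \<and> Y \<subseteq> W" using F(4) dfil_step.hyps by auto
      ultimately show ?case using F(1,2) by (intro exI[of _ "F @ [W]"]) simp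
    qed
    then obtain F where F: "F \<noteq> []" "hd F = {\<zero>}" "last F = W" "\<forall>U\<in>set F. reg.subm U \<and> U \<subseteq> W"
      and stF: "\<forall>l. Suc l < length F \<longrightarrow> F ! l \<subseteq> F ! Suc l \<and>
        (\<exists>j\<in>V. P j \<and> reg.gens (F ! l) (F ! Suc l) j (ker r j))" by (elim exE conjE)
    have st: "F ! l \<subseteq> F ! Suc l" "\<exists>j\<in>V. P j \<and> reg.gens (F ! l) (F ! Suc l) j (ker r j)"
      if "Suc l < length F" for l using stF that by auto
    have "filtration R ?K F"
      unfolding filtration_def using F st(1) reg.restrict_subm[OF W] by simp
    moreover have "\<exists>j\<in>V. P j \<and> mod_iso R (subquot ?K F l) (stdm r j)" if l: "Suc l < length F" for l
    proof -
      have "reg.subm (F ! l)" "reg.subm (F ! Suc l)" using F(4) l by auto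
      then show ?thesis using sq[of F l] st[OF l] by blast
    qed
    ultimately show "\<exists>F. filtration R ?K F \<and> (\<forall>l. Suc l < length F \<longrightarrow>
      (\<exists>j\<in>V. P j \<and> mod_iso R (subquot ?K F l) (stdm r j)))" by blast
  }
qed

definition qh :: "('v \<times> 'v) set \<Rightarrow> bool" where
  "qh r \<longleftrightarrow> partial_order_on V r \<and>
    (\<forall>i\<in>V. schur r i \<and> (\<exists>J. dfil r J (ker r i) \<and> (\<forall>j\<in>J. j \<in> V \<and> (i, j) \<in> r - Id)))"

lemma qhD:
  assumes "qh r"
  shows "partial_order_on V r" "i \<in> V \<Longrightarrow> schur r i"
    "i \<in> V \<Longrightarrow> \<exists>J. dfil r J (ker r i) \<and> (\<forall>j\<in>J. j \<in> V \<and> (i, j) \<in> r - Id)"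
    "i \<in> V \<Longrightarrow> (i, i) \<in> r" "(i, j) \<in> r \<Longrightarrow> (j, l) \<in> r \<Longrightarrow> (i, l) \<in> r"
    "(i, j) \<in> r \<Longrightarrow> (j, i) \<in> r \<Longrightarrow> i = j" "r \<subseteq> V \<times> V"
proof -
  show po: "partial_order_on V r" and "i \<in> V \<Longrightarrow> schur r i"
    "i \<in> V \<Longrightarrow> \<exists>J. dfil r J (ker r i) \<and> (\<forall>j\<in>J. j \<in> V \<and> (i, j) \<in> r - Id)"
    using assms unfolding qh_def by blast+
  show "i \<in> V \<Longrightarrow> (i, i) \<in> r" using partial_order_onD(1)[OF po] by (simp add: refl_on_def)
  show "(i, j) \<in> r \<Longrightarrow> (j, l) \<in> r \<Longrightarrow> (i, l) \<in> r" using partial_order_onD(2)[OF po] by (rule transD)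
  show "(i, j) \<in> r \<Longrightarrow> (j, i) \<in> r \<Longrightarrow> i = j" using partial_order_onD(3)[OF po] by (rule antisymD)
  show "r \<subseteq> V \<times> V" using partial_order_onD(4)[OF po] .
qed

section \<open>Arrows and the labels of filtrations\<close>

lemma off_diag_N:
  assumes "i \<in> V" "q \<in> V" "i \<noteq> q" "a \<in> carrier R"
  shows "e i \<otimes> a \<otimes> e q \<in> N 1"
proof -
  obtain c n where n: "n \<in> N 1" "e i \<otimes> a = s c \<otimes> e i \<oplus> n" using e_local assms by blast
  have nR: "n \<in> carrier R" using n reg.N_closed by blast
  have "e i \<otimes> a \<otimes> e q = n \<otimes> e q"
    using assms nR unfolding n(2) by (simp add: l_distr m_assoc e_orth)
  then show ?thesis using reg.N_r[OF n(1)] assms by simp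
qed

lemma ker_N:
  assumes i: "i \<in> V" and ii: "(i, i) \<in> r"
  shows "ker r i \<subseteq> N 1"
  unfolding ker_def
proof (rule trace_least[OF N_subm])
  fix x q assume x: "x \<in> eR i" and q: "q \<in> V" "(q, i) \<notin> r"
  then have "i \<noteq> q" using ii by blast
  moreover have "x \<in> carrier R" "e i \<otimes> x = x" using x eR_iff[OF i] by auto
  ultimately show "x \<otimes> e q \<in> N 1" using off_diag_N[OF i q(1)] by metis
qed

lemma N1_mult: "a \<in> N 1 \<Longrightarrow> b \<in> N 1 \<Longrightarrow> a \<otimes> b \<in> N 2"
  using N_mult[of a 1 b 1] by (simp add: numeral_2_eq_2)

lemma left_detect:
  assumes G: "\<zero> \<in> G" "\<And>x y. x \<in> G \<Longrightarrow> y \<in> G \<Longrightarrow> x \<oplus> y \<in> G" and y: "y \<in> carrier R"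
    and ex: "\<And>q. q \<in> V \<Longrightarrow> e q \<otimes> y \<in> G"
  shows "y \<in> G"
proof -
  have "finsum R e T \<in> carrier R \<and> finsum R e T \<otimes> y \<in> G" if "finite T" "T \<subseteq> V" for T
    using that
  proof (induction T rule: finite_induct)
    case empty
    then show ?case using y G by simp
  next
    case (insert j T)
    then have j: "j \<in> V" and T: "T \<subseteq> V" by auto
    have "finsum R e (insert j T) = e j \<oplus> finsum R e T"
      using insert.hyps T by (intro finsum_insert) (auto simp: j)
    moreover have "finsum R e T \<in> carrier R" "finsum R e T \<otimes> y \<in> G" using insert.IH T by auto
    ultimately show ?case using y j ex[OF j] G by (simp add: l_distr)
  qed
  then have "finsum R e V \<otimes> y \<in> G" using fin_V by blast
  then show ?thesis using y by (simp add: e_sum)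
qed

text \<open>The generators x e_q of the kernel have q different from \<open>i\<close> and
  \<open>j\<close>, so they lie in the radical and are killed by \<open>e j\<close>. They are
  therefore contained in the right ideal \<open>?S\<close> of radical elements whose part at
  \<open>j\<close> is in the square of the radical, and \<alpha> is not.\<close>

lemma arrow_notin_ker:
  assumes X: "(i, \<alpha>, j) \<in> X" and ii: "(i, i) \<in> r" and ji: "(j, i) \<in> r"
  shows "\<alpha> \<notin> ker r i"
proof
  have a: "i \<in> V" "j \<in> V" "\<alpha> \<notin> N 2" "\<alpha> \<otimes> e j = \<alpha>" using arrow[OF X] by auto
  let ?S = "{f \<in> N 1. f \<otimes> e j \<in> N 2}"
  have "ker r i \<subseteq> ?S"
    unfolding ker_def
  proof (rule trace_least)
    show "reg.subm ?S"
      unfolding reg.subm_iff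
    proof (intro conjI ballI)
      show "?S \<subseteq> carrier reg" using reg.N_closed by auto
      show "\<zero>\<^bsub>reg\<^esub> \<in> ?S" using reg.submD(2)[OF N_subm] a by simp
      show "x \<oplus>\<^bsub>reg\<^esub> y \<in> ?S" if xy: "x \<in> ?S" "y \<in> ?S" for x y
      proof -
        have R: "x \<in> carrier R" "y \<in> carrier R" using xy reg.N_closed by auto
        have "x \<oplus> y \<in> N 1" using reg.submD(4)[OF N_subm, of x 1 y] xy by simp
        moreover have "x \<otimes> e j \<oplus> y \<otimes> e j \<in> N 2" using reg.submD(4)[OF N_subm, of "x \<otimes> e j" 2 "y \<otimes> e j"] xy by simp
        ultimately show ?thesis using R a by (simp add: l_distr)
      qed
      fix b f assume b: "b \<in> carrier R" and f: "f \<in> ?S"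
      have fR: "f \<in> carrier R" using f reg.N_closed by blast
      \<comment> \<open>The identity, as the sum of the \<open>e q\<close>, is inserted between
        \<open>f\<close> and \<open>b\<close>. For q = j the factor f e_j is in the square of the
        radical; for the other q both f and e_q b e_j are in the radical.\<close>
      have "b \<otimes> e j \<in> {y \<in> carrier R. f \<otimes> y \<in> N 2}"
      proof (rule left_detect)
        show "\<zero> \<in> {y \<in> carrier R. f \<otimes> y \<in> N 2}" using fR reg.submD(2)[OF N_subm] by simp
        show "x \<oplus> y \<in> {y \<in> carrier R. f \<otimes> y \<in> N 2}"
          if xy: "x \<in> {y \<in> carrier R. f \<otimes> y \<in> N 2}" "y \<in> {y \<in> carrier R. f \<otimes> y \<in> N 2}" for x y
          using xy fR reg.submD(4)[OF N_subm, of "f \<otimes> x" 2 "f \<otimes> y"] by (simp add: r_distr)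
        show "b \<otimes> e j \<in> carrier R" using a b by simp
        fix q assume q: "q \<in> V"
        have "f \<otimes> (e q \<otimes> (b \<otimes> e j)) \<in> N 2"
        proof (cases "q = j")
          case True
          have "f \<otimes> e j \<otimes> (b \<otimes> e j) \<in> N 2" using f a b reg.N_r[of "f \<otimes> e j" 2 "b \<otimes> e j"] by simp
          moreover have "f \<otimes> e j \<otimes> (b \<otimes> e j) = f \<otimes> (e j \<otimes> (b \<otimes> e j))" using fR a b by (intro m_assoc) simp_all
          ultimately show ?thesis using True by simp
        next
          case False
          then have "e q \<otimes> b \<otimes> e j \<in> N 1" using off_diag_N q a b by blast
          then have "f \<otimes> (e q \<otimes> b \<otimes> e j) \<in> N 2" using f N1_mult by blast
          then show ?thesis using q a b by (simp add: m_assoc)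
        qed
        then show "e q \<otimes> (b \<otimes> e j) \<in> {y \<in> carrier R. f \<otimes> y \<in> N 2}" using q a b by simp
      qed
      then have "f \<otimes> b \<otimes> e j \<in> N 2" using fR b a by (simp add: m_assoc)
      then show "b \<odot>\<^bsub>reg\<^esub> f \<in> ?S" using reg.N_r f b by simp
    qed
    fix x q assume x: "x \<in> eR i" and q: "q \<in> V" "(q, i) \<notin> r"
    then have "i \<noteq> q" "q \<noteq> j" using ii ji by auto
    have xR: "x \<in> carrier R" "e i \<otimes> x = x" using x eR_iff[OF a(1)] by auto
    have "x \<otimes> e q \<in> N 1" using off_diag_N[OF a(1) q(1) \<open>i \<noteq> q\<close> xR(1)] xR(2) by simp
    moreover have "x \<otimes> e q \<otimes> e j = \<zero>" using xR q a \<open>q \<noteq> j\<close> by (simp add: m_assoc e_orth)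
    ultimately show "x \<otimes> e q \<in> ?S" using reg.submD(2)[OF N_subm, of 2] by simp
  qed
  moreover assume "\<alpha> \<in> ker r i"
  ultimately show False using a by auto
qed

text \<open>An arrow out of \<open>i\<close> lying in the kernel of \<open>P(i) \<rightarrow> \<Delta>(i)\<close> is not in the square of the radical,
  so it must be visible in the top of some filtration step.\<close>

lemma arrow_label:
  assumes X: "(i, \<alpha>, j) \<in> X" and ii: "(i, i) \<in> r" and ji: "(j, i) \<notin> r" and d: "dfil r J (ker r i)"
  shows "j \<in> J"
proof (rule ccontr)
  assume nj: "j \<notin> J"
  have a: "i \<in> V" "j \<in> V" "\<alpha> \<in> N 1" "\<alpha> \<notin> N 2" "e i \<otimes> \<alpha> = \<alpha>" "\<alpha> \<otimes> e j = \<alpha>" using arrow[OF X] by auto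
  have aR: "\<alpha> \<in> carrier R" using reg.N_closed a by blast
  \<comment> \<open>If \<open>j\<close> is no label, each step is generated by some t = t e_q with q
    different from \<open>j\<close>, so the multiples of \<open>t\<close> that end in
    \<open>j\<close> are products of two radical elements.\<close>
  have "f \<otimes> e j \<in> N 2" if "dfil r J W" "j \<notin> J" "W \<subseteq> N 1" "f \<in> W" for J W f
    using that
  proof (induction arbitrary: f rule: dfil.induct)
    case dfil_zero
    then show ?case using a reg.submD(2)[OF N_subm] by simp
  next
    case (dfil_step J U W q)
    obtain t where t: "t \<in> W" "t \<otimes> e q = t" "W = reg.gen U t" using dfil_step.hyps unfolding reg.gens_def by auto
    then obtain u b where u: "f = u \<oplus> t \<otimes> b" "u \<in> U" "b \<in> carrier R"
      using dfil_step.prems(3) unfolding reg.gen_def by auto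
    have qj: "q \<noteq> j" "j \<notin> J" using dfil_step.prems by auto
    have N: "t \<in> N 1" "u \<in> N 1" "t \<in> carrier R" "u \<in> carrier R"
      using t u dfil_step.prems(2) dfil_step.hyps(3) reg.N_closed by auto
    have "u \<otimes> e j \<in> N 2" using dfil_step.IH[OF qj(2) _ u(2)] dfil_step.prems(2) dfil_step.hyps(3) by blast
    moreover have "t \<otimes> (b \<otimes> e j) \<in> N 2"
    proof -
      have "t \<otimes> (e q \<otimes> b \<otimes> e j) \<in> N 2"
        using N1_mult[OF N(1) off_diag_N[OF dfil_step.hyps(4) a(2) qj(1) u(3)]] .
      moreover have "t \<otimes> (e q \<otimes> b \<otimes> e j) = t \<otimes> e q \<otimes> (b \<otimes> e j)"
        using N u(3) a dfil_step.hyps(4) by (simp add: m_assoc)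
      ultimately show ?thesis using t(2) by simp
    qed
    moreover have "f \<otimes> e j = u \<otimes> e j \<oplus> t \<otimes> (b \<otimes> e j)"
      using u N a by (simp add: l_distr m_assoc)
    ultimately show ?case using reg.submD(4)[OF N_subm] by simp
  qed
  moreover have "\<alpha> \<in> ker r i" using ker_in[OF a(1,2) ji aR] a by simp
  ultimately show False using d nj ker_N[OF a(1) ii] a by metis
qed

text \<open>If \<open>j\<close> is not below \<open>i\<close>, the arrow lies in the kernel of P(i)
  \<rightarrow> \<Delta>(i); by \<open>arrow_label\<close> its target is then the label of a
  filtration step, hence above \<open>i\<close>.\<close>

lemma arrow_comparable:
  assumes r: "qh r" and X: "(i, \<alpha>, j) \<in> X" and ji: "(j, i) \<notin> r"
  shows "(i, j) \<in> r"
proof -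
  have i: "i \<in> V" using arrow[OF X] by simp
  obtain J where "dfil r J (ker r i)" "\<forall>j\<in>J. j \<in> V \<and> (i, j) \<in> r - Id" using qhD(3)[OF r i] by blast
  then show ?thesis using arrow_label[OF X qhD(4)[OF r i] ji] by blast
qed

text \<open>Every step is generated by some t = t e_q with \<open>P q\<close>.\<close>

lemma dfil_trace_self:
  assumes "dfil r J W" "\<forall>p\<in>J. p \<in> V \<and> P p"
  shows "W \<subseteq> trace P W"
  using assms
proof (induction rule: dfil.induct)
  case dfil_zero
  then show ?case using reg.submD(2)[OF trace_subm[of "{\<zero>}"]] by simp
next
  case (dfil_step J U W q)
  have W: "reg.subm W" by fact
  then have sW: "reg.subm (trace P W)" using reg.submD(1)[OF W] by (intro trace_subm) simp
  obtain t where t: "t \<in> W" "t \<otimes> e q = t" "W = reg.gen U t" using dfil_step.hyps unfolding reg.gens_def by auto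
  have "t \<in> trace P W" using trace_in[of t W q P] t dfil_step.prems by simp
  moreover have "U \<subseteq> trace P W" using dfil_step trace_mono[of U W P] by auto
  ultimately show ?case using reg.gen_subset[OF sW] t(3) by metis
qed

text \<open>The hypothesis \<open>up\<close> says that \<open>P\<close> is an upper set, so that the filtration steps with label outside
  \<open>P\<close> do not contribute to the trace.\<close>

lemma trace_step:
  assumes d: "reg.subm U" "reg.subm W" "U \<subseteq> W" "q \<in> V" and t: "t \<in> W" "t \<otimes> e q = t" "W = reg.gen U t"
    and tU: "\<And>a. a \<in> carrier R \<Longrightarrow> t \<otimes> a \<in> U \<longleftrightarrow> e q \<otimes> a \<in> ker r q"
    and up: "\<And>x. x \<in> V \<Longrightarrow> P x \<Longrightarrow> (x, q) \<in> r \<Longrightarrow> P q"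
    and self: "P q \<Longrightarrow> ker r q \<subseteq> trace P (ker r q)"
  shows "\<not> P q \<Longrightarrow> trace P W \<subseteq> trace P U" "U \<inter> trace P W \<subseteq> trace P U"
proof -
  have UR: "U \<subseteq> carrier R" and tR: "t \<in> carrier R" using reg.submD(1)[OF d(1)] reg.submD(3)[OF d(2) t(1)] by auto
  have sU: "reg.subm (trace P U)" by (rule trace_subm[OF UR])
  have rep: "\<exists>u\<in>U. \<exists>a\<in>carrier R. f = u \<oplus> t \<otimes> a" if "f \<in> W" for f
    using that unfolding t(3) reg.gen_def by auto
  show 1: "trace P W \<subseteq> trace P U" if nP: "\<not> P q"
  proof (rule trace_least[OF sU])
    fix f x assume f: "f \<in> W" and x: "x \<in> V" "P x"
    obtain u a where u: "f = u \<oplus> t \<otimes> a" "u \<in> U" "a \<in> carrier R" using rep[OF f] by blast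
    have uR: "u \<in> carrier R" using u UR by blast
    have "(x, q) \<notin> r" using up x nP by blast
    then have "e q \<otimes> (a \<otimes> e x) \<in> ker r q" using ker_in[OF d(4) x(1) _ u(3)] u x d(4) by (simp add: m_assoc)
    then have "t \<otimes> (a \<otimes> e x) \<in> U" using tU u x by simp
    moreover have "u \<otimes> e x \<in> U" using reg.submD(5)[OF d(1) _ u(2)] x by simp
    moreover have "f \<otimes> e x = u \<otimes> e x \<oplus> t \<otimes> (a \<otimes> e x)" using u uR tR x by (simp add: l_distr m_assoc)
    ultimately have "f \<otimes> e x \<in> U" using reg.submD(4)[OF d(1)] by simp
    then have "f \<otimes> e x \<otimes> e x \<in> trace P U" using trace_in x by blast
    moreover have "f \<in> carrier R" using u uR tR by simp
    ultimately show "f \<otimes> e x \<in> trace P U" using x by (simp add: m_assoc e_idem)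
  qed
  show "U \<inter> trace P W \<subseteq> trace P U"
  proof (cases "P q")
    case False
    then show ?thesis using 1 by blast
  next
    case True
    have sg: "reg.subm (reg.gen (trace P U) t)" using reg.gen_subm(1)[OF sU] tR by simp
    \<comment> \<open>The new step contributes multiples of \<open>t\<close> only. So an element of
      the trace that lies in \<open>U\<close> is an element of the trace of \<open>U\<close> plus
      some multiple of \<open>t\<close> in \<open>U\<close>, and the latter has to be
      absorbed.\<close>
    have "trace P W \<subseteq> reg.gen (trace P U) t"
    proof (rule trace_least[OF sg])
      fix f x assume f: "f \<in> W" and x: "x \<in> V" "P x"
      obtain u a where u: "f = u \<oplus> t \<otimes> a" "u \<in> U" "a \<in> carrier R" using rep[OF f] by blast
      have uR: "u \<in> carrier R" using u UR by blast
      have "f \<otimes> e x = u \<otimes> e x \<oplus> t \<otimes> (a \<otimes> e x)" using u uR tR x by (simp add: l_distr m_assoc)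
      moreover have "u \<otimes> e x \<in> trace P U" using trace_in u x by blast
      moreover have "a \<otimes> e x \<in> carrier R" using u x by simp
      ultimately show "f \<otimes> e x \<in> reg.gen (trace P U) t" unfolding reg.gen_def by auto
    qed
    moreover have "u \<in> trace P U" if u: "u \<in> U" "u \<in> reg.gen (trace P U) t" for u
    proof -
      obtain u' a where u': "u = u' \<oplus> t \<otimes> a" "u' \<in> trace P U" "a \<in> carrier R"
        using u(2) unfolding reg.gen_def by auto
      have u'U: "u' \<in> U" using u' trace_sub[OF d(1)] by blast
      have "u \<ominus> u' = t \<otimes> a"
        using reg.minus_add_cancel(2)[of "t \<otimes> a" u'] u' u'U UR tR by (auto simp: a_comm)
      then have "t \<otimes> a \<in> U" using reg.submD(7)[OF d(1) u(1) u'U] by simp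
      then have "e q \<otimes> a \<in> ker r q" using tU u' by simp
      then have ea: "e q \<otimes> a \<in> trace P (ker r q)" using self[OF True] by blast
      \<comment> \<open>A multiple t a lies in \<open>U\<close> only if e_q a is in the kernel for
        \<open>q\<close>, which by \<open>self\<close> equals its own trace. Multiplication by
        \<open>t\<close> carries that trace into the trace of \<open>U\<close>, because the right
        ideal \<open>?T\<close> contains its generators.\<close>
      let ?T = "{b \<in> carrier R. t \<otimes> b \<in> trace P U}"
      have "trace P (ker r q) \<subseteq> ?T"
      proof (rule trace_least)
        show "reg.subm ?T"
          unfolding reg.subm_iff
        proof (intro conjI ballI)
          show "\<zero>\<^bsub>reg\<^esub> \<in> ?T" using reg.submD(2)[OF sU] tR by simp
          show "x \<oplus>\<^bsub>reg\<^esub> y \<in> ?T" if "x \<in> ?T" "y \<in> ?T" for x y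
            using that reg.submD(4)[OF sU, of "t \<otimes> x" "t \<otimes> y"] tR by (simp add: r_distr)
          show "b \<odot>\<^bsub>reg\<^esub> x \<in> ?T" if "b \<in> carrier R" "x \<in> ?T" for b x
            using that reg.submD(5)[OF sU, of b "t \<otimes> x"] tR by (simp add: m_assoc)
        qed auto
        fix k x assume k: "k \<in> ker r q" and x: "x \<in> V" "P x"
        have kR: "k \<in> carrier R" "e q \<otimes> k = k" using k ker_sub[OF d(4)] eR_iff[OF d(4)] by auto
        have "t \<otimes> k \<in> U" using tU[OF kR(1)] kR k by simp
        then have "t \<otimes> k \<otimes> e x \<in> trace P U" using trace_in x by blast
        then show "k \<otimes> e x \<in> ?T" using kR tR x by (simp add: m_assoc)
      qed
      then have "t \<otimes> (e q \<otimes> a) \<in> trace P U" using ea by blast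
      then have "t \<otimes> a \<in> trace P U" using t(2) tR u'(3) d(4) by (simp add: m_assoc[symmetric])
      then show ?thesis using u'(1,2) reg.submD(4)[OF sU] by simp
    qed
    ultimately show ?thesis by blast
  qed
qed

text \<open>If all arrows into \<open>v\<close> start at larger vertices, then the largest
  submodule of \<open>I(v)\<close> with composition factors below \<open>v\<close> is \<open>S(v)\<close>, and by reciprocity \<open>\<Delta>(v)\<close> occurs
  in no \<open>P(i)\<close> with \<open>i \<noteq> v\<close>.  Reciprocity is replaced by an argument with traces.\<close>

lemma no_label:
  assumes r: "qh r" and v: "v \<in> V" and arr: "\<And>x \<alpha>. (x, \<alpha>, v) \<in> X \<Longrightarrow> (x, v) \<notin> r"
    and i: "i \<in> V" and d: "dfil r J (ker r i)" and J: "\<forall>j\<in>J. j \<in> V \<and> (i, j) \<in> r - Id"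
  shows "v \<notin> J"
proof
  assume vJ: "v \<in> J"
  then have iv: "(i, v) \<in> r" "i \<noteq> v" using J by auto
  \<comment> \<open>The vertices strictly above \<open>v\<close>. Since \<open>v\<close> itself is
    excluded, a step with label \<open>v\<close> adds nothing to the trace.\<close>
  let ?P = "\<lambda>x. (v, x) \<in> r \<and> x \<noteq> v"
  have up: "?P q" if "?P x" "(x, q) \<in> r" for x q
    using that qhD(5,6)[OF r] by metis
  have self: "ker r q \<subseteq> trace ?P (ker r q)" if "q \<in> V" "?P q" for q
  proof -
    obtain K where K: "dfil r K (ker r q)" "\<forall>j\<in>K. j \<in> V \<and> (q, j) \<in> r - Id" using qhD(3)[OF r \<open>q \<in> V\<close>] by blast
    then have "\<forall>p\<in>K. p \<in> V \<and> ?P p" using up[OF that(2)] by blast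
    then show ?thesis using dfil_trace_self[OF K(1), of ?P] by blast
  qed
  \<comment> \<open>The invariant says that all elements ending in \<open>v\<close> are generated
    from vertices strictly above \<open>v\<close>. It descends along the filtration by
    \<open>trace_step\<close>, and a step with label \<open>v\<close> would have its generator in
    the trace of the smaller module, so that \<Delta>(v) would vanish.\<close>
  have main: "v \<notin> J" if "dfil r J W" "\<forall>f\<in>W. f \<otimes> e v \<in> trace ?P W" for J W
    using that
  proof (induction rule: dfil.induct)
    case dfil_zero
    then show ?case by simp
  next
    case (dfil_step J U W q)
    obtain t where t: "t \<in> W" "t \<otimes> e q = t" "W = reg.gen U t"
      and tU: "\<And>a. a \<in> carrier R \<Longrightarrow> t \<otimes> a \<in> U \<longleftrightarrow> e q \<otimes> a \<in> ker r q"
      using dfil_step.hyps(5) unfolding reg.gens_def by auto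
    have sU: "reg.subm U" by (rule dfil_subm) fact
    have q: "q \<in> V" by fact
    note st = trace_step[of U W q t r ?P, OF sU dfil_step.hyps(2,3) q t tU]
    have "f \<otimes> e v \<in> trace ?P U" if f: "f \<in> U" for f
    proof -
      have "f \<otimes> e v \<in> U" using reg.submD(5)[OF sU _ f] v by simp
      moreover have "f \<otimes> e v \<in> trace ?P W" using dfil_step.prems f dfil_step.hyps(3) by blast
      ultimately show ?thesis using st(2) up self[OF q] by blast
    qed
    then have "v \<notin> J" using dfil_step.IH by blast
    moreover have "q \<noteq> v"
    proof
      assume qv: "q = v"
      then have "t \<in> trace ?P W" using dfil_step.prems t by metis
      then have "t \<in> trace ?P U" using st(1) up qv by blast
      then have "t \<in> U" using trace_sub[OF sU] by blast
      moreover have "t \<in> carrier R" using calculation reg.submD(3)[OF sU] by simp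
      ultimately have "e v \<in> ker r v" using tU[of \<one>] qv v by simp
      then show False using qhD(2)[OF r v] by (simp add: schur_def)
    qed
    ultimately show ?case by simp
  qed
  \<comment> \<open>The invariant holds for the kernel: a radical element ending in \<open>v\<close>
    is a sum of products with arrows x \<rightarrow> v in last place. All such x are strictly above
    \<open>v\<close>, hence not below \<open>i\<close>, so the factor in front of the arrow already
    lies in the kernel.\<close>
  have "f \<otimes> e v \<in> trace ?P (ker r i)" if f: "f \<in> ker r i" for f
  proof -
    let ?T = "trace ?P (ker r i)" and ?G = "{y \<in> carrier R. e i \<otimes> y \<in> trace ?P (ker r i)}"
    have kR: "ker r i \<subseteq> carrier R" using ker_sub[OF i] eR_sub[OF i] by blast
    have sT: "reg.subm ?T" by (rule trace_subm[OF kR])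
    have fi: "f \<in> carrier R" "e i \<otimes> f = f" "f \<in> N 1"
      using f ker_sub[OF i] eR_iff[OF i] ker_N[OF i qhD(4)[OF r i]] by auto
    have "f \<otimes> e v \<in> ?G"
    proof (rule N_right[OF fi(3) v])
      show "subgroup ?G (add_monoid R)"
      proof (intro subgroup.intro)
        show "x \<otimes>\<^bsub>add_monoid R\<^esub> y \<in> ?G" if "x \<in> ?G" "y \<in> ?G" for x y
          using that reg.submD(4)[OF sT, of "e i \<otimes> x" "e i \<otimes> y"] i by (simp add: r_distr)
        show "\<one>\<^bsub>add_monoid R\<^esub> \<in> ?G" using reg.submD(2)[OF sT] i by simp
        show "inv\<^bsub>add_monoid R\<^esub> x \<in> ?G" if "x \<in> ?G" for x
          using that reg.submD(6)[OF sT, of "e i \<otimes> x"] i by (simp add: a_inv_def[of R, symmetric] r_minus)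
      qed auto
      fix x \<alpha> a assume X: "(x, \<alpha>, v) \<in> X" and a: "a \<in> carrier R"
      have x: "x \<in> V" "\<alpha> \<in> carrier R" "e x \<otimes> \<alpha> = \<alpha>" using arrow[OF X] reg.N_closed by auto
      have vx: "?P x" using arr[OF X] arrow_comparable[OF r X] qhD(4)[OF r v] by (cases "(v, x) \<in> r") auto
      have "(x, i) \<notin> r" using vx iv qhD(5,6)[OF r] by metis
      then have k: "e i \<otimes> a \<otimes> e x \<in> ker r i" using ker_in[OF i x(1) _ a] by blast
      then have "e i \<otimes> a \<otimes> e x \<otimes> e x \<in> ?T" using trace_in[of _ "ker r i" x ?P] x vx by blast
      then have "e i \<otimes> a \<otimes> e x \<otimes> e x \<otimes> \<alpha> \<in> ?T" using reg.submD(5)[OF sT x(2)] by simp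
      then have "e i \<otimes> (a \<otimes> \<alpha>) \<in> ?T" using x i a by (simp add: m_assoc)
      then show "a \<otimes> \<alpha> \<in> ?G" using a x by simp
    qed
    then have "e i \<otimes> (f \<otimes> e v) \<in> ?T" by simp
    then show ?thesis using fi v i by (simp add: m_assoc[symmetric])
  qed
  then show False using main[OF d] vJ by blast
qed

end

section \<open>Costandard modules and minimal adapted orders\<close>

context basic_algebra
begin

definition lP :: "'v \<Rightarrow> 'r set" where
  "lP i = {a \<otimes> e i | a. a \<in> carrier R}"

text \<open>The dual of the left module R e_i, with all fields as in \<open>inj_mod\<close>, so that
  the two records agree for bound quiver algebras.\<close>

definition imod :: "'v \<Rightarrow> ('r, 'r \<Rightarrow> 'k) module" where
  "imod i = \<lparr>carrier = {\<phi> \<in> extensional (lP i).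
       (\<forall>x\<in>lP i. \<forall>y\<in>lP i. \<phi> (x \<oplus> y) = \<phi> x + \<phi> y) \<and> (\<forall>c. \<forall>x\<in>lP i. \<phi> (s c \<otimes> x) = c * \<phi> x)},
     mult = undefined, one = undefined,
     zero = (\<lambda>x\<in>lP i. 0), add = (\<lambda>\<phi> \<psi>. \<lambda>x\<in>lP i. \<phi> x + \<psi> x),
     smult = (\<lambda>a \<phi>. \<lambda>x\<in>lP i. \<phi> (a \<otimes> x))\<rparr>"

lemma lP_iff: "i \<in> V \<Longrightarrow> x \<in> lP i \<longleftrightarrow> x \<in> carrier R \<and> x \<otimes> e i = x"
  by (auto simp: lP_def m_assoc e_idem) metis

lemma lP_closed:
  assumes "i \<in> V"
  shows "x \<in> lP i \<Longrightarrow> x \<in> carrier R" "x \<in> lP i \<Longrightarrow> y \<in> lP i \<Longrightarrow> x \<oplus> y \<in> lP i"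
    "a \<in> carrier R \<Longrightarrow> x \<in> lP i \<Longrightarrow> a \<otimes> x \<in> lP i" "\<zero> \<in> lP i" "e i \<in> lP i"
    "a \<in> carrier R \<Longrightarrow> a \<otimes> e i \<in> lP i"
  using assms by (auto simp: lP_iff l_distr m_assoc e_idem)

lemma imod_carrierD:
  assumes "\<phi> \<in> carrier (imod i)"
  shows "x \<in> lP i \<Longrightarrow> y \<in> lP i \<Longrightarrow> \<phi> (x \<oplus> y) = \<phi> x + \<phi> y" "x \<in> lP i \<Longrightarrow> \<phi> (s c \<otimes> x) = c * \<phi> x"
    "\<phi> \<in> extensional (lP i)"
  using assms by (auto simp: imod_def)

lemma imod_carrierI:
  assumes "\<phi> \<in> extensional (lP i)" "\<And>x y. x \<in> lP i \<Longrightarrow> y \<in> lP i \<Longrightarrow> \<phi> (x \<oplus> y) = \<phi> x + \<phi> y"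
    "\<And>c x. x \<in> lP i \<Longrightarrow> \<phi> (s c \<otimes> x) = c * \<phi> x"
  shows "\<phi> \<in> carrier (imod i)"
  using assms by (auto simp: imod_def)

lemma imod_ops:
  "\<zero>\<^bsub>imod i\<^esub> = (\<lambda>x\<in>lP i. 0)" "\<phi> \<oplus>\<^bsub>imod i\<^esub> \<psi> = (\<lambda>x\<in>lP i. \<phi> x + \<psi> x)"
  "a \<odot>\<^bsub>imod i\<^esub> \<phi> = (\<lambda>x\<in>lP i. \<phi> (a \<otimes> x))"
  by (simp_all add: imod_def)

lemma imod_eqI:
  assumes "\<phi> \<in> extensional (lP i)" "\<psi> \<in> extensional (lP i)" "\<And>x. x \<in> lP i \<Longrightarrow> \<phi> x = \<psi> x"
  shows "\<phi> = \<psi>"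
  using assms by (rule extensionalityI)

lemma rmodule_imod:
  assumes i: "i \<in> V"
  shows "rmodule R V e s N X (imod i)"
proof -
  note cl = lP_closed[OF i]
  have sm: "a \<odot>\<^bsub>imod i\<^esub> \<phi> \<in> carrier (imod i)" if a: "a \<in> carrier R" and p: "\<phi> \<in> carrier (imod i)" for a \<phi>
  proof (rule imod_carrierI)
    show "a \<odot>\<^bsub>imod i\<^esub> \<phi> \<in> extensional (lP i)" by (simp add: imod_ops)
    fix x y assume x: "x \<in> lP i" and y: "y \<in> lP i"
    show "(a \<odot>\<^bsub>imod i\<^esub> \<phi>) (x \<oplus> y) = (a \<odot>\<^bsub>imod i\<^esub> \<phi>) x + (a \<odot>\<^bsub>imod i\<^esub> \<phi>) y"
      using x y a cl imod_carrierD(1)[OF p] by (simp add: imod_ops r_distr)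
  next
    fix c x assume x: "x \<in> lP i"
    have "a \<otimes> (s c \<otimes> x) = s c \<otimes> (a \<otimes> x)"
      using a cl(1)[OF x] m_assoc[of a "s c" x] m_assoc[of "s c" a x] s_comm[OF a, of c] by simp
    then show "(a \<odot>\<^bsub>imod i\<^esub> \<phi>) (s c \<otimes> x) = c * (a \<odot>\<^bsub>imod i\<^esub> \<phi>) x"
      using x a cl imod_carrierD(2)[OF p] by (simp add: imod_ops)
  qed
  have "abelian_group (imod i)"
  proof (rule abelian_groupI)
    fix \<phi> \<psi> assume p: "\<phi> \<in> carrier (imod i)" "\<psi> \<in> carrier (imod i)"
    show "\<phi> \<oplus>\<^bsub>imod i\<^esub> \<psi> \<in> carrier (imod i)"
      using imod_carrierD[OF p(1)] imod_carrierD[OF p(2)] cl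
      by (intro imod_carrierI) (auto simp: imod_ops algebra_simps)
    show "\<phi> \<oplus>\<^bsub>imod i\<^esub> \<psi> = \<psi> \<oplus>\<^bsub>imod i\<^esub> \<phi>" by (simp add: imod_ops add.commute)
  next
    show "\<zero>\<^bsub>imod i\<^esub> \<in> carrier (imod i)"
      using cl by (intro imod_carrierI) (auto simp: imod_ops)
  next
    fix \<phi> assume p: "\<phi> \<in> carrier (imod i)"
    show "\<zero>\<^bsub>imod i\<^esub> \<oplus>\<^bsub>imod i\<^esub> \<phi> = \<phi>"
      by (rule imod_eqI[OF _ imod_carrierD(3)[OF p]]) (simp_all add: imod_ops)
    have "(s (- 1) \<odot>\<^bsub>imod i\<^esub> \<phi>) \<oplus>\<^bsub>imod i\<^esub> \<phi> = \<zero>\<^bsub>imod i\<^esub>"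
      by (rule imod_eqI[where i = i]) (simp_all add: imod_ops imod_carrierD(2)[OF p])
    then show "\<exists>\<psi>\<in>carrier (imod i). \<psi> \<oplus>\<^bsub>imod i\<^esub> \<phi> = \<zero>\<^bsub>imod i\<^esub>" using sm[OF s_closed p] by blast
  next
    fix \<phi> \<psi> \<chi> assume "\<phi> \<in> carrier (imod i)" "\<psi> \<in> carrier (imod i)" "\<chi> \<in> carrier (imod i)"
    show "\<phi> \<oplus>\<^bsub>imod i\<^esub> \<psi> \<oplus>\<^bsub>imod i\<^esub> \<chi> = \<phi> \<oplus>\<^bsub>imod i\<^esub> (\<psi> \<oplus>\<^bsub>imod i\<^esub> \<chi>)"
      by (rule imod_eqI[where i = i]) (simp_all add: imod_ops add.assoc)
  qed
  then show ?thesis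
  proof (intro rmodule.intro basic_algebra_axioms rmodule_axioms.intro)
    show "a \<odot>\<^bsub>imod i\<^esub> \<phi> \<in> carrier (imod i)" if "a \<in> carrier R" "\<phi> \<in> carrier (imod i)" for a \<phi>
      using that by (rule sm)
    fix a b \<phi> assume a: "a \<in> carrier R" and b: "b \<in> carrier R" and p: "\<phi> \<in> carrier (imod i)"
    show "(a \<oplus> b) \<odot>\<^bsub>imod i\<^esub> \<phi> = a \<odot>\<^bsub>imod i\<^esub> \<phi> \<oplus>\<^bsub>imod i\<^esub> b \<odot>\<^bsub>imod i\<^esub> \<phi>"
      by (rule imod_eqI[where i = i]) (simp_all add: imod_ops l_distr a b cl imod_carrierD(1)[OF p])
    show "(a \<otimes> b) \<odot>\<^bsub>imod i\<^esub> \<phi> = b \<odot>\<^bsub>imod i\<^esub> (a \<odot>\<^bsub>imod i\<^esub> \<phi>)"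
      by (rule imod_eqI[where i = i]) (simp_all add: imod_ops m_assoc a b cl)
  next
    fix a \<phi> \<psi> assume a: "a \<in> carrier R" and p: "\<phi> \<in> carrier (imod i)" "\<psi> \<in> carrier (imod i)"
    show "a \<odot>\<^bsub>imod i\<^esub> (\<phi> \<oplus>\<^bsub>imod i\<^esub> \<psi>) = a \<odot>\<^bsub>imod i\<^esub> \<phi> \<oplus>\<^bsub>imod i\<^esub> a \<odot>\<^bsub>imod i\<^esub> \<psi>"
      by (rule imod_eqI[where i = i]) (simp_all add: imod_ops a cl)
  next
    fix \<phi> assume p: "\<phi> \<in> carrier (imod i)"
    show "\<one> \<odot>\<^bsub>imod i\<^esub> \<phi> = \<phi>"
      by (rule imod_eqI[OF _ imod_carrierD(3)[OF p]]) (simp_all add: imod_ops cl)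
  qed
qed

text \<open>The flag is dual to the one for the algebra: \<open>L n\<close> consists of the forms
  that vanish on the generators with index at least \<open>n\<close>, so passing to the next level
  frees the value on one generator.\<close>

lemma fd_imod:
  assumes i: "i \<in> V"
  shows "rmodule.fd s (imod i)"
proof -
  interpret I: rmodule R V e s N X "imod i" by (rule rmodule_imod[OF i])
  note cl = lP_closed[OF i]
  obtain bs where bs: "set bs \<subseteq> carrier R" and
    gen: "\<And>G. subgroup G (add_monoid R) \<Longrightarrow> (\<forall>c. \<forall>x\<in>G. s c \<otimes> x \<in> G) \<Longrightarrow> set bs \<subseteq> G \<Longrightarrow> carrier R \<subseteq> G"
    using fin_gen by metis
  let ?K = "length bs"
  have bn: "bs ! n \<otimes> e i \<in> lP i" if "n < ?K" for n
    using bs nth_mem[OF that] cl(6) by blast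
  define L where "L n = {\<phi> \<in> carrier (imod i). \<forall>m<?K. n \<le> m \<longrightarrow> \<phi> (bs ! m \<otimes> e i) = 0}" for n
  have zero: "\<phi> = \<zero>\<^bsub>imod i\<^esub>" if p: "\<phi> \<in> L 0" for \<phi>
  proof -
    have pc: "\<phi> \<in> carrier (imod i)" and p0: "\<And>m. m < ?K \<Longrightarrow> \<phi> (bs ! m \<otimes> e i) = 0" using p by (auto simp: L_def)
    note pD = imod_carrierD[OF pc]
    let ?G = "{y \<in> carrier R. \<phi> (y \<otimes> e i) = 0}"
    have z: "\<phi> \<zero> = 0" using pD(2)[OF cl(4), of 0] by simp
    have "carrier R \<subseteq> ?G"
    proof (rule gen)
      show "\<forall>c. \<forall>x\<in>?G. s c \<otimes> x \<in> ?G" using pD(2)[OF cl(6)] i by (auto simp: m_assoc)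
      show "set bs \<subseteq> ?G" using bs p0 by (auto simp: in_set_conv_nth)
      show "subgroup ?G (add_monoid R)"
      proof (intro subgroup.intro)
        show "x \<otimes>\<^bsub>add_monoid R\<^esub> y \<in> ?G" if "x \<in> ?G" "y \<in> ?G" for x y
          using that pD(1)[OF cl(6) cl(6), of x y] i by (simp add: l_distr)
        show "\<one>\<^bsub>add_monoid R\<^esub> \<in> ?G" using z i by simp
        show "inv\<^bsub>add_monoid R\<^esub> x \<in> ?G" if x: "x \<in> ?G" for x
        proof -
          have "\<ominus> x \<otimes> e i = s (- 1) \<otimes> (x \<otimes> e i)" using x i by (simp add: I.s_uminus s_one l_minus)
          then show ?thesis using x i pD(2)[OF cl(6), of x "- 1"] by (simp add: a_inv_def[of R, symmetric])
        qed
      qed auto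
    qed
    then have "\<phi> (x \<otimes> e i) = 0" if "x \<in> carrier R" for x using that by blast
    then have "\<phi> x = 0" if "x \<in> lP i" for x using that unfolding lP_def by blast
    then show ?thesis by (intro imod_eqI[OF pD(3)]) (simp_all add: imod_ops)
  qed
  have sub: "I.subsp (L n)" for n
    unfolding I.subsp_def
  proof (intro conjI ballI allI)
    show "L n \<subseteq> carrier (imod i)" by (auto simp: L_def)
    show "\<zero>\<^bsub>imod i\<^esub> \<in> L n" using bn by (simp add: L_def imod_ops(1)[of i]) (simp add: imod_ops(1)[symmetric])
    show "x \<oplus>\<^bsub>imod i\<^esub> y \<in> L n" if xy: "x \<in> L n" "y \<in> L n" for x y
    proof -
      have "x \<oplus>\<^bsub>imod i\<^esub> y \<in> carrier (imod i)" using xy by (simp add: L_def)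
      then show ?thesis using xy bn by (simp add: L_def imod_ops(2))
    qed
    show "s c \<odot>\<^bsub>imod i\<^esub> x \<in> L n" if x: "x \<in> L n" for c x
    proof -
      have xc: "x \<in> carrier (imod i)" using x by (simp add: L_def)
      then have "s c \<odot>\<^bsub>imod i\<^esub> x \<in> carrier (imod i)" by simp
      then show ?thesis using x bn imod_carrierD(2)[OF xc] by (simp add: L_def imod_ops(3))
    qed
  qed
  have "I.flag L ?K"
    unfolding I.flag_def
  proof (intro conjI allI ballI)
    show "L 0 = {\<zero>\<^bsub>imod i\<^esub>}" using zero I.subspD(2)[OF sub] by blast
    show "L ?K = carrier (imod i)" by (auto simp: L_def)
    show "I.subsp (L n)" for n by (rule sub)
    show "L n \<subseteq> L (Suc n)" for n by (auto simp: L_def)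
    fix n x y assume x: "x \<in> L (Suc n)" and y: "y \<in> L (Suc n) - L n"
    have c: "x \<in> carrier (imod i)" "y \<in> carrier (imod i)" using x y by (auto simp: L_def)
    obtain m where m: "m < ?K" "n \<le> m" "y (bs ! m \<otimes> e i) \<noteq> 0" using y by (auto simp: L_def)
    have "m = n"
    proof (rule ccontr)
      assume "m \<noteq> n"
      then have "Suc n \<le> m" using m by simp
      then show False using y m by (auto simp: L_def)
    qed
    then have n: "n < ?K" "y (bs ! n \<otimes> e i) \<noteq> 0" using m by auto
    define d where "d = x (bs ! n \<otimes> e i) / y (bs ! n \<otimes> e i)"
    have "x \<ominus>\<^bsub>imod i\<^esub> s d \<odot>\<^bsub>imod i\<^esub> y = x \<oplus>\<^bsub>imod i\<^esub> s (- d) \<odot>\<^bsub>imod i\<^esub> y"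
      using I.s_minus_smult[OF c(2)] by (simp add: a_minus_def)
    moreover have "x \<oplus>\<^bsub>imod i\<^esub> s (- d) \<odot>\<^bsub>imod i\<^esub> y \<in> L n"
    proof -
      have "x \<oplus>\<^bsub>imod i\<^esub> s (- d) \<odot>\<^bsub>imod i\<^esub> y \<in> L (Suc n)"
        using I.subspD(4,5)[OF sub] x y by blast
      moreover have "(x \<oplus>\<^bsub>imod i\<^esub> s (- d) \<odot>\<^bsub>imod i\<^esub> y) (bs ! n \<otimes> e i) = 0"
        using bn[OF n(1)] imod_carrierD(2)[OF c(2)] n(2) by (simp add: imod_ops(2,3) d_def)
      ultimately show ?thesis by (auto simp: L_def le_Suc_eq) (metis Suc_leI le_neq_implies_less)
    qed
    ultimately show "\<exists>c. x \<ominus>\<^bsub>imod i\<^esub> s c \<odot>\<^bsub>imod i\<^esub> y \<in> L n" by (intro exI[of _ d]) simp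
  qed
  then show ?thesis unfolding I.fd_def by blast
qed

text \<open>The forms that generate a submodule without factors S(q) for q not below
  \<open>i\<close>.\<close>

definition costd_sub :: "('v \<times> 'v) set \<Rightarrow> 'v \<Rightarrow> ('r \<Rightarrow> 'k) set" where
  "costd_sub r i = {\<phi> \<in> carrier (imod i). \<forall>a\<in>carrier R. \<forall>q\<in>V. (q, i) \<notin> r \<longrightarrow>
     e q \<odot>\<^bsub>imod i\<^esub> (a \<odot>\<^bsub>imod i\<^esub> \<phi>) = \<zero>\<^bsub>imod i\<^esub>}"

lemma costd_sub_subm:
  assumes i: "i \<in> V"
  shows "submodule (costd_sub r i) R (imod i)"
proof -
  interpret I: rmodule R V e s N X "imod i" by (rule rmodule_imod[OF i])
  show ?thesis
    unfolding I.subm_iff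
  proof (intro conjI ballI)
    show "costd_sub r i \<subseteq> carrier (imod i)" by (auto simp: costd_sub_def)
    show "\<zero>\<^bsub>imod i\<^esub> \<in> costd_sub r i" by (simp add: costd_sub_def)
    show "x \<oplus>\<^bsub>imod i\<^esub> y \<in> costd_sub r i" if "x \<in> costd_sub r i" "y \<in> costd_sub r i" for x y
      using that by (simp add: costd_sub_def I.smult_r_distr)
    show "b \<odot>\<^bsub>imod i\<^esub> x \<in> costd_sub r i" if b: "b \<in> carrier R" and x: "x \<in> costd_sub r i" for b x
    proof -
      have xc: "x \<in> carrier (imod i)" using x by (simp add: costd_sub_def)
      have "e q \<odot>\<^bsub>imod i\<^esub> (a \<odot>\<^bsub>imod i\<^esub> (b \<odot>\<^bsub>imod i\<^esub> x)) = \<zero>\<^bsub>imod i\<^esub>"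
        if "a \<in> carrier R" "q \<in> V" "(q, i) \<notin> r" for a q
      proof -
        have "a \<odot>\<^bsub>imod i\<^esub> (b \<odot>\<^bsub>imod i\<^esub> x) = (b \<otimes> a) \<odot>\<^bsub>imod i\<^esub> x"
          using I.smult_assoc[OF b that(1) xc] by simp
        moreover have "b \<otimes> a \<in> carrier R" using b that by simp
        ultimately show ?thesis using x that(2,3) unfolding costd_sub_def by auto
      qed
      then show ?thesis using b xc by (simp add: costd_sub_def)
    qed
  qed
qed

lemma costd_comp_mult:
  assumes i: "i \<in> V" and j: "j \<in> V" and U: "submodule U R (imod i)"
  shows "comp_mult R (restrict_mod (imod i) U) (simp_of j) \<noteq> 0 \<longleftrightarrow> (\<exists>\<phi>\<in>U. e j \<odot>\<^bsub>imod i\<^esub> \<phi> \<noteq> \<zero>\<^bsub>imod i\<^esub>)"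
proof -
  interpret I: rmodule R V e s N X "imod i" by (rule rmodule_imod[OF i])
  interpret U: rmodule R V e s N X "restrict_mod (imod i) U" by (rule I.rmodule_restrict[OF U])
  show ?thesis using U.comp_mult_nonzero_iff[OF I.fd_restrict[OF fd_imod[OF i] U] j]
    by (simp only: restrict_simps)
qed

lemma costd_greatest:
  assumes i: "i \<in> V"
  shows "(GREATEST U. submodule U R (imod i) \<and> fbelow r i (restrict_mod (imod i) U)) = costd_sub r i"
proof (rule Greatest_equality)
  interpret I: rmodule R V e s N X "imod i" by (rule rmodule_imod[OF i])
  have "(j, i) \<in> r" if j: "j \<in> V" and p: "\<phi> \<in> costd_sub r i" "e j \<odot>\<^bsub>imod i\<^esub> \<phi> \<noteq> \<zero>\<^bsub>imod i\<^esub>" for j \<phi>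
  proof (rule ccontr)
    assume "(j, i) \<notin> r"
    then have "e j \<odot>\<^bsub>imod i\<^esub> (\<one> \<odot>\<^bsub>imod i\<^esub> \<phi>) = \<zero>\<^bsub>imod i\<^esub>" using p(1) j unfolding costd_sub_def by blast
    moreover have "\<one> \<odot>\<^bsub>imod i\<^esub> \<phi> = \<phi>" using p(1) unfolding costd_sub_def by (intro I.smult_one) blast
    ultimately show False using p(2) by simp
  qed
  then have "fbelow r i (restrict_mod (imod i) (costd_sub r i))"
    unfolding fbelow_def using costd_comp_mult[OF i _ costd_sub_subm[OF i]] by blast
  then show "submodule (costd_sub r i) R (imod i) \<and> fbelow r i (restrict_mod (imod i) (costd_sub r i))"
    using costd_sub_subm[OF i] by (intro conjI)
next
  interpret I: rmodule R V e s N X "imod i" by (rule rmodule_imod[OF i])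
  fix U assume U: "submodule U R (imod i) \<and> fbelow r i (restrict_mod (imod i) U)"
  show "U \<subseteq> costd_sub r i"
  proof
    fix \<phi> assume p: "\<phi> \<in> U"
    have "e q \<odot>\<^bsub>imod i\<^esub> (a \<odot>\<^bsub>imod i\<^esub> \<phi>) = \<zero>\<^bsub>imod i\<^esub>" if "a \<in> carrier R" "q \<in> V" "(q, i) \<notin> r" for a q
      using that U costd_comp_mult[OF i that(2), of U] I.submD(5)[of U a \<phi>] p unfolding fbelow_def by blast
    then show "\<phi> \<in> costd_sub r i" using I.submD(3)[of U \<phi>] U p unfolding costd_sub_def by blast
  qed
qed

definition costdm :: "('v \<times> 'v) set \<Rightarrow> 'v \<Rightarrow> ('r, 'r \<Rightarrow> 'k) module" where
  "costdm r i = restrict_mod (imod i) (costd_sub r i)"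

text \<open>The socle of the dual module is S(j): if \<psi> is nonzero at x, then acting by x moves
  this value to \<open>e j\<close>.\<close>

lemma imod_socle:
  assumes j: "j \<in> V" and p: "\<psi> \<in> carrier (imod j)" "\<psi> \<noteq> \<zero>\<^bsub>imod j\<^esub>"
  shows "\<exists>x\<in>carrier R. (x \<otimes> e j) \<odot>\<^bsub>imod j\<^esub> \<psi> \<noteq> \<zero>\<^bsub>imod j\<^esub>"
proof -
  note cl = lP_closed[OF j]
  obtain x where x: "x \<in> lP j" "\<psi> x \<noteq> 0"
    using p imod_eqI[OF imod_carrierD(3)[OF p(1)], of "\<zero>\<^bsub>imod j\<^esub>"] by (auto simp: imod_ops)
  have xR: "x \<in> carrier R" "x \<otimes> e j = x" using x lP_iff[OF j] by auto
  have "((x \<otimes> e j) \<odot>\<^bsub>imod j\<^esub> \<psi>) (e j) \<noteq> \<zero>\<^bsub>imod j\<^esub> (e j)"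
    using x xR cl(5) by (simp add: imod_ops)
  then show ?thesis using xR(1) by metis
qed

text \<open>This replaces the reciprocity \<open>(P(i) : \<Delta>(j)) = [\<nabla>(j) : S(i)]\<close>; it only uses that there are no
  nonzero homomorphisms \<open>\<Delta>(q) \<rightarrow> \<nabla>(j)\<close> for \<open>q \<noteq> j\<close>, and therefore allows two different but equivalent
  orders for \<open>\<Delta>\<close> and \<open>\<nabla>\<close>.\<close>

lemma costd_label:
  assumes r: "qh r" and j: "j \<in> V" and eq: "\<And>i. i \<in> V \<Longrightarrow> ker r i = ker r' i"
    and p: "\<phi> \<in> costd_sub r j" and d: "dfil r' J W" and w: "\<exists>w\<in>W. w \<odot>\<^bsub>imod j\<^esub> \<phi> \<noteq> \<zero>\<^bsub>imod j\<^esub>"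
  shows "j \<in> J"
proof -
  interpret I: rmodule R V e s N X "imod j" by (rule rmodule_imod[OF j])
  have pc: "\<phi> \<in> carrier (imod j)" using p by (simp add: costd_sub_def)
  show ?thesis using d w
  proof (induction rule: dfil.induct)
    case dfil_zero
    then show ?case using pc by simp
  next
    case (dfil_step J U W q)
    show ?case
    proof (cases "\<exists>w\<in>U. w \<odot>\<^bsub>imod j\<^esub> \<phi> \<noteq> \<zero>\<^bsub>imod j\<^esub>")
      case True
      then show ?thesis using dfil_step.IH by blast
    next
      case False
      have q: "q \<in> V" by fact
      obtain t where t: "t \<in> W" "t \<otimes> e q = t" "W = reg.gen U t"
        and tU: "\<And>a. a \<in> carrier R \<Longrightarrow> t \<otimes> a \<in> U \<longleftrightarrow> e q \<otimes> a \<in> ker r' q"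
        using dfil_step.hyps(5) unfolding reg.gens_def by auto
      have tR: "t \<in> carrier R" using reg.submD(3)[OF dfil_step.hyps(2) t(1)] by simp
      \<comment> \<open>In this case \<open>W\<close> is the first module of the filtration that
        does not annihilate \<phi>. The form \<psi> is the image of the generator under the
        resulting homomorphism \<Delta>(q) \<rightarrow> \<nabla>(j).\<close>
      define \<psi> where "\<psi> = t \<odot>\<^bsub>imod j\<^esub> \<phi>"
      have psc: "\<psi> \<in> carrier (imod j)" using tR pc by (simp add: \<psi>_def)
      have eps: "e q \<odot>\<^bsub>imod j\<^esub> \<psi> = \<psi>"
        using I.smult_assoc[of t "e q" \<phi>] tR q pc t(2) by (simp add: \<psi>_def)
      have ps0: "\<psi> \<noteq> \<zero>\<^bsub>imod j\<^esub>"
      proof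
        assume z: "\<psi> = \<zero>\<^bsub>imod j\<^esub>"
        obtain w where w: "w \<in> W" "w \<odot>\<^bsub>imod j\<^esub> \<phi> \<noteq> \<zero>\<^bsub>imod j\<^esub>" using dfil_step.prems by blast
        obtain u a where u: "w = u \<oplus> t \<otimes> a" "u \<in> U" "a \<in> carrier R" using w(1) unfolding t(3) reg.gen_def by auto
        have uR: "u \<in> carrier R" using reg.submD(3)[OF dfil_subm[OF dfil_step.hyps(1)] u(2)] by simp
        have "w \<odot>\<^bsub>imod j\<^esub> \<phi> = u \<odot>\<^bsub>imod j\<^esub> \<phi> \<oplus>\<^bsub>imod j\<^esub> a \<odot>\<^bsub>imod j\<^esub> \<psi>"
          using u uR tR pc by (simp add: I.smult_l_distr I.smult_assoc \<psi>_def)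
        also have "\<dots> = \<zero>\<^bsub>imod j\<^esub>" using False u z by simp
        finally show False using w by simp
      qed
      \<comment> \<open>The form \<psi> is the component at \<open>q\<close> of a multiple of
        \<phi>, and \<phi> belongs to the costandard module.\<close>
      have "(q, j) \<in> r"
      proof (rule ccontr)
        assume "(q, j) \<notin> r"
        then have "e q \<odot>\<^bsub>imod j\<^esub> \<psi> = \<zero>\<^bsub>imod j\<^esub>" using p tR q unfolding costd_sub_def \<psi>_def by blast
        then show False using eps ps0 by simp
      qed
      \<comment> \<open>Some x e_j carries \<psi> to a nonzero element of the socle S(j). If
        \<open>j\<close> were not below \<open>q\<close>, multiplying it by \<open>e q\<close> would
        give an element of the kernel for \<open>q\<close>, which annihilates \<psi>.\<close>
      moreover have "(j, q) \<in> r"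
      proof (rule ccontr)
        assume jq: "(j, q) \<notin> r"
        obtain x where x: "x \<in> carrier R" "(x \<otimes> e j) \<odot>\<^bsub>imod j\<^esub> \<psi> \<noteq> \<zero>\<^bsub>imod j\<^esub>" using imod_socle[OF j psc ps0] by blast
        have "e q \<otimes> (x \<otimes> e j) \<in> ker r' q" using ker_in[OF q j jq x(1)] eq[OF q] q j x(1) by (simp add: m_assoc)
        then have "t \<otimes> (x \<otimes> e j) \<in> U" using tU x j by simp
        then have "(t \<otimes> (x \<otimes> e j)) \<odot>\<^bsub>imod j\<^esub> \<phi> = \<zero>\<^bsub>imod j\<^esub>" using False by blast
        then show False using x tR pc j by (simp add: I.smult_assoc \<psi>_def)
      qed
      ultimately show ?thesis using qhD(6)[OF r] by blast
    qed
  qed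
qed

text \<open>P(i) itself has a filtration whose labels are those of its kernel, all above
  \<open>i\<close>, and \<open>i\<close> at the top. A form with nonzero component at
  \<open>i\<close> is not annihilated by P(i), so \<open>j\<close> is one of these labels.\<close>

lemma costd_below:
  assumes r: "qh r" and r': "qh r'" and eq: "\<And>i. i \<in> V \<Longrightarrow> ker r i = ker r' i" and i: "i \<in> V" and j: "j \<in> V"
    and p: "\<phi> \<in> costd_sub r j" "e i \<odot>\<^bsub>imod j\<^esub> \<phi> \<noteq> \<zero>\<^bsub>imod j\<^esub>"
  shows "(i, j) \<in> r'"
proof -
  obtain J where J: "dfil r' J (ker r' i)" "\<forall>j\<in>J. j \<in> V \<and> (i, j) \<in> r' - Id" using qhD(3)[OF r' i] by blast
  have "reg.gens (ker r' i) (eR i) i (ker r' i)"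
    unfolding reg.gens_def
  proof (intro bexI conjI ballI)
    show "e i \<in> eR i" by (rule e_in_eR[OF i])
    show "e i \<odot>\<^bsub>reg\<^esub> e i = e i" using i by (simp add: e_idem)
    show "a \<odot>\<^bsub>reg\<^esub> e i \<in> ker r' i \<longleftrightarrow> e i \<otimes> a \<in> ker r' i" for a by simp
    have "eR i \<subseteq> reg.gen (ker r' i) (e i)"
    proof
      fix x assume "x \<in> eR i"
      then obtain a where a: "a \<in> carrier R" "x = e i \<otimes> a" by (auto simp: eR_def)
      then have "x = \<zero> \<oplus> e i \<otimes> a" using i by simp
      then show "x \<in> reg.gen (ker r' i) (e i)"
        unfolding reg.gen_def using a reg.submD(2)[OF ker_subm[OF i]] by auto
    qed
    moreover have "reg.gen (ker r' i) (e i) \<subseteq> eR i"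
      by (rule reg.gen_subset[OF eR_subm[OF i] ker_sub[OF i] e_in_eR[OF i]])
    ultimately show "eR i = reg.gen (ker r' i) (e i)" by blast
  qed
  then have "dfil r' (insert i J) (eR i)"
    by (rule dfil_step[OF J(1) eR_subm[OF i] ker_sub[OF i] i])
  then have "j \<in> insert i J" using costd_label[OF r j eq p(1)] p(2) e_in_eR[OF i] by blast
  then show ?thesis using J(2) qhD(4)[OF r' i] by auto
qed

text \<open>The witness is the coefficient of the arrow, as a form on R e_j. It is nonzero at
  \<alpha>, and the submodule it generates has zero components at all vertices other than
  \<open>i\<close> and \<open>j\<close>, which are both below \<open>j\<close>.\<close>

lemma arrow_costd:
  assumes X: "(i, \<alpha>, j) \<in> X" and jj: "(j, j) \<in> r" and ij: "(i, j) \<in> r"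
  shows "\<exists>\<phi>\<in>costd_sub r j. e i \<odot>\<^bsub>imod j\<^esub> \<phi> \<noteq> \<zero>\<^bsub>imod j\<^esub>"
proof -
  have a: "i \<in> V" "j \<in> V" "\<alpha> \<in> carrier R" "e i \<otimes> \<alpha> = \<alpha>" "\<alpha> \<otimes> e j = \<alpha>" using arrow[OF X] reg.N_closed by auto
  obtain \<kappa> \<epsilon> \<epsilon>' where k: "\<And>a b. a \<in> carrier R \<Longrightarrow> b \<in> carrier R \<Longrightarrow> \<kappa> (a \<oplus> b) = \<kappa> a + (\<kappa> b :: 'k)"
      "\<And>a b. a \<in> carrier R \<Longrightarrow> b \<in> carrier R \<Longrightarrow> \<kappa> (a \<otimes> b) = \<epsilon>' a * \<kappa> b + \<kappa> a * \<epsilon> b"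
    and ep: "\<And>a b. a \<in> carrier R \<Longrightarrow> b \<in> carrier R \<Longrightarrow> \<epsilon> (a \<otimes> b) = \<epsilon> a * (\<epsilon> b :: 'k)"
    and k1: "\<kappa> \<alpha> = 1" and sc: "\<And>c. \<kappa> (s c) = 0 \<and> \<epsilon> (s c) = c \<and> \<epsilon>' (s c) = c"
    and eq: "\<And>q. q \<in> V \<Longrightarrow> \<kappa> (e q) = 0 \<and> \<epsilon> (e q) = (if q = j then 1 else 0) \<and> \<epsilon>' (e q) = (if q = i then 1 else 0)"
    using arrow_coef[OF X] by blast
  note cl = lP_closed[OF a(2)]
  define \<phi> where "\<phi> = (\<lambda>z\<in>lP j. \<kappa> z)"
  have pc: "\<phi> \<in> carrier (imod j)"
    using cl k sc by (intro imod_carrierI) (auto simp: \<phi>_def)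
  have "\<phi> \<in> costd_sub r j"
    unfolding costd_sub_def
  proof (intro CollectI conjI pc ballI impI)
    fix b q assume b: "b \<in> carrier R" and q: "q \<in> V" and n: "(q, j) \<notin> r"
    have qij: "q \<noteq> i" "q \<noteq> j" using n jj ij by auto
    show "e q \<odot>\<^bsub>imod j\<^esub> (b \<odot>\<^bsub>imod j\<^esub> \<phi>) = \<zero>\<^bsub>imod j\<^esub>"
    proof (rule imod_eqI[where i = j])
      fix z assume z: "z \<in> lP j"
      then have zR: "z \<in> carrier R" "e q \<otimes> z \<in> lP j" "b \<otimes> (e q \<otimes> z) \<in> lP j" using cl b q by auto
      have "\<kappa> (b \<otimes> (e q \<otimes> z)) = \<epsilon>' b * (\<epsilon>' (e q) * \<kappa> z + \<kappa> (e q) * \<epsilon> z) + \<kappa> b * (\<epsilon> (e q) * \<epsilon> z)"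
        using k(2) ep b q zR by simp
      also have "\<dots> = 0" using eq[OF q] qij by simp
      finally show "(e q \<odot>\<^bsub>imod j\<^esub> (b \<odot>\<^bsub>imod j\<^esub> \<phi>)) z = \<zero>\<^bsub>imod j\<^esub> z"
        using z zR by (simp add: imod_ops \<phi>_def)
    qed (simp_all add: imod_ops)
  qed
  moreover have "e i \<odot>\<^bsub>imod j\<^esub> \<phi> \<noteq> \<zero>\<^bsub>imod j\<^esub>"
  proof
    have al: "\<alpha> \<in> lP j" using a lP_iff by blast
    assume "e i \<odot>\<^bsub>imod j\<^esub> \<phi> = \<zero>\<^bsub>imod j\<^esub>"
    then have "(e i \<odot>\<^bsub>imod j\<^esub> \<phi>) \<alpha> = \<zero>\<^bsub>imod j\<^esub> \<alpha>" by simp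
    then show False using al a k1 by (simp add: imod_ops \<phi>_def)
  qed
  ultimately show ?thesis by blast
qed

section \<open>The minimal adapted order\<close>

definition madapt :: "('v \<times> 'v) set set \<Rightarrow> ('v \<times> 'v) set" where
  "madapt \<X> = {(i, j). i \<in> V \<and> j \<in> V \<and> (\<exists>r\<in>\<X>.
      comp_mult R (stdm r j) (simp_of i) \<noteq> 0 \<or> comp_mult R (costdm r j) (simp_of i) \<noteq> 0)}\<^sup>+"

text \<open>The definition collects relations from all representatives. The standard modules depend
  on the kernels only, but the costandard modules for \<open>r\<close> have to be compared with the
  order \<open>r'\<close>, which is what \<open>costd_below\<close> achieves.\<close>

lemma madapt_sub:
  assumes X: "\<And>r. r \<in> \<X> \<Longrightarrow> qh r" "\<And>r r' i. r \<in> \<X> \<Longrightarrow> r' \<in> \<X> \<Longrightarrow> i \<in> V \<Longrightarrow> ker r i = ker r' i"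
    and r': "r' \<in> \<X>"
  shows "madapt \<X> \<subseteq> r'"
proof -
  let ?B = "{(i, j). i \<in> V \<and> j \<in> V \<and> (\<exists>r\<in>\<X>.
      comp_mult R (stdm r j) (simp_of i) \<noteq> 0 \<or> comp_mult R (costdm r j) (simp_of i) \<noteq> 0)}"
  have "(i, j) \<in> r'" if i: "i \<in> V" and j: "j \<in> V" and r: "r \<in> \<X>"
    and c: "comp_mult R (stdm r j) (simp_of i) \<noteq> 0 \<or> comp_mult R (costdm r j) (simp_of i) \<noteq> 0" for i j r
    using c
  proof
    assume "comp_mult R (stdm r j) (simp_of i) \<noteq> 0"
    then obtain x where x: "x \<in> eR j" "x \<otimes> e i \<notin> ker r j" using stdm_comp_mult[OF j i] by blast
    then have "x \<otimes> e i \<notin> ker r' j" using X(2)[OF r r' j] by simp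
    then show ?thesis using trace_in[OF x(1) i, of "\<lambda>q. (q, j) \<notin> r'"] unfolding ker_def by blast
  next
    assume "comp_mult R (costdm r j) (simp_of i) \<noteq> 0"
    then obtain \<phi> where "\<phi> \<in> costd_sub r j" "e i \<odot>\<^bsub>imod j\<^esub> \<phi> \<noteq> \<zero>\<^bsub>imod j\<^esub>"
      unfolding costdm_def using costd_comp_mult[OF j i costd_sub_subm[OF j]] by blast
    then show ?thesis using costd_below[OF X(1)[OF r] X(1)[OF r'] X(2)[OF r r'] i j] by blast
  qed
  then have "?B \<subseteq> r'" by auto
  then have "?B\<^sup>+ \<subseteq> r'\<^sup>+" using trancl_mono by blast
  also have "r'\<^sup>+ = r'" by (rule trancl_id[OF partial_order_onD(2)[OF qhD(1)[OF X(1)[OF r']]]])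
  finally show ?thesis unfolding madapt_def .
qed

text \<open>The arrow survives in \<Delta>(i) if \<open>j\<close> is below \<open>i\<close>, and
  dually in \<nabla>(j) if \<open>i\<close> is below \<open>j\<close>. So the relation of its ends
  in a representative is already forced by composition factors.\<close>

lemma madapt_arrow:
  assumes X: "\<And>r. r \<in> \<X> \<Longrightarrow> qh r" "\<And>r r' i. r \<in> \<X> \<Longrightarrow> r' \<in> \<X> \<Longrightarrow> i \<in> V \<Longrightarrow> ker r i = ker r' i"
    and r: "r \<in> \<X>" and a: "(i, \<alpha>, j) \<in> X"
  shows "(i, j) \<in> madapt \<X> \<longleftrightarrow> (i, j) \<in> r" "(j, i) \<in> madapt \<X> \<longleftrightarrow> (j, i) \<in> r"
proof -
  have sub: "madapt \<X> \<subseteq> r" using madapt_sub[of \<X> r] X r by blast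
  have ar: "i \<in> V" "j \<in> V" "\<alpha> \<in> carrier R" "e i \<otimes> \<alpha> = \<alpha>" "\<alpha> \<otimes> e j = \<alpha>" using arrow[OF a] reg.N_closed by auto
  have ij: "(i, j) \<in> madapt \<X>" if "(i, j) \<in> r"
  proof -
    have "comp_mult R (costdm r j) (simp_of i) \<noteq> 0"
      unfolding costdm_def costd_comp_mult[OF ar(2,1) costd_sub_subm[OF ar(2)]]
      by (rule arrow_costd[OF a qhD(4)[OF X(1)[OF r] ar(2)] that])
    then show ?thesis unfolding madapt_def using ar r by (intro r_into_trancl) blast
  qed
  have ji: "(j, i) \<in> madapt \<X>" if "(j, i) \<in> r"
  proof -
    have "\<alpha> \<otimes> e j \<notin> ker r i" using arrow_notin_ker[OF a qhD(4)[OF X(1)[OF r] ar(1)] that] ar by simp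
    moreover have "\<alpha> \<in> eR i" using ar eR_iff by blast
    ultimately have "comp_mult R (stdm r i) (simp_of j) \<noteq> 0" using stdm_comp_mult[OF ar(1,2)] by blast
    then show ?thesis unfolding madapt_def using ar r by (intro r_into_trancl) blast
  qed
  show "(i, j) \<in> madapt \<X> \<longleftrightarrow> (i, j) \<in> r" "(j, i) \<in> madapt \<X> \<longleftrightarrow> (j, i) \<in> r" using ij ji sub by blast+
qed

end

section \<open>Bound quiver algebras as basic algebras\<close>

locale bqa = fin_digraph Q for Q :: "('v, 'e) pre_digraph" (structure) +
  fixes I :: "('v \<times> 'e list \<Rightarrow> 'k::field) set"
  assumes adm: "admissible_ideal Q I"
begin

abbreviation kQ :: "('v \<times> 'e list \<Rightarrow> 'k) ring" where
  "kQ \<equiv> path_algebra Q"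

abbreviation A :: "('v \<times> 'e list \<Rightarrow> 'k) set ring" where
  "A \<equiv> bq_algebra Q I"

definition cl :: "('v \<times> 'e list \<Rightarrow> 'k) \<Rightarrow> ('v \<times> 'e list \<Rightarrow> 'k) set" where
  "cl f = I +>\<^bsub>kQ\<^esub> f"

definition NN :: "nat \<Rightarrow> ('v \<times> 'e list \<Rightarrow> 'k) set set" where
  "NN p = cl ` arrow_ideal_power Q p"

definition XX :: "('v \<times> ('v \<times> 'e list \<Rightarrow> 'k) set \<times> 'v) set" where
  "XX = {(tail Q a, cl (path_elem (tail Q a, [a])), head Q a) | a. a \<in> arcs Q}"

lemma XXI: "a \<in> arcs Q \<Longrightarrow> tail Q a = u \<Longrightarrow> head Q a = v \<Longrightarrow> (u, cl (path_elem (u, [a])), v) \<in> XX"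
  unfolding XX_def by blast

lemma zero_kQ: "(\<lambda>_. 0) \<in> carrier kQ"
  by (rule path_zero_closed)

lemma I_ideal: "ideal I kQ"
  using adm by (simp add: admissible_ideal_def)

sublocale I: ideal I kQ
  by (rule I_ideal)

lemma I_long: "f \<in> I \<Longrightarrow> f (u, p) \<noteq> 0 \<Longrightarrow> 2 \<le> length p"
  using adm by (auto simp: admissible_ideal_def arrow_ideal_power_def)

lemma I_short: "f \<in> I \<Longrightarrow> length p \<le> 1 \<Longrightarrow> f (u, p) = 0"
  using I_long[of f u p] by fastforce

lemma power_sub: "arrow_ideal_power Q p \<subseteq> carrier kQ"
  by (auto simp: arrow_ideal_power_def)

lemma powerD: "f \<in> arrow_ideal_power Q p \<Longrightarrow> f (u, w) \<noteq> 0 \<Longrightarrow> p \<le> length w"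
  by (auto simp: arrow_ideal_power_def)

lemma powerI: "f \<in> carrier kQ \<Longrightarrow> (\<And>u w. f (u, w) \<noteq> 0 \<Longrightarrow> p \<le> length w) \<Longrightarrow> f \<in> arrow_ideal_power Q p"
  by (auto simp: arrow_ideal_power_def)

lemma I_sub: "f \<in> I \<Longrightarrow> f \<in> carrier kQ"
  using I.a_subset by blast

lemma cl_self: "f \<in> carrier kQ \<Longrightarrow> f \<in> cl f"
  unfolding cl_def by (rule abelian_subgroup.a_rcos_self[OF I.abelian_subgroup_axioms])

lemma cl_mem: "g \<in> cl f \<longleftrightarrow> (\<exists>h\<in>I. g = (\<lambda>x. h x + f x))"
  unfolding cl_def a_r_coset_def' by (auto simp: path_algebra_simps)

lemma cl_eq_iff:
  assumes f: "f \<in> carrier kQ" and g: "g \<in> carrier kQ"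
  shows "cl f = cl g \<longleftrightarrow> (\<lambda>x. f x - g x) \<in> I"
proof
  assume "cl f = cl g"
  then have "f \<in> cl g" using cl_self[OF f] by simp
  then obtain h where "h \<in> I" "f = (\<lambda>x. h x + g x)" unfolding cl_mem by blast
  then show "(\<lambda>x. f x - g x) \<in> I" by simp
next
  assume *: "(\<lambda>x. f x - g x) \<in> I"
  have "f \<in> cl g" unfolding cl_mem by (rule bexI[OF _ *]) simp
  then show "cl f = cl g"
    using I.a_repr_independence[of f I g] g I.a_subgroup unfolding cl_def by simp
qed

lemma zero_A: "\<zero>\<^bsub>A\<^esub> = I"
  by (simp add: bq_algebra_def FactRing_def)

lemma cl_zero: "cl (\<lambda>_. 0) = \<zero>\<^bsub>A\<^esub>"
  unfolding cl_def zero_A using I.a_coset_add_zero[OF I.a_subset] by (simp add: path_algebra_simps)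

lemma cl_eq_zero_iff: "f \<in> carrier kQ \<Longrightarrow> cl f = \<zero>\<^bsub>A\<^esub> \<longleftrightarrow> f \<in> I"
  using cl_eq_iff[of f "\<lambda>_. 0"] zero_kQ by (simp add: cl_zero)

lemma carrier_A: "carrier A = cl ` carrier kQ"
  unfolding bq_algebra_def FactRing_def A_RCOSETS_def' cl_def by auto

lemma cl_closed [intro]: "f \<in> carrier kQ \<Longrightarrow> cl f \<in> carrier A"
  by (simp add: carrier_A)

lemma cl_add: "f \<in> carrier kQ \<Longrightarrow> g \<in> carrier kQ \<Longrightarrow> cl f \<oplus>\<^bsub>A\<^esub> cl g = cl (\<lambda>x. f x + g x)"
  using I.a_rcos_sum[of f g] by (simp add: cl_def bq_algebra_def FactRing_def path_algebra_simps)

lemma cl_mult: "f \<in> carrier kQ \<Longrightarrow> g \<in> carrier kQ \<Longrightarrow> cl f \<otimes>\<^bsub>A\<^esub> cl g = cl (path_mult Q f g)"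
  using I.rcoset_mult_add[of f g] by (simp add: cl_def bq_algebra_def FactRing_def path_algebra_simps)

lemma one_A: "\<one>\<^bsub>A\<^esub> = cl \<one>\<^bsub>kQ\<^esub>"
  by (simp add: cl_def bq_algebra_def FactRing_def)

lemma ring_A: "ring A"
  unfolding bq_algebra_def by (rule I.quotient_is_ring)

lemma e_eq: "vertex_idem Q I i = cl (path_elem (i, []))"
  by (simp add: vertex_idem_def cl_def)

lemma s_eq: "scalar_elem Q I c = cl (\<lambda>x. c * \<one>\<^bsub>kQ\<^esub> x)"
  by (simp add: scalar_elem_def cl_def)

lemma one_closed': "\<one>\<^bsub>kQ\<^esub> \<in> carrier kQ"
  by (rule I.one_closed)

lemma s_mult_cl: "f \<in> carrier kQ \<Longrightarrow> scalar_elem Q I c \<otimes>\<^bsub>A\<^esub> cl f = cl (\<lambda>x. c * f x)"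
  unfolding s_eq using cl_mult[OF path_smul_closed[OF one_closed'], of f c] path_one_mult[of f]
  by (simp add: path_smul_mult path_algebra_simps(1))

lemma cl_mult_s: "f \<in> carrier kQ \<Longrightarrow> cl f \<otimes>\<^bsub>A\<^esub> scalar_elem Q I c = cl (\<lambda>x. c * f x)"
  unfolding s_eq using cl_mult[OF _ path_smul_closed[OF one_closed'], of f c] path_mult_one[of f]
  by (simp add: path_smul_mult path_algebra_simps(1))

lemma vertex_closed: "i \<in> verts Q \<Longrightarrow> path_elem (i, []) \<in> carrier kQ"
  by (rule path_elem_closed) simp

lemma vertex_mult: "f \<in> carrier kQ \<Longrightarrow> path_mult Q (path_elem (i, [])) f = (\<lambda>(u, p). if u = i then f (u, p) else 0)"
  unfolding path_elem_vertex by (rule idem_mult[of f "\<lambda>u. u = i"])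

lemma mult_vertex: "f \<in> carrier kQ \<Longrightarrow>
    path_mult Q f (path_elem (i, [])) = (\<lambda>(u, p). if awlast u p = i then f (u, p) else 0)"
  unfolding path_elem_vertex by (rule mult_idem[of f "\<lambda>u. u = i"])

text \<open>The coefficient of an arbitrary representative. On paths of length at most one it is
  well defined, because \<open>I\<close> lies in the square of the arrow ideal.\<close>

definition coef :: "'v \<times> 'e list \<Rightarrow> ('v \<times> 'e list \<Rightarrow> 'k) set \<Rightarrow> 'k" where
  "coef x Z = (SOME f. f \<in> Z) x"

lemma coef_cl:
  assumes f: "f \<in> carrier kQ" and p: "length p \<le> 1"
  shows "coef (u, p) (cl f) = f (u, p)"
proof -
  have "(SOME g. g \<in> cl f) \<in> cl f" using cl_self[OF f] by (rule someI[of "\<lambda>g. g \<in> cl f"])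
  then obtain h where h: "h \<in> I" "(SOME g. g \<in> cl f) = (\<lambda>x. h x + f x)" unfolding cl_mem by blast
  have "h (u, p) = 0" using I_long[OF h(1), of u p] p by auto
  then show ?thesis by (simp add: coef_def h(2))
qed

lemma NN_ideal: "ideal (NN p) A"
proof (rule idealI[OF ring_A])
  have sub: "NN p \<subseteq> carrier A" using power_sub by (auto simp: NN_def)
  have mem: "\<exists>f\<in>arrow_ideal_power Q p. x = cl f" if "x \<in> NN p" for x using that by (auto simp: NN_def)
  interpret A: ring A by (rule ring_A)
  show "subgroup (NN p) (add_monoid A)"
  proof (intro subgroup.intro)
    show "NN p \<subseteq> carrier (add_monoid A)" using sub by simp
    show "\<one>\<^bsub>add_monoid A\<^esub> \<in> NN p"
      unfolding NN_def using cl_zero[symmetric] zero_kQ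
      by (intro image_eqI[of _ _ "\<lambda>_. 0"] powerI) auto
    show "x \<otimes>\<^bsub>add_monoid A\<^esub> y \<in> NN p" if xy: "x \<in> NN p" "y \<in> NN p" for x y
    proof -
      obtain f g where f: "f \<in> arrow_ideal_power Q p" "x = cl f" and g: "g \<in> arrow_ideal_power Q p" "y = cl g"
        using mem xy by blast
      have c: "f \<in> carrier kQ" "g \<in> carrier kQ" using f g power_sub by auto
      have "(\<lambda>x. f x + g x) \<in> arrow_ideal_power Q p"
      proof (rule powerI[OF path_add_closed[OF c]])
        fix u w assume "f (u, w) + g (u, w) \<noteq> 0"
        then have "f (u, w) \<noteq> 0 \<or> g (u, w) \<noteq> 0" by auto
        then show "p \<le> length w" using powerD[OF f(1)] powerD[OF g(1)] by blast
      qed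
      then show ?thesis using f g cl_add[OF c] by (auto simp: NN_def)
    qed
    show "inv\<^bsub>add_monoid A\<^esub> x \<in> NN p" if x: "x \<in> NN p" for x
    proof -
      obtain f where f: "f \<in> arrow_ideal_power Q p" "x = cl f" using mem x by blast
      have c: "f \<in> carrier kQ" using f power_sub by auto
      have d: "(\<lambda>x. (- 1) * f x) \<in> carrier kQ" by (rule path_smul_closed[OF c])
      have "cl (\<lambda>x. (- 1) * f x) \<oplus>\<^bsub>A\<^esub> x = \<zero>\<^bsub>A\<^esub>" using cl_add[OF d c] f by (simp add: cl_zero)
      then have "\<ominus>\<^bsub>A\<^esub> x = cl (\<lambda>x. (- 1) * f x)"
        using A.minus_equality cl_closed[OF c] cl_closed[OF d] f by simp
      moreover have "(\<lambda>x. (- 1) * f x) \<in> arrow_ideal_power Q p"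
        using d powerD[OF f(1)] by (intro powerI) auto
      ultimately show ?thesis unfolding a_inv_def by (auto simp: NN_def)
    qed
  qed
  fix a x assume a: "a \<in> NN p" and x: "x \<in> carrier A"
  obtain f where f: "f \<in> arrow_ideal_power Q p" "a = cl f" using mem[OF a] by blast
  obtain g where g: "g \<in> carrier kQ" "x = cl g" using x carrier_A by auto
  have c: "f \<in> carrier kQ" using f power_sub by auto
  have len: "p \<le> length w" if "f (u, take n w) \<noteq> 0 \<or> f (u, drop n w) \<noteq> 0" for u w n
    using that powerD[OF f(1), of u "take n w"] powerD[OF f(1), of u "drop n w"] by auto
  have "path_mult Q g f \<in> arrow_ideal_power Q p" "path_mult Q f g \<in> arrow_ideal_power Q p"
    using path_mult_closed[OF g(1) c] path_mult_closed[OF c g(1)] len path_mult_nz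
    by (metis powerI)+
  then show "x \<otimes>\<^bsub>A\<^esub> a \<in> NN p" "a \<otimes>\<^bsub>A\<^esub> x \<in> NN p"
    using f g cl_mult c by (auto simp: NN_def)
qed

text \<open>\<open>G\<close> is merely an additive subgroup, as in \<open>N_left\<close> and
  \<open>N_right\<close>, so all scalar multiples of the paths have to be supplied.\<close>

lemma smul_induct:
  assumes f: "f \<in> carrier kQ" and G: "subgroup G (add_monoid A)"
    and x: "\<And>x c. f x \<noteq> 0 \<Longrightarrow> cl (\<lambda>y. c * path_elem x y) \<in> G"
  shows "cl f \<in> G"
proof -
  let ?S = "{h \<in> carrier kQ. \<forall>c. cl (\<lambda>y. c * h y) \<in> G}"
  have "f \<in> ?S"
  proof (rule path_algebra_induct[OF f])
    show "path_elem x \<in> ?S" if "f x \<noteq> 0" for x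
      using that x path_elem_closed[OF path_carrierD(2)[OF f that]] by simp
    show "(\<lambda>_. 0) \<in> ?S"
      using zero_kQ subgroup.one_closed[OF G] by (simp add: cl_zero)
    show "(\<lambda>x. g x + h x) \<in> ?S" if "g \<in> ?S" "h \<in> ?S" for g h
    proof -
      have c: "g \<in> carrier kQ" "h \<in> carrier kQ" using that by auto
      have "cl (\<lambda>y. c * (g y + h y)) \<in> G" for c
      proof -
        have "cl (\<lambda>y. c * g y) \<oplus>\<^bsub>A\<^esub> cl (\<lambda>y. c * h y) \<in> G"
          using subgroup.m_closed[OF G, of "cl (\<lambda>y. c * g y)" "cl (\<lambda>y. c * h y)"] that by simp
        then show ?thesis using cl_add[OF path_smul_closed[OF c(1)] path_smul_closed[OF c(2)], of c c]
          by (simp add: distrib_left)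
      qed
      then show ?thesis using path_add_closed[OF c] by simp
    qed
    show "(\<lambda>x. c * g x) \<in> ?S" if "g \<in> ?S" for c g
      using that path_smul_closed[of g c] by (auto simp: mult.assoc[symmetric])
  qed
  then have "cl (\<lambda>y. 1 * f y) \<in> G" by blast
  then show ?thesis by simp
qed

lemma basic_algebra_A:
  "basic_algebra A (verts Q) (vertex_idem Q I) (scalar_elem Q I) NN XX"
proof (intro basic_algebra.intro ring_A basic_algebra_axioms.intro)
  interpret A: ring A by (rule ring_A)
  note vc = vertex_closed
  show "finite (verts Q)" by simp
  show "vertex_idem Q I i \<in> carrier A" if "i \<in> verts Q" for i
    unfolding e_eq using vc[OF that] by (rule cl_closed)
  show "vertex_idem Q I i \<otimes>\<^bsub>A\<^esub> vertex_idem Q I i = vertex_idem Q I i" if "i \<in> verts Q" for i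
    unfolding e_eq using cl_mult[OF vc[OF that] vc[OF that]] path_elem_append[where 'k = 'k, of i "[]" "[]"] by simp
  show "vertex_idem Q I i \<otimes>\<^bsub>A\<^esub> vertex_idem Q I j = \<zero>\<^bsub>A\<^esub>" if "i \<in> verts Q" "j \<in> verts Q" "i \<noteq> j" for i j
  proof -
    have "path_mult Q (path_elem (i, [])) (path_elem (j, [])) = (\<lambda>_. 0 :: 'k)"
      unfolding vertex_mult[OF vc[OF that(2)]] using that(3) by (auto simp: path_elem_def fun_eq_iff)
    then show ?thesis unfolding e_eq using cl_mult[OF vc[OF that(1)] vc[OF that(2)]] cl_zero by simp
  qed
  show "finsum A (vertex_idem Q I) (verts Q) = \<one>\<^bsub>A\<^esub>"
  proof -
    have "finsum A (vertex_idem Q I) T = cl (\<lambda>(u, p). if u \<in> T \<and> p = [] then 1 else 0) \<and>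
        (\<lambda>(u, p). if u \<in> T \<and> p = [] then 1 else (0::'k)) \<in> carrier kQ" if "finite T" "T \<subseteq> verts Q" for T
      using that
    proof (induction T rule: finite_induct)
      case empty
      have "(\<lambda>(u, p). if u \<in> {} \<and> p = [] then 1 else 0) = (\<lambda>_. 0 :: 'k)" by (auto simp: fun_eq_iff)
      then show ?case using cl_zero zero_kQ by simp
    next
      case (insert j T)
      have j: "j \<in> verts Q" and T: "T \<subseteq> verts Q" using insert.prems by auto
      let ?f = "\<lambda>(u, p). if u \<in> T \<and> p = [] then 1 else (0::'k)"
      have eq: "(\<lambda>x. path_elem (j, []) x + ?f x) = (\<lambda>(u, p). if u \<in> insert j T \<and> p = [] then 1 else (0::'k))"
        using insert.hyps by (auto simp: path_elem_def fun_eq_iff)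
      have IH: "finsum A (vertex_idem Q I) T = cl ?f" "?f \<in> carrier kQ" using insert.IH[OF T] by blast+
      have s1: "finsum A (vertex_idem Q I) (insert j T) = vertex_idem Q I j \<oplus>\<^bsub>A\<^esub> finsum A (vertex_idem Q I) T"
        using insert.hyps T cl_closed[OF vc] j by (intro A.finsum_insert) (auto simp: e_eq)
      have "finsum A (vertex_idem Q I) (insert j T) = cl (\<lambda>x. path_elem (j, []) x + ?f x)"
        unfolding s1 IH(1) unfolding e_eq by (rule cl_add[OF vc[OF j] IH(2)])
      then show ?case using path_add_closed[OF vc[OF j] IH(2)] unfolding eq by blast
    qed
    from this[of "verts Q"] show ?thesis by (simp add: one_A path_algebra_simps(4))
  qed
  show "scalar_elem Q I c \<in> carrier A" for c
    unfolding s_eq using path_smul_closed[OF one_closed'] by (rule cl_closed)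
  show "scalar_elem Q I (c + d) = scalar_elem Q I c \<oplus>\<^bsub>A\<^esub> scalar_elem Q I d" for c d
    unfolding s_eq cl_add[OF path_smul_closed[OF one_closed'] path_smul_closed[OF one_closed']]
    by (simp add: distrib_right)
  show "scalar_elem Q I (c * d) = scalar_elem Q I c \<otimes>\<^bsub>A\<^esub> scalar_elem Q I d" for c d
    unfolding s_eq[of d] s_mult_cl[OF path_smul_closed[OF one_closed']] by (simp add: s_eq mult.assoc)
  show "scalar_elem Q I 1 = \<one>\<^bsub>A\<^esub>" by (simp add: s_eq one_A)
  show "scalar_elem Q I c \<otimes>\<^bsub>A\<^esub> x = x \<otimes>\<^bsub>A\<^esub> scalar_elem Q I c" if "x \<in> carrier A" for x c
    using that s_mult_cl cl_mult_s unfolding carrier_A by auto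
  show "ideal (NN p) A" for p by (rule NN_ideal)
  show "a \<otimes>\<^bsub>A\<^esub> b \<in> NN (p + q)" if ab: "a \<in> NN p" "b \<in> NN q" for a b p q
  proof -
    obtain f g where f: "f \<in> arrow_ideal_power Q p" "a = cl f" and g: "g \<in> arrow_ideal_power Q q" "b = cl g"
      using ab by (auto simp: NN_def)
    have c: "f \<in> carrier kQ" "g \<in> carrier kQ" using f g power_sub by auto
    have "path_mult Q f g \<in> arrow_ideal_power Q (p + q)"
    proof (rule powerI[OF path_mult_closed[OF c]])
      fix u w assume "path_mult Q f g (u, w) \<noteq> 0"
      then obtain n where "n \<le> length w" "f (u, take n w) \<noteq> 0" "g (awlast u (take n w), drop n w) \<noteq> 0"
        using path_mult_nz by blast
      then show "p + q \<le> length w" using powerD[OF f(1)] powerD[OF g(1)] by fastforce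
    qed
    then show ?thesis using f g cl_mult[OF c] by (simp add: NN_def)
  qed
  show "NN 0 = carrier A" by (simp add: NN_def carrier_A arrow_ideal_power_def)
  obtain m where m: "arrow_ideal_power Q m \<subseteq> I" using adm by (auto simp: admissible_ideal_def)
  show "\<exists>m. NN m = {\<zero>\<^bsub>A\<^esub>}"
  proof
    have "cl f = \<zero>\<^bsub>A\<^esub>" if "f \<in> arrow_ideal_power Q m" for f
      using that m power_sub cl_eq_zero_iff by blast
    moreover have "(\<lambda>_. 0 :: 'k) \<in> arrow_ideal_power Q m" using zero_kQ by (intro powerI) auto
    ultimately show "NN m = {\<zero>\<^bsub>A\<^esub>}" unfolding NN_def by blast
  qed
  show "\<exists>c. \<exists>n\<in>NN 1. vertex_idem Q I i \<otimes>\<^bsub>A\<^esub> a = scalar_elem Q I c \<otimes>\<^bsub>A\<^esub> vertex_idem Q I i \<oplus>\<^bsub>A\<^esub> n"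
    if i: "i \<in> verts Q" and a: "a \<in> carrier A" for i a
  proof -
    obtain f where f: "f \<in> carrier kQ" "a = cl f" using a carrier_A by auto
    let ?g = "path_mult Q (path_elem (i, [])) f"
    let ?c = "f (i, [])"
    have gc: "?g \<in> carrier kQ" by (rule path_mult_closed[OF vc[OF i] f(1)])
    \<comment> \<open>The rest of e_i a after removal of its constant term; it contains no trivial
      path.\<close>
    define n where "n = (\<lambda>x. ?g x + (- ?c) * path_elem (i, []) x)"
    have nc: "n \<in> carrier kQ" unfolding n_def by (intro path_add_closed gc path_smul_closed vc i)
    have "n (u, w) = 0" if "w = []" for u w
      unfolding n_def vertex_mult[OF f(1)] using that by (simp add: path_elem_def)
    then have z: "n (u, []) = 0" for u by simp
    have "n \<in> arrow_ideal_power Q 1"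
    proof (rule powerI[OF nc])
      fix u w assume "n (u, w) \<noteq> 0"
      then show "1 \<le> length w" using z[of u] by (cases w) auto
    qed
    moreover have "vertex_idem Q I i \<otimes>\<^bsub>A\<^esub> a = scalar_elem Q I ?c \<otimes>\<^bsub>A\<^esub> vertex_idem Q I i \<oplus>\<^bsub>A\<^esub> cl n"
      unfolding e_eq f(2) cl_mult[OF vc[OF i] f(1)] s_mult_cl[OF vc[OF i]]
        cl_add[OF path_smul_closed[OF vc[OF i]] nc] by (simp add: n_def)
    ultimately show ?thesis unfolding NN_def by blast
  qed
  show "vertex_idem Q I i \<notin> NN 1" if i: "i \<in> verts Q" for i
  proof
    assume "vertex_idem Q I i \<in> NN 1"
    then obtain f where f: "f \<in> arrow_ideal_power Q 1" "cl (path_elem (i, [])) = cl f" by (auto simp: NN_def e_eq)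
    have c: "f \<in> carrier kQ" using f power_sub by auto
    have "(\<lambda>x. path_elem (i, []) x - f x) \<in> I" using f(2) cl_eq_iff[OF vc[OF i] c] by simp
    from I_short[OF this, of "[]" i] have "f (i, []) = 1" by (simp add: path_elem_def)
    moreover have "f (i, []) = 0" using powerD[OF f(1), of i "[]"] by auto
    ultimately show False by simp
  qed
  show "\<exists>bs. set bs \<subseteq> carrier A \<and> (\<forall>G. subgroup G (add_monoid A) \<longrightarrow>
      (\<forall>c. \<forall>x\<in>G. scalar_elem Q I c \<otimes>\<^bsub>A\<^esub> x \<in> G) \<longrightarrow> set bs \<subseteq> G \<longrightarrow> carrier A \<subseteq> G)"
  proof -
    \<comment> \<open>Paths longer than \<open>m\<close> vanish in the algebra, since the
      \<open>m\<close>-th power of the arrow ideal lies in \<open>I\<close>; the finitely many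
      others span it.\<close>
    let ?P = "{x \<in> qpaths Q. length (snd x) \<le> m}"
    have "?P \<subseteq> verts Q \<times> {p. set p \<subseteq> arcs Q \<and> length p \<le> m}"
      by (auto simp: qpaths_iff awalk_def)
    then have fin: "finite ?P"
      by (rule finite_subset) (intro finite_cartesian_product finite_lists_length_le, simp_all)
    then obtain ps where ps: "set ps = ?P" using finite_list by blast
    let ?bs = "map (\<lambda>x. cl (path_elem x)) ps"
    have "set ?bs \<subseteq> carrier A" using ps path_elem_closed by auto
    moreover have "carrier A \<subseteq> G" if G: "subgroup G (add_monoid A)"
      and sG: "\<forall>c. \<forall>x\<in>G. scalar_elem Q I c \<otimes>\<^bsub>A\<^esub> x \<in> G" and b: "set ?bs \<subseteq> G" for G
    proof
      fix a assume "a \<in> carrier A"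
      then obtain f where f: "f \<in> carrier kQ" "a = cl f" using carrier_A by auto
      have "cl f \<in> G"
      proof (rule smul_induct[OF f(1) G])
        fix x c assume "f x \<noteq> 0"
        then have x: "x \<in> qpaths Q" using path_carrierD(2)[OF f(1)] by blast
        have pc: "path_elem x \<in> carrier kQ" by (rule path_elem_closed[OF x])
        have "cl (path_elem x) \<in> G"
        proof (cases "length (snd x) \<le> m")
          case True
          then show ?thesis using b x ps by auto
        next
          case False
          then have "(path_elem x :: 'v \<times> 'e list \<Rightarrow> 'k) \<in> arrow_ideal_power Q m"
            by (intro powerI pc) (auto simp: path_elem_def split: if_splits)
          then have "cl (path_elem x) = \<zero>\<^bsub>A\<^esub>" using m cl_eq_zero_iff[OF pc] by blast
          then show ?thesis using subgroup.one_closed[OF G] by simp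
        qed
        then have "scalar_elem Q I c \<otimes>\<^bsub>A\<^esub> cl (path_elem x) \<in> G" using sG by blast
        then show "cl (\<lambda>y. c * path_elem x y) \<in> G" by (simp add: s_mult_cl[OF pc])
      qed
      then show "a \<in> G" using f by simp
    qed
    ultimately show ?thesis by (intro exI[of _ ?bs] conjI allI impI) blast+
  qed
  show "i \<in> verts Q \<and> j \<in> verts Q \<and> \<alpha> \<in> NN 1 \<and> \<alpha> \<notin> NN 2 \<and> vertex_idem Q I i \<otimes>\<^bsub>A\<^esub> \<alpha> = \<alpha> \<and>
      \<alpha> \<otimes>\<^bsub>A\<^esub> vertex_idem Q I j = \<alpha>" if X: "(i, \<alpha>, j) \<in> XX" for i \<alpha> j
  proof -
    obtain a where a: "a \<in> arcs Q" "i = tail Q a" "j = head Q a" "\<alpha> = cl (path_elem (i, [a]))"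
      using X unfolding XX_def by blast
    have ij: "i \<in> verts Q" "j \<in> verts Q" using a by auto
    have ac: "path_elem (i, [a]) \<in> carrier kQ"
      using a ij by (intro path_elem_closed) (simp add: qpaths_Cons)
    have "(path_elem (i, [a]) :: 'v \<times> 'e list \<Rightarrow> 'k) \<in> arrow_ideal_power Q 1"
      by (intro powerI ac) (auto simp: path_elem_def split: if_splits)
    then have "\<alpha> \<in> NN 1" by (simp add: NN_def a(4))
    moreover have "\<alpha> \<notin> NN 2"
    proof
      assume "\<alpha> \<in> NN 2"
      then obtain f where f: "f \<in> arrow_ideal_power Q 2" "cl (path_elem (i, [a])) = cl f" by (auto simp: NN_def a(4))
      have c: "f \<in> carrier kQ" using f power_sub by auto
      have "(\<lambda>x. path_elem (i, [a]) x - f x) \<in> I" using f(2) cl_eq_iff[OF ac c] by simp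
      from I_short[OF this, of "[a]" i] have "f (i, [a]) = 1" by (simp add: path_elem_def)
      moreover have "f (i, [a]) = 0" using powerD[OF f(1), of i "[a]"] by auto
      ultimately show False by simp
    qed
    moreover have "vertex_idem Q I i \<otimes>\<^bsub>A\<^esub> \<alpha> = \<alpha>"
      unfolding e_eq a(4) cl_mult[OF vc[OF ij(1)] ac] using path_elem_append[where 'k = 'k, of i "[]" "[a]"] by simp
    moreover have "\<alpha> \<otimes>\<^bsub>A\<^esub> vertex_idem Q I j = \<alpha>"
      unfolding e_eq a(4) cl_mult[OF ac vc[OF ij(2)]] using path_elem_append[where 'k = 'k, of i "[a]" "[]"] a(3) by simp
    ultimately show ?thesis using ij by simp
  qed
  show "n \<otimes>\<^bsub>A\<^esub> vertex_idem Q I v \<in> G" if n: "n \<in> NN 1" and v: "v \<in> verts Q" and G: "subgroup G (add_monoid A)"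
    and mem: "\<And>x \<alpha> a. (x, \<alpha>, v) \<in> XX \<Longrightarrow> a \<in> carrier A \<Longrightarrow> a \<otimes>\<^bsub>A\<^esub> \<alpha> \<in> G" for n v G
  proof -
    obtain f where f: "f \<in> arrow_ideal_power Q 1" "n = cl f" using n by (auto simp: NN_def)
    have c: "f \<in> carrier kQ" using f power_sub by auto
    let ?g = "path_mult Q f (path_elem (v, []))"
    have "cl ?g \<in> G"
    proof (rule smul_induct[OF path_mult_closed[OF c vc[OF v]] G])
      fix x :: "'v \<times> 'e list" and c' :: 'k assume gx: "?g x \<noteq> 0"
      obtain u p where x: "x = (u, p)" by fastforce
      have fp: "f (u, p) \<noteq> 0" "awlast u p = v" using gx by (auto simp: x mult_vertex[OF c] split: if_splits)
      then have "p \<noteq> []" using powerD[OF f(1), of u p] by auto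
      \<comment> \<open>A nontrivial path into \<open>v\<close> ends with an arrow into
        \<open>v\<close>; the scalar is absorbed by the part in front of that arrow.\<close>
      then obtain p' a where p: "p = p' @ [a]" by (metis rev_exhaust)
      have up: "(u, p') \<in> qpaths Q" "(awlast u p', [a]) \<in> qpaths Q"
        using path_carrierD(2)[OF c fp(1)] qpaths_append by (auto simp: p)
      have a: "a \<in> arcs Q" "tail Q a = awlast u p'" using up(2) by (auto simp: qpaths_Cons)
      have hv: "head Q a = v" using fp(2) by (simp add: p awlast_append)
      have ac: "path_elem (awlast u p', [a]) \<in> carrier kQ" by (rule path_elem_closed[OF up(2)])
      have "path_mult Q (\<lambda>y. c' * path_elem (u, p') y) (path_elem (awlast u p', [a])) = (\<lambda>y. c' * path_elem x y)"
        by (simp add: path_smul_mult path_elem_append x p)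
      then have "cl (\<lambda>y. c' * path_elem x y) = cl (\<lambda>y. c' * path_elem (u, p') y) \<otimes>\<^bsub>A\<^esub> cl (path_elem (awlast u p', [a]))"
        using cl_mult[OF path_smul_closed[OF path_elem_closed[OF up(1)]] ac, of c'] by simp
      moreover have "(awlast u p', cl (path_elem (awlast u p', [a])), v) \<in> XX" using a hv by (rule XXI)
      ultimately show "cl (\<lambda>y. c' * path_elem x y) \<in> G"
        using mem[OF _ cl_closed[OF path_smul_closed[OF path_elem_closed[OF up(1)]]]] by simp
    qed
    then show ?thesis using cl_mult[OF c vc[OF v]] by (simp add: f(2) e_eq)
  qed
  show "vertex_idem Q I v \<otimes>\<^bsub>A\<^esub> n \<in> G" if n: "n \<in> NN 1" and v: "v \<in> verts Q" and G: "subgroup G (add_monoid A)"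
    and mem: "\<And>y \<alpha> a. (v, \<alpha>, y) \<in> XX \<Longrightarrow> a \<in> carrier A \<Longrightarrow> \<alpha> \<otimes>\<^bsub>A\<^esub> a \<in> G" for n v G
  proof -
    obtain f where f: "f \<in> arrow_ideal_power Q 1" "n = cl f" using n by (auto simp: NN_def)
    have c: "f \<in> carrier kQ" using f power_sub by auto
    let ?g = "path_mult Q (path_elem (v, [])) f"
    have "cl ?g \<in> G"
    proof (rule smul_induct[OF path_mult_closed[OF vc[OF v] c] G])
      fix x :: "'v \<times> 'e list" and c' :: 'k assume gx: "?g x \<noteq> 0"
      obtain u p where x: "x = (u, p)" by fastforce
      have fp: "f (u, p) \<noteq> 0" "u = v" using gx by (auto simp: x vertex_mult[OF c] split: if_splits)
      then have "p \<noteq> []" using powerD[OF f(1), of u p] by auto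
      then obtain p' a where p: "p = a # p'" by (cases p) auto
      have up: "(v, [a]) \<in> qpaths Q" "(head Q a, p') \<in> qpaths Q" and a: "a \<in> arcs Q" "tail Q a = v"
        using path_carrierD(2)[OF c fp(1)] fp(2) by (auto simp: p qpaths_Cons)
      have ac: "path_elem (v, [a]) \<in> carrier kQ" by (rule path_elem_closed[OF up(1)])
      have "path_mult Q (path_elem (v, [a])) (\<lambda>y. c' * path_elem (head Q a, p') y) = (\<lambda>y. c' * path_elem x y)"
        using path_elem_append[where 'k = 'k, of v "[a]" p'] fp(2) by (simp add: path_smul_mult x p)
      then have "cl (\<lambda>y. c' * path_elem x y) = cl (path_elem (v, [a])) \<otimes>\<^bsub>A\<^esub> cl (\<lambda>y. c' * path_elem (head Q a, p') y)"
        using cl_mult[OF ac path_smul_closed[OF path_elem_closed[OF up(2)]], of c'] by simp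
      moreover have "(v, cl (path_elem (v, [a])), head Q a) \<in> XX" using a by (intro XXI) auto
      ultimately show "cl (\<lambda>y. c' * path_elem x y) \<in> G"
        using mem[OF _ cl_closed[OF path_smul_closed[OF path_elem_closed[OF up(2)]]]] by simp
    qed
    then show ?thesis using cl_mult[OF vc[OF v] c] by (simp add: f(2) e_eq)
  qed
  show "\<exists>\<kappa> \<epsilon> \<epsilon>'.
      (\<forall>a\<in>carrier A. \<forall>b\<in>carrier A. \<kappa> (a \<oplus>\<^bsub>A\<^esub> b) = \<kappa> a + (\<kappa> b :: 'k) \<and> \<epsilon> (a \<oplus>\<^bsub>A\<^esub> b) = \<epsilon> a + (\<epsilon> b :: 'k) \<and>
        \<kappa> (a \<otimes>\<^bsub>A\<^esub> b) = \<epsilon>' a * \<kappa> b + \<kappa> a * \<epsilon> b \<and> \<epsilon> (a \<otimes>\<^bsub>A\<^esub> b) = \<epsilon> a * \<epsilon> b) \<and>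
      \<kappa> \<alpha> = 1 \<and> (\<forall>c. \<kappa> (scalar_elem Q I c) = 0 \<and> \<epsilon> (scalar_elem Q I c) = c \<and> \<epsilon>' (scalar_elem Q I c) = c) \<and>
      (\<forall>q\<in>verts Q. \<kappa> (vertex_idem Q I q) = 0 \<and> \<epsilon> (vertex_idem Q I q) = (if q = j then 1 else 0) \<and>
        \<epsilon>' (vertex_idem Q I q) = (if q = i then 1 else 0))" if X: "(i, \<alpha>, j) \<in> XX" for i \<alpha> j
  proof -
    obtain a where a: "a \<in> arcs Q" "i = tail Q a" "j = head Q a" "\<alpha> = cl (path_elem (i, [a]))"
      using X unfolding XX_def by blast
    have ij: "i \<in> verts Q" "j \<in> verts Q" using a by auto
    have ac: "path_elem (i, [a]) \<in> carrier kQ"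
      using a ij by (intro path_elem_closed) (simp add: qpaths_Cons)
    \<comment> \<open>The coefficients of the arrow and of the trivial paths at its target and its
      source. A path of length one has only two cuts, which gives the product rule.\<close>
    let ?k = "coef (i, [a])" and ?e = "coef (j, [])" and ?e' = "coef (i, [])"
    have add: "?k (x \<oplus>\<^bsub>A\<^esub> y) = ?k x + ?k y \<and> ?e (x \<oplus>\<^bsub>A\<^esub> y) = ?e x + ?e y \<and>
        ?k (x \<otimes>\<^bsub>A\<^esub> y) = ?e' x * ?k y + ?k x * ?e y \<and> ?e (x \<otimes>\<^bsub>A\<^esub> y) = ?e x * ?e y"
      if "x \<in> carrier A" "y \<in> carrier A" for x y
    proof -
      obtain f g where f: "f \<in> carrier kQ" "x = cl f" and g: "g \<in> carrier kQ" "y = cl g"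
        using \<open>x \<in> carrier A\<close> \<open>y \<in> carrier A\<close> carrier_A by auto
      have "path_mult Q f g (i, [a]) = f (i, []) * g (i, [a]) + f (i, [a]) * g (j, [])"
        by (simp add: path_mult_apply a(3) atMost_Suc)
      moreover have "path_mult Q f g (j, []) = f (j, []) * g (j, [])"
        by (simp add: path_mult_apply)
      ultimately show ?thesis
        using f g by (simp add: cl_add cl_mult coef_cl path_add_closed path_mult_closed)
    qed
    have sc: "?k (scalar_elem Q I c) = 0 \<and> ?e (scalar_elem Q I c) = c \<and> ?e' (scalar_elem Q I c) = c" for c
      using ij path_smul_closed[OF one_closed', of c] by (simp add: s_eq coef_cl path_algebra_simps(4))
    have ve: "?k (vertex_idem Q I q) = 0 \<and> ?e (vertex_idem Q I q) = (if q = j then 1 else 0) \<and>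
        ?e' (vertex_idem Q I q) = (if q = i then 1 else 0)" if "q \<in> verts Q" for q
      using vc[OF that] by (simp add: e_eq coef_cl) (simp add: path_elem_def)
    have k1: "?k \<alpha> = 1" using ac by (simp add: a(4) coef_cl) (simp add: path_elem_def)
    show ?thesis
      by (rule exI[of _ ?k], rule exI[of _ ?e], rule exI[of _ ?e'])
        (intro conjI ballI allI, simp_all add: add sc ve k1)
  qed
qed

sublocale R: basic_algebra A "verts Q" "vertex_idem Q I" "scalar_elem Q I" NN XX
  by (rule basic_algebra_A)

section \<open>Translation from bound quiver algebras to basic algebras\<close>

lemma proj_mod_eq: "proj_mod Q I i = R.pmod i"
  by (simp add: proj_mod_def Let_def R.pmod_def restrict_mod_def R.reg_def R.eR_def)

lemma simple_at_eq: "simple_at Q I i = R.simp_of i"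
  by (simp add: simple_at_def R.simp_of_def proj_mod_eq)

lemma inj_mod_eq: "inj_mod Q I i = R.imod i"
  by (simp add: inj_mod_def left_proj_def Let_def R.imod_def R.lP_def)

lemma factors_below_eq: "factors_below Q I r i M = R.fbelow r i M"
  by (simp add: factors_below_def R.fbelow_def simple_at_eq)

lemma std_kernel_eq: "i \<in> verts Q \<Longrightarrow> std_kernel Q I r i = R.ker r i"
  unfolding std_kernel_def proj_mod_eq factors_below_eq by (rule R.ker_least)

lemma std_mod_eq: "i \<in> verts Q \<Longrightarrow> std_mod Q I r i = R.stdm r i"
  by (simp add: std_mod_def R.stdm_def std_kernel_eq proj_mod_eq)

lemma costd_mod_eq: "i \<in> verts Q \<Longrightarrow> costd_mod Q I r i = R.costdm r i"
  unfolding costd_mod_def R.costdm_def inj_mod_eq factors_below_eq by (simp add: R.costd_greatest)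

lemma qh_eq: "quasi_hereditary_order Q I r \<longleftrightarrow> R.qh r"
proof -
  have "(let K = restrict_mod (proj_mod Q I i) (std_kernel Q I r i) in
         \<exists>F. filtration A K F \<and> (\<forall>l. Suc l < length F \<longrightarrow>
             (\<exists>j\<in>verts Q. (i, j) \<in> r - Id \<and> mod_iso A (subquot K F l) (std_mod Q I r j)))) \<longleftrightarrow>
      (\<exists>J. R.dfil r J (R.ker r i) \<and> (\<forall>j\<in>J. j \<in> verts Q \<and> (i, j) \<in> r - Id))" if i: "i \<in> verts Q" for i
  proof -
    have K: "restrict_mod (proj_mod Q I i) (std_kernel Q I r i) = restrict_mod R.reg (R.ker r i)"
      by (simp add: proj_mod_eq R.pmod_def std_kernel_eq[OF i])
    show ?thesis
      unfolding Let_def K using R.dfil_iff_filtration[OF i R.ker_subm[OF i], of r "\<lambda>j. (i, j) \<in> r - Id" r]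
      by (simp add: std_mod_eq cong: bex_cong)
  qed
  then show ?thesis
    unfolding quasi_hereditary_order_def R.qh_def
    using R.stdm_comp_mult_one by (simp add: std_mod_eq simple_at_eq cong: ball_cong)
qed

text \<open>The zero of a quotient module is the submodule itself, so equal quotients have equal
  kernels.\<close>

lemma stdm_eq_iff: "i \<in> verts Q \<Longrightarrow> R.stdm r i = R.stdm r' i \<longleftrightarrow> R.ker r i = R.ker r' i"
  by (auto simp: R.stdm_def quot_mod_def)

lemma equivalent_orders_eq:
  "equivalent_orders Q I = {(r, r'). R.qh r \<and> R.qh r' \<and> (\<forall>i\<in>verts Q. R.ker r i = R.ker r' i)}"
  unfolding equivalent_orders_def qh_eq using stdm_eq_iff by (auto simp: std_mod_eq)

lemma min_adapted_eq: "min_adapted Q I \<X> = R.madapt \<X>"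
  unfolding min_adapted_def R.madapt_def
  by (rule arg_cong[of _ _ trancl]) (simp add: std_mod_eq costd_mod_eq simple_at_eq cong: conj_cong)

end

section \<open>Transfer along surjective homomorphisms\<close>

text \<open>\<open>R\<close> is the larger algebra; \<pi> keeps the idempotents of the vertices
  coming from \<open>V'\<close> and kills the others. For the glued algebra, \<pi> is induced by
  killing all paths outside one of the two quivers.\<close>

locale basic_hom = C: basic_algebra R V e s N X + D: basic_algebra R' V' e' s' N' X'
  for R :: "('r, 'z) ring_scheme" and V :: "'v set" and e and s :: "'k::field \<Rightarrow> 'r" and N X
    and R' :: "('r2, 'z2) ring_scheme" and V' :: "'v2 set" and e' and s' :: "'k \<Rightarrow> 'r2" and N' X' +
  fixes \<iota> :: "'v2 \<Rightarrow> 'v" and \<pi> :: "'r \<Rightarrow> 'r2"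
  assumes inj: "inj \<iota>" and iota_V: "i \<in> V' \<Longrightarrow> \<iota> i \<in> V"
    and hom: "\<pi> \<in> ring_hom R R'" and surj: "y \<in> carrier R' \<Longrightarrow> \<exists>x\<in>carrier R. \<pi> x = y"
    and pi_e: "i \<in> V' \<Longrightarrow> \<pi> (e (\<iota> i)) = e' i"
    and pi_e0: "q \<in> V \<Longrightarrow> q \<notin> \<iota> ` V' \<Longrightarrow> \<pi> (e q) = \<zero>\<^bsub>R'\<^esub>"
    and pi_s: "\<pi> (s c) = s' c"
begin

definition restr :: "('v \<times> 'v) set \<Rightarrow> ('v2 \<times> 'v2) set" where
  "restr r = {(a, b). a \<in> V' \<and> b \<in> V' \<and> (\<iota> a, \<iota> b) \<in> r}"

text \<open>P(\<iota> i) over \<open>R\<close> is then identified with P(i) over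
  \<open>R'\<close>.\<close>

definition inj_at :: "'v2 \<Rightarrow> bool" where
  "inj_at i \<longleftrightarrow> (\<forall>x\<in>C.eR (\<iota> i). \<pi> x = \<zero>\<^bsub>R'\<^esub> \<longrightarrow> x = \<zero>\<^bsub>R\<^esub>)"

text \<open>This says that the standard module of \<iota> j is already a module over
  \<open>R'\<close>, namely the standard module of \<open>j\<close> for the restricted order. It
  follows from injectivity on P(\<iota> j) by \<open>inj_at_covered\<close>, and it is exactly what
  a filtration step with label \<open>j\<close> requires.\<close>

definition ker_covered :: "('v \<times> 'v) set \<Rightarrow> 'v2 \<Rightarrow> bool" where
  "ker_covered r j \<longleftrightarrow> (\<forall>x\<in>C.eR (\<iota> j). \<pi> x = \<zero>\<^bsub>R'\<^esub> \<longrightarrow> x \<in> C.ker r (\<iota> j))"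

lemma pi_simps [simp]:
  "x \<in> carrier R \<Longrightarrow> \<pi> x \<in> carrier R'"
  "x \<in> carrier R \<Longrightarrow> y \<in> carrier R \<Longrightarrow> \<pi> (x \<otimes>\<^bsub>R\<^esub> y) = \<pi> x \<otimes>\<^bsub>R'\<^esub> \<pi> y"
  "x \<in> carrier R \<Longrightarrow> y \<in> carrier R \<Longrightarrow> \<pi> (x \<oplus>\<^bsub>R\<^esub> y) = \<pi> x \<oplus>\<^bsub>R'\<^esub> \<pi> y"
  using hom by (simp_all add: ring_hom_closed ring_hom_mult ring_hom_add)

lemma pi_zero [simp]: "\<pi> \<zero>\<^bsub>R\<^esub> = \<zero>\<^bsub>R'\<^esub>"
  by (rule ring_hom_zero[OF hom C.ring_axioms D.ring_axioms])

lemma pi_uminus: "x \<in> carrier R \<Longrightarrow> \<pi> (\<ominus>\<^bsub>R\<^esub> x) = \<ominus>\<^bsub>R'\<^esub> \<pi> x"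
  by (rule D.minus_equality[symmetric]) (simp_all add: pi_simps(3)[symmetric] C.l_neg del: pi_simps(3))

lemma pi_minus: "x \<in> carrier R \<Longrightarrow> y \<in> carrier R \<Longrightarrow> \<pi> (x \<ominus>\<^bsub>R\<^esub> y) = \<pi> x \<ominus>\<^bsub>R'\<^esub> \<pi> y"
  by (simp add: a_minus_def pi_uminus)

lemma pi_minus_zero: "x \<in> carrier R \<Longrightarrow> y \<in> carrier R \<Longrightarrow> \<pi> x = \<pi> y \<Longrightarrow> \<pi> (x \<ominus>\<^bsub>R\<^esub> y) = \<zero>\<^bsub>R'\<^esub>"
  by (simp add: pi_minus) (simp add: a_minus_def D.r_neg)

lemma inj_at_eq:
  assumes i: "i \<in> V'" and ia: "inj_at i" and x: "x \<in> C.eR (\<iota> i)" and y: "y \<in> C.eR (\<iota> i)" and eq: "\<pi> x = \<pi> y"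
  shows "x = y"
proof -
  note E = C.eR_subm[OF iota_V[OF i]]
  have R: "x \<in> carrier R" "y \<in> carrier R" using x y C.eR_sub[OF iota_V[OF i]] by auto
  have "x \<ominus>\<^bsub>R\<^esub> y \<in> C.eR (\<iota> i)" using C.reg.submD(7)[OF E x y] by simp
  moreover have "\<pi> (x \<ominus>\<^bsub>R\<^esub> y) = \<zero>\<^bsub>R'\<^esub>" using R eq by (intro pi_minus_zero)
  ultimately have "x \<ominus>\<^bsub>R\<^esub> y = \<zero>\<^bsub>R\<^esub>" using ia unfolding inj_at_def by blast
  then show ?thesis using C.reg.minus_add_cancel(1)[of x y] R by simp
qed

lemma pi_eR:
  assumes i: "i \<in> V'"
  shows "x \<in> C.eR (\<iota> i) \<Longrightarrow> \<pi> x \<in> D.eR i" "y \<in> D.eR i \<Longrightarrow> \<exists>x\<in>C.eR (\<iota> i). \<pi> x = y"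
proof -
  note iV = iota_V[OF i]
  show "\<pi> x \<in> D.eR i" if x: "x \<in> C.eR (\<iota> i)"
  proof -
    have "x \<in> carrier R" "e (\<iota> i) \<otimes>\<^bsub>R\<^esub> x = x" using x C.eR_iff[OF iV] by auto
    then show ?thesis using pi_simps(2)[of "e (\<iota> i)" x] iV unfolding D.eR_iff[OF i] by (simp add: pi_e[OF i])
  qed
  show "\<exists>x\<in>C.eR (\<iota> i). \<pi> x = y" if y: "y \<in> D.eR i"
  proof -
    have yR: "y \<in> carrier R'" "e' i \<otimes>\<^bsub>R'\<^esub> y = y" using y D.eR_iff[OF i] by auto
    obtain x where x: "x \<in> carrier R" "\<pi> x = y" using surj[OF yR(1)] by blast
    have "e (\<iota> i) \<otimes>\<^bsub>R\<^esub> x \<in> C.eR (\<iota> i)" using x by (auto simp: C.eR_def)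
    moreover have "\<pi> (e (\<iota> i) \<otimes>\<^bsub>R\<^esub> x) = y" using x iV yR(2) by (simp add: pi_e[OF i])
    ultimately show ?thesis by blast
  qed
qed

lemma image_subm:
  assumes U: "C.reg.subm U"
  shows "D.reg.subm (\<pi> ` U)"
proof -
  note u = C.reg.submD[OF U]
  show ?thesis
    unfolding D.reg.subm_iff
  proof (intro conjI ballI)
    show "\<pi> ` U \<subseteq> carrier D.reg" using u(3) by auto
    show "\<zero>\<^bsub>D.reg\<^esub> \<in> \<pi> ` U" using u(2) by (intro image_eqI[of _ _ "\<zero>\<^bsub>R\<^esub>"]) simp_all
    show "x \<oplus>\<^bsub>D.reg\<^esub> y \<in> \<pi> ` U" if xy: "x \<in> \<pi> ` U" "y \<in> \<pi> ` U" for x y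
    proof -
      obtain a b where "a \<in> U" "b \<in> U" "x = \<pi> a" "y = \<pi> b" using xy by blast
      then show ?thesis using u(3,4)[of a] u(3,4)[of b] by (intro image_eqI[of _ _ "a \<oplus>\<^bsub>R\<^esub> b"]) auto
    qed
    show "a \<odot>\<^bsub>D.reg\<^esub> x \<in> \<pi> ` U" if a: "a \<in> carrier R'" and x: "x \<in> \<pi> ` U" for a x
    proof -
      obtain b where b: "b \<in> U" "x = \<pi> b" using x by blast
      obtain c where c: "c \<in> carrier R" "\<pi> c = a" using surj[OF a] by blast
      then show ?thesis using b u(3)[of b] u(5)[of c b] by (intro image_eqI[of _ _ "b \<otimes>\<^bsub>R\<^esub> c"]) auto
    qed
  qed
qed

lemma preimage_subm:
  assumes U: "D.reg.subm U"
  shows "C.reg.subm {x \<in> carrier R. \<pi> x \<in> U}"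
proof -
  note u = D.reg.submD[OF U]
  show ?thesis
    unfolding C.reg.subm_iff
  proof (intro conjI ballI)
    show "\<zero>\<^bsub>C.reg\<^esub> \<in> {x \<in> carrier R. \<pi> x \<in> U}" using u(2) by simp
    show "x \<oplus>\<^bsub>C.reg\<^esub> y \<in> {x \<in> carrier R. \<pi> x \<in> U}"
      if "x \<in> {x \<in> carrier R. \<pi> x \<in> U}" "y \<in> {x \<in> carrier R. \<pi> x \<in> U}" for x y
      using that u(4)[of "\<pi> x" "\<pi> y"] by simp
    show "a \<odot>\<^bsub>C.reg\<^esub> x \<in> {x \<in> carrier R. \<pi> x \<in> U}"
      if "a \<in> carrier R" "x \<in> {x \<in> carrier R. \<pi> x \<in> U}" for a x
      using that u(5)[of "\<pi> a" "\<pi> x"] by simp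
  qed auto
qed

text \<open>The generators correspond: elements of P(i) over \<open>R'\<close> lift to P(\<iota> i),
  and the idempotents of the vertices not coming from \<open>V'\<close> are killed.\<close>

lemma image_ker:
  assumes i: "i \<in> V'"
  shows "\<pi> ` C.ker r (\<iota> i) = D.ker (restr r) i"
proof
  note iV = iota_V[OF i]
  have "C.ker r (\<iota> i) \<subseteq> {x \<in> carrier R. \<pi> x \<in> D.ker (restr r) i}"
    unfolding C.ker_def
  proof (rule C.trace_least[OF preimage_subm[OF D.ker_subm[OF i]]])
    fix x q assume x: "x \<in> C.eR (\<iota> i)" and q: "q \<in> V" "(q, \<iota> i) \<notin> r"
    have xR: "x \<in> carrier R" using x C.eR_sub[OF iV] by blast
    have "\<pi> x \<otimes>\<^bsub>R'\<^esub> \<pi> (e q) \<in> D.ker (restr r) i"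
    proof (cases "q \<in> \<iota> ` V'")
      case True
      then obtain q' where q': "q' \<in> V'" "q = \<iota> q'" by blast
      then have "(q', i) \<notin> restr r" using q by (simp add: restr_def)
      then show ?thesis unfolding q'(2) pi_e[OF q'(1)] D.ker_def using pi_eR(1)[OF i x] q'(1) by (intro D.trace_in)
    next
      case False
      then show ?thesis using pi_e0[OF q(1)] xR D.reg.submD(2)[OF D.ker_subm[OF i]] by simp
    qed
    then show "x \<otimes>\<^bsub>R\<^esub> e q \<in> {x \<in> carrier R. \<pi> x \<in> D.ker (restr r) i}" using xR q by simp
  qed
  then show "\<pi> ` C.ker r (\<iota> i) \<subseteq> D.ker (restr r) i" by blast
  show "D.ker (restr r) i \<subseteq> \<pi> ` C.ker r (\<iota> i)"
    unfolding D.ker_def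
  proof (rule D.trace_least[OF image_subm[OF C.ker_subm[OF iV]]])
    fix y q assume y: "y \<in> D.eR i" and q: "q \<in> V'" "(q, i) \<notin> restr r"
    obtain x where x: "x \<in> C.eR (\<iota> i)" "\<pi> x = y" using pi_eR(2)[OF i y] by blast
    have "(\<iota> q, \<iota> i) \<notin> r" using q i by (simp add: restr_def)
    then have "x \<otimes>\<^bsub>R\<^esub> e (\<iota> q) \<in> C.ker r (\<iota> i)" unfolding C.ker_def using x iota_V[OF q(1)] by (intro C.trace_in)
    moreover have "\<pi> (x \<otimes>\<^bsub>R\<^esub> e (\<iota> q)) = y \<otimes>\<^bsub>R'\<^esub> e' q"
      using x C.eR_sub[OF iV] iota_V[OF q(1)] by (auto simp: pi_e[OF q(1)])
    ultimately show "y \<otimes>\<^bsub>R'\<^esub> e' q \<in> \<pi> ` C.ker r (\<iota> i)" by (metis imageI)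
  qed
qed

lemma ker_mem_iff:
  assumes j: "j \<in> V'" and kc: "ker_covered r j" and x: "x \<in> C.eR (\<iota> j)"
  shows "x \<in> C.ker r (\<iota> j) \<longleftrightarrow> \<pi> x \<in> D.ker (restr r) j"
proof
  note jV = iota_V[OF j]
  show "x \<in> C.ker r (\<iota> j) \<Longrightarrow> \<pi> x \<in> D.ker (restr r) j" using image_ker[OF j, of r] by blast
  assume "\<pi> x \<in> D.ker (restr r) j"
  then obtain k where k: "k \<in> C.ker r (\<iota> j)" "\<pi> x = \<pi> k" using image_ker[OF j, of r] by blast
  have kE: "k \<in> C.eR (\<iota> j)" using k C.ker_sub[OF jV] by blast
  have R: "x \<in> carrier R" "k \<in> carrier R" using x kE C.eR_sub[OF jV] by auto
  have "x \<ominus>\<^bsub>R\<^esub> k \<in> C.eR (\<iota> j)" using C.reg.submD(7)[OF C.eR_subm[OF jV] x kE] by simp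
  moreover have "\<pi> (x \<ominus>\<^bsub>R\<^esub> k) = \<zero>\<^bsub>R'\<^esub>" using R k by (intro pi_minus_zero)
  ultimately have "x \<ominus>\<^bsub>R\<^esub> k \<in> C.ker r (\<iota> j)" using kc unfolding ker_covered_def by blast
  then have "x \<ominus>\<^bsub>R\<^esub> k \<oplus>\<^bsub>R\<^esub> k \<in> C.ker r (\<iota> j)"
    using C.reg.submD(4)[OF C.ker_subm[OF jV] _ k(1)] by simp
  then show "x \<in> C.ker r (\<iota> j)" using C.reg.minus_add_cancel(1)[of x k] R by simp
qed

lemma inj_at_covered: "i \<in> V' \<Longrightarrow> inj_at i \<Longrightarrow> ker_covered r i"
  unfolding inj_at_def ker_covered_def using C.reg.submD(2)[OF C.ker_subm[OF iota_V]] by fastforce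

lemma schur_iff:
  assumes i: "i \<in> V'" and ia: "inj_at i"
  shows "C.schur r (\<iota> i) \<longleftrightarrow> D.schur (restr r) i"
proof -
  note iV = iota_V[OF i] and mem = ker_mem_iff[OF i inj_at_covered[OF i ia]]
  have 1: "e (\<iota> i) \<in> C.ker r (\<iota> i) \<longleftrightarrow> e' i \<in> D.ker (restr r) i"
    using mem[OF C.e_in_eR[OF iV]] by (simp add: pi_e[OF i])
  have 2: "e (\<iota> i) \<otimes>\<^bsub>R\<^esub> a \<otimes>\<^bsub>R\<^esub> e (\<iota> i) \<ominus>\<^bsub>R\<^esub> s c \<otimes>\<^bsub>R\<^esub> e (\<iota> i) \<in> C.ker r (\<iota> i) \<longleftrightarrow>
      e' i \<otimes>\<^bsub>R'\<^esub> \<pi> a \<otimes>\<^bsub>R'\<^esub> e' i \<ominus>\<^bsub>R'\<^esub> s' c \<otimes>\<^bsub>R'\<^esub> e' i \<in> D.ker (restr r) i" if a: "a \<in> carrier R" for a c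
  proof -
    have "e (\<iota> i) \<otimes>\<^bsub>R\<^esub> a \<otimes>\<^bsub>R\<^esub> e (\<iota> i) \<in> C.eR (\<iota> i)" using a iV by (simp add: C.eR_iff C.m_assoc[symmetric] C.e_idem)
    moreover have "s c \<otimes>\<^bsub>R\<^esub> e (\<iota> i) \<in> C.eR (\<iota> i)"
      using iV by (simp add: C.eR_iff C.s_comm[of "e (\<iota> i)"] C.m_assoc[symmetric] C.e_idem)
    ultimately have "e (\<iota> i) \<otimes>\<^bsub>R\<^esub> a \<otimes>\<^bsub>R\<^esub> e (\<iota> i) \<ominus>\<^bsub>R\<^esub> s c \<otimes>\<^bsub>R\<^esub> e (\<iota> i) \<in> C.eR (\<iota> i)"
      using C.reg.submD(7)[OF C.eR_subm[OF iV]] by simp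
    from mem[OF this] show ?thesis using a iV by (simp add: pi_minus pi_e[OF i] pi_s)
  qed
  show ?thesis
    unfolding C.schur_def D.schur_def 1
  proof (intro conj_cong refl iffI ballI)
    fix b assume H: "\<forall>a\<in>carrier R. \<exists>c. e (\<iota> i) \<otimes>\<^bsub>R\<^esub> a \<otimes>\<^bsub>R\<^esub> e (\<iota> i) \<ominus>\<^bsub>R\<^esub> s c \<otimes>\<^bsub>R\<^esub> e (\<iota> i) \<in> C.ker r (\<iota> i)"
      and b: "b \<in> carrier R'"
    obtain a where a: "a \<in> carrier R" "\<pi> a = b" using surj[OF b] by blast
    then show "\<exists>c. e' i \<otimes>\<^bsub>R'\<^esub> b \<otimes>\<^bsub>R'\<^esub> e' i \<ominus>\<^bsub>R'\<^esub> s' c \<otimes>\<^bsub>R'\<^esub> e' i \<in> D.ker (restr r) i"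
      using H 2[OF a(1)] by blast
  next
    fix a assume H: "\<forall>a\<in>carrier R'. \<exists>c. e' i \<otimes>\<^bsub>R'\<^esub> a \<otimes>\<^bsub>R'\<^esub> e' i \<ominus>\<^bsub>R'\<^esub> s' c \<otimes>\<^bsub>R'\<^esub> e' i \<in> D.ker (restr r) i"
      and a: "a \<in> carrier R"
    then show "\<exists>c. e (\<iota> i) \<otimes>\<^bsub>R\<^esub> a \<otimes>\<^bsub>R\<^esub> e (\<iota> i) \<ominus>\<^bsub>R\<^esub> s c \<otimes>\<^bsub>R\<^esub> e (\<iota> i) \<in> C.ker r (\<iota> i)"
      using 2[OF a] pi_simps(1)[OF a] by blast
  qed
qed

lemma gens_mem_iff:
  assumes i: "i \<in> V'" and ia: "inj_at i" and U: "C.reg.subm U" "U \<subseteq> C.eR (\<iota> i)" and x: "x \<in> C.eR (\<iota> i)"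
  shows "\<pi> x \<in> \<pi> ` U \<longleftrightarrow> x \<in> U"
proof
  assume "\<pi> x \<in> \<pi> ` U"
  then obtain u where u: "u \<in> U" "\<pi> x = \<pi> u" by blast
  then have "x = u" using inj_at_eq[OF i ia x, of u] U by blast
  then show "x \<in> U" using u by simp
qed simp

text \<open>The step is generated by some \<open>t\<close> in P(\<iota> i), where \<pi> is
  injective. A label not coming from \<open>V'\<close> would make \<pi> t and so \<open>t\<close>
  zero. If \<pi> x is zero, so are \<pi> (t x) and t x; thus x annihilates the generator of the
  standard module and lies in its kernel, which is why the label is covered.\<close>

lemma gens_push:
  assumes i: "i \<in> V'" and ia: "inj_at i" and U: "C.reg.subm U" and W: "C.reg.subm W" "U \<subseteq> W" "W \<subseteq> C.eR (\<iota> i)"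
    and j: "j \<in> V" "e j \<notin> C.ker r j" and g: "C.reg.gens U W j (C.ker r j)"
  obtains j' where "j' \<in> V'" "j = \<iota> j'" "ker_covered r j'"
    "D.reg.gens (\<pi> ` U) (\<pi> ` W) j' (D.ker (restr r) j')"
proof -
  note iV = iota_V[OF i]
  obtain t where t: "t \<in> W" "t \<otimes>\<^bsub>R\<^esub> e j = t" "W = C.reg.gen U t"
    and tU: "\<And>a. a \<in> carrier R \<Longrightarrow> t \<otimes>\<^bsub>R\<^esub> a \<in> U \<longleftrightarrow> e j \<otimes>\<^bsub>R\<^esub> a \<in> C.ker r j"
    using g unfolding C.reg.gens_def by auto
  have tE: "t \<in> C.eR (\<iota> i)" and tR: "t \<in> carrier R" using t(1) W(3) C.eR_sub[OF iV] by auto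
  have UE: "U \<subseteq> C.eR (\<iota> i)" using W by blast
  have UR: "u \<in> carrier R" if "u \<in> U" for u using that UE C.eR_sub[OF iV] by blast
  have taE: "t \<otimes>\<^bsub>R\<^esub> a \<in> C.eR (\<iota> i)" if "a \<in> carrier R" for a
    using C.reg.submD(5)[OF C.eR_subm[OF iV] that tE] by simp
  have zU: "\<zero>\<^bsub>R\<^esub> \<in> U" using C.reg.submD(2)[OF U] by simp
  have "j \<in> \<iota> ` V'"
  proof (rule ccontr)
    assume "j \<notin> \<iota> ` V'"
    then have "\<pi> (t \<otimes>\<^bsub>R\<^esub> e j) = \<zero>\<^bsub>R'\<^esub>" using pi_e0[OF j(1)] tR j(1) by simp
    then have "t = \<zero>\<^bsub>R\<^esub>" using ia tE t(2) unfolding inj_at_def by simp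
    then have "e j \<in> C.ker r j" using tU[of "\<one>\<^bsub>R\<^esub>"] zU j by simp
    then show False using j by simp
  qed
  then obtain j' where j': "j' \<in> V'" "j = \<iota> j'" by blast
  have kc: "ker_covered r j'"
    unfolding ker_covered_def
  proof (intro ballI impI)
    fix x assume x: "x \<in> C.eR (\<iota> j')" "\<pi> x = \<zero>\<^bsub>R'\<^esub>"
    have xR: "x \<in> carrier R" "e j \<otimes>\<^bsub>R\<^esub> x = x" using x C.eR_iff[of j x] j j' by auto
    have "\<pi> (t \<otimes>\<^bsub>R\<^esub> x) = \<zero>\<^bsub>R'\<^esub>" using x xR tR by simp
    then have "t \<otimes>\<^bsub>R\<^esub> x = \<zero>\<^bsub>R\<^esub>" using ia taE[OF xR(1)] unfolding inj_at_def by blast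
    then have "e j \<otimes>\<^bsub>R\<^esub> x \<in> C.ker r j" using tU[OF xR(1)] zU by simp
    then show "x \<in> C.ker r (\<iota> j')" using xR j' by simp
  qed
  have "D.reg.gens (\<pi> ` U) (\<pi> ` W) j' (D.ker (restr r) j')"
    unfolding D.reg.gens_def
  proof (intro bexI conjI ballI)
    show "\<pi> t \<in> \<pi> ` W" using t by blast
    show "e' j' \<odot>\<^bsub>D.reg\<^esub> \<pi> t = \<pi> t"
      using pi_simps(2)[OF tR, of "e j"] t(2) j by (simp add: j' pi_e)
    show "\<pi> ` W = D.reg.gen (\<pi> ` U) (\<pi> t)"
    proof
      show "\<pi> ` W \<subseteq> D.reg.gen (\<pi> ` U) (\<pi> t)"
      proof
        fix y assume "y \<in> \<pi> ` W"
        then obtain u a where u: "u \<in> U" "a \<in> carrier R" "y = \<pi> (u \<oplus>\<^bsub>R\<^esub> t \<otimes>\<^bsub>R\<^esub> a)"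
          unfolding t(3) C.reg.gen_def by auto
        then have "y = \<pi> u \<oplus>\<^bsub>R'\<^esub> \<pi> t \<otimes>\<^bsub>R'\<^esub> \<pi> a" using UR tR by simp
        then show "y \<in> D.reg.gen (\<pi> ` U) (\<pi> t)" unfolding D.reg.gen_def using u by (intro CollectI exI[of _ "\<pi> u"] exI[of _ "\<pi> a"]) simp
      qed
      show "D.reg.gen (\<pi> ` U) (\<pi> t) \<subseteq> \<pi> ` W"
        by (rule D.reg.gen_subset[OF image_subm[OF W(1)]]) (use W(2) t(1) in auto)
    qed
    fix a' assume a': "a' \<in> carrier R'"
    obtain a where a: "a \<in> carrier R" "\<pi> a = a'" using surj[OF a'] by blast
    have "\<pi> (t \<otimes>\<^bsub>R\<^esub> a) \<in> \<pi> ` U \<longleftrightarrow> t \<otimes>\<^bsub>R\<^esub> a \<in> U" by (rule gens_mem_iff[OF i ia U UE taE[OF a(1)]])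
    also have "\<dots> \<longleftrightarrow> e j \<otimes>\<^bsub>R\<^esub> a \<in> C.ker r j" by (rule tU[OF a(1)])
    also have "\<dots> \<longleftrightarrow> \<pi> (e j \<otimes>\<^bsub>R\<^esub> a) \<in> D.ker (restr r) j'"
      using ker_mem_iff[OF j'(1) kc, of "e j \<otimes>\<^bsub>R\<^esub> a"] a j' by (auto simp: C.eR_def)
    finally show "a' \<odot>\<^bsub>D.reg\<^esub> \<pi> t \<in> \<pi> ` U \<longleftrightarrow> e' j' \<otimes>\<^bsub>R'\<^esub> a' \<in> D.ker (restr r) j'"
      using a tR j by (simp add: j' pi_e)
  qed
  then show ?thesis using that j' kc by blast
qed

text \<open>The generator is lifted along \<pi> and multiplied by the idempotent of its label.
  Injectivity on P(\<iota> i) lifts the relations, and covering identifies the two kernels.\<close>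

lemma gens_pull:
  assumes i: "i \<in> V'" and ia: "inj_at i" and U: "C.reg.subm U" and W: "C.reg.subm W" "U \<subseteq> W" "W \<subseteq> C.eR (\<iota> i)"
    and j: "j \<in> V'" and kc: "ker_covered r j" and g: "D.reg.gens (\<pi> ` U) (\<pi> ` W) j (D.ker (restr r) j)"
  shows "C.reg.gens U W (\<iota> j) (C.ker r (\<iota> j))"
proof -
  note iV = iota_V[OF i] and jV = iota_V[OF j]
  obtain t' where t': "t' \<in> \<pi> ` W" "t' \<otimes>\<^bsub>R'\<^esub> e' j = t'" "\<pi> ` W = D.reg.gen (\<pi> ` U) t'"
    and tU': "\<And>a. a \<in> carrier R' \<Longrightarrow> t' \<otimes>\<^bsub>R'\<^esub> a \<in> \<pi> ` U \<longleftrightarrow> e' j \<otimes>\<^bsub>R'\<^esub> a \<in> D.ker (restr r) j"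
    using g unfolding D.reg.gens_def by auto
  obtain t0 where t0: "t0 \<in> W" "t' = \<pi> t0" using t'(1) by blast
  have t0R: "t0 \<in> carrier R" using t0 W C.eR_sub[OF iV] by blast
  define t where "t = t0 \<otimes>\<^bsub>R\<^esub> e (\<iota> j)"
  have tW: "t \<in> W" using C.reg.submD(5)[OF W(1) _ t0(1), of "e (\<iota> j)"] jV by (simp add: t_def)
  then have tE: "t \<in> C.eR (\<iota> i)" and tR: "t \<in> carrier R" using W(3) C.eR_sub[OF iV] by auto
  have te: "t \<otimes>\<^bsub>R\<^esub> e (\<iota> j) = t" using t0R jV by (simp add: t_def C.m_assoc C.e_idem)
  have pt: "\<pi> t = t'" using t0R jV t'(2) by (simp add: t_def pi_e[OF j] t0(2)[symmetric])
  have UE: "U \<subseteq> C.eR (\<iota> i)" using W by blast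
  have UR: "u \<in> carrier R" if "u \<in> U" for u using that UE C.eR_sub[OF iV] by blast
  have taE: "t \<otimes>\<^bsub>R\<^esub> a \<in> C.eR (\<iota> i)" if "a \<in> carrier R" for a
    using C.reg.submD(5)[OF C.eR_subm[OF iV] that tE] by simp
  show ?thesis
    unfolding C.reg.gens_def
  proof (intro bexI conjI ballI)
    show "t \<in> W" by (rule tW)
    show "e (\<iota> j) \<odot>\<^bsub>C.reg\<^esub> t = t" using te by simp
    show "W = C.reg.gen U t"
    proof
      show "C.reg.gen U t \<subseteq> W" by (rule C.reg.gen_subset[OF W(1,2) tW])
      show "W \<subseteq> C.reg.gen U t"
      proof
        fix w assume w: "w \<in> W"
        then have "\<pi> w \<in> D.reg.gen (\<pi> ` U) t'" using t'(3) by blast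
        then obtain u a' where u: "u \<in> U" "a' \<in> carrier R'" "\<pi> w = \<pi> u \<oplus>\<^bsub>R'\<^esub> t' \<otimes>\<^bsub>R'\<^esub> a'"
          unfolding D.reg.gen_def by auto
        obtain a where a: "a \<in> carrier R" "\<pi> a = a'" using surj[OF u(2)] by blast
        have "\<pi> w = \<pi> (u \<oplus>\<^bsub>R\<^esub> t \<otimes>\<^bsub>R\<^esub> a)" using u a UR tR pt by simp
        moreover have "u \<oplus>\<^bsub>R\<^esub> t \<otimes>\<^bsub>R\<^esub> a \<in> C.eR (\<iota> i)"
          using C.reg.submD(4)[OF C.eR_subm[OF iV] _ taE[OF a(1)], of u] u UE by auto
        ultimately have "w = u \<oplus>\<^bsub>R\<^esub> t \<otimes>\<^bsub>R\<^esub> a" using inj_at_eq[OF i ia] w W(3) by blast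
        then show "w \<in> C.reg.gen U t" unfolding C.reg.gen_def using u a by auto
      qed
    qed
    fix a assume a: "a \<in> carrier R"
    have "t \<otimes>\<^bsub>R\<^esub> a \<in> U \<longleftrightarrow> \<pi> (t \<otimes>\<^bsub>R\<^esub> a) \<in> \<pi> ` U" using gens_mem_iff[OF i ia U UE taE[OF a]] by simp
    also have "\<dots> \<longleftrightarrow> e' j \<otimes>\<^bsub>R'\<^esub> \<pi> a \<in> D.ker (restr r) j" using tU'[of "\<pi> a"] a tR pt by simp
    also have "\<dots> \<longleftrightarrow> e (\<iota> j) \<otimes>\<^bsub>R\<^esub> a \<in> C.ker r (\<iota> j)"
      using ker_mem_iff[OF j kc, of "e (\<iota> j) \<otimes>\<^bsub>R\<^esub> a"] a jV by (auto simp: C.eR_def pi_e[OF j])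
    finally show "a \<odot>\<^bsub>C.reg\<^esub> t \<in> U \<longleftrightarrow> e (\<iota> j) \<otimes>\<^bsub>R\<^esub> a \<in> C.ker r (\<iota> j)" by simp
  qed
qed

text \<open>Besides the filtration over \<open>R'\<close>, the conclusion records that all labels
  are covered. This is the origin of the condition on the arrows at the node.\<close>

lemma dfil_push:
  assumes "C.dfil r J W" "W \<subseteq> C.eR (\<iota> i)" and i: "i \<in> V'" and ia: "inj_at i"
    and "\<forall>j\<in>J. j \<in> V \<and> e j \<notin> C.ker r j"
  shows "\<exists>J'. J' \<subseteq> V' \<and> J = \<iota> ` J' \<and> (\<forall>j\<in>J'. ker_covered r j) \<and> D.dfil (restr r) J' (\<pi> ` W)"
  using assms(1,2,5)
proof (induction rule: C.dfil.induct)
  case dfil_zero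
  show ?case by (intro exI[of _ "{}"]) (simp add: D.dfil_zero)
next
  case (dfil_step J U W j)
  have "U \<subseteq> C.eR (\<iota> i)" using dfil_step.hyps dfil_step.prems by blast
  then obtain J' where J': "J' \<subseteq> V'" "J = \<iota> ` J'" "\<forall>j\<in>J'. ker_covered r j" "D.dfil (restr r) J' (\<pi> ` U)"
    using dfil_step.IH dfil_step.prems by blast
  have sU: "C.reg.subm U" by (rule C.dfil_subm) fact
  have ej: "e j \<notin> C.ker r j" using dfil_step.prems by blast
  obtain j' where j': "j' \<in> V'" "j = \<iota> j'" "ker_covered r j'"
    "D.reg.gens (\<pi> ` U) (\<pi> ` W) j' (D.ker (restr r) j')"
    using gens_push[OF i ia sU dfil_step.hyps(2,3) dfil_step.prems(1) dfil_step.hyps(4) ej dfil_step.hyps(5)] by blast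
  have "D.dfil (restr r) (insert j' J') (\<pi> ` W)"
    using J'(4) image_subm[OF dfil_step.hyps(2)] image_mono[OF dfil_step.hyps(3)] j'(1,4) by (rule D.dfil_step)
  then show ?case using J' j' by (intro exI[of _ "insert j' J'"]) auto
qed

lemma dfil_pull:
  assumes "D.dfil (restr r) J W" "W \<subseteq> D.eR i" and i: "i \<in> V'" and ia: "inj_at i"
    and "\<forall>j\<in>J. ker_covered r j"
  shows "C.dfil r (\<iota> ` J) {x \<in> C.eR (\<iota> i). \<pi> x \<in> W}"
  using assms(1,2,5)
proof (induction rule: D.dfil.induct)
  case dfil_zero
  have "{x \<in> C.eR (\<iota> i). \<pi> x \<in> {\<zero>\<^bsub>R'\<^esub>}} = {\<zero>\<^bsub>R\<^esub>}"
  proof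
    show "{x \<in> C.eR (\<iota> i). \<pi> x \<in> {\<zero>\<^bsub>R'\<^esub>}} \<subseteq> {\<zero>\<^bsub>R\<^esub>}" using ia unfolding inj_at_def by blast
    show "{\<zero>\<^bsub>R\<^esub>} \<subseteq> {x \<in> C.eR (\<iota> i). \<pi> x \<in> {\<zero>\<^bsub>R'\<^esub>}}"
      using C.reg.submD(2)[OF C.eR_subm[OF iota_V[OF i]]] by simp
  qed
  then show ?case by (simp add: C.dfil_zero)
next
  case (dfil_step J U W j)
  let ?p = "\<lambda>U. {x \<in> C.eR (\<iota> i). \<pi> x \<in> U}"
  have sub: "C.reg.subm (?p Y)" if "D.reg.subm Y" for Y
  proof -
    have "?p Y = C.eR (\<iota> i) \<inter> {x \<in> carrier R. \<pi> x \<in> Y}" using C.eR_sub[OF iota_V[OF i]] by blast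
    then show ?thesis using C.inter_subm[OF C.eR_subm[OF iota_V[OF i]] preimage_subm[OF that]] by simp
  qed
  have im: "\<pi> ` ?p Y = Y" if "Y \<subseteq> D.eR i" for Y using pi_eR(2)[OF i] that by blast
  have UE: "U \<subseteq> D.eR i" using dfil_step.hyps dfil_step.prems by blast
  have sU: "D.reg.subm U" by (rule D.dfil_subm) fact
  have IH: "C.dfil r (\<iota> ` J) (?p U)" using dfil_step.IH UE dfil_step.prems by blast
  have UW: "?p U \<subseteq> ?p W" using dfil_step.hyps(3) by blast
  have "C.reg.gens (?p U) (?p W) (\<iota> j) (C.ker r (\<iota> j))"
    by (rule gens_pull[OF i ia sub[OF sU] sub[OF dfil_step.hyps(2)] UW _ dfil_step.hyps(4)])
      (use dfil_step.prems dfil_step.hyps(5) im[OF UE] im[OF dfil_step.prems(1)] in auto)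
  then have "C.dfil r (insert (\<iota> j) (\<iota> ` J)) (?p W)"
    by (rule C.dfil_step[OF IH sub[OF dfil_step.hyps(2)] UW iota_V[OF dfil_step.hyps(4)]])
  then show ?case by simp
qed

lemma preimage_ker:
  assumes i: "i \<in> V'" and ia: "inj_at i"
  shows "{x \<in> C.eR (\<iota> i). \<pi> x \<in> D.ker (restr r) i} = C.ker r (\<iota> i)"
  using ker_mem_iff[OF i inj_at_covered[OF i ia], of _ r] C.ker_sub[OF iota_V[OF i], of r] by blast

lemma ker_eq_iff:
  assumes i: "i \<in> V'" and ia: "inj_at i"
  shows "C.ker r (\<iota> i) = C.ker r' (\<iota> i) \<longleftrightarrow> D.ker (restr r) i = D.ker (restr r') i"
  using preimage_ker[OF i ia] image_ker[OF i] by metis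

lemma restr_order:
  assumes po: "partial_order_on V r"
  shows "partial_order_on V' (restr r)"
proof -
  note p = partial_order_onD[OF po]
  have "refl_on V' (restr r)" using p(1) iota_V by (auto simp: refl_on_def restr_def)
  moreover have "trans (restr r)" using p(2) unfolding trans_def restr_def by blast
  moreover have "antisym (restr r)" using p(3) inj unfolding antisym_def restr_def inj_def by blast
  moreover have "restr r \<subseteq> V' \<times> V'" by (auto simp: restr_def)
  ultimately show ?thesis by (simp add: partial_order_on_def preorder_on_def)
qed

lemma qh_push:
  assumes q: "C.qh r" and i: "i \<in> V'" and ia: "inj_at i"
  shows "D.schur (restr r) i" "\<exists>J. D.dfil (restr r) J (D.ker (restr r) i) \<and> (\<forall>j\<in>J. j \<in> V' \<and> (i, j) \<in> restr r - Id)"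
proof -
  note iV = iota_V[OF i]
  show "D.schur (restr r) i" using C.qhD(2)[OF q iV] schur_iff[OF i ia] by simp
  obtain J where J: "C.dfil r J (C.ker r (\<iota> i))" "\<forall>j\<in>J. j \<in> V \<and> (\<iota> i, j) \<in> r - Id" using C.qhD(3)[OF q iV] by blast
  have "\<forall>j\<in>J. j \<in> V \<and> e j \<notin> C.ker r j" using J(2) C.qhD(2)[OF q] unfolding C.schur_def by blast
  then obtain J' where J': "J' \<subseteq> V'" "J = \<iota> ` J'" "D.dfil (restr r) J' (\<pi> ` C.ker r (\<iota> i))"
    using dfil_push[OF J(1) C.ker_sub[OF iV] i ia] by blast
  have "\<forall>j\<in>J'. j \<in> V' \<and> (i, j) \<in> restr r - Id" using J' J(2) i by (auto simp: restr_def)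
  then show "\<exists>J. D.dfil (restr r) J (D.ker (restr r) i) \<and> (\<forall>j\<in>J. j \<in> V' \<and> (i, j) \<in> restr r - Id)"
    using J'(3) unfolding image_ker[OF i] by blast
qed

lemma qh_pull:
  assumes i: "i \<in> V'" and ia: "inj_at i" and sch: "D.schur (restr r) i"
    and d: "D.dfil (restr r) J (D.ker (restr r) i)" "\<forall>j\<in>J. j \<in> V' \<and> (i, j) \<in> restr r - Id"
    and kc: "\<forall>j\<in>J. ker_covered r j"
  shows "C.schur r (\<iota> i)" "\<exists>J. C.dfil r J (C.ker r (\<iota> i)) \<and> (\<forall>j\<in>J. j \<in> V \<and> (\<iota> i, j) \<in> r - Id)"
proof -
  show "C.schur r (\<iota> i)" using sch schur_iff[OF i ia] by simp
  have "C.dfil r (\<iota> ` J) (C.ker r (\<iota> i))"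
    using dfil_pull[OF d(1) D.ker_sub[OF i] i ia kc] unfolding preimage_ker[OF i ia] .
  moreover have "\<forall>j\<in>\<iota> ` J. j \<in> V \<and> (\<iota> i, j) \<in> r - Id"
    using d(2) iota_V inj by (auto simp: restr_def inj_def)
  ultimately show "\<exists>J. C.dfil r J (C.ker r (\<iota> i)) \<and> (\<forall>j\<in>J. j \<in> V \<and> (\<iota> i, j) \<in> r - Id)" by blast
qed

end

section \<open>Quasi-hereditary orders on a glued algebra\<close>

lemma (in basic_algebra) reg_subgroup:
  assumes "reg.subm U"
  shows "subgroup U (add_monoid R)"
proof
  note u = reg.submD[OF assms]
  show "U \<subseteq> carrier (add_monoid R)" using u(3) by auto
  show "x \<otimes>\<^bsub>add_monoid R\<^esub> y \<in> U" if "x \<in> U" "y \<in> U" for x y using u(4) that by simp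
  show "\<one>\<^bsub>add_monoid R\<^esub> \<in> U" using u(2) by simp
  show "inv\<^bsub>add_monoid R\<^esub> x \<in> U" if "x \<in> U" for x using u(6)[OF that] by (simp add: a_inv_def[of R, symmetric])
qed

text \<open>What the argument uses about gluing a node, free of quivers. Injectivity of \<pi>A
  excludes the node, because the arrows of \<open>B\<close> leaving it are killed
  (\<open>node_lift\<close>); that of \<pi>B includes it, because no arrow of \<open>A\<close>
  leaves the sink.\<close>

locale glued =
  A: basic_hom R V e s N X RA VA eA sA NA XA \<iota>A \<pi>A + B: basic_hom R V e s N X RB VB eB sB NB XB \<iota>B \<pi>B
  for R :: "('r, 'z) ring_scheme" and V :: "'v set" and e and s :: "'k::field \<Rightarrow> 'r" and N X
    and RA :: "('ra, 'za) ring_scheme" and VA :: "'va set" and eA sA NA XA \<iota>A \<pi>A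
    and RB :: "('rb, 'zb) ring_scheme" and VB :: "'vb set" and eB sB NB XB \<iota>B \<pi>B +
  fixes v :: 'va and w :: 'vb
  assumes v: "v \<in> VA" and w: "w \<in> VB" and vw: "\<iota>A v = \<iota>B w"
    and V_eq: "V = \<iota>A ` VA \<union> \<iota>B ` VB" and V_int: "\<iota>A ` VA \<inter> \<iota>B ` VB \<subseteq> {\<iota>A v}"
    and sink: "(v, \<alpha>, u) \<notin> XA"
    and injA: "i \<in> VA \<Longrightarrow> i \<noteq> v \<Longrightarrow> A.inj_at i" and injB: "j \<in> VB \<Longrightarrow> B.inj_at j"
    and node_out: "(\<iota>A v, \<gamma>, z) \<in> X \<Longrightarrow> \<exists>\<beta> y. (w, \<beta>, y) \<in> XB \<and> z = \<iota>B y"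
    and node_lift: "(w, \<beta>, y) \<in> XB \<Longrightarrow> \<exists>\<gamma>. (\<iota>A v, \<gamma>, \<iota>B y) \<in> X \<and> \<pi>A \<gamma> = \<zero>\<^bsub>RA\<^esub>"
    and node_in: "(x, \<alpha>, v) \<in> XA \<Longrightarrow> \<exists>\<gamma>. (\<iota>A x, \<gamma>, \<iota>A v) \<in> X"
    and piA_N: "n \<in> N 1 \<Longrightarrow> \<pi>A n \<in> NA 1"
begin

lemma sink_right: "n \<in> NA 1 \<Longrightarrow> eA v \<otimes>\<^bsub>RA\<^esub> n = \<zero>\<^bsub>RA\<^esub>"
proof -
  assume "n \<in> NA 1"
  then have "eA v \<otimes>\<^bsub>RA\<^esub> n \<in> {\<zero>\<^bsub>RA\<^esub>}"
  proof (rule A.D.N_left[OF _ v])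
    show "subgroup {\<zero>\<^bsub>RA\<^esub>} (add_monoid RA)"
      using A.D.reg_subgroup[OF A.D.reg.zero_subm] unfolding A.D.reg_simps .
  qed (use sink in blast)
  then show ?thesis by simp
qed

text \<open>The kernel lies in the radical of P(v), and over \<open>A\<close> this radical is zero
  by \<open>sink_right\<close>.\<close>

lemma sink_ker: "(v, v) \<in> r \<Longrightarrow> A.D.ker r v = {\<zero>\<^bsub>RA\<^esub>}"
proof
  assume vv: "(v, v) \<in> r"
  show "{\<zero>\<^bsub>RA\<^esub>} \<subseteq> A.D.ker r v" using A.D.reg.submD(2)[OF A.D.ker_subm[OF v]] by simp
  show "A.D.ker r v \<subseteq> {\<zero>\<^bsub>RA\<^esub>}"
    using A.D.ker_N[OF v vv] A.D.ker_sub[OF v, of r] sink_right A.D.eR_iff[OF v] by (metis singleton_iff subset_iff)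
qed

lemma sink_schur:
  assumes vv: "(v, v) \<in> r"
  shows "A.D.schur r v"
  unfolding A.D.schur_def sink_ker[OF vv]
proof (intro conjI ballI)
  show "eA v \<notin> {\<zero>\<^bsub>RA\<^esub>}" using A.D.e_notin[OF v] A.D.reg.submD(2)[OF A.D.N_subm, of 1] by auto
  fix a assume a: "a \<in> carrier RA"
  obtain c n where n: "n \<in> NA 1" "eA v \<otimes>\<^bsub>RA\<^esub> a = sA c \<otimes>\<^bsub>RA\<^esub> eA v \<oplus>\<^bsub>RA\<^esub> n" using A.D.e_local[OF v a] by blast
  have nR: "n \<in> carrier RA" using n A.D.reg.N_closed by blast
  have "n = eA v \<otimes>\<^bsub>RA\<^esub> n"
  proof -
    have "eA v \<otimes>\<^bsub>RA\<^esub> a \<in> A.D.eR v" using a by (auto simp: A.D.eR_def)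
    moreover have "sA c \<otimes>\<^bsub>RA\<^esub> eA v \<in> A.D.eR v"
      using v by (simp add: A.D.eR_iff A.D.s_comm[of "eA v"] A.D.m_assoc[symmetric] A.D.e_idem)
    ultimately have "eA v \<otimes>\<^bsub>RA\<^esub> a \<ominus>\<^bsub>RA\<^esub> sA c \<otimes>\<^bsub>RA\<^esub> eA v \<in> A.D.eR v"
      using A.D.reg.submD(7)[OF A.D.eR_subm[OF v]] by simp
    moreover have "eA v \<otimes>\<^bsub>RA\<^esub> a \<ominus>\<^bsub>RA\<^esub> sA c \<otimes>\<^bsub>RA\<^esub> eA v = n"
      using A.D.reg.minus_add_cancel(2)[of n "sA c \<otimes>\<^bsub>RA\<^esub> eA v"] n(2) nR v by (simp add: A.D.a_comm)
    ultimately show ?thesis using A.D.eR_iff[OF v] by simp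
  qed
  then have "n = \<zero>\<^bsub>RA\<^esub>" using sink_right[OF n(1)] by simp
  then have "eA v \<otimes>\<^bsub>RA\<^esub> a = sA c \<otimes>\<^bsub>RA\<^esub> eA v" using n(2) v by simp
  then have "eA v \<otimes>\<^bsub>RA\<^esub> a \<otimes>\<^bsub>RA\<^esub> eA v = sA c \<otimes>\<^bsub>RA\<^esub> eA v" using v by (simp add: A.D.m_assoc A.D.e_idem)
  then have "eA v \<otimes>\<^bsub>RA\<^esub> a \<otimes>\<^bsub>RA\<^esub> eA v \<ominus>\<^bsub>RA\<^esub> sA c \<otimes>\<^bsub>RA\<^esub> eA v = \<zero>\<^bsub>RA\<^esub>" using v by (simp add: a_minus_def A.D.r_neg)
  then show "\<exists>c. eA v \<otimes>\<^bsub>RA\<^esub> a \<otimes>\<^bsub>RA\<^esub> eA v \<ominus>\<^bsub>RA\<^esub> sA c \<otimes>\<^bsub>RA\<^esub> eA v \<in> {\<zero>\<^bsub>RA\<^esub>}" by blast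
qed

text \<open>On P(v) the map \<pi>A kills exactly the radical, which is generated by the arrows from
  the node into \<open>B\<close>. The radical is contained in the kernel of P(v) \<rightarrow>
  \<Delta>(v) if and only if none of the targets of these arrows is below the node.\<close>

lemma node_covered_iff:
  assumes zz: "(\<iota>A v, \<iota>A v) \<in> r"
  shows "A.ker_covered r v \<longleftrightarrow> (\<forall>\<beta> y. (w, \<beta>, y) \<in> XB \<longrightarrow> (y, w) \<notin> B.restr r)"
proof (intro iffI allI impI)
  note zV = A.iota_V[OF v]
  fix \<beta> y assume kc: "A.ker_covered r v" and b: "(w, \<beta>, y) \<in> XB"
  obtain \<gamma> where g: "(\<iota>A v, \<gamma>, \<iota>B y) \<in> X" "\<pi>A \<gamma> = \<zero>\<^bsub>RA\<^esub>" using node_lift[OF b] by blast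
  have "\<gamma> \<in> A.C.eR (\<iota>A v)" using A.C.arrow[OF g(1)] A.C.reg.N_closed A.C.eR_iff[OF zV] by blast
  then have "\<gamma> \<in> A.C.ker r (\<iota>A v)" using kc g(2) unfolding A.ker_covered_def by blast
  then have "(\<iota>B y, \<iota>A v) \<notin> r" using A.C.arrow_notin_ker[OF g(1) zz] by blast
  then show "(y, w) \<notin> B.restr r" by (simp add: B.restr_def vw)
next
  note zV = A.iota_V[OF v]
  assume H: "\<forall>\<beta> y. (w, \<beta>, y) \<in> XB \<longrightarrow> (y, w) \<notin> B.restr r"
  show "A.ker_covered r v"
    unfolding A.ker_covered_def
  proof (intro ballI impI)
    fix x assume x: "x \<in> A.C.eR (\<iota>A v)" "\<pi>A x = \<zero>\<^bsub>RA\<^esub>"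
    obtain c n where n: "n \<in> A.C.eR (\<iota>A v)" "n \<in> N 1" "x = s c \<otimes>\<^bsub>R\<^esub> e (\<iota>A v) \<oplus>\<^bsub>R\<^esub> n"
      using A.C.local_decomp[OF zV x(1)] by blast
    have nR: "n \<in> carrier R" "e (\<iota>A v) \<otimes>\<^bsub>R\<^esub> n = n" using n A.C.eR_iff[OF zV] by auto
    have pn: "\<pi>A n \<in> NA 1" by (rule piA_N[OF n(2)])
    \<comment> \<open>A nonzero constant term would put \<open>eA v\<close> into the radical of
      \<open>A\<close>.\<close>
    have c0: "c = 0"
    proof (rule ccontr)
      assume c: "c \<noteq> 0"
      have "sA c \<otimes>\<^bsub>RA\<^esub> eA v \<oplus>\<^bsub>RA\<^esub> \<pi>A n = \<zero>\<^bsub>RA\<^esub>"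
        using x(2) nR(1) zV by (simp add: n(3) A.pi_e[OF v] A.pi_s)
      then have "sA c \<otimes>\<^bsub>RA\<^esub> eA v = \<ominus>\<^bsub>RA\<^esub> \<pi>A n" using v nR(1) by (metis A.D.e_closed A.D.m_closed A.D.minus_equality A.D.s_closed A.pi_simps(1))
      then have "sA c \<otimes>\<^bsub>RA\<^esub> eA v \<in> NA 1" using A.D.reg.submD(6)[OF A.D.N_subm pn] by simp
      then have "sA (1 / c) \<otimes>\<^bsub>RA\<^esub> (sA c \<otimes>\<^bsub>RA\<^esub> eA v) \<in> NA 1"
        using A.D.reg.N_l[of "sA c \<otimes>\<^bsub>RA\<^esub> eA v" 1 "sA (1 / c)"] by simp
      moreover have "sA (1 / c) \<otimes>\<^bsub>RA\<^esub> (sA c \<otimes>\<^bsub>RA\<^esub> eA v) = eA v"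
        using v A.D.s_mult[of "1 / c" c, symmetric] c by (simp add: A.D.m_assoc[symmetric] A.D.s_one)
      ultimately show False using A.D.e_notin[OF v] by simp
    qed
    have "e (\<iota>A v) \<otimes>\<^bsub>R\<^esub> n \<in> A.C.ker r (\<iota>A v)"
    proof (rule A.C.N_left[OF n(2) zV])
      show "subgroup (A.C.ker r (\<iota>A v)) (add_monoid R)"
        by (rule A.C.reg_subgroup[OF A.C.ker_subm[OF zV]])
      fix y \<gamma> a assume g: "(\<iota>A v, \<gamma>, y) \<in> X" and a: "a \<in> carrier R"
      obtain \<beta> y' where y': "(w, \<beta>, y') \<in> XB" "y = \<iota>B y'" using node_out[OF g] by blast
      have yB: "y' \<in> VB" using B.D.arrow[OF y'(1)] by simp
      have "(y', w) \<notin> B.restr r" using H y'(1) by blast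
      then have yr: "(y, \<iota>A v) \<notin> r" using yB w by (simp add: B.restr_def vw y'(2))
      have ar: "y \<in> V" "\<gamma> \<in> carrier R" "e (\<iota>A v) \<otimes>\<^bsub>R\<^esub> \<gamma> = \<gamma>" "\<gamma> \<otimes>\<^bsub>R\<^esub> e y = \<gamma>"
        using A.C.arrow[OF g] A.C.reg.N_closed by auto
      have "\<gamma> \<in> A.C.ker r (\<iota>A v)" using A.C.ker_in[OF zV ar(1) yr ar(2)] ar by simp
      then show "\<gamma> \<otimes>\<^bsub>R\<^esub> a \<in> A.C.ker r (\<iota>A v)" using A.C.reg.submD(5)[OF A.C.ker_subm[OF zV] a] by simp
    qed
    then show "x \<in> A.C.ker r (\<iota>A v)" using n(3) c0 nR zV by simp
  qed
qed

lemma glue_qh_iff: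
  assumes po: "partial_order_on V r"
  shows "A.C.qh r \<longleftrightarrow> A.D.qh (A.restr r) \<and> B.D.qh (B.restr r) \<and>
    ((\<exists>x \<alpha>. (x, \<alpha>, v) \<in> XA \<and> (x, v) \<in> A.restr r) \<longrightarrow> (\<forall>\<beta> y. (w, \<beta>, y) \<in> XB \<longrightarrow> (y, w) \<notin> B.restr r))"
proof
  have poA: "partial_order_on VA (A.restr r)" and poB: "partial_order_on VB (B.restr r)"
    using A.restr_order[OF po] B.restr_order[OF po] by auto
  have zz: "(\<iota>A v, \<iota>A v) \<in> r" using partial_order_onD(1)[OF po] A.iota_V[OF v] by (simp add: refl_on_def)
  have vv: "(v, v) \<in> A.restr r" using zz v by (simp add: A.restr_def)
  {
    assume q: "A.C.qh r"
    have "A.D.schur (A.restr r) i \<and> (\<exists>J. A.D.dfil (A.restr r) J (A.D.ker (A.restr r) i) \<and>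
        (\<forall>j\<in>J. j \<in> VA \<and> (i, j) \<in> A.restr r - Id))" if i: "i \<in> VA" for i
    proof (cases "i = v")
      case True
      then show ?thesis using sink_schur[OF vv] sink_ker[OF vv] A.D.dfil_zero by (intro conjI exI[of _ "{}"]) auto
    next
      case False
      then show ?thesis using A.qh_push[OF q i injA[OF i False]] by blast
    qed
    then have qA: "A.D.qh (A.restr r)" unfolding A.D.qh_def using poA by blast
    have qB: "B.D.qh (B.restr r)" unfolding B.D.qh_def using poB B.qh_push[OF q _ injB] by blast
    \<comment> \<open>By \<open>arrow_label\<close> an arrow x \<rightarrow> v with x below v makes
      v a label in the filtration for x, and pushing that filtration to \<open>A\<close> shows that
      v is covered.\<close>
    have "(y, w) \<notin> B.restr r" if x: "(x, \<alpha>, v) \<in> XA" "(x, v) \<in> A.restr r" and y: "(w, \<beta>, y) \<in> XB" for x \<alpha> \<beta> y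
    proof -
      have xV: "x \<in> VA" using A.D.arrow[OF x(1)] by simp
      have xv: "x \<noteq> v" using x(1) sink by blast
      obtain \<gamma> where g: "(\<iota>A x, \<gamma>, \<iota>A v) \<in> X" using node_in[OF x(1)] by blast
      have "(\<iota>A x, \<iota>A v) \<in> r" using x(2) by (simp add: A.restr_def)
      moreover have "\<iota>A x \<noteq> \<iota>A v" using xv inj_eq[OF A.inj] by simp
      ultimately have "(\<iota>A v, \<iota>A x) \<notin> r" using A.C.qhD(6)[OF q, of "\<iota>A x" "\<iota>A v"] by blast
      note lab = A.C.arrow_label[OF g A.C.qhD(4)[OF q A.iota_V[OF xV]] this]
      obtain J where J: "A.C.dfil r J (A.C.ker r (\<iota>A x))" "\<forall>j\<in>J. j \<in> V \<and> (\<iota>A x, j) \<in> r - Id"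
        using A.C.qhD(3)[OF q A.iota_V[OF xV]] by blast
      have "\<forall>j\<in>J. j \<in> V \<and> e j \<notin> A.C.ker r j" using J(2) A.C.qhD(2)[OF q] unfolding A.C.schur_def by blast
      then obtain J' where J': "J = \<iota>A ` J'" "\<forall>j\<in>J'. A.ker_covered r j"
        using A.dfil_push[OF J(1) A.C.ker_sub[OF A.iota_V[OF xV]] xV injA[OF xV xv]] by blast
      have "\<iota>A v \<in> \<iota>A ` J'" using lab[OF J(1)] J'(1) by simp
      then have "v \<in> J'" using A.inj by (simp add: inj_image_mem_iff)
      then have "A.ker_covered r v" using J'(2) by blast
      then show ?thesis using node_covered_iff[OF zz] y by blast
    qed
    then show "A.D.qh (A.restr r) \<and> B.D.qh (B.restr r) \<and>
      ((\<exists>x \<alpha>. (x, \<alpha>, v) \<in> XA \<and> (x, v) \<in> A.restr r) \<longrightarrow> (\<forall>\<beta> y. (w, \<beta>, y) \<in> XB \<longrightarrow> (y, w) \<notin> B.restr r))"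
      using qA qB by blast
  }
  {
    assume H: "A.D.qh (A.restr r) \<and> B.D.qh (B.restr r) \<and>
      ((\<exists>x \<alpha>. (x, \<alpha>, v) \<in> XA \<and> (x, v) \<in> A.restr r) \<longrightarrow> (\<forall>\<beta> y. (w, \<beta>, y) \<in> XB \<longrightarrow> (y, w) \<notin> B.restr r))"
    then have qA: "A.D.qh (A.restr r)" and qB: "B.D.qh (B.restr r)" by auto
    have vert: "A.C.schur r i \<and> (\<exists>J. A.C.dfil r J (A.C.ker r i) \<and> (\<forall>j\<in>J. j \<in> V \<and> (i, j) \<in> r - Id))" if i: "i \<in> V" for i
    proof (cases "i \<in> \<iota>B ` VB")
      \<comment> \<open>The node is treated as a vertex of \<open>B\<close>: over \<open>B\<close>
        all projectives are preserved, so all labels are covered.\<close>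
      case True
      then obtain i' where i': "i' \<in> VB" "i = \<iota>B i'" by blast
      obtain J where J: "B.D.dfil (B.restr r) J (B.D.ker (B.restr r) i')" "\<forall>j\<in>J. j \<in> VB \<and> (i', j) \<in> B.restr r - Id"
        using B.D.qhD(3)[OF qB i'(1)] by blast
      have "\<forall>j\<in>J. B.ker_covered r j" using J(2) B.inj_at_covered injB by blast
      then show ?thesis using B.qh_pull[OF i'(1) injB[OF i'(1)] B.D.qhD(2)[OF qB i'(1)] J] i'(2) by blast
    next
      case False
      then obtain i' where i': "i' \<in> VA" "i = \<iota>A i'" using i V_eq by blast
      have iv: "i' \<noteq> v" using False i'(2) vw w by auto
      obtain J where J: "A.D.dfil (A.restr r) J (A.D.ker (A.restr r) i')" "\<forall>j\<in>J. j \<in> VA \<and> (i', j) \<in> A.restr r - Id"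
        using A.D.qhD(3)[OF qA i'(1)] by blast
      \<comment> \<open>Only the label v is critical. If some arrow x \<rightarrow> v has x below v,
        the hypothesis covers it; otherwise it does not occur, by \<open>no_label\<close>.\<close>
      have "A.ker_covered r j" if j: "j \<in> J" for j
      proof (cases "j = v")
        case True
        show ?thesis
        proof (cases "\<exists>x \<alpha>. (x, \<alpha>, v) \<in> XA \<and> (x, v) \<in> A.restr r")
          case True
          then show ?thesis using H node_covered_iff[OF zz] \<open>j = v\<close> by blast
        next
          case False
          then have "v \<notin> J" using A.D.no_label[OF qA v _ i'(1) J] by blast
          then show ?thesis using j \<open>j = v\<close> by simp
        qed
      next
        case False
        then show ?thesis using J(2) j A.inj_at_covered injA by blast
      qed
      then show ?thesis
        using A.qh_pull[OF i'(1) injA[OF i'(1) iv] A.D.qhD(2)[OF qA i'(1)] J] i'(2) by blast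
    qed
    then show "A.C.qh r" unfolding A.C.qh_def using po by blast
  }
qed

text \<open>At the node the kernel over the glued algebra corresponds to the one over
  \<open>B\<close>, while the one over \<open>A\<close> is zero for both orders and imposes no
  condition.\<close>

lemma glue_ker_eq_iff:
  assumes rr: "(\<iota>A v, \<iota>A v) \<in> r" "(\<iota>A v, \<iota>A v) \<in> r'"
  shows "(\<forall>i\<in>V. A.C.ker r i = A.C.ker r' i) \<longleftrightarrow>
    (\<forall>i\<in>VA. A.D.ker (A.restr r) i = A.D.ker (A.restr r') i) \<and> (\<forall>i\<in>VB. B.D.ker (B.restr r) i = B.D.ker (B.restr r') i)"
proof -
  have vv: "(v, v) \<in> A.restr r" "(v, v) \<in> A.restr r'" using rr v by (auto simp: A.restr_def)
  have "(\<forall>i\<in>V. A.C.ker r i = A.C.ker r' i) \<longleftrightarrow>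
      (\<forall>i\<in>VA - {v}. A.C.ker r (\<iota>A i) = A.C.ker r' (\<iota>A i)) \<and> (\<forall>i\<in>VB. A.C.ker r (\<iota>B i) = A.C.ker r' (\<iota>B i))"
    unfolding V_eq using vw w by auto
  also have "\<dots> \<longleftrightarrow> (\<forall>i\<in>VA - {v}. A.D.ker (A.restr r) i = A.D.ker (A.restr r') i) \<and>
      (\<forall>i\<in>VB. B.D.ker (B.restr r) i = B.D.ker (B.restr r') i)"
    using A.ker_eq_iff[OF _ injA] B.ker_eq_iff[OF _ injB] by auto
  also have "\<dots> \<longleftrightarrow> (\<forall>i\<in>VA. A.D.ker (A.restr r) i = A.D.ker (A.restr r') i) \<and>
      (\<forall>i\<in>VB. B.D.ker (B.restr r) i = B.D.ker (B.restr r') i)"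
    using sink_ker[OF vv(1)] sink_ker[OF vv(2)] by auto
  finally show ?thesis .
qed

text \<open>The vertex set of the glued quiver embeds into \<open>VA \<times> VB\<close> as the union of the two axes through \<open>(v, w)\<close>;
  the amalgamated order is induced by the product order.\<close>

definition prA :: "'v \<Rightarrow> 'va" where
  "prA x = (if x \<in> \<iota>A ` VA then inv_into UNIV \<iota>A x else v)"

definition prB :: "'v \<Rightarrow> 'vb" where
  "prB x = (if x \<in> \<iota>B ` VB then inv_into UNIV \<iota>B x else w)"

definition amalgam :: "('va \<times> 'va) set \<Rightarrow> ('vb \<times> 'vb) set \<Rightarrow> ('v \<times> 'v) set" where
  "amalgam rA rB = {(x, y). x \<in> V \<and> y \<in> V \<and> (prA x, prA y) \<in> rA \<and> (prB x, prB y) \<in> rB}"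

lemma pr_A:
  assumes a: "a \<in> VA"
  shows "prA (\<iota>A a) = a" "prB (\<iota>A a) = w"
proof -
  show "prA (\<iota>A a) = a" using a A.inj by (simp add: prA_def inv_f_f)
  show "prB (\<iota>A a) = w"
  proof (cases "\<iota>A a \<in> \<iota>B ` VB")
    case True
    then have "\<iota>A a = \<iota>B w" using V_int a vw by auto
    then show ?thesis using w B.inj by (simp add: prB_def inv_f_f)
  qed (simp add: prB_def)
qed

lemma pr_B:
  assumes b: "b \<in> VB"
  shows "prA (\<iota>B b) = v" "prB (\<iota>B b) = b"
proof -
  show "prB (\<iota>B b) = b" using b B.inj by (simp add: prB_def inv_f_f)
  show "prA (\<iota>B b) = v"
  proof (cases "\<iota>B b \<in> \<iota>A ` VA")
    case True
    then have "\<iota>B b = \<iota>A v" using V_int b by auto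
    then show ?thesis using v A.inj by (simp add: prA_def inv_f_f)
  qed (simp add: prA_def)
qed

lemma amalgam_order:
  assumes A: "partial_order_on VA rA" and B: "partial_order_on VB rB"
  shows "partial_order_on V (amalgam rA rB)" "A.restr (amalgam rA rB) = rA" "B.restr (amalgam rA rB) = rB"
proof -
  note a = partial_order_onD[OF A] and b = partial_order_onD[OF B]
  have mem: "prA x \<in> VA \<and> prB x \<in> VB" if "x \<in> V" for x
    using that pr_A pr_B v w unfolding V_eq by auto
  have ww: "(w, w) \<in> rB" and vv: "(v, v) \<in> rA" using a(1) b(1) v w by (auto simp: refl_on_def)
  \<comment> \<open>One of the two coordinates is always the node, so the pair of coordinates
    determines the vertex; this is what antisymmetry rests on.\<close>
  have rec: "x = (if prA x = v then \<iota>B (prB x) else \<iota>A (prA x))" if x: "x \<in> V" for x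
    using x unfolding V_eq
  proof
    assume "x \<in> \<iota>A ` VA"
    then obtain a where "a \<in> VA" "x = \<iota>A a" by blast
    then show ?thesis using pr_A[of a] pr_B[OF w] vw by auto
  next
    assume "x \<in> \<iota>B ` VB"
    then obtain b where "b \<in> VB" "x = \<iota>B b" by blast
    then show ?thesis using pr_B[of b] by simp
  qed
  have inj: "x = y" if xy: "x \<in> V" "y \<in> V" "prA x = prA y" "prB x = prB y" for x y
    using rec[OF xy(1)] rec[OF xy(2)] xy(3,4) by metis
  have "refl_on V (amalgam rA rB)" using a(1) b(1) mem by (auto simp: refl_on_def amalgam_def)
  moreover have "trans (amalgam rA rB)" using a(2) b(2) unfolding trans_def amalgam_def by blast
  moreover have "antisym (amalgam rA rB)"
  proof (rule antisymI)
    fix x y assume "(x, y) \<in> amalgam rA rB" "(y, x) \<in> amalgam rA rB"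
    then have "x \<in> V" "y \<in> V" "(prA x, prA y) \<in> rA" "(prA y, prA x) \<in> rA" "(prB x, prB y) \<in> rB" "(prB y, prB x) \<in> rB"
      by (simp_all add: amalgam_def)
    then show "x = y" using antisymD[OF a(3), of "prA x" "prA y"] antisymD[OF b(3), of "prB x" "prB y"] by (intro inj) simp_all
  qed
  moreover have "amalgam rA rB \<subseteq> V \<times> V" by (auto simp: amalgam_def)
  ultimately show "partial_order_on V (amalgam rA rB)" by (simp add: partial_order_on_def preorder_on_def)
  show "A.restr (amalgam rA rB) = rA"
  proof
    show "A.restr (amalgam rA rB) \<subseteq> rA" using pr_A by (auto simp: A.restr_def amalgam_def)
    show "rA \<subseteq> A.restr (amalgam rA rB)"
    proof
      fix p assume p: "p \<in> rA"
      then obtain x y where xy: "p = (x, y)" "x \<in> VA" "y \<in> VA" using a(4) by blast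
      then show "p \<in> A.restr (amalgam rA rB)" using p pr_A ww A.iota_V by (simp add: A.restr_def amalgam_def)
    qed
  qed
  show "B.restr (amalgam rA rB) = rB"
  proof
    show "B.restr (amalgam rA rB) \<subseteq> rB" using pr_B by (auto simp: B.restr_def amalgam_def)
    show "rB \<subseteq> B.restr (amalgam rA rB)"
    proof
      fix p assume p: "p \<in> rB"
      then obtain x y where xy: "p = (x, y)" "x \<in> VB" "y \<in> VB" using b(4) by blast
      then show "p \<in> B.restr (amalgam rA rB)" using p pr_B vv B.iota_V by (simp add: B.restr_def amalgam_def)
    qed
  qed
qed

end

text \<open>Jointly, \<open>f\<close> and \<open>g\<close> respect and reflect equivalence, and
  \<open>P\<close> singles out the pairs of classes that are reached. The map on classes is written
  without choosing representatives: all images of a class lie in a single class.\<close>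

lemma bij_betw_quotients:
  assumes EC: "equiv SC EC" and EA: "equiv SA EA" and EB: "equiv SB EB"
    and f: "\<And>r. r \<in> SC \<Longrightarrow> f r \<in> SA" and g: "\<And>r. r \<in> SC \<Longrightarrow> g r \<in> SB"
    and P: "\<And>r. r \<in> SC \<Longrightarrow> P (EA `` {f r}) (EB `` {g r})"
    and E: "\<And>r r'. r \<in> SC \<Longrightarrow> r' \<in> SC \<Longrightarrow> (r, r') \<in> EC \<longleftrightarrow> (f r, f r') \<in> EA \<and> (g r, g r') \<in> EB"
    and surj: "\<And>x y. x \<in> SA \<Longrightarrow> y \<in> SB \<Longrightarrow> P (EA `` {x}) (EB `` {y}) \<Longrightarrow> \<exists>r\<in>SC. f r = x \<and> g r = y"
  shows "\<exists>h. bij_betw h (SC // EC) {(X, Y). X \<in> SA // EA \<and> Y \<in> SB // EB \<and> P X Y}"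
proof
  let ?h = "\<lambda>X. (EA `` (f ` X), EB `` (g ` X))"
  have h: "?h (EC `` {r}) = (EA `` {f r}, EB `` {g r})" if r: "r \<in> SC" for r
  proof -
    have rr: "r \<in> EC `` {r}" using equiv_class_self[OF EC r] .
    have "EA `` {f r'} = EA `` {f r} \<and> EB `` {g r'} = EB `` {g r}" if r': "r' \<in> EC `` {r}" for r'
    proof -
      have "(r, r') \<in> EC" using r' by simp
      moreover have "r' \<in> SC" using calculation equiv_type[OF EC] by blast
      ultimately show ?thesis using E[OF r] equiv_class_eq[OF EA] equiv_class_eq[OF EB] by metis
    qed
    then show ?thesis using rr by fast
  qed
  show "bij_betw ?h (SC // EC) {(X, Y). X \<in> SA // EA \<and> Y \<in> SB // EB \<and> P X Y}"
    unfolding bij_betw_def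
  proof
    show "inj_on ?h (SC // EC)"
    proof (rule inj_onI)
      fix X Y assume X: "X \<in> SC // EC" and Y: "Y \<in> SC // EC" and eq: "?h X = ?h Y"
      obtain r where r: "r \<in> SC" "X = EC `` {r}" using X by (rule quotientE)
      obtain r' where r': "r' \<in> SC" "Y = EC `` {r'}" using Y by (rule quotientE)
      have "EA `` {f r} = EA `` {f r'}" "EB `` {g r} = EB `` {g r'}"
        using eq h[OF r(1)] h[OF r'(1)] r r' by simp_all
      then have "(r, r') \<in> EC"
        using E[OF r(1) r'(1)] eq_equiv_class_iff[OF EA f[OF r(1)] f[OF r'(1)]] eq_equiv_class_iff[OF EB g[OF r(1)] g[OF r'(1)]]
        by simp
      then show "X = Y" using r r' equiv_class_eq[OF EC] by simp
    qed
    show "?h ` (SC // EC) = {(X, Y). X \<in> SA // EA \<and> Y \<in> SB // EB \<and> P X Y}"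
    proof
      show "?h ` (SC // EC) \<subseteq> {(X, Y). X \<in> SA // EA \<and> Y \<in> SB // EB \<and> P X Y}"
      proof
        fix z assume "z \<in> ?h ` (SC // EC)"
        then obtain X where X: "X \<in> SC // EC" "z = ?h X" by blast
        obtain r where r: "r \<in> SC" "X = EC `` {r}" using X(1) by (rule quotientE)
        then show "z \<in> {(X, Y). X \<in> SA // EA \<and> Y \<in> SB // EB \<and> P X Y}"
          using h[OF r(1)] X(2) P[OF r(1)] quotientI[OF f[OF r(1)]] quotientI[OF g[OF r(1)]] by simp
      qed
      show "{(X, Y). X \<in> SA // EA \<and> Y \<in> SB // EB \<and> P X Y} \<subseteq> ?h ` (SC // EC)"
      proof
        fix z assume "z \<in> {(X, Y). X \<in> SA // EA \<and> Y \<in> SB // EB \<and> P X Y}"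
        then obtain X Y where z: "z = (X, Y)" "X \<in> SA // EA" "Y \<in> SB // EB" "P X Y" by blast
        obtain x where x: "x \<in> SA" "X = EA `` {x}" using z(2) by (rule quotientE)
        obtain y where y: "y \<in> SB" "Y = EB `` {y}" using z(3) by (rule quotientE)
        obtain r where r: "r \<in> SC" "f r = x" "g r = y" using surj[OF x(1) y(1)] z(4) x y by blast
        then have "z = ?h (EC `` {r})" using h[OF r(1)] x y z by simp
        then show "z \<in> ?h ` (SC // EC)" using quotientI[OF r(1)] by blast
      qed
    qed
  qed
qed

section \<open>The algebra obtained by gluing a node\<close>

locale quiver_embedding = S: fin_digraph Q + T: fin_digraph QC
  for Q :: "('v, 'e) pre_digraph" and QC :: "('w, 'f) pre_digraph" +
  fixes \<iota> :: "'v \<Rightarrow> 'w" and \<eta> :: "'e \<Rightarrow> 'f"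
  assumes inj_iota: "inj \<iota>" and inj_eta: "inj \<eta>"
    and iota_verts: "\<iota> u \<in> verts QC \<longleftrightarrow> u \<in> verts Q" and eta_arcs: "\<eta> a \<in> arcs QC \<longleftrightarrow> a \<in> arcs Q"
    and tail_eta: "tail QC (\<eta> a) = \<iota> (tail Q a)" and head_eta: "head QC (\<eta> a) = \<iota> (head Q a)"
begin

abbreviation pmap :: "'v \<times> 'e list \<Rightarrow> 'w \<times> 'f list" where
  "pmap \<equiv> map_prod \<iota> (map \<eta>)"

text \<open>The projection of path algebras that kills all paths outside the embedded quiver;
  \<open>push_forward pmap\<close> is a linear section of it.\<close>

definition pull :: "('w \<times> 'f list \<Rightarrow> 'k::field) \<Rightarrow> 'v \<times> 'e list \<Rightarrow> 'k" where
  "pull f = (\<lambda>(u, p). f (\<iota> u, map \<eta> p))"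

lemma pull_apply [simp]: "pull f (u, p) = f (\<iota> u, map \<eta> p)"
  by (simp add: pull_def)

lemma inj_pmap: "inj pmap"
  using inj_iota inj_eta by (intro prod.inj_map inj_mapI)

lemma awlast_pmap: "T.awlast (\<iota> u) (map \<eta> p) = \<iota> (S.awlast u p)"
  by (simp add: S.awlast_eq T.awlast_eq last_map head_eta)

lemma qpaths_pmap: "(\<iota> u, map \<eta> p) \<in> qpaths QC \<longleftrightarrow> (u, p) \<in> qpaths Q"
proof (induction p arbitrary: u)
  case Nil
  then show ?case by (simp add: iota_verts)
next
  case (Cons a p)
  then show ?case
    by (simp add: S.qpaths_Cons T.qpaths_Cons eta_arcs tail_eta head_eta inj_eq[OF inj_iota])
qed

lemma pull_closed:
  assumes f: "f \<in> carrier (path_algebra QC)"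
  shows "pull f \<in> carrier (path_algebra Q)"
proof (rule S.path_carrierI)
  have "{x. pull f x \<noteq> 0} \<subseteq> pmap -` {y. f y \<noteq> 0}" by auto
  then show "finite {x. pull f x \<noteq> 0}"
    by (rule finite_subset) (intro finite_vimageI T.path_carrierD(1)[OF f] inj_pmap)
  show "x \<in> qpaths Q" if "pull f x \<noteq> 0" for x
    using that T.path_carrierD(2)[OF f] by (cases x) (auto simp: qpaths_pmap[symmetric])
qed

text \<open>All pieces of an embedded path are embedded, so both sides sum over the same
  cuts.\<close>

lemma pull_mult: "pull (path_mult QC f g) = path_mult Q (pull f) (pull g)"
proof (rule ext)
  fix x :: "'v \<times> 'e list"
  obtain u p where x: "x = (u, p)" by fastforce
  show "pull (path_mult QC f g) x = path_mult Q (pull f) (pull g) x"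
    by (simp add: x S.path_mult_apply T.path_mult_apply take_map drop_map awlast_pmap)
qed

lemma push_pmap: "push_forward pmap f (pmap x) = (f x :: 'k::field)"
proof -
  have "{y. f y \<noteq> 0 \<and> pmap y = pmap x} = (if f x = 0 then {} else {x})"
    unfolding inj_eq[OF inj_pmap] by auto
  then show ?thesis by (simp add: push_forward_def)
qed

lemma push_off: "y \<notin> range pmap \<Longrightarrow> push_forward pmap f y = (0 :: 'k::field)"
proof -
  assume "y \<notin> range pmap"
  then have e: "{x. f x \<noteq> 0 \<and> pmap x = y} = {}" by auto
  show ?thesis unfolding push_forward_def e by simp
qed

lemma push_closed:
  fixes f :: "'v \<times> 'e list \<Rightarrow> 'k::field"
  assumes f: "f \<in> carrier (path_algebra Q)"
  shows "push_forward pmap f \<in> carrier (path_algebra QC)"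
proof (rule T.path_carrierI)
  have mem: "\<exists>x. y = pmap x \<and> f x \<noteq> 0" if y: "push_forward pmap f y \<noteq> 0" for y
  proof -
    have "y \<in> range pmap" using push_off[of y f] y by (rule contrapos_np[rotated])
    then obtain x where x: "y = pmap x" by (rule rangeE)
    have "f x \<noteq> 0" using y unfolding x(1) push_pmap .
    then show ?thesis using x by blast
  qed
  have "{y. push_forward pmap f y \<noteq> 0} \<subseteq> pmap ` {x. f x \<noteq> 0}"
  proof
    fix y assume "y \<in> {y. push_forward pmap f y \<noteq> 0}"
    then show "y \<in> pmap ` {x. f x \<noteq> 0}" using mem[of y] by blast
  qed
  then show "finite {y. push_forward pmap f y \<noteq> 0}"
    by (rule finite_subset) (intro finite_imageI S.path_carrierD(1)[OF f])
  fix y assume "push_forward pmap f y \<noteq> 0"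
  then obtain x where x: "y = pmap x" "f x \<noteq> 0" using mem by blast
  then show "y \<in> qpaths QC" using S.path_carrierD(2)[OF f x(2)] by (cases x) (simp add: qpaths_pmap)
qed

lemma pull_push: "pull (push_forward pmap f) = (f :: 'v \<times> 'e list \<Rightarrow> 'k::field)"
proof (rule ext)
  fix x :: "'v \<times> 'e list"
  obtain u p where "x = (u, p)" by fastforce
  then show "pull (push_forward pmap f) x = f x" using push_pmap[of f "(u, p)"] by simp
qed

lemma pull_elem: "pull (path_elem (\<iota> u, map \<eta> p)) = (path_elem (u, p) :: 'v \<times> 'e list \<Rightarrow> 'k::field)"
  by (rule ext) (auto simp: path_elem_def pull_def inj_eq[OF inj_iota] inj_eq[OF inj_mapI[OF inj_eta]] split: if_splits)

lemma pull_elem_off: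
  assumes "y \<notin> range pmap"
  shows "pull (path_elem y) = (\<lambda>_. 0 :: 'k::field)"
proof (rule ext)
  fix x :: "'v \<times> 'e list"
  have "pmap x \<noteq> y" using assms by blast
  then show "pull (path_elem y) x = (0 :: 'k)" by (cases x) (auto simp: path_elem_def)
qed

lemma pull_one: "pull \<one>\<^bsub>path_algebra QC\<^esub> = (\<one>\<^bsub>path_algebra Q\<^esub> :: 'v \<times> 'e list \<Rightarrow> 'k::field)"
  by (rule ext) (auto simp: S.path_algebra_simps T.path_algebra_simps iota_verts)

lemma pull_lin: "pull (\<lambda>x. f x + g x) = (\<lambda>x. pull f x + pull g x)" "pull (\<lambda>x. f x - g x) = (\<lambda>x. pull f x - pull g x)"
    "pull (\<lambda>x. c * f x) = (\<lambda>x. c * pull f x)"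
  by (rule ext, simp add: pull_def split: prod.split)+

lemma pull_power: "f \<in> arrow_ideal_power QC m \<Longrightarrow> pull f \<in> arrow_ideal_power Q m"
  unfolding arrow_ideal_power_def using pull_closed[of f] by fastforce

lemma pull_preimage_ideal:
  assumes I: "ideal I (path_algebra Q :: ('v \<times> 'e list \<Rightarrow> 'k::field) ring)"
  shows "ideal {f \<in> carrier (path_algebra QC). pull f \<in> I} (path_algebra QC)"
proof -
  have "pull \<in> ring_hom (path_algebra QC) (path_algebra Q :: ('v \<times> 'e list \<Rightarrow> 'k) ring)"
    by (rule ring_hom_memI) (simp_all add: pull_closed pull_one S.path_algebra_simps(1,2) T.path_algebra_simps(1,2) pull_mult pull_lin)
  then interpret h: ring_hom_ring "path_algebra QC :: ('w \<times> 'f list \<Rightarrow> 'k) ring" "path_algebra Q" pull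
    by (intro ring_hom_ringI2 S.ring_path_algebra T.ring_path_algebra)
  show ?thesis by (rule h.ideal_vimage[OF I])
qed

end

locale bqa_embedding = quiver_embedding Q QC \<iota> \<eta> + S: bqa Q I + T: bqa QC J
  for Q :: "('v, 'e) pre_digraph" and QC :: "('w, 'f) pre_digraph" and \<iota> \<eta>
    and I :: "('v \<times> 'e list \<Rightarrow> 'k::field) set" and J :: "('w \<times> 'f list \<Rightarrow> 'k) set" +
  assumes pull_J: "f \<in> J \<Longrightarrow> pull f \<in> I"
begin

definition proj :: "('w \<times> 'f list \<Rightarrow> 'k) set \<Rightarrow> ('v \<times> 'e list \<Rightarrow> 'k) set" where
  "proj Z = S.cl (pull (SOME f. f \<in> Z))"

text \<open>Two representatives differ by an element of \<open>J\<close>, which \<open>pull\<close>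
  sends into \<open>I\<close>.\<close>

lemma proj_cl:
  assumes f: "f \<in> carrier (path_algebra QC)"
  shows "proj (T.cl f) = S.cl (pull f)"
proof -
  have "(SOME g. g \<in> T.cl f) \<in> T.cl f" using T.cl_self[OF f] by (rule someI[of "\<lambda>g. g \<in> T.cl f"])
  then obtain h where h: "h \<in> J" "(SOME g. g \<in> T.cl f) = (\<lambda>x. h x + f x)" unfolding T.cl_mem by blast
  have hC: "h \<in> carrier (path_algebra QC)" using T.I_sub[OF h(1)] .
  have "S.cl (\<lambda>x. pull h x + pull f x) = S.cl (pull f)"
    using S.cl_eq_iff[of "\<lambda>x. pull h x + pull f x" "pull f"] pull_J[OF h(1)]
      S.path_add_closed[OF pull_closed[OF hC] pull_closed[OF f]] pull_closed[OF f] by simp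
  then show ?thesis by (simp add: proj_def h(2) pull_lin)
qed

lemma basic_hom_proj:
  "basic_hom T.A (verts QC) (vertex_idem QC J) (scalar_elem QC J) T.NN T.XX
     S.A (verts Q) (vertex_idem Q I) (scalar_elem Q I) S.NN S.XX \<iota> proj"
proof (intro basic_hom.intro basic_hom_axioms.intro T.basic_algebra_A S.basic_algebra_A)
  show "inj \<iota>" by (rule inj_iota)
  show "\<iota> i \<in> verts QC" if "i \<in> verts Q" for i using that by (simp add: iota_verts)
  show "proj \<in> ring_hom T.A S.A"
  proof (rule ring_hom_memI)
    fix x assume "x \<in> carrier T.A"
    then obtain f where f: "f \<in> carrier (path_algebra QC)" "x = T.cl f" unfolding T.carrier_A by blast
    show "proj x \<in> carrier S.A" unfolding f(2) proj_cl[OF f(1)] by (rule S.cl_closed[OF pull_closed[OF f(1)]])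
    fix y assume "y \<in> carrier T.A"
    then obtain g where g: "g \<in> carrier (path_algebra QC)" "y = T.cl g" unfolding T.carrier_A by blast
    show "proj (x \<otimes>\<^bsub>T.A\<^esub> y) = proj x \<otimes>\<^bsub>S.A\<^esub> proj y"
      unfolding f(2) g(2) proj_cl[OF f(1)] proj_cl[OF g(1)] T.cl_mult[OF f(1) g(1)]
        S.cl_mult[OF pull_closed[OF f(1)] pull_closed[OF g(1)]] proj_cl[OF T.path_mult_closed[OF f(1) g(1)]] pull_mult ..
    show "proj (x \<oplus>\<^bsub>T.A\<^esub> y) = proj x \<oplus>\<^bsub>S.A\<^esub> proj y"
      unfolding f(2) g(2) proj_cl[OF f(1)] proj_cl[OF g(1)] T.cl_add[OF f(1) g(1)]
        S.cl_add[OF pull_closed[OF f(1)] pull_closed[OF g(1)]] proj_cl[OF T.path_add_closed[OF f(1) g(1)]] pull_lin ..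
  next
    show "proj \<one>\<^bsub>T.A\<^esub> = \<one>\<^bsub>S.A\<^esub>"
      unfolding T.one_A S.one_A proj_cl[OF T.one_closed'] pull_one ..
  qed
  show "\<exists>x\<in>carrier T.A. proj x = y" if y: "y \<in> carrier S.A" for y
  proof -
    obtain f where f: "f \<in> carrier (path_algebra Q)" "y = S.cl f" using y unfolding S.carrier_A by blast
    have "proj (T.cl (push_forward pmap f)) = y" by (simp only: proj_cl[OF push_closed[OF f(1)]] pull_push f(2))
    then show ?thesis using T.cl_closed[OF push_closed[OF f(1)]] by blast
  qed
  show "proj (vertex_idem QC J (\<iota> i)) = vertex_idem Q I i" if i: "i \<in> verts Q" for i
  proof -
    have c: "path_elem (\<iota> i, []) \<in> carrier (path_algebra QC :: ('w \<times> 'f list \<Rightarrow> 'k) ring)"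
      using i by (intro T.vertex_closed) (simp add: iota_verts)
    show ?thesis unfolding T.e_eq S.e_eq proj_cl[OF c] using pull_elem[of i "[]", where 'k = 'k] by simp
  qed
  show "proj (vertex_idem QC J q) = \<zero>\<^bsub>S.A\<^esub>" if q: "q \<in> verts QC" "q \<notin> \<iota> ` verts Q" for q
  proof -
    have "(q, []) \<notin> range pmap" using q iota_verts by auto
    then show ?thesis unfolding T.e_eq proj_cl[OF T.vertex_closed[OF q(1)]] S.cl_zero[symmetric]
      by (intro arg_cong[of _ _ S.cl] pull_elem_off)
  qed
  show "proj (scalar_elem QC J c) = scalar_elem Q I c" for c
    unfolding T.s_eq S.s_eq proj_cl[OF T.path_smul_closed[OF T.one_closed']] pull_lin pull_one ..
qed

sublocale H: basic_hom T.A "verts QC" "vertex_idem QC J" "scalar_elem QC J" T.NN T.XX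
  S.A "verts Q" "vertex_idem Q I" "scalar_elem Q I" S.NN S.XX \<iota> proj
  by (rule basic_hom_proj)

lemma proj_NN:
  assumes "n \<in> T.NN m"
  shows "proj n \<in> S.NN m"
proof -
  obtain f where f: "f \<in> arrow_ideal_power QC m" "n = T.cl f" using assms unfolding T.NN_def by blast
  have "f \<in> carrier (path_algebra QC)" using f(1) T.power_sub by blast
  then show ?thesis using pull_power[OF f(1)] by (simp add: f(2) proj_cl S.NN_def)
qed

lemma proj_arrow_off:
  assumes b: "b \<in> arcs QC" "b \<notin> range \<eta>"
  shows "proj (T.cl (path_elem (tail QC b, [b]))) = \<zero>\<^bsub>S.A\<^esub>"
proof -
  have c: "path_elem (tail QC b, [b]) \<in> carrier (path_algebra QC :: ('w \<times> 'f list \<Rightarrow> 'k) ring)"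
    using b(1) T.wf_digraph by (intro T.path_elem_closed) (simp add: T.qpaths_Cons)
  have "(tail QC b, [b]) \<notin> range pmap" using b(2) by auto
  then show ?thesis unfolding proj_cl[OF c] S.cl_zero[symmetric] by (intro arg_cong[of _ _ S.cl] pull_elem_off)
qed

text \<open>An element of P(\<iota> i) has a representative supported on paths that start at \<iota>
  i, so it suffices to test these.\<close>

lemma proj_inj_at:
  assumes i: "i \<in> verts Q"
    and h: "\<And>f. f \<in> carrier (path_algebra QC) \<Longrightarrow> (\<And>u p. f (u, p) \<noteq> 0 \<Longrightarrow> u = \<iota> i) \<Longrightarrow> pull f \<in> I \<Longrightarrow> f \<in> J"
  shows "H.inj_at i"
  unfolding H.inj_at_def
proof (intro ballI impI)
  fix x assume x: "x \<in> T.R.eR (\<iota> i)" "proj x = \<zero>\<^bsub>S.A\<^esub>"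
  obtain a where a: "a \<in> carrier T.A" "x = vertex_idem QC J (\<iota> i) \<otimes>\<^bsub>T.A\<^esub> a" using x(1) unfolding T.R.eR_def by blast
  obtain f where f: "f \<in> carrier (path_algebra QC)" "a = T.cl f" using a(1) unfolding T.carrier_A by blast
  define g where "g = path_mult QC (path_elem (\<iota> i, [])) f"
  have c: "path_elem (\<iota> i, []) \<in> carrier (path_algebra QC :: ('w \<times> 'f list \<Rightarrow> 'k) ring)"
    using i by (intro T.vertex_closed) (simp add: iota_verts)
  have g: "g \<in> carrier (path_algebra QC)" unfolding g_def by (rule T.path_mult_closed[OF c f(1)])
  have xg: "x = T.cl g" unfolding a(2) f(2) T.e_eq T.cl_mult[OF c f(1)] g_def ..
  have supp: "u = \<iota> i" if "g (u, p) \<noteq> 0" for u p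
    using that unfolding g_def T.vertex_mult[OF f(1)] by (simp split: if_splits)
  have "pull g \<in> I" using x(2) S.cl_eq_zero_iff[OF pull_closed[OF g]] unfolding xg proj_cl[OF g] by simp
  then have "g \<in> J" by (rule h[OF g, rotated]) (rule supp)
  then show "x = \<zero>\<^bsub>T.A\<^esub>" using T.cl_eq_zero_iff[OF g] by (simp add: xg)
qed

end

section \<open>The ideal of the glued algebra and its two projections\<close>

locale node_gluing = A: bqa QA IA + B: bqa QB IB
  for QA :: "('a, 'e) pre_digraph" and IA :: "('a \<times> 'e list \<Rightarrow> 'k::field) set"
    and QB :: "('b, 'f) pre_digraph" and IB :: "('b \<times> 'f list \<Rightarrow> 'k) set" +
  fixes v :: 'a and w :: 'b
  assumes v: "v \<in> verts QA" and sink: "out_arcs QA v = {}" and w: "w \<in> verts QB" and source: "in_arcs QB w = {}"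
begin

abbreviation QC :: "('a + 'b, 'e + 'f) pre_digraph" where
  "QC \<equiv> glue_quiver QA v QB w"

abbreviation J :: "(('a + 'b) \<times> ('e + 'f) list \<Rightarrow> 'k) set" where
  "J \<equiv> glue_ideal QA IA v QB IB w"

abbreviation gv :: "'b \<Rightarrow> 'a + 'b" where
  "gv \<equiv> glue_vertex v w"

lemma sinkD: "a \<in> arcs QA \<Longrightarrow> tail QA a \<noteq> v"
  using sink by (auto simp: out_arcs_def)

lemma sourceD: "b \<in> arcs QB \<Longrightarrow> head QB b \<noteq> w"
  using source by (auto simp: in_arcs_def)

lemma gv_eq: "gv y = Inl x \<longleftrightarrow> y = w \<and> x = v" "Inl x = gv y \<longleftrightarrow> y = w \<and> x = v" "gv w = Inl v" "gv y = gv y' \<longleftrightarrow> y = y'"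
  by (auto simp: glue_vertex_def)

lemma QC_simps:
  "verts QC = Inl ` verts QA \<union> gv ` verts QB" "arcs QC = Inl ` arcs QA \<union> Inr ` arcs QB"
  "tail QC (Inl a) = Inl (tail QA a)" "head QC (Inl a) = Inl (head QA a)"
  "tail QC (Inr b) = gv (tail QB b)" "head QC (Inr b) = gv (head QB b)"
  by (simp_all add: glue_quiver_def)

lemma fin_QC: "fin_digraph QC"
proof
  show "finite (verts QC)" "finite (arcs QC)" by (simp_all add: QC_simps)
  fix c assume "c \<in> arcs QC"
  then show "tail QC c \<in> verts QC" "head QC c \<in> verts QC"
    using A.wf_digraph B.wf_digraph by (auto simp: QC_simps)
qed

sublocale C: fin_digraph QC
  by (rule fin_QC)

sublocale EA: quiver_embedding QA QC Inl Inl
proof (intro quiver_embedding.intro quiver_embedding_axioms.intro)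
  show "fin_digraph QA" "fin_digraph QC" by unfold_locales
qed (use v gv_eq in \<open>auto simp: QC_simps\<close>)

sublocale EB: quiver_embedding QB QC gv Inr
proof (intro quiver_embedding.intro quiver_embedding_axioms.intro)
  show "fin_digraph QB" "fin_digraph QC" by unfold_locales
  show "inj gv" by (rule injI) (simp add: gv_eq)
  show "gv u \<in> verts QC \<longleftrightarrow> u \<in> verts QB" for u
    using w by (auto simp: QC_simps gv_eq)
qed (auto simp: QC_simps)

text \<open>Read from its end, a path stays in one quiver unless an arrow of \<open>A\<close> is put
  in front of an arrow of \<open>B\<close>. An arrow of \<open>B\<close> in front of a path of
  \<open>A\<close> would have to end at the source.\<close>

lemma path_cases:
  assumes "(u, p) \<in> qpaths QC"
  shows "(u, p) \<in> range EA.pmap \<or> (u, p) \<in> range EB.pmap \<or> (\<exists>p1 a b p2. p = p1 @ Inl a # Inr b # p2)"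
  using assms
proof (induction p arbitrary: u)
  case Nil
  then have "u \<in> Inl ` verts QA \<or> u \<in> gv ` verts QB" by (simp add: QC_simps)
  then show ?case
  proof
    assume "u \<in> Inl ` verts QA"
    then obtain x where "u = Inl x" by blast
    then have "(u, []) = EA.pmap (x, [])" by simp
    then show ?case by blast
  next
    assume "u \<in> gv ` verts QB"
    then obtain x where "u = gv x" by blast
    then have "(u, []) = EB.pmap (x, [])" by simp
    then show ?case by blast
  qed
next
  case (Cons c p)
  have c: "c \<in> arcs QC" "tail QC c = u" "(head QC c, p) \<in> qpaths QC" using Cons.prems by (auto simp: C.qpaths_Cons)
  consider (A) x q where "(head QC c, p) = EA.pmap (x, q)" | (B) x q where "(head QC c, p) = EB.pmap (x, q)"
    | (M) p1 a b p2 where "p = p1 @ Inl a # Inr b # p2"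
    using Cons.IH[OF c(3)] by (auto simp: image_iff)
  then show ?case
  proof cases
    case (A x q)
    show ?thesis
    proof (cases c)
      case (Inl a)
      then have "(u, c # p) = EA.pmap (tail QA a, a # q)" using c(2) A by (simp add: QC_simps)
      then show ?thesis by blast
    next
      case (Inr b)
      then have "head QB b = w" "b \<in> arcs QB" using A c(1) by (auto simp: QC_simps gv_eq)
      then show ?thesis using sourceD by blast
    qed
  next
    case (B x q)
    show ?thesis
    proof (cases c)
      case (Inl a)
      show ?thesis
      proof (cases q)
        case Nil
        then have "(u, c # p) = EA.pmap (tail QA a, [a])" using c(2) B Inl by (simp add: QC_simps)
        then show ?thesis by blast
      next
        case (Cons b q')
        then have "c # p = [] @ Inl a # Inr b # map Inr q'" using B Inl by simp
        then show ?thesis by blast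
      qed
    next
      case (Inr b)
      then have "(u, c # p) = EB.pmap (tail QB b, b # q)" using c(2) B by (simp add: QC_simps)
      then show ?thesis by blast
    qed
  next
    case (M p1 a b p2)
    then have "c # p = (c # p1) @ Inl a # Inr b # p2" by simp
    then show ?thesis by blast
  qed
qed

definition gens where
  "gens = push_forward EA.pmap ` IA \<union> push_forward EB.pmap ` IB \<union>
     {path_elem (tail QC p, [p, q]) | p q.
        p \<in> arcs QC \<and> q \<in> arcs QC \<and> head QC p = Inl v \<and> tail QC q = Inl v}"

lemma J_eq: "J = Idl\<^bsub>path_algebra QC\<^esub> gens"
  by (simp add: glue_ideal_def gens_def Let_def)

text \<open>This turns out to be \<open>J\<close>. As an intersection of preimages it is an ideal,
  so it contains \<open>J\<close> as soon as it contains the generators.\<close>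

definition KK where
  "KK = {f \<in> carrier (path_algebra QC). EA.pull f \<in> IA} \<inter> {f \<in> carrier (path_algebra QC). EB.pull f \<in> IB}"

lemma KK_ideal: "ideal KK (path_algebra QC)"
  unfolding KK_def
  by (intro ring.i_intersect[OF C.ring_path_algebra] EA.pull_preimage_ideal EB.pull_preimage_ideal A.I_ideal B.I_ideal)

lemma zero_I: "(\<lambda>_. 0) \<in> IA" "(\<lambda>_. 0) \<in> IB"
  using additive_subgroup.zero_closed[OF ideal.axioms(1)[OF A.I_ideal]]
    additive_subgroup.zero_closed[OF ideal.axioms(1)[OF B.I_ideal]]
  by (simp_all add: A.path_algebra_simps B.path_algebra_simps)

lemma range_int: "EA.pmap x = EB.pmap y \<longleftrightarrow> x = (v, []) \<and> y = (w, [])"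
proof (cases x; cases y)
  fix a p b q assume x: "x = (a, p)" and y: "y = (b, q)"
  have "map Inl p = map Inr q \<longleftrightarrow> p = [] \<and> q = []" by (cases p; cases q) auto
  then show ?thesis by (auto simp: x y gv_eq)
qed

text \<open>The two quivers share only the trivial path at the node, and relations have coefficient
  zero there, so a relation of one algebra is invisible in the other. The paths of length two
  through the node pass from \<open>A\<close> to \<open>B\<close>, because the node has no outgoing
  arrow in \<open>A\<close> and no incoming one in \<open>B\<close>; both projections kill
  them.\<close>

lemma gens_KK: "gens \<subseteq> KK"
proof
  fix g assume "g \<in> gens"
  then consider (A) f where "f \<in> IA" "g = push_forward EA.pmap f" | (B) f where "f \<in> IB" "g = push_forward EB.pmap f"
    | (M) p q where "p \<in> arcs QC" "q \<in> arcs QC" "head QC p = Inl v" "tail QC q = Inl v" "g = path_elem (tail QC p, [p, q])"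
    unfolding gens_def by blast
  then show "g \<in> KK"
  proof cases
    case (A f)
    have "EB.pull g = (\<lambda>_. 0)"
    proof
      fix y :: "'b \<times> 'f list"
      show "EB.pull g y = 0"
      proof (cases "EB.pmap y \<in> range EA.pmap")
        case True
        then obtain x where x: "EB.pmap y = EA.pmap x" by (rule rangeE)
        then have "x = (v, [])" using range_int[of x y] by simp
        then have "f x = 0" using A.I_short[OF A(1)] by simp
        then show ?thesis using EA.push_pmap[of f x] x by (cases y) (simp add: A(2))
      next
        case False
        then show ?thesis using EA.push_off[OF False, of f] by (cases y) (simp add: A(2))
      qed
    qed
    then show ?thesis using A(1) EA.push_closed[OF A.I_sub[OF A(1)]] zero_I(2) by (simp add: A(2) KK_def EA.pull_push)
  next
    case (B f)
    have "EA.pull g = (\<lambda>_. 0)"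
    proof
      fix x :: "'a \<times> 'e list"
      show "EA.pull g x = 0"
      proof (cases "EA.pmap x \<in> range EB.pmap")
        case True
        then obtain y where y: "EA.pmap x = EB.pmap y" by (rule rangeE)
        then have "y = (w, [])" using range_int[of x y] by simp
        then have "f y = 0" using B.I_short[OF B(1)] by simp
        then show ?thesis using EB.push_pmap[of f y] y by (cases x) (simp add: B(2))
      next
        case False
        then show ?thesis using EB.push_off[OF False, of f] by (cases x) (simp add: B(2))
      qed
    qed
    then show ?thesis using B(1) EB.push_closed[OF B.I_sub[OF B(1)]] zero_I(1) by (simp add: B(2) KK_def EB.pull_push)
  next
    case (M p q)
    obtain a where a: "p = Inl a" using M(1,3) sourceD by (auto simp: QC_simps gv_eq)
    obtain b where b: "q = Inr b" using M(2,4) sinkD by (auto simp: QC_simps)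
    have n: "(tail QC p, [p, q]) \<notin> range EA.pmap" "(tail QC p, [p, q]) \<notin> range EB.pmap" by (auto simp: a b)
    have "EA.pull g = (\<lambda>_. 0)" "EB.pull g = (\<lambda>_. 0)"
      unfolding M(5) by (rule EA.pull_elem_off[OF n(1)] EB.pull_elem_off[OF n(2)])+
    moreover have "g \<in> carrier (path_algebra QC)"
      unfolding M(5) using M(1-4) C.wf_digraph by (intro C.path_elem_closed) (simp add: C.qpaths_Cons)
    ultimately show ?thesis using zero_I by (simp add: KK_def)
  qed
qed

lemma gens_closed: "gens \<subseteq> carrier (path_algebra QC)"
  using gens_KK unfolding KK_def by blast

lemma J_ideal: "ideal J (path_algebra QC)"
  unfolding J_eq by (rule ring.genideal_ideal[OF C.ring_path_algebra gens_closed])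

lemma gens_J: "gens \<subseteq> J"
  unfolding J_eq by (rule ring.genideal_self[OF C.ring_path_algebra gens_closed])

lemma mixed_J:
  assumes p: "(u, p1 @ Inl a # Inr b # p2) \<in> qpaths QC"
  shows "path_elem (u, p1 @ Inl a # Inr b # p2) \<in> J"
proof -
  interpret J: ideal J "path_algebra QC" by (rule J_ideal)
  let ?x = "tail QC (Inl a)"
  have q: "(u, p1) \<in> qpaths QC" "C.awlast u p1 = ?x" "Inl a \<in> arcs QC" "Inr b \<in> arcs QC"
      "tail QC (Inr b) = head QC (Inl a)" "(head QC (Inr b), p2) \<in> qpaths QC"
    using p by (auto simp: C.qpaths_append C.qpaths_Cons)
  have hv: "head QC (Inl a) = Inl v" using q(5) by (simp add: QC_simps gv_eq)
  have "path_elem (?x, [Inl a, Inr b]) \<in> gens"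
    unfolding gens_def by (intro UnI2 CollectI exI conjI, rule refl) (use q hv in simp_all)
  then have m: "path_elem (?x, [Inl a, Inr b]) \<in> J" using gens_J by blast
  have "path_elem (head QC (Inr b), p2) \<in> carrier (path_algebra QC :: (('a + 'b) \<times> ('e + 'f) list \<Rightarrow> 'k) ring)"
    by (rule C.path_elem_closed[OF q(6)])
  then have "path_mult QC (path_elem (?x, [Inl a, Inr b])) (path_elem (head QC (Inr b), p2)) \<in> J"
    using J.I_r_closed[OF m] by (simp add: C.path_algebra_simps)
  moreover have "path_mult QC (path_elem (?x, [Inl a, Inr b])) (path_elem (head QC (Inr b), p2)) =
      (path_elem (?x, Inl a # Inr b # p2) :: ('a + 'b) \<times> ('e + 'f) list \<Rightarrow> 'k)"
    using C.path_elem_append[where 'k = 'k, of ?x "[Inl a, Inr b]" p2] by (simp add: C.awlast_eq)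
  ultimately have m2: "path_elem (?x, Inl a # Inr b # p2) \<in> J" by simp
  have "path_elem (u, p1) \<in> carrier (path_algebra QC :: (('a + 'b) \<times> ('e + 'f) list \<Rightarrow> 'k) ring)"
    by (rule C.path_elem_closed[OF q(1)])
  then have "path_mult QC (path_elem (u, p1)) (path_elem (?x, Inl a # Inr b # p2)) \<in> J"
    using J.I_l_closed[OF m2] by (simp add: C.path_algebra_simps)
  then show ?thesis
    using C.path_elem_append[where 'k = 'k, of u p1 "Inl a # Inr b # p2"] q(2) by simp
qed

text \<open>Modulo the paths that pass from \<open>A\<close> to \<open>B\<close>, which all lie in
  \<open>J\<close> by \<open>mixed_J\<close>, such an element is the sum of its parts in the two
  path algebras.\<close>

lemma J_iff: "f \<in> J \<longleftrightarrow> f \<in> carrier (path_algebra QC) \<and> EA.pull f \<in> IA \<and> EB.pull f \<in> IB"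
proof
  assume "f \<in> J"
  moreover have "J \<subseteq> KK" unfolding J_eq by (rule ring.genideal_minimal[OF C.ring_path_algebra KK_ideal gens_KK])
  ultimately show "f \<in> carrier (path_algebra QC) \<and> EA.pull f \<in> IA \<and> EB.pull f \<in> IB" by (auto simp: KK_def)
next
  assume H: "f \<in> carrier (path_algebra QC) \<and> EA.pull f \<in> IA \<and> EB.pull f \<in> IB"
  interpret J: ideal J "path_algebra QC" by (rule J_ideal)
  have add: "(\<lambda>x. g x + h x) \<in> J" if "g \<in> J" "h \<in> J" for g h
    using additive_subgroup.a_closed[OF ideal.axioms(1)[OF J_ideal] that] by (simp add: C.path_algebra_simps)
  have smul: "(\<lambda>x. c * g x) \<in> J" if g: "g \<in> J" for c g
  proof -
    have "path_mult QC (\<lambda>x. c * \<one>\<^bsub>path_algebra QC\<^esub> x) g \<in> J"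
      using J.I_l_closed[OF g C.path_smul_closed[OF J.one_closed, of c]] by (simp add: C.path_algebra_simps(1))
    then show ?thesis using C.path_one_mult[of g] J.Icarr[OF g] by (simp add: C.path_smul_mult C.path_algebra_simps(1))
  qed
  define fA where "fA = push_forward EA.pmap (EA.pull f)"
  define fB where "fB = push_forward EB.pmap (EB.pull f)"
  \<comment> \<open>The trivial path at the node would be subtracted twice, but its coefficient is
    zero since elements of \<open>IA\<close> and \<open>IB\<close> have no terms of length below
    two. Hence \<open>g\<close> is supported on paths passing from \<open>A\<close> to
    \<open>B\<close>.\<close>
  define g where "g = (\<lambda>x. f x - (fA x + fB x))"
  have AB: "fA \<in> J" "fB \<in> J" using H gens_J unfolding gens_def fA_def fB_def by blast+
  have ABs: "(\<lambda>x. fA x + fB x) \<in> J" by (rule add[OF AB])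
  have gC: "g \<in> carrier (path_algebra QC)"
    using J.minus_closed[of f "\<lambda>x. fA x + fB x"] H J.Icarr[OF ABs] by (simp add: g_def C.path_diff)
  have "g \<in> J"
  proof (rule C.path_algebra_induct[OF gC _ _ add smul])
    show "(\<lambda>_. 0) \<in> J" using additive_subgroup.zero_closed[OF ideal.axioms(1)[OF J_ideal]] by (simp add: C.path_algebra_simps)
    fix x assume x: "g x \<noteq> 0"
    obtain u p where up: "x = (u, p)" by fastforce
    have A0: "fA x = 0 \<and> fB x = f x" if xB: "x \<in> range EB.pmap"
    proof -
      obtain y where y: "x = EB.pmap y" using xB by (rule rangeE)
      have "fB x = f x" unfolding fB_def y EB.push_pmap by (cases y) simp
      moreover have "fA x = 0"
      proof (cases "x \<in> range EA.pmap")
        case True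
        then obtain z where z: "x = EA.pmap z" by (rule rangeE)
        then have "z = (v, [])" using range_int[of z y] y by simp
        then show ?thesis unfolding fA_def z EA.push_pmap using A.I_short[of "EA.pull f" "[]" v] H by simp
      next
        case False
        then show ?thesis unfolding fA_def by (rule EA.push_off)
      qed
      ultimately show ?thesis by simp
    qed
    have nB: "x \<notin> range EB.pmap"
    proof
      assume "x \<in> range EB.pmap"
      then show False using A0 x by (simp add: g_def)
    qed
    then have B0: "fB x = 0" unfolding fB_def by (rule EB.push_off)
    have nA: "x \<notin> range EA.pmap"
    proof
      assume "x \<in> range EA.pmap"
      then obtain y where y: "x = EA.pmap y" by (rule rangeE)
      have "fA x = f x" unfolding fA_def y EA.push_pmap by (cases y) simp
      then show False using x B0 by (simp add: g_def)
    qed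
    have xq: "(u, p) \<in> qpaths QC" using C.path_carrierD(2)[OF gC x] up by simp
    then obtain p1 a b p2 where "p = p1 @ Inl a # Inr b # p2" using path_cases[OF xq] nA nB up by blast
    then show "path_elem x \<in> J" using mixed_J[of u p1 a b p2] xq up by simp
  qed
  then have "(\<lambda>x. g x + (fA x + fB x)) \<in> J" by (rule add[OF _ ABs])
  then show "f \<in> J" by (simp add: g_def)
qed

text \<open>By \<open>J_iff\<close> both bounds can be checked on the two projections; the remaining
  paths, which pass through the node, have length at least two.\<close>

lemma J_admissible: "admissible_ideal QC J"
  unfolding admissible_ideal_def
proof (intro conjI)
  show "ideal J (path_algebra QC)" by (rule J_ideal)
  show "J \<subseteq> arrow_ideal_power QC 2"
  proof
    fix f assume f: "f \<in> J"
    have fC: "f \<in> carrier (path_algebra QC)" and fA: "EA.pull f \<in> IA" and fB: "EB.pull f \<in> IB" using J_iff[of f] f by simp_all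
    have "2 \<le> length p" if nz: "f (u, p) \<noteq> 0" for u p
    proof -
      consider (A) x q where "(u, p) = EA.pmap (x, q)" | (B) x q where "(u, p) = EB.pmap (x, q)"
        | (M) p1 a b p2 where "p = p1 @ Inl a # Inr b # p2"
        using path_cases[OF C.path_carrierD(2)[OF fC nz]] by (auto simp: image_iff)
      then show ?thesis
      proof cases
        case (A x q)
        then show ?thesis using A.I_long[OF fA, of x q] nz by simp
      next
        case (B x q)
        then show ?thesis using B.I_long[OF fB, of x q] nz by simp
      qed simp
    qed
    then show "f \<in> arrow_ideal_power QC 2" unfolding arrow_ideal_power_def using fC by blast
  qed
  obtain mA where mA: "mA \<ge> 2" "arrow_ideal_power QA mA \<subseteq> IA"
    using A.adm by (auto simp: admissible_ideal_def)
  obtain mB where mB: "arrow_ideal_power QB mB \<subseteq> IB"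
    using B.adm by (auto simp: admissible_ideal_def)
  have "f \<in> J" if f: "f \<in> arrow_ideal_power QC (max mA mB)" for f
  proof -
    have "f \<in> arrow_ideal_power QC mA" "f \<in> arrow_ideal_power QC mB" using f by (auto simp: arrow_ideal_power_def)
    then have "EA.pull f \<in> IA" "EB.pull f \<in> IB"
      using EA.pull_power[of f mA] EB.pull_power[of f mB] mA(2) mB by blast+
    then show ?thesis using f J_iff[of f] by (simp add: arrow_ideal_power_def)
  qed
  then show "\<exists>m\<ge>2. arrow_ideal_power QC m \<subseteq> J" using mA(1) by (intro exI[of _ "max mA mB"]) auto
qed

sublocale T: bqa QC J
  by (intro bqa.intro bqa_axioms.intro fin_QC J_admissible)

sublocale PA: bqa_embedding QA QC Inl Inl IA J
  by (intro bqa_embedding.intro bqa_embedding_axioms.intro EA.quiver_embedding_axioms A.bqa_axioms T.bqa_axioms)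
    (simp add: J_iff)

sublocale PB: bqa_embedding QB QC gv Inr IB J
  by (intro bqa_embedding.intro bqa_embedding_axioms.intro EB.quiver_embedding_axioms B.bqa_axioms T.bqa_axioms)
    (simp add: J_iff)

text \<open>No path of \<open>B\<close> starts at a vertex of \<open>A\<close> other than the node,
  so the projection to \<open>B\<close> vanishes.\<close>

lemma inj_at_A:
  assumes i: "i \<in> verts QA" "i \<noteq> v"
  shows "PA.H.inj_at i"
proof (rule PA.proj_inj_at[OF i(1)])
  fix f assume f: "f \<in> carrier (path_algebra QC)" "\<And>u p. f (u, p) \<noteq> 0 \<Longrightarrow> u = Inl i" "EA.pull f \<in> IA"
  have "EB.pull f x = 0" for x
  proof (cases x)
    case (Pair u p)
    have "gv u \<noteq> Inl i" using i(2) by (simp add: gv_eq)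
    then show ?thesis using f(2)[of "gv u" "map Inr p"] Pair by auto
  qed
  then have "EB.pull f = (\<lambda>_. 0)" by (rule ext)
  then show "f \<in> J" using f zero_I by (simp add: J_iff)
qed

text \<open>A path starting at a vertex of \<open>B\<close> belongs to \<open>A\<close> only if it
  is the trivial path at the node, which is a sink of \<open>A\<close>; its coefficient is zero by
  \<open>B.I_short\<close>. So the projection to \<open>A\<close> vanishes.\<close>

lemma inj_at_B:
  assumes i: "i \<in> verts QB"
  shows "PB.H.inj_at i"
proof (rule PB.proj_inj_at[OF i])
  fix f assume f: "f \<in> carrier (path_algebra QC)" "\<And>u p. f (u, p) \<noteq> 0 \<Longrightarrow> u = gv i" "EB.pull f \<in> IB"
  have "EA.pull f x = 0" for x
  proof (rule ccontr)
    assume nz: "EA.pull f x \<noteq> 0"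
    obtain u p where x: "x = (u, p)" by fastforce
    have "Inl u = gv i" using f(2)[of "Inl u" "map Inl p"] nz x by simp
    then have u: "u = v" "i = w" by (simp_all add: gv_eq)
    have "(u, p) \<in> qpaths QA" using A.path_carrierD(2)[OF EA.pull_closed[OF f(1)] nz] x by simp
    then have "p = []" using sinkD u(1) by (cases p) (auto simp: A.qpaths_Cons)
    then show False using nz B.I_short[OF f(3), of "[]" w] by (simp add: x u(1) gv_eq)
  qed
  then have "EA.pull f = (\<lambda>_. 0)" by (rule ext)
  then show "f \<in> J" using f zero_I by (simp add: J_iff)
qed

sublocale G: glued T.A "verts QC" "vertex_idem QC J" "scalar_elem QC J" T.NN T.XX
  A.A "verts QA" "vertex_idem QA IA" "scalar_elem QA IA" A.NN A.XX Inl PA.proj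
  B.A "verts QB" "vertex_idem QB IB" "scalar_elem QB IB" B.NN B.XX gv PB.proj v w
proof (intro glued.intro glued_axioms.intro PA.basic_hom_proj PB.basic_hom_proj)
  show "v \<in> verts QA" "w \<in> verts QB" by (fact v w)+
  show "Inl v = gv w" by (simp add: gv_eq)
  show "verts QC = Inl ` verts QA \<union> gv ` verts QB" by (simp add: QC_simps)
  show "Inl ` verts QA \<inter> gv ` verts QB \<subseteq> {Inl v}" by (auto simp: gv_eq)
  show "(v, \<alpha>, u) \<notin> A.XX" for \<alpha> u using sinkD by (auto simp: A.XX_def)
  show "PA.H.inj_at i" if "i \<in> verts QA" "i \<noteq> v" for i using that by (rule inj_at_A)
  show "PB.H.inj_at i" if "i \<in> verts QB" for i using that by (rule inj_at_B)
  show "\<exists>\<beta> y. (w, \<beta>, y) \<in> B.XX \<and> z = gv y" if z: "(Inl v, \<gamma>, z) \<in> T.XX" for \<gamma> z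
  proof -
    obtain c where c: "c \<in> arcs QC" "tail QC c = Inl v" "z = head QC c" using z unfolding T.XX_def by auto
    obtain b where b: "c = Inr b" "b \<in> arcs QB" using c(1,2) sinkD by (auto simp: QC_simps)
    have "tail QB b = w" using b c(2) by (simp add: QC_simps gv_eq)
    then show ?thesis using B.XXI[OF b(2)] c(3) b(1) by (auto simp: QC_simps)
  qed
  show "\<exists>\<gamma>. (Inl v, \<gamma>, gv y) \<in> T.XX \<and> PA.proj \<gamma> = \<zero>\<^bsub>A.A\<^esub>" if y: "(w, \<beta>, y) \<in> B.XX" for \<beta> y
  proof -
    obtain b where b: "b \<in> arcs QB" "tail QB b = w" "y = head QB b" using y unfolding B.XX_def by auto
    have c: "Inr b \<in> arcs QC" "tail QC (Inr b) = Inl v" "head QC (Inr b) = gv y" using b by (auto simp: QC_simps gv_eq)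
    have "PA.proj (T.cl (path_elem (tail QC (Inr b), [Inr b]))) = \<zero>\<^bsub>A.A\<^esub>"
      by (rule PA.proj_arrow_off[OF c(1)]) auto
    then show ?thesis using T.XXI[OF c] c(2) by auto
  qed
  show "\<exists>\<gamma>. (Inl x, \<gamma>, Inl v) \<in> T.XX" if x: "(x, \<alpha>, v) \<in> A.XX" for x \<alpha>
  proof -
    obtain a where a: "a \<in> arcs QA" "tail QA a = x" "head QA a = v" using x unfolding A.XX_def by auto
    have "Inl a \<in> arcs QC" "tail QC (Inl a) = Inl x" "head QC (Inl a) = Inl v" using a by (auto simp: QC_simps)
    then show ?thesis using T.XXI by blast
  qed
  show "PA.proj n \<in> A.NN 1" if "n \<in> T.NN 1" for n using that by (rule PA.proj_NN)
qed

end

section \<open>Equivalence classes of orders and the compatibility conditions\<close>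

context bqa
begin

lemma equiv_orders: "equiv {r. R.qh r} (equivalent_orders Q I)"
  unfolding equivalent_orders_eq by (rule equivI) (auto simp: refl_on_def sym_def trans_def)

lemma qh_structures_eq: "qh_structures Q I = {r. R.qh r} // equivalent_orders Q I"
  by (simp add: qh_structures_def qh_eq)

lemma min_adapted_arc:
  assumes r: "R.qh r" and a: "a \<in> arcs Q"
  shows "(tail Q a, head Q a) \<in> min_adapted Q I (equivalent_orders Q I `` {r}) \<longleftrightarrow> (tail Q a, head Q a) \<in> r"
    "(head Q a, tail Q a) \<in> min_adapted Q I (equivalent_orders Q I `` {r}) \<longleftrightarrow> (head Q a, tail Q a) \<in> r"
proof -
  have X: "R.qh r'" if "r' \<in> equivalent_orders Q I `` {r}" for r' using that by (simp add: equivalent_orders_eq)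
  have X': "R.ker r' i = R.ker r'' i" if "r' \<in> equivalent_orders Q I `` {r}" "r'' \<in> equivalent_orders Q I `` {r}" "i \<in> verts Q" for r' r'' i
    using that by (simp add: equivalent_orders_eq)
  have rX: "r \<in> equivalent_orders Q I `` {r}" using r by (simp add: equivalent_orders_eq)
  note m = R.madapt_arrow[OF X X' rX XXI[OF a refl refl]]
  show "(tail Q a, head Q a) \<in> min_adapted Q I (equivalent_orders Q I `` {r}) \<longleftrightarrow> (tail Q a, head Q a) \<in> r"
    unfolding min_adapted_eq by (rule m(1))
  show "(head Q a, tail Q a) \<in> min_adapted Q I (equivalent_orders Q I `` {r}) \<longleftrightarrow> (head Q a, tail Q a) \<in> r"
    unfolding min_adapted_eq by (rule m(2))
qed

lemma arc_comparable:
  assumes r: "R.qh r" and a: "a \<in> arcs Q" and ne: "tail Q a \<noteq> head Q a"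
  shows "(tail Q a, head Q a) \<in> r \<longleftrightarrow> (head Q a, tail Q a) \<notin> r"
  using R.arrow_comparable[OF r XXI[OF a refl refl]] R.qhD(6)[OF r, of "tail Q a" "head Q a"] ne by blast

end

context node_gluing
begin

text \<open>Up to contraposition this is symmetric in \<open>A\<close> and \<open>B\<close>: there
  are no arrows x \<rightarrow> v \<rightarrow> y with x and y both below the node. It refers to
  representatives instead of minimal adapted orders.\<close>

definition compat :: "('a \<times> 'a) set \<Rightarrow> ('b \<times> 'b) set \<Rightarrow> bool" where
  "compat rA rB \<longleftrightarrow> (\<exists>a\<in>arcs QA. head QA a = v \<and> (tail QA a, v) \<in> rA) \<longrightarrow>
     (\<forall>b\<in>arcs QB. tail QB b = w \<longrightarrow> (head QB b, w) \<notin> rB)"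

text \<open>The ends of an arrow at the node are distinct and comparable, and the minimal adapted
  order relates them like every representative; so being above the node is the negation of being
  below it. With this, the first condition becomes \<open>compat\<close> and the second one its
  contrapositive.\<close>

lemma cond_iff:
  assumes rA: "A.R.qh rA" and rB: "B.R.qh rB"
  defines "mA \<equiv> min_adapted QA IA (equivalent_orders QA IA `` {rA})"
    and "mB \<equiv> min_adapted QB IB (equivalent_orders QB IB `` {rB})"
  shows "cond_Delta QA v mA QB w mB \<longleftrightarrow> compat rA rB" "cond_nabla QA v mA QB w mB \<longleftrightarrow> compat rA rB"
proof -
  have a: "(tail QA a, v) \<in> mA - Id \<longleftrightarrow> (tail QA a, v) \<in> rA" "(v, tail QA a) \<in> mA - Id \<longleftrightarrow> (tail QA a, v) \<notin> rA"
    if "a \<in> arcs QA" "head QA a = v" for a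
    using A.min_adapted_arc[OF rA that(1)] A.arc_comparable[OF rA that(1)] sinkD[OF that(1)] that(2) by (auto simp: mA_def)
  have b: "(head QB b, w) \<in> mB - Id \<longleftrightarrow> (head QB b, w) \<in> rB" "(w, head QB b) \<in> mB - Id \<longleftrightarrow> (head QB b, w) \<notin> rB"
    if "b \<in> arcs QB" "tail QB b = w" for b
    using B.min_adapted_arc[OF rB that(1)] B.arc_comparable[OF rB that(1)] sourceD[OF that(1)] that(2) by (auto simp: mB_def)
  show "cond_Delta QA v mA QB w mB \<longleftrightarrow> compat rA rB"
    unfolding cond_Delta_def compat_def using a(1) b(2) by (simp cong: conj_cong)
  have "cond_nabla QA v mA QB w mB \<longleftrightarrow> ((\<exists>b\<in>arcs QB. tail QB b = w \<and> (head QB b, w) \<in> rB) \<longrightarrow>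
      (\<forall>a\<in>arcs QA. head QA a = v \<longrightarrow> (tail QA a, v) \<notin> rA))"
    unfolding cond_nabla_def using a(2) b(1) by (simp cong: conj_cong)
  then show "cond_nabla QA v mA QB w mB \<longleftrightarrow> compat rA rB" unfolding compat_def by blast
qed

lemma glue_qh:
  assumes "partial_order_on (verts QC) r"
  shows "T.R.qh r \<longleftrightarrow> A.R.qh (PA.H.restr r) \<and> B.R.qh (PB.H.restr r) \<and> compat (PA.H.restr r) (PB.H.restr r)"
proof -
  have "(\<exists>x \<alpha>. (x, \<alpha>, v) \<in> A.XX \<and> (x, v) \<in> PA.H.restr r) \<longleftrightarrow>
      (\<exists>a\<in>arcs QA. head QA a = v \<and> (tail QA a, v) \<in> PA.H.restr r)" by (auto simp: A.XX_def)
  moreover have "(\<forall>\<beta> y. (w, \<beta>, y) \<in> B.XX \<longrightarrow> (y, w) \<notin> PB.H.restr r) \<longleftrightarrow>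
      (\<forall>b\<in>arcs QB. tail QB b = w \<longrightarrow> (head QB b, w) \<notin> PB.H.restr r)" by (auto simp: B.XX_def)
  ultimately show ?thesis using G.glue_qh_iff[OF assms] by (simp add: compat_def)
qed

text \<open>Both bijections arise from the restriction of orders to the two quivers, with the
  amalgam of orders providing preimages; therefore the condition is left as a parameter
  \<open>P\<close>.\<close>

lemma glue_bij:
  assumes P: "\<And>rA rB. A.R.qh rA \<Longrightarrow> B.R.qh rB \<Longrightarrow>
    P (equivalent_orders QA IA `` {rA}) (equivalent_orders QB IB `` {rB}) \<longleftrightarrow> compat rA rB"
  shows "\<exists>h. bij_betw h (qh_structures QC J) {(X, Y). X \<in> qh_structures QA IA \<and> Y \<in> qh_structures QB IB \<and> P X Y}"
  unfolding A.qh_structures_eq B.qh_structures_eq T.qh_structures_eq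
proof (rule bij_betw_quotients[OF T.equiv_orders A.equiv_orders B.equiv_orders])
  have q: "A.R.qh (PA.H.restr r) \<and> B.R.qh (PB.H.restr r) \<and> compat (PA.H.restr r) (PB.H.restr r)" if "r \<in> {r. T.R.qh r}" for r
    using that glue_qh[OF T.R.qhD(1)[of r]] by simp
  show "PA.H.restr r \<in> {r. A.R.qh r}" "PB.H.restr r \<in> {r. B.R.qh r}" if "r \<in> {r. T.R.qh r}" for r
    using q[OF that] by simp_all
  show "P (equivalent_orders QA IA `` {PA.H.restr r}) (equivalent_orders QB IB `` {PB.H.restr r})" if "r \<in> {r. T.R.qh r}" for r
    using q[OF that] P by simp
  show "(r, r') \<in> equivalent_orders QC J \<longleftrightarrow> (PA.H.restr r, PA.H.restr r') \<in> equivalent_orders QA IA \<and>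
      (PB.H.restr r, PB.H.restr r') \<in> equivalent_orders QB IB"
    if r: "r \<in> {r. T.R.qh r}" "r' \<in> {r. T.R.qh r}" for r r'
  proof -
    have V: "Inl v \<in> verts QC" using v by (simp add: QC_simps)
    have "(Inl v, Inl v) \<in> r" "(Inl v, Inl v) \<in> r'" using r T.R.qhD(4)[OF _ V] by auto
    then show ?thesis
      using G.glue_ker_eq_iff[of r r'] q[OF r(1)] q[OF r(2)] r
      unfolding A.equivalent_orders_eq B.equivalent_orders_eq T.equivalent_orders_eq by simp
  qed
  show "\<exists>r\<in>{r. T.R.qh r}. PA.H.restr r = x \<and> PB.H.restr r = y"
    if x: "x \<in> {r. A.R.qh r}" and y: "y \<in> {r. B.R.qh r}" and Pxy: "P (equivalent_orders QA IA `` {x}) (equivalent_orders QB IB `` {y})"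
    for x y
  proof -
    have c: "compat x y" using P[of x y] x y Pxy by simp
    have po: "partial_order_on (verts QA) x" "partial_order_on (verts QB) y" using x y A.R.qhD(1) B.R.qhD(1) by auto
    note am = G.amalgam_order[OF po]
    have "T.R.qh (G.amalgam x y)" using glue_qh[OF am(1)] c x y by (simp add: am(2,3))
    then show ?thesis using am(2,3) by blast
  qed
qed

end

theorem theorem1p6:
  fixes QA :: "('a, 'e) pre_digraph" and IA :: "('a \<times> 'e list \<Rightarrow> 'k::field) set" and v :: 'a
    and QB :: "('b, 'f) pre_digraph" and IB :: "('b \<times> 'f list \<Rightarrow> 'k) set" and w :: 'b
  assumes "bound_quiver QA IA" and "bound_quiver QB IB"
    and "v \<in> verts QA" and "out_arcs QA v = {}"
    and "w \<in> verts QB" and "in_arcs QB w = {}"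
  shows
    "(\<exists>f. bij_betw f
        (qh_structures (glue_quiver QA v QB w) (glue_ideal QA IA v QB IB w))
        {(X, Y). X \<in> qh_structures QA IA \<and> Y \<in> qh_structures QB IB \<and>
           cond_Delta QA v (min_adapted QA IA X) QB w (min_adapted QB IB Y)}) \<and>
     (\<exists>g. bij_betw g
        (qh_structures (glue_quiver QA v QB w) (glue_ideal QA IA v QB IB w))
        {(X, Y). X \<in> qh_structures QA IA \<and> Y \<in> qh_structures QB IB \<and>
           cond_nabla QA v (min_adapted QA IA X) QB w (min_adapted QB IB Y)})"
proof -
  interpret node_gluing QA IA QB IB v w
    using assms by (intro node_gluing.intro node_gluing_axioms.intro bqa.intro bqa_axioms.intro)
      (simp_all add: bound_quiver_def)
  show ?thesis
    by (intro conjI glue_bij cond_iff)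
qed



end
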